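(* Suppose that assumptions (A1)–(A5) listed in the context hold. Then, for any fixed (but arbitrary) $\nu_0\in(0,1]$, as $n\to\infty$, $$\sup_{\nu\in[\nu_0,1]}\Big\Vert \nu\big\{\hat\beta_{n,\lambda}(\cdot,\nu)-\beta_0+W_\lambda(\beta_0)\big\}-\frac1n\sum_{i=1}^{\lfloor n\nu\rfloor}\varepsilon_i\,\tau_\lambda(X_i)\Big\Vert_K=O_p(v_n),$$ where $$v_n=n^{-1/2}\lambda^{-\varsigma}\big(\lambda^{1/2}+n^{-1/2}\lambda^{-(2a+1)/(4D)}\big)(\log n)^{1/2},\qquad \varsigma=\frac{2D-2a-1}{4Dm}+\frac{a+1}{2D}.$$
   Context: Model. $\{(X_i,\varepsilon_i)\}_{i\in\mathbb Z}$ is a strictly stationary time series, the $X_i$ are mean zero square-integrable random functions on $[0,1]$, the $\varepsilon_i$ are centred real random variables, and $Y_i=\int_0^1X_i(s)\beta_0(s)\,ds+\varepsilon_i$ with slope function $\beta_0\in\mathcal H$. $\langle\cdot,\cdot\rangle_{L^2}$, $\|\cdot\|_{L^2}$ are the usual inner product and norm of $L^2([0,1])$; $\|\cdot\|_\infty$ is the sup-norm. Spaces and forms. $\mathcal H$ is the Sobolev space of order $m>1/2$ ($m$ an integer): functions $\beta:[0,1]\to\mathbb R$ with $\beta^{(\theta)}$ absolutely continuous for $0\le\theta\le m-1$ and $\beta^{(m)}\in L^2([0,1])$. $C_X(s,t)=\mathrm{cov}\{X_1(s),X_1(t)\}$; $V(\beta_1,\beta_2)=\int_0^1\int_0^1C_X(s,t)\beta_1(s)\beta_2(t)\,ds\,dt$;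 $J(\beta_1,\beta_2)=\int_0^1\beta_1^{(m)}(s)\beta_2^{(m)}(s)\,ds$; $\langle\beta_1,\beta_2\rangle_K=V(\beta_1,\beta_2)+\lambda J(\beta_1,\beta_2)$, an inner product on $\mathcal H$ with norm $\|\cdot\|_K$, where $\lambda=\lambda_n>0$ is a regularization parameter. Estimator. For $\nu\in[\nu_0,1]$, $\hat\beta_{n,\lambda}(\cdot,\nu)=\arg\min_{\beta\in\mathcal H}\big[\frac1{2\lfloor n\nu\rfloor}\sum_{i=1}^{\lfloor n\nu\rfloor}\{Y_i-\int_0^1X_i(s)\beta(s)ds\}^2+\frac\lambda2J(\beta,\beta)\big]$. Operators. $W_\lambda:\mathcal H\to\mathcal H$ is defined by $\langle W_\lambda(\beta_1),\beta_2\rangle_K=\lambda J(\beta_1,\beta_2)$ for all $\beta_1,\beta_2\in\mathcal H$. For $z\in L^2([0,1])$, $\tau_\lambda(z)\in\mathcal H$ is the unique element with $\langle\tau_\lambda(z),\beta\rangle_K=\int_0^1\beta(s)z(s)ds$ for all $\beta\in\mathcal H$; equivalently $\tau_\lambda(z)=\sum_{k\ge1}\frac{\langle z,\varphi_k\rangle_{L^2}}{1+\lambda\rho_k}\varphi_k$ with $(\rho_k,\varphi_k)$ from (A2). Assumptions. (A1) $C_X$ is continuous on $[0,1]^2$, and for $\gamma\in L^2([0,1])$, $\int_0^1C_X(s,t)\gamma(s)ds=0$ for all $t\in[0,1]$ implies $\gamma\equiv0$. (A2) There are functions $\{\varphi_k\}_{k\ge1}\subset\mathcal H$ and constants $a\ge0$,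 $c>0$, $D>a+1/2$ with $\|\varphi_k\|_\infty\le ck^a$ for all $k\ge 1$, $V(\varphi_k,\varphi_{k'})=\delta_{kk'}$, $J(\varphi_k,\varphi_{k'})=\rho_k\delta_{kk'}$ for all $k,k'\ge 1$, where $\rho_k\asymp k^{2D}$ (ratio bounded above and away from $0$ for all large $k$). Every $\beta\in\mathcal H$ satisfies $\beta=\sum_{k\ge1}V(\beta,\varphi_k)\varphi_k$ with convergence in $\|\cdot\|_K$. (A3) (i) $E\{\exp(\varpi\|X_0\|_{L^2}^2)\}<\infty$ for some $\varpi>0$. (ii) For some $c_0>0$, $E(\langle X_0,\beta\rangle_{L^2}^4)\le c_0\{E(\langle X_0,\beta\rangle_{L^2}^2)\}^2$ for all $\beta\in\mathcal H$. (iii) $\sum_{k\ge1}\rho_k^2V^2(\beta_0,\varphi_k)<\infty$. (iv) With $C_{U,\lambda}(s,t)=\lambda^{(2a+1)/D}\sum_{\ell\in\mathbb Z}\mathrm{cov}\{\varepsilon_0\tau_\lambda(X_0)(s),\varepsilon_\ell\tau_\lambda(X_\ell)(t)\}$, the limit $C_U(s,t)=\lim_{\lambda\downarrow0}C_{U,\lambda}(s,t)$ exists for all $(s,t)\in[0,1]^2$. (A4) As $n\to\infty$: $\lambda=o(1)$, $n^{-1}\lambda^{-(2a+1)/D}=o(1)$, $n\lambda^{2+(2a+1)/(2D)}=o(1)$, $n^{-1}\lambda^{-2\varsigma}\log n=o(1)$, $\lambda^{-2\varsigma+(2D+2a+1)/(2D)}\log n=o(1)$, where $\varsigma=(2D-2a-1)/(4Dm)+(a+1)/(2D)>0$.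 (A5) (i) $X_i=g(\ldots,\xi_{i-1},\xi_i)$, $\varepsilon_i=h(\ldots,\eta_{i-1},\eta_i)$ for deterministic measurable $g:\mathcal S^\infty\to L^2([0,1])$, $h:\mathbb R^\infty\to\mathbb R$, $\mathcal S$ a measurable space, $\xi_i=\xi_i(t,\omega)$ jointly measurable in $(t,\omega)$; the $\xi_i$ are i.i.d., the $\eta_i$ are i.i.d., and the two families are independent (so $\{X_i\}$ and $\{\varepsilon_i\}$ are independent). (ii) $E\{X_0(s)\}=E(\varepsilon_0)=0$ for all $s$, and $E|\varepsilon_0|^{2+\delta}<\infty$ for some $\delta\in(0,1)$. (iii) For some $\kappa>2+\delta$, $\sum_{\ell\ge1}(E\|X_i-X_{i,\ell}\|_{L^2}^{2+\delta})^{1/\kappa}<\infty$ and $\sum_{\ell\ge1}(E|\varepsilon_i-\varepsilon_{i,\ell}|^{2+\delta})^{1/\kappa}<\infty$, where $X_{i,\ell}=g(\xi_i,\xi_{i-1},\ldots,\xi_{i-\ell+1},\boldsymbol\xi^*_{i,\ell})$, $\varepsilon_{i,\ell}=h(\eta_i,\ldots,\eta_{i-\ell+1},\boldsymbol\eta^*_{i,\ell})$ (arguments listed from most recent to oldest), $\boldsymbol\xi^*_{i,\ell}=(\xi^*_{i,\ell,i-\ell},\xi^*_{i,\ell,i-\ell-1},\ldots)$, $\boldsymbol\eta^*_{i,\ell}=(\eta^*_{i,\ell,i-\ell},\eta^*_{i,\ell,i-\ell-1},\ldots)$, and the $\xi^*_{i,\ell,k}$, $\eta^*_{i,\ell,k}$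 are independent copies of $\xi_0$, $\eta_0$, independent of $\{\xi_i\}$, $\{\eta_i\}$. *)

theory Defs
  imports "HOL-Probability.Probability" "HOL-Library.Landau_Symbols"
begin

section \<open>Function spaces on the unit interval\<close>

abbreviation unit_leb :: "real measure" where
  "unit_leb \<equiv> restrict_space lborel {0..1}"

text \<open>
  Elements of \<open>L\<^sup>2([0,1])\<close> are represented by square-integrable functions (not by their
  classes), so equality in \<open>L\<^sup>2\<close> is equality almost everywhere and values outside \<open>[0,1]\<close>
  are irrelevant.
\<close>

definition L2 :: "(real \<Rightarrow> real) set" where
  "L2 = {f. f \<in> borel_measurable unit_leb \<and> integrable unit_leb (\<lambda>s. (f s)\<^sup>2)}"

definition L2_inner :: "(real \<Rightarrow> real) \<Rightarrow> (real \<Rightarrow> real) \<Rightarrow> real" where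
  "L2_inner f g = (\<integral>s. f s * g s \<partial>unit_leb)"

definition L2_norm :: "(real \<Rightarrow> real) \<Rightarrow> real" where
  "L2_norm f = sqrt (L2_inner f f)"

text \<open>The Borel sigma-algebra of the (pseudo-)metric space \<open>L\<^sup>2([0,1])\<close>.\<close>

definition L2_borel :: "(real \<Rightarrow> real) measure" where
  "L2_borel = sigma L2
     {U. U \<subseteq> L2 \<and> (\<forall>f\<in>U. \<exists>r>0. \<forall>h\<in>L2. L2_norm (\<lambda>s. h s - f s) < r \<longrightarrow> h \<in> U)}"

definition abs_continuous_unit :: "(real \<Rightarrow> real) \<Rightarrow> bool" where
  "abs_continuous_unit f \<longleftrightarrow>
     (\<forall>e>0. \<exists>d>0. \<forall>(N::nat) x y.
        (\<forall>i<N. 0 \<le> x i \<and> x i \<le> y i \<and> y i \<le> 1) \<and>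
        disjoint_family_on (\<lambda>i. {x i<..<y i}) {..<N} \<and>
        (\<Sum>i<N. y i - x i) < d
        \<longrightarrow> (\<Sum>i<N. \<bar>f (y i) - f (x i)\<bar>) < e)"

text \<open>
  Derivatives are taken relative to \<open>[0,1]\<close>, hence one-sided at the end points.  Where the
  derivative does not exist, the value is one fixed unspecified real number; for the top
  derivative of a Sobolev function this concerns a null set only.
\<close>

fun nderiv :: "nat \<Rightarrow> (real \<Rightarrow> real) \<Rightarrow> real \<Rightarrow> real" where
  "nderiv 0 b = b"
| "nderiv (Suc k) b = (\<lambda>s. vector_derivative (nderiv k b) (at s within {0..1}))"

text \<open>
  The Sobolev space of order \<open>m\<close>.  A function on \<open>[0,1]\<close> is represented by its extension
  by zero, so that two elements with the same values on \<open>[0,1]\<close> are equal.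
\<close>

definition sobolev :: "nat \<Rightarrow> (real \<Rightarrow> real) set" where
  "sobolev m = {b.
     (\<forall>s. s \<notin> {0..1} \<longrightarrow> b s = 0) \<and>
     (\<forall>k. Suc k < m \<longrightarrow> (\<forall>s\<in>{0..1}. nderiv k b differentiable (at s within {0..1}))) \<and>
     (\<forall>k<m. abs_continuous_unit (nderiv k b)) \<and>
     nderiv m b \<in> L2}"


section \<open>Bilinear forms and operators\<close>

definition covariance :: "'w measure \<Rightarrow> ('w \<Rightarrow> real) \<Rightarrow> ('w \<Rightarrow> real) \<Rightarrow> real" where
  "covariance M U W =
     (\<integral>\<omega>. (U \<omega> - (\<integral>\<omega>'. U \<omega>' \<partial>M)) * (W \<omega> - (\<integral>\<omega>'. W \<omega>' \<partial>M)) \<partial>M)"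

definition C_X :: "'w measure \<Rightarrow> (int \<Rightarrow> 'w \<Rightarrow> real \<Rightarrow> real) \<Rightarrow> real \<Rightarrow> real \<Rightarrow> real" where
  "C_X M X s t = covariance M (\<lambda>\<omega>. X 1 \<omega> s) (\<lambda>\<omega>. X 1 \<omega> t)"

definition V_form ::
    "'w measure \<Rightarrow> (int \<Rightarrow> 'w \<Rightarrow> real \<Rightarrow> real) \<Rightarrow> (real \<Rightarrow> real) \<Rightarrow> (real \<Rightarrow> real) \<Rightarrow> real" where
  "V_form M X b1 b2 = (\<integral>s. (\<integral>t. C_X M X s t * b1 s * b2 t \<partial>unit_leb) \<partial>unit_leb)"

definition J_form :: "nat \<Rightarrow> (real \<Rightarrow> real) \<Rightarrow> (real \<Rightarrow> real) \<Rightarrow> real" where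
  "J_form m b1 b2 = (\<integral>s. nderiv m b1 s * nderiv m b2 s \<partial>unit_leb)"

definition K_inner ::
    "'w measure \<Rightarrow> (int \<Rightarrow> 'w \<Rightarrow> real \<Rightarrow> real) \<Rightarrow> nat \<Rightarrow> real
     \<Rightarrow> (real \<Rightarrow> real) \<Rightarrow> (real \<Rightarrow> real) \<Rightarrow> real" where
  "K_inner M X m l b1 b2 = V_form M X b1 b2 + l * J_form m b1 b2"

definition K_norm ::
    "'w measure \<Rightarrow> (int \<Rightarrow> 'w \<Rightarrow> real \<Rightarrow> real) \<Rightarrow> nat \<Rightarrow> real \<Rightarrow> (real \<Rightarrow> real) \<Rightarrow> real" where
  "K_norm M X m l b = sqrt (K_inner M X m l b b)"

definition W_op ::
    "'w measure \<Rightarrow> (int \<Rightarrow> 'w \<Rightarrow> real \<Rightarrow> real) \<Rightarrow> nat \<Rightarrow> real \<Rightarrow> (real \<Rightarrow> real) \<Rightarrow> real \<Rightarrow> real" where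
  "W_op M X m l b1 =
     (THE w. w \<in> sobolev m \<and> (\<forall>b2\<in>sobolev m. K_inner M X m l w b2 = l * J_form m b1 b2))"

definition tau ::
    "'w measure \<Rightarrow> (int \<Rightarrow> 'w \<Rightarrow> real \<Rightarrow> real) \<Rightarrow> nat \<Rightarrow> real \<Rightarrow> (real \<Rightarrow> real) \<Rightarrow> real \<Rightarrow> real" where
  "tau M X m l z =
     (THE w. w \<in> sobolev m \<and> (\<forall>b\<in>sobolev m. K_inner M X m l w b = L2_inner b z))"


section \<open>Model and estimator\<close>

definition strictly_stationary ::
    "'w measure \<Rightarrow> (int \<Rightarrow> 'w \<Rightarrow> real \<Rightarrow> real) \<Rightarrow> (int \<Rightarrow> 'w \<Rightarrow> real) \<Rightarrow> bool" where
  "strictly_stationary M X \<epsilon> \<longleftrightarrow>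
     (\<forall>h::int.
        distr M (\<Pi>\<^sub>M i\<in>UNIV. L2_borel \<Otimes>\<^sub>M borel) (\<lambda>\<omega> i. (X (i + h) \<omega>, \<epsilon> (i + h) \<omega>)) =
        distr M (\<Pi>\<^sub>M i\<in>UNIV. L2_borel \<Otimes>\<^sub>M borel) (\<lambda>\<omega> i. (X i \<omega>, \<epsilon> i \<omega>)))"

definition regression_model ::
    "'w measure \<Rightarrow> (int \<Rightarrow> 'w \<Rightarrow> real \<Rightarrow> real) \<Rightarrow> (int \<Rightarrow> 'w \<Rightarrow> real) \<Rightarrow> bool" where
  "regression_model M X \<epsilon> \<longleftrightarrow>
     prob_space M \<and>
     strictly_stationary M X \<epsilon> \<and>
     (\<forall>i. (\<lambda>(\<omega>, s). X i \<omega> s) \<in> borel_measurable (M \<Otimes>\<^sub>M unit_leb)) \<and>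
     (\<forall>i. \<forall>\<omega>\<in>space M. X i \<omega> \<in> L2) \<and>
     (\<forall>i. integrable M (\<lambda>\<omega>. (L2_norm (X i \<omega>))\<^sup>2)) \<and>
     (\<forall>i. \<forall>s\<in>{0..1}. integrable M (\<lambda>\<omega>. (X i \<omega> s)\<^sup>2) \<and> (\<integral>\<omega>. X i \<omega> s \<partial>M) = 0) \<and>
     (\<forall>i. integrable M (\<epsilon> i) \<and> (\<integral>\<omega>. \<epsilon> i \<omega> \<partial>M) = 0)"

definition response ::
    "(int \<Rightarrow> 'w \<Rightarrow> real \<Rightarrow> real) \<Rightarrow> (int \<Rightarrow> 'w \<Rightarrow> real) \<Rightarrow> (real \<Rightarrow> real) \<Rightarrow> int \<Rightarrow> 'w \<Rightarrow> real" where
  "response X \<epsilon> \<beta>\<^sub>0 i \<omega> = (\<integral>s. X i \<omega> s * \<beta>\<^sub>0 s \<partial>unit_leb) + \<epsilon> i \<omega>"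

text \<open>The penalised least squares criterion based on the first \<open>k\<close> observations.\<close>

definition criterion ::
    "(int \<Rightarrow> 'w \<Rightarrow> real \<Rightarrow> real) \<Rightarrow> (int \<Rightarrow> 'w \<Rightarrow> real) \<Rightarrow> nat \<Rightarrow> real \<Rightarrow> nat \<Rightarrow> 'w
     \<Rightarrow> (real \<Rightarrow> real) \<Rightarrow> real" where
  "criterion X Y m l k \<omega> b =
     1 / (2 * real k) * (\<Sum>i=1..k. (Y (int i) \<omega> - (\<integral>s. X (int i) \<omega> s * b s \<partial>unit_leb))\<^sup>2)
     + l / 2 * J_form m b b"

abbreviation subsample :: "nat \<Rightarrow> real \<Rightarrow> nat" where
  "subsample n \<nu> \<equiv> nat \<lfloor>real n * \<nu>\<rfloor>"

text \<open>
  The minimiser need not be unique for every outcome and sample size (polynomials of degree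
  less than \<open>m\<close> may be orthogonal to all observed regressors), so an estimator is any
  selection from the set of minimisers.
\<close>

definition is_estimator ::
    "'w measure \<Rightarrow> (int \<Rightarrow> 'w \<Rightarrow> real \<Rightarrow> real) \<Rightarrow> (int \<Rightarrow> 'w \<Rightarrow> real) \<Rightarrow> nat \<Rightarrow> (nat \<Rightarrow> real) \<Rightarrow> real
     \<Rightarrow> (nat \<Rightarrow> real \<Rightarrow> 'w \<Rightarrow> real \<Rightarrow> real) \<Rightarrow> bool" where
  "is_estimator M X Y m lam \<nu>\<^sub>0 \<beta>hat \<longleftrightarrow>
     (\<forall>n. \<forall>\<nu>\<in>{\<nu>\<^sub>0..1}. \<forall>\<omega>\<in>space M. subsample n \<nu> \<ge> 1 \<longrightarrow>
        is_arg_min (criterion X Y m (lam n) (subsample n \<nu>) \<omega>) (\<lambda>b. b \<in> sobolev m)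
          (\<beta>hat n \<nu> \<omega>))"

text \<open>
  \<open>Z\<^sub>n = O\<^sub>p(v\<^sub>n)\<close>, formulated with measurable events of probability at least \<open>1 - e\<close> so that
  no measurability of \<open>Z\<^sub>n\<close> has to be presupposed (i.e. with respect to outer probability).
\<close>

definition bigO_p :: "'w measure \<Rightarrow> (nat \<Rightarrow> 'w \<Rightarrow> ereal) \<Rightarrow> (nat \<Rightarrow> real) \<Rightarrow> bool" where
  "bigO_p M Z v \<longleftrightarrow>
     (\<forall>e>0. \<exists>B>0. \<forall>\<^sub>F n in sequentially.
        \<exists>A\<in>sets M. measure M A \<ge> 1 - e \<and> (\<forall>\<omega>\<in>A. \<bar>Z n \<omega>\<bar> \<le> ereal (B * v n)))"


section \<open>Assumptions\<close>

definition A1 :: "'w measure \<Rightarrow> (int \<Rightarrow> 'w \<Rightarrow> real \<Rightarrow> real) \<Rightarrow> bool" where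
  "A1 M X \<longleftrightarrow>
     continuous_on ({0..1} \<times> {0..1}) (\<lambda>(s, t). C_X M X s t) \<and>
     (\<forall>\<gamma>\<in>L2. (\<forall>t\<in>{0..1}. (\<integral>s. C_X M X s t * \<gamma> s \<partial>unit_leb) = 0) \<longrightarrow> (AE s in unit_leb. \<gamma> s = 0))"

definition A2 ::
    "'w measure \<Rightarrow> (int \<Rightarrow> 'w \<Rightarrow> real \<Rightarrow> real) \<Rightarrow> nat
     \<Rightarrow> (nat \<Rightarrow> real \<Rightarrow> real) \<Rightarrow> (nat \<Rightarrow> real) \<Rightarrow> real \<Rightarrow> real \<Rightarrow> bool" where
  "A2 M X m \<phi> \<rho> a D \<longleftrightarrow>
     a \<ge> 0 \<and> D > a + 1/2 \<and>
     (\<forall>k\<ge>1. \<phi> k \<in> sobolev m) \<and>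
     (\<exists>c>0. \<forall>k\<ge>1. \<forall>s\<in>{0..1}. \<bar>\<phi> k s\<bar> \<le> c * real k powr a) \<and>
     (\<forall>k\<ge>1. \<forall>k'\<ge>1. V_form M X (\<phi> k) (\<phi> k') = (if k = k' then 1 else 0)) \<and>
     (\<forall>k\<ge>1. \<forall>k'\<ge>1. J_form m (\<phi> k) (\<phi> k') = (if k = k' then \<rho> k else 0)) \<and>
     \<rho> \<in> \<Theta>(\<lambda>k. real k powr (2 * D)) \<and>
     (\<forall>l>0. \<forall>b\<in>sobolev m.
        (\<lambda>N. K_norm M X m l (\<lambda>s. b s - (\<Sum>k=1..N. V_form M X b (\<phi> k) * \<phi> k s))) \<longlonglongrightarrow> 0)"

definition C_U_lam ::
    "'w measure \<Rightarrow> (int \<Rightarrow> 'w \<Rightarrow> real \<Rightarrow> real) \<Rightarrow> (int \<Rightarrow> 'w \<Rightarrow> real) \<Rightarrow> nat \<Rightarrow> real \<Rightarrow> real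
     \<Rightarrow> real \<Rightarrow> real \<Rightarrow> real \<Rightarrow> real" where
  "C_U_lam M X \<epsilon> m a D l s t =
     l powr ((2 * a + 1) / D) *
     infsum (\<lambda>j::int. covariance M (\<lambda>\<omega>. \<epsilon> 0 \<omega> * tau M X m l (X 0 \<omega>) s)
                                   (\<lambda>\<omega>. \<epsilon> j \<omega> * tau M X m l (X j \<omega>) t)) UNIV"

definition A3 ::
    "'w measure \<Rightarrow> (int \<Rightarrow> 'w \<Rightarrow> real \<Rightarrow> real) \<Rightarrow> (int \<Rightarrow> 'w \<Rightarrow> real) \<Rightarrow> (real \<Rightarrow> real) \<Rightarrow> nat
     \<Rightarrow> (nat \<Rightarrow> real \<Rightarrow> real) \<Rightarrow> (nat \<Rightarrow> real) \<Rightarrow> real \<Rightarrow> real \<Rightarrow> bool" where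
  "A3 M X \<epsilon> \<beta>\<^sub>0 m \<phi> \<rho> a D \<longleftrightarrow>
     (\<exists>q>0. integrable M (\<lambda>\<omega>. exp (q * (L2_norm (X 0 \<omega>))\<^sup>2))) \<and>
     (\<exists>c\<^sub>0>0. \<forall>b\<in>sobolev m.
        (\<integral>\<omega>. (L2_inner (X 0 \<omega>) b) ^ 4 \<partial>M) \<le> c\<^sub>0 * (\<integral>\<omega>. (L2_inner (X 0 \<omega>) b)\<^sup>2 \<partial>M)\<^sup>2) \<and>
     (\<lambda>k. (\<rho> k)\<^sup>2 * (V_form M X \<beta>\<^sub>0 (\<phi> k))\<^sup>2) summable_on {1..} \<and>
     (\<forall>s\<in>{0..1}. \<forall>t\<in>{0..1}. \<exists>L.
        ((\<lambda>l. C_U_lam M X \<epsilon> m a D l s t) \<longlongrightarrow> L) (at_right 0))"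

definition varsigma :: "nat \<Rightarrow> real \<Rightarrow> real \<Rightarrow> real" where
  "varsigma m a D = (2 * D - 2 * a - 1) / (4 * D * real m) + (a + 1) / (2 * D)"

definition A4 :: "nat \<Rightarrow> real \<Rightarrow> real \<Rightarrow> (nat \<Rightarrow> real) \<Rightarrow> bool" where
  "A4 m a D lam \<longleftrightarrow>
     lam \<longlonglongrightarrow> 0 \<and>
     (\<lambda>n. 1 / real n * lam n powr (- (2 * a + 1) / D)) \<longlonglongrightarrow> 0 \<and>
     (\<lambda>n. real n * lam n powr (2 + (2 * a + 1) / (2 * D))) \<longlonglongrightarrow> 0 \<and>
     (\<lambda>n. 1 / real n * lam n powr (- 2 * varsigma m a D) * ln (real n)) \<longlonglongrightarrow> 0 \<and>
     (\<lambda>n. lam n powr (- 2 * varsigma m a D + (2 * D + 2 * a + 1) / (2 * D)) * ln (real n))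
        \<longlonglongrightarrow> 0"

text \<open>Independence of two random elements whose values may have different types.\<close>

definition indep_elements ::
    "'w measure \<Rightarrow> 'b measure \<Rightarrow> ('w \<Rightarrow> 'b) \<Rightarrow> 'c measure \<Rightarrow> ('w \<Rightarrow> 'c) \<Rightarrow> bool" where
  "indep_elements M N F N' G \<longleftrightarrow>
     F \<in> measurable M N \<and> G \<in> measurable M N' \<and>
     prob_space.indep_set M {F -` A \<inter> space M | A. A \<in> sets N} {G -` B \<inter> space M | B. B \<in> sets N'}"

text \<open>
  Sequences fed to \<open>g\<close> and \<open>h\<close> are indexed by \<open>nat\<close> and run from the most recent innovation
  into the past.  In the coupled sequence at time \<open>i\<close>, the first \<open>l\<close> entries are original
  innovations and the innovations at times \<open>i - l, i - l - 1, \<dots>\<close> are replaced by copies.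
\<close>

definition past :: "(int \<Rightarrow> 'w \<Rightarrow> 'b) \<Rightarrow> int \<Rightarrow> 'w \<Rightarrow> nat \<Rightarrow> 'b" where
  "past \<xi> i \<omega> = (\<lambda>j. \<xi> (i - int j) \<omega>)"

definition coupled_past ::
    "(int \<Rightarrow> 'w \<Rightarrow> 'b) \<Rightarrow> (int \<Rightarrow> nat \<Rightarrow> int \<Rightarrow> 'w \<Rightarrow> 'b) \<Rightarrow> int \<Rightarrow> nat \<Rightarrow> 'w \<Rightarrow> nat \<Rightarrow> 'b" where
  "coupled_past \<xi> \<xi>s i l \<omega> =
     (\<lambda>j. if j < l then \<xi> (i - int j) \<omega> else \<xi>s i l (i - int j) \<omega>)"

text \<open>
  The measurable space \<open>S\<close> consists of functions of \<open>t\<close> with values in a measurable space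
  \<open>R\<close>, which gives meaning to joint measurability of \<open>\<xi>\<^sub>i(t,\<omega>)\<close>; an arbitrary measurable space
  is covered through constant functions.
\<close>

definition innovations ::
    "'w measure \<Rightarrow> (real \<Rightarrow> 'r) measure \<Rightarrow> 'r measure
     \<Rightarrow> (int \<Rightarrow> 'w \<Rightarrow> real \<Rightarrow> 'r) \<Rightarrow> (int \<Rightarrow> 'w \<Rightarrow> real) \<Rightarrow> bool" where
  "innovations M S R \<xi> \<eta> \<longleftrightarrow>
     (\<forall>i. (\<lambda>(t, \<omega>). \<xi> i \<omega> t) \<in> measurable (unit_leb \<Otimes>\<^sub>M M) R) \<and>
     prob_space.indep_vars M (\<lambda>_. S) \<xi> UNIV \<and>
     (\<forall>i. distr M S (\<xi> i) = distr M S (\<xi> 0)) \<and>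
     prob_space.indep_vars M (\<lambda>_. borel) \<eta> UNIV \<and>
     (\<forall>i. distr M borel (\<eta> i) = distr M borel (\<eta> 0)) \<and>
     indep_elements M (\<Pi>\<^sub>M i\<in>UNIV. S) (\<lambda>\<omega> i. \<xi> i \<omega>) (\<Pi>\<^sub>M i\<in>UNIV. borel) (\<lambda>\<omega> i. \<eta> i \<omega>)"

text \<open>
  The family \<open>\<zeta>s\<close> consists of independent copies of \<open>\<zeta> 0\<close> and is independent of the two
  innovation sequences \<open>\<xi>\<close>, \<open>\<eta>\<close>.
\<close>

definition independent_copies ::
    "'w measure \<Rightarrow> (real \<Rightarrow> 'r) measure \<Rightarrow> (int \<Rightarrow> 'w \<Rightarrow> real \<Rightarrow> 'r) \<Rightarrow> (int \<Rightarrow> 'w \<Rightarrow> real)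
     \<Rightarrow> 'b measure \<Rightarrow> (int \<Rightarrow> 'w \<Rightarrow> 'b) \<Rightarrow> (int \<Rightarrow> nat \<Rightarrow> int \<Rightarrow> 'w \<Rightarrow> 'b) \<Rightarrow> bool" where
  "independent_copies M S \<xi> \<eta> T \<zeta> \<zeta>s \<longleftrightarrow>
     prob_space.indep_vars M (\<lambda>_. T) (\<lambda>(i, l, k). \<zeta>s i l k) UNIV \<and>
     (\<forall>i l k. distr M T (\<zeta>s i l k) = distr M T (\<zeta> 0)) \<and>
     indep_elements M
       (\<Pi>\<^sub>M p\<in>UNIV. T) (\<lambda>\<omega> (i, l, k). \<zeta>s i l k \<omega>)
       ((\<Pi>\<^sub>M i\<in>UNIV. S) \<Otimes>\<^sub>M (\<Pi>\<^sub>M i\<in>UNIV. borel)) (\<lambda>\<omega>. (\<lambda>i. \<xi> i \<omega>, \<lambda>i. \<eta> i \<omega>))"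

definition A5 ::
    "'w measure \<Rightarrow> (int \<Rightarrow> 'w \<Rightarrow> real \<Rightarrow> real) \<Rightarrow> (int \<Rightarrow> 'w \<Rightarrow> real)
     \<Rightarrow> (real \<Rightarrow> 'r) measure \<Rightarrow> 'r measure
     \<Rightarrow> ((nat \<Rightarrow> real \<Rightarrow> 'r) \<Rightarrow> real \<Rightarrow> real) \<Rightarrow> ((nat \<Rightarrow> real) \<Rightarrow> real)
     \<Rightarrow> (int \<Rightarrow> 'w \<Rightarrow> real \<Rightarrow> 'r) \<Rightarrow> (int \<Rightarrow> 'w \<Rightarrow> real)
     \<Rightarrow> (int \<Rightarrow> nat \<Rightarrow> int \<Rightarrow> 'w \<Rightarrow> real \<Rightarrow> 'r) \<Rightarrow> (int \<Rightarrow> nat \<Rightarrow> int \<Rightarrow> 'w \<Rightarrow> real) \<Rightarrow> bool" where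
  "A5 M X \<epsilon> S R g h \<xi> \<eta> \<xi>s \<eta>s \<longleftrightarrow>
     innovations M S R \<xi> \<eta> \<and>
     g \<in> measurable (\<Pi>\<^sub>M j\<in>UNIV. S) L2_borel \<and>
     h \<in> measurable (\<Pi>\<^sub>M j\<in>UNIV. borel) borel \<and>
     (\<forall>i. AE \<omega> in M. AE s in unit_leb. X i \<omega> s = g (past \<xi> i \<omega>) s) \<and>
     (\<forall>i. AE \<omega> in M. \<epsilon> i \<omega> = h (past \<eta> i \<omega>)) \<and>
     (\<forall>s\<in>{0..1}. (\<integral>\<omega>. X 0 \<omega> s \<partial>M) = 0) \<and> (\<integral>\<omega>. \<epsilon> 0 \<omega> \<partial>M) = 0 \<and>
     independent_copies M S \<xi> \<eta> S \<xi> \<xi>s \<and>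
     independent_copies M S \<xi> \<eta> borel \<eta> \<eta>s \<and>
     (\<exists>\<delta>\<in>{0<..<1}.
        integrable M (\<lambda>\<omega>. \<bar>\<epsilon> 0 \<omega>\<bar> powr (2 + \<delta>)) \<and>
        (\<exists>\<kappa>>2 + \<delta>. \<forall>i.
           (\<lambda>l. (\<integral>\<omega>. L2_norm (\<lambda>s. X i \<omega> s - g (coupled_past \<xi> \<xi>s i l \<omega>) s) powr (2 + \<delta>) \<partial>M)
                  powr (1 / \<kappa>)) summable_on {1..} \<and>
           (\<lambda>l. (\<integral>\<omega>. \<bar>\<epsilon> i \<omega> - h (coupled_past \<eta> \<eta>s i l \<omega>)\<bar> powr (2 + \<delta>) \<partial>M)
                  powr (1 / \<kappa>)) summable_on {1..}))"

end

theory Submission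
  imports Defs "HOL-Computational_Algebra.Polynomial"
begin

text \<open>
  The first-order condition of the penalised criterion, tested against the Riesz representatives in
  \<open>\<langle>\<cdot>,\<cdot>\<rangle>\<^sub>K\<close>, bounds the remainder by the deviation of the empirical from the true
  covariance form times the estimation error, plus \<open>O(1/n)\<close> times the noise functional.  In the eigenbasis both
  random quantities are controlled by Hilbert--Schmidt norms, with weights \<open>1 / (1 + \<lambda>\<rho>\<^sub>k)\<close>, of
  partial sums of the centred products of scores and of the noise scores.  Coupling with independent copies of the remote
  innovations gives summable covariances, hence second moments of blocks linear in their length, and the Rademacher--Menshov
  inequality makes the bounds uniform over all partial sums at the cost of logarithms.  The logarithms
  are harmless because \<open>\<varsigma>\<close> is strictly larger than the exponent \<open>(a + 1) / (2 D)\<close> of the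
  Hilbert--Schmidt norm and \<open>log n\<close> is smaller than any negative power of \<open>\<lambda>\<close>.
\<close>

section \<open>Absolutely continuous functions on the unit interval\<close>

text \<open>\<open>W_op\<close> and \<open>tau\<close> are definite descriptions, so they mean
  something only after a Riesz theorem for the form \<open>K\<close>. Assumption \<open>A2\<close>
  expands given elements of \<open>sobolev m\<close>; that a weighted square-summable coefficient
  sequence comes from an element is a matter of completeness. Completeness rests on writing a
  Sobolev function as a polynomial plus an \<open>m\<close>-fold indefinite integral, and for
  \<open>m = 1\<close> this is the theorem that absolutely continuous functions are indefinite
  integrals.

  The probabilistic obstacle is a lack of moments: noise and coupling errors are controlled in
  moments of order \<open>2 + \<delta>\<close>, while a covariance of two products of scores has
  four factors. Second moments with Markov's inequality are therefore used throughout. The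
  exponential moment supplies the missing integrability for the norm of \<open>X\<close>, so each
  index \<open>k\<close> costs a factor \<open>L2_norm (ev k)\<close>, at most of order
  \<open>k powr a\<close>. Summed against \<open>wt l k\<close> this leads, up to arbitrarily small
  slack, to the exponent \<open>(a + 1) / (2 * D)\<close> in \<open>varsigma\<close>.\<close>

lemma space_unit_leb [simp]: "space unit_leb = {0..1}"
  by (simp add: space_restrict_space)

lemma prob_space_unit_leb: "prob_space unit_leb"
  by standard (simp add: emeasure_restrict_space)

interpretation unit_leb: prob_space unit_leb
  by (rule prob_space_unit_leb)

section \<open>Indefinite integrals and their derivatives almost everywhere\<close>

lemma integrable_unit_leb_mult_indicator:
  fixes h :: "real \<Rightarrow> real"
  assumes "integrable unit_leb h" "A \<in> sets borel"
  shows "integrable unit_leb (\<lambda>s. h s * indicator A s)"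
proof -
  have "A \<inter> {0..1} \<in> sets unit_leb"
    using assms(2) by (auto simp: sets_restrict_space)
  then have "integrable unit_leb (\<lambda>s. h s * indicator (A \<inter> {0..1}) s)"
    using assms(1) by (intro integrable_real_mult_indicator) auto
  moreover have "integrable unit_leb (\<lambda>s. h s * indicator (A \<inter> {0..1}) s)
    \<longleftrightarrow> integrable unit_leb (\<lambda>s. h s * indicator A s)"
    by (rule Bochner_Integration.integrable_cong) (auto simp: indicator_def)
  ultimately show ?thesis by simp
qed

text \<open>The upper limit sits in an indicator under the fixed measure, so \<open>prim h\<close>
  is a total function of a real argument and can be iterated as \<open>prim ^^ k\<close>.\<close>

definition prim :: "(real \<Rightarrow> real) \<Rightarrow> real \<Rightarrow> real" where
  "prim h x = (\<integral>s. h s * indicator {0..x} s \<partial>unit_leb)"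

lemma AE_unit_leb_neq: "AE s in unit_leb. s \<noteq> c"
proof -
  have "AE s in lborel. s \<noteq> c" by (rule AE_lborel_singleton)
  then show ?thesis by (subst AE_restrict_space_iff) auto
qed

lemma prim_0 [simp]: "prim h 0 = 0"
  unfolding prim_def
  by (rule integral_eq_zero_AE) (use AE_unit_leb_neq[of 0] in eventually_elim, auto simp: indicator_def)

lemma prim_diff:
  assumes "integrable unit_leb h" "0 \<le> x" "x \<le> y"
  shows "prim h y - prim h x = (\<integral>s. h s * indicator {x<..y} s \<partial>unit_leb)"
proof -
  have "prim h y - prim h x = (\<integral>s. h s * indicator {0..y} s - h s * indicator {0..x} s \<partial>unit_leb)"
    unfolding prim_def
    by (rule Bochner_Integration.integral_diff[symmetric]) (auto intro!: integrable_unit_leb_mult_indicator assms)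
  also have "\<dots> = (\<integral>s. h s * indicator {x<..y} s \<partial>unit_leb)"
    by (rule Bochner_Integration.integral_cong) (use assms in \<open>auto simp: indicator_def\<close>)
  finally show ?thesis .
qed

lemma prim_cong_AE:
  assumes "h \<in> borel_measurable unit_leb" "h' \<in> borel_measurable unit_leb" "AE s in unit_leb. h s = h' s"
  shows "prim h x = prim h' x"
proof -
  have [measurable]: "indicat_real {0..x} \<in> borel_measurable unit_leb"
    by (rule measurable_restrict_space1) simp
  show ?thesis
    unfolding prim_def using assms
    by (intro Bochner_Integration.integral_cong_AE borel_measurable_times) auto
qed

lemma integrable_lborel_extend_unit:
  assumes "integrable unit_leb (h::real\<Rightarrow>real)"
  shows "integrable lborel (\<lambda>s. indicator {0..1} s * h s)"
  using assms by (subst (asm) integrable_restrict_space) (auto simp: mult_ac)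

text \<open>Bridge to the Henstock--Kurzweil integral, for which the differentiation theorem and the
  fundamental theorem of calculus are available. The indicator extends \<open>h\<close> by
  zero.\<close>

lemma integral_eq_prim_diff:
  assumes "integrable unit_leb h" "0 \<le> x" "x \<le> y" "y \<le> 1"
  shows "integral {x..y} (\<lambda>s. indicator {0..1} s * h s) = prim h y - prim h x"
proof -
  let ?f = "\<lambda>s. indicator {0..1} s * h s"
  have i: "integrable lborel (\<lambda>s. indicator {x<..y} s * ?f s)"
    by (subst mult.commute, intro integrable_real_mult_indicator integrable_lborel_extend_unit assms(1)) simp
  have "prim h y - prim h x = (\<integral>s. h s * indicator {x<..y} s \<partial>unit_leb)"
    by (rule prim_diff) (use assms in auto)
  also have "\<dots> = (\<integral>s. indicator {x<..y} s * ?f s \<partial>lborel)"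
    by (subst integral_restrict_space) (auto simp: mult_ac)
  also have "\<dots> = integral UNIV (\<lambda>s. indicator {x<..y} s * ?f s)"
    using has_integral_integral_lborel[OF i] by (simp add: integral_unique)
  also have "\<dots> = integral UNIV (\<lambda>s. if s \<in> {x..y} then ?f s else 0)"
    by (rule integral_spike[where S = "{x}"]) (auto simp: indicator_def)
  also have "\<dots> = integral {x..y} ?f"
    by (rule integral_restrict_UNIV)
  finally show ?thesis by simp
qed

text \<open>Lebesgue differentiation. \<open>integrable_ccontinuous_explicit\<close> controls
  averages over \<open>{x..x + t}\<close>, that is, right derivatives; left derivatives come from
  applying it also to the reflected function.\<close>

lemma prim_has_derivative_AE:
  assumes h: "integrable unit_leb h"
  shows "AE x in unit_leb. (prim h has_real_derivative h x) (at x within {0..1})"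
proof -
  let ?f = "\<lambda>s. indicator {0..1} s * h s"
  have il: "integrable lborel ?f"
    by (rule integrable_lborel_extend_unit[OF h])
  have io: "?f integrable_on cbox a b" for a b
    using integrable_on_lborel[OF il] integrable_on_subcbox by blast
  have ir: "(\<lambda>s. ?f (- s)) integrable_on cbox a b" for a b
  proof -
    have "integrable lborel (\<lambda>s. ?f (- s))"
      using lborel_integrable_real_affine[OF il, of "-1" 0] by simp
    from integrable_on_lborel[OF this] show ?thesis using integrable_on_subcbox by blast
  qed
  obtain N1 where N1: "negligible N1" "\<And>x e. x \<notin> N1 \<Longrightarrow> 0 < e \<Longrightarrow>
      \<exists>d>0. \<forall>t. 0 < t \<and> t < d \<longrightarrow> norm (integral (cbox x (x + t *\<^sub>R One)) ?f /\<^sub>R t ^ DIM(real) - ?f x) < e"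
    by (rule integrable_ccontinuous_explicit[OF io]) blast
  obtain N2 where N2: "negligible N2" "\<And>x e. x \<notin> N2 \<Longrightarrow> 0 < e \<Longrightarrow>
      \<exists>d>0. \<forall>t. 0 < t \<and> t < d \<longrightarrow> norm (integral (cbox x (x + t *\<^sub>R One)) (\<lambda>s. ?f (- s)) /\<^sub>R t ^ DIM(real) - ?f (- x)) < e"
    by (rule integrable_ccontinuous_explicit[OF ir]) blast
  \<comment> \<open>\<open>N2\<close> lives on the reflected axis. The end points are discarded as
    well, so that every remaining point is interior and the limit there is two-sided.\<close>
  have neg: "negligible (N1 \<union> uminus ` N2 \<union> {0, 1})"
    using N1(1) N2(1)
    by (intro negligible_Un negligible_differentiable_image_negligible)
       (auto intro!: derivative_intros simp: differentiable_on_def)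
  have "AE x in lebesgue. x \<notin> N1 \<union> uminus ` N2 \<union> {0, 1}"
    by (rule AE_not_in) (use neg in \<open>simp only: negligible_iff_null_sets\<close>)
  then have "AE x in lborel. x \<notin> N1 \<union> uminus ` N2 \<union> {0, 1}"
    by (simp add: AE_completion_iff)
  then have "AE x in unit_leb. x \<notin> N1 \<union> uminus ` N2 \<union> {0, 1}"
    by (subst AE_restrict_space_iff) auto
  then show ?thesis
  proof (rule AE_mp, intro AE_I2 impI)
    fix x :: real assume xs: "x \<in> space unit_leb" and xN: "x \<notin> N1 \<union> uminus ` N2 \<union> {0, 1}"
    have x01: "0 < x" "x < 1" using xs xN by (auto simp: less_le)
    have fx: "?f x = h x" using x01 by simp
    have mN2: "- x \<notin> N2" using xN by (metis UnCI image_eqI minus_minus)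
    have "((\<lambda>y. (prim h y - prim h x) / (y - x)) \<longlongrightarrow> h x) (at x)"
    proof (rule tendstoI)
      fix e :: real assume e: "e > 0"
      from N1(2)[OF _ e, of x] xN obtain d1 where d1: "d1 > 0"
        "\<And>t. 0 < t \<Longrightarrow> t < d1 \<Longrightarrow> \<bar>integral {x..x+t} ?f / t - h x\<bar> < e"
        using fx by (auto simp: divide_inverse_commute)
      from N2(2)[OF mN2 e] obtain d2 where d2: "d2 > 0"
        "\<And>t. 0 < t \<Longrightarrow> t < d2 \<Longrightarrow> \<bar>integral {-x..-x+t} (\<lambda>s. ?f (- s)) / t - h x\<bar> < e"
        using fx by (auto simp: divide_inverse_commute)
      define d where "d = Min {d1, d2, x, 1 - x}"
      have d: "d > 0" "d \<le> d1" "d \<le> d2" "d \<le> x" "d \<le> 1 - x"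
        using d1 d2 x01 by (auto simp: d_def)
      have "dist ((prim h y - prim h x) / (y - x)) (h x) < e" if y: "y \<noteq> x" "dist y x < d" for y
      proof (cases "y > x")
        case True
        define t where "t = y - x"
        have t: "0 < t" "t < d1" "x + t \<le> 1" using True y d by (auto simp: t_def dist_real_def)
        have "integral {x..x+t} ?f = prim h (x+t) - prim h x"
          by (rule integral_eq_prim_diff) (use h t x01 in auto)
        then show ?thesis using d1(2)[OF t(1,2)] by (simp add: t_def dist_real_def)
      next
        case False
        define t where "t = x - y"
        have t: "0 < t" "t < d2" "0 \<le> x - t" using False y d by (auto simp: t_def dist_real_def)
        have "integral {-x..-x+t} (\<lambda>s. ?f (- s)) = integral {x - t..x} ?f"
          using Henstock_Kurzweil_Integration.integral_reflect_real[of x "x - t" "?f"] by simp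
        also have "\<dots> = prim h x - prim h (x - t)"
          by (rule integral_eq_prim_diff) (use h t x01 in auto)
        finally have *: "\<bar>(prim h x - prim h y) / (x - y) - h x\<bar> < e"
          using d2(2)[OF t(1,2)] by (simp add: t_def)
        have "(prim h x - prim h y) / (x - y) = (prim h y - prim h x) / (y - x)"
          using y by (simp add: field_simps)
        with * show ?thesis by (simp add: dist_real_def)
      qed
      then show "\<forall>\<^sub>F y in at x. dist ((prim h y - prim h x) / (y - x)) (h x) < e"
        unfolding eventually_at using d(1) by auto
    qed
    then have "(prim h has_real_derivative h x) (at x)"
      by (simp add: has_field_derivative_iff)
    then show "(prim h has_real_derivative h x) (at x within {0..1})"
      by (rule has_field_derivative_at_within)
  qed
qed

section \<open>Absolute continuity: finite families of intervals and elementary properties\<close>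

lemma abs_continuous_unitE:
  assumes "abs_continuous_unit f" "e > 0"
  obtains d where "d > 0"
    "\<And>(I::'i set) x y. finite I \<Longrightarrow> (\<And>i. i \<in> I \<Longrightarrow> 0 \<le> x i \<and> x i \<le> y i \<and> y i \<le> 1) \<Longrightarrow>
       disjoint_family_on (\<lambda>i. {x i<..<y i}) I \<Longrightarrow> (\<Sum>i\<in>I. y i - x i) < d \<Longrightarrow>
       (\<Sum>i\<in>I. \<bar>f (y i) - f (x i)\<bar>) < e"
proof -
  have "\<exists>d>0. \<forall>(N::nat) x y.
        (\<forall>i<N. 0 \<le> x i \<and> x i \<le> y i \<and> y i \<le> 1) \<and>
        disjoint_family_on (\<lambda>i. {x i<..<y i}) {..<N} \<and>
        (\<Sum>i<N. y i - x i) < d \<longrightarrow> (\<Sum>i<N. \<bar>f (y i) - f (x i)\<bar>) < e"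
    using assms unfolding abs_continuous_unit_def by (elim allE[of _ e] impE)
  then obtain d where d: "d > 0" and d': "\<forall>(N::nat) x y.
        (\<forall>i<N. 0 \<le> x i \<and> x i \<le> y i \<and> y i \<le> 1) \<and>
        disjoint_family_on (\<lambda>i. {x i<..<y i}) {..<N} \<and>
        (\<Sum>i<N. y i - x i) < d \<longrightarrow> (\<Sum>i<N. \<bar>f (y i) - f (x i)\<bar>) < e"
    by (elim exE conjE)
  show ?thesis
  proof (rule that[OF d])
    fix I :: "'i set" and x y
    assume I: "finite I" "\<And>i. i \<in> I \<Longrightarrow> 0 \<le> x i \<and> x i \<le> y i \<and> y i \<le> 1"
      "disjoint_family_on (\<lambda>i. {x i<..<y i}) I" "(\<Sum>i\<in>I. y i - x i) < d"
    \<comment> \<open>The definition speaks of families over \<open>{..<N}\<close>. Below, families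
      are indexed by pairs of numbers and by sets of intervals, hence the transfer to an arbitrary
      finite index set.\<close>
    obtain b where b: "bij_betw b {..<card I} I"
      using ex_bij_betw_nat_finite[OF I(1)] by (auto simp: atLeast0LessThan)
    have bI: "b i \<in> I" if "i < card I" for i using b that by (auto simp: bij_betw_def)
    have inj: "b i \<noteq> b j" if "i < card I" "j < card I" "i \<noteq> j" for i j
      using b that by (auto simp: bij_betw_def inj_on_def)
    have "(\<Sum>i<card I. \<bar>f ((y \<circ> b) i) - f ((x \<circ> b) i)\<bar>) < e"
    proof (rule d'[rule_format], intro conjI allI impI)
      show "disjoint_family_on (\<lambda>i. {(x \<circ> b) i<..<(y \<circ> b) i}) {..<card I}"
        using I(3) bI inj unfolding disjoint_family_on_def by (auto simp: o_def)
      show "(\<Sum>i<card I. (y \<circ> b) i - (x \<circ> b) i) < d"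
        using I(4) sum.reindex_bij_betw[OF b, of "\<lambda>i. y i - x i"] by simp
    qed (use I(2) bI in auto)
    then show "(\<Sum>i\<in>I. \<bar>f (y i) - f (x i)\<bar>) < e"
      using sum.reindex_bij_betw[OF b, of "\<lambda>i. \<bar>f (y i) - f (x i)\<bar>"] by simp
  qed
qed

lemma abs_continuous_unit_diff:
  assumes "abs_continuous_unit f" "abs_continuous_unit g"
  shows "abs_continuous_unit (\<lambda>x. f x - g x)"
  unfolding abs_continuous_unit_def
proof (intro allI impI)
  fix e :: real assume "e > 0"
  then have e2: "e / 2 > 0" by simp
  obtain d1 where d1: "d1 > 0" "\<And>(I::nat set) x y. finite I \<Longrightarrow> (\<And>i. i \<in> I \<Longrightarrow> 0 \<le> x i \<and> x i \<le> y i \<and> y i \<le> 1) \<Longrightarrow>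
       disjoint_family_on (\<lambda>i. {x i<..<y i}) I \<Longrightarrow> (\<Sum>i\<in>I. y i - x i) < d1 \<Longrightarrow>
       (\<Sum>i\<in>I. \<bar>f (y i) - f (x i)\<bar>) < e / 2"
    using abs_continuous_unitE[OF assms(1) e2] by blast
  obtain d2 where d2: "d2 > 0" "\<And>(I::nat set) x y. finite I \<Longrightarrow> (\<And>i. i \<in> I \<Longrightarrow> 0 \<le> x i \<and> x i \<le> y i \<and> y i \<le> 1) \<Longrightarrow>
       disjoint_family_on (\<lambda>i. {x i<..<y i}) I \<Longrightarrow> (\<Sum>i\<in>I. y i - x i) < d2 \<Longrightarrow>
       (\<Sum>i\<in>I. \<bar>g (y i) - g (x i)\<bar>) < e / 2"
    using abs_continuous_unitE[OF assms(2) e2] by blast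
  show "\<exists>d>0. \<forall>(N::nat) x y.
        (\<forall>i<N. 0 \<le> x i \<and> x i \<le> y i \<and> y i \<le> 1) \<and> disjoint_family_on (\<lambda>i. {x i<..<y i}) {..<N} \<and>
        (\<Sum>i<N. y i - x i) < d \<longrightarrow> (\<Sum>i<N. \<bar>f (y i) - g (y i) - (f (x i) - g (x i))\<bar>) < e"
  proof (intro exI[of _ "min d1 d2"] conjI allI impI; (elim conjE)?)
    fix N :: nat and x y
    assume a: "\<forall>i<N. 0 \<le> x i \<and> x i \<le> y i \<and> y i \<le> 1" "disjoint_family_on (\<lambda>i. {x i<..<y i}) {..<N}"
        "(\<Sum>i<N. y i - x i) < min d1 d2"
    have "(\<Sum>i<N. \<bar>f (y i) - g (y i) - (f (x i) - g (x i))\<bar>)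
        \<le> (\<Sum>i<N. \<bar>f (y i) - f (x i)\<bar> + \<bar>g (y i) - g (x i)\<bar>)"
      by (rule sum_mono) linarith
    also have "\<dots> < e / 2 + e / 2"
      unfolding sum.distrib using a by (intro add_strict_mono d1(2) d2(2)) auto
    finally show "(\<Sum>i<N. \<bar>f (y i) - g (y i) - (f (x i) - g (x i))\<bar>) < e" by simp
  qed (use d1(1) d2(1) in auto)
qed

lemma abs_continuous_unit_imp_continuous:
  assumes "abs_continuous_unit f"
  shows "continuous_on {0..1} f"
  unfolding continuous_on_iff
proof (intro ballI allI impI)
  fix x e :: real assume x: "x \<in> {0..1}" and e: "0 < e"
  obtain d where d: "d > 0" "\<And>(I::nat set) x y. finite I \<Longrightarrow> (\<And>i. i \<in> I \<Longrightarrow> 0 \<le> x i \<and> x i \<le> y i \<and> y i \<le> 1) \<Longrightarrow>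
       disjoint_family_on (\<lambda>i. {x i<..<y i}) I \<Longrightarrow> (\<Sum>i\<in>I. y i - x i) < d \<Longrightarrow>
       (\<Sum>i\<in>I. \<bar>f (y i) - f (x i)\<bar>) < e"
    using abs_continuous_unitE[OF assms e] by blast
  have "dist (f y) (f x) < e" if "y \<in> {0..1}" "dist y x < d" for y
    using d(2)[of "{0}" "\<lambda>_. x" "\<lambda>_. y"] d(2)[of "{0}" "\<lambda>_. y" "\<lambda>_. x"] x that
    by (cases "x \<le> y") (auto simp: disjoint_family_on_def dist_real_def abs_minus_commute)
  then show "\<exists>d>0. \<forall>y\<in>{0..1}. dist y x < d \<longrightarrow> dist (f y) (f x) < e"
    using d(1) by blast
qed

section \<open>Total variation of an absolutely continuous function\<close>

lemma disjoint_intervals_length: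
  fixes x y :: "'i \<Rightarrow> real"
  assumes "finite I" "\<And>i. i \<in> I \<Longrightarrow> u \<le> x i \<and> x i \<le> y i \<and> y i \<le> v"
    "disjoint_family_on (\<lambda>i. {x i<..<y i}) I" "u \<le> v"
  shows "(\<Sum>i\<in>I. y i - x i) \<le> v - u"
proof -
  have "ennreal (\<Sum>i\<in>I. y i - x i) = (\<Sum>i\<in>I. ennreal (y i - x i))"
    using assms(2) by (subst sum_ennreal) auto
  also have "\<dots> = (\<Sum>i\<in>I. emeasure lborel {x i<..<y i})"
    using assms(2) by (intro sum.cong) auto
  also have "\<dots> = emeasure lborel (\<Union>i\<in>I. {x i<..<y i})"
    using assms by (intro sum_emeasure) auto
  also have "\<dots> \<le> emeasure lborel {u..v}"
    using assms(2) by (intro emeasure_mono) force+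
  also have "\<dots> = ennreal (v - u)" using assms(4) by simp
  finally show ?thesis using assms(4) by (simp add: ennreal_le_iff)
qed

text \<open>Disjoint subintervals in place of partitions: gaps do not change the supremum, and
  families can be clipped and merged without ordering their end points.\<close>

definition var_sums :: "(real \<Rightarrow> real) \<Rightarrow> real \<Rightarrow> real \<Rightarrow> real set" where
  "var_sums f u v = {(\<Sum>i<N. \<bar>f (y i) - f (x i)\<bar>) | (N::nat) x y.
     (\<forall>i<N. u \<le> x i \<and> x i \<le> y i \<and> y i \<le> v) \<and> disjoint_family_on (\<lambda>i. {x i<..<y i}) {..<N}}"

definition variation :: "(real \<Rightarrow> real) \<Rightarrow> real \<Rightarrow> real \<Rightarrow> real" where
  "variation f u v = Sup (var_sums f u v)"

lemma var_sumsI: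
  fixes I :: "'i set"
  assumes I: "finite I" "\<And>i. i \<in> I \<Longrightarrow> u \<le> x i \<and> x i \<le> y i \<and> y i \<le> v"
    "disjoint_family_on (\<lambda>i. {x i<..<y i}) I"
  shows "(\<Sum>i\<in>I. \<bar>f (y i) - f (x i)\<bar>) \<in> var_sums f u v"
proof -
  obtain b where b: "bij_betw b {..<card I} I"
    using ex_bij_betw_nat_finite[OF I(1)] by (auto simp: atLeast0LessThan)
  have bI: "b i \<in> I" if "i < card I" for i using b that by (auto simp: bij_betw_def)
  have inj: "b i \<noteq> b j" if "i < card I" "j < card I" "i \<noteq> j" for i j
    using b that by (auto simp: bij_betw_def inj_on_def)
  have "disjoint_family_on (\<lambda>i. {(x \<circ> b) i<..<(y \<circ> b) i}) {..<card I}"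
    using I(3) bI inj unfolding disjoint_family_on_def by (auto simp: o_def)
  moreover have "(\<Sum>i\<in>I. \<bar>f (y i) - f (x i)\<bar>) = (\<Sum>i<card I. \<bar>f ((y \<circ> b) i) - f ((x \<circ> b) i)\<bar>)"
    using sum.reindex_bij_betw[OF b, of "\<lambda>i. \<bar>f (y i) - f (x i)\<bar>"] by simp
  moreover have "\<forall>i<card I. u \<le> (x \<circ> b) i \<and> (x \<circ> b) i \<le> (y \<circ> b) i \<and> (y \<circ> b) i \<le> v"
    using I(2) bI by auto
  ultimately show ?thesis unfolding var_sums_def by blast
qed

lemma var_sums_nonempty: "var_sums f u v \<noteq> {}"
  using var_sumsI[of "{}::nat set" u _ _ v f] by (auto simp: disjoint_family_on_def)

lemma var_sums_split:
  assumes s: "s \<in> var_sums f u v" and w: "u \<le> w" "w \<le> v"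
  obtains s1 s2 where "s1 \<in> var_sums f u w" "s2 \<in> var_sums f w v" "s \<le> s1 + s2"
proof -
  from s obtain N :: nat and x y where xy: "\<And>i. i < N \<Longrightarrow> u \<le> x i \<and> x i \<le> y i \<and> y i \<le> v"
    "disjoint_family_on (\<lambda>i. {x i<..<y i}) {..<N}" and s_eq: "s = (\<Sum>i<N. \<bar>f (y i) - f (x i)\<bar>)"
    unfolding var_sums_def by blast
  \<comment> \<open>Each interval is clipped at \<open>w\<close> from both sides. An interval on one
    side of \<open>w\<close> becomes degenerate on the other and contributes zero there; one that
    straddles \<open>w\<close> is split, at the cost of a triangle inequality.\<close>
  let ?s1 = "\<Sum>i<N. \<bar>f (min (y i) w) - f (min (x i) w)\<bar>"
  let ?s2 = "\<Sum>i<N. \<bar>f (max (y i) w) - f (max (x i) w)\<bar>"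
  show ?thesis
  proof (rule that)
    show "?s1 \<in> var_sums f u w"
      using xy w by (intro var_sumsI) (force simp: disjoint_family_on_def)+
    show "?s2 \<in> var_sums f w v"
      using xy w by (intro var_sumsI) (force simp: disjoint_family_on_def)+
    have "s \<le> (\<Sum>i<N. \<bar>f (min (y i) w) - f (min (x i) w)\<bar> + \<bar>f (max (y i) w) - f (max (x i) w)\<bar>)"
      unfolding s_eq
    proof (rule sum_mono)
      fix i assume "i \<in> {..<N}"
      then have "x i \<le> y i" using xy(1) by auto
      then show "\<bar>f (y i) - f (x i)\<bar> \<le> \<bar>f (min (y i) w) - f (min (x i) w)\<bar> + \<bar>f (max (y i) w) - f (max (x i) w)\<bar>"
        by (auto simp: min_def max_def)
    qed
    then show "s \<le> ?s1 + ?s2" by (simp add: sum.distrib)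
  qed
qed

text \<open>On an interval shorter than the modulus \<open>d\<close> for \<open>e = 1\<close> no
  variation sum exceeds 1; finitely many such intervals cover \<open>{u..v}\<close>.\<close>

lemma var_sums_bdd:
  assumes ac: "abs_continuous_unit f" and uv: "0 \<le> u" "v \<le> 1"
  shows "bdd_above (var_sums f u v)"
proof -
  obtain d where d: "d > 0" "\<And>(I::nat set) x y. finite I \<Longrightarrow> (\<And>i. i \<in> I \<Longrightarrow> 0 \<le> x i \<and> x i \<le> y i \<and> y i \<le> 1) \<Longrightarrow>
       disjoint_family_on (\<lambda>i. {x i<..<y i}) I \<Longrightarrow> (\<Sum>i\<in>I. y i - x i) < d \<Longrightarrow>
       (\<Sum>i\<in>I. \<bar>f (y i) - f (x i)\<bar>) < 1"
    using abs_continuous_unitE[OF ac, of 1] by auto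
  have small: "s \<le> 1" if s: "s \<in> var_sums f u v" "0 \<le> u" "u \<le> v" "v \<le> 1" "v - u < d" for s u v
  proof -
    from s obtain N :: nat and x y where xy: "\<And>i. i < N \<Longrightarrow> u \<le> x i \<and> x i \<le> y i \<and> y i \<le> v"
      "disjoint_family_on (\<lambda>i. {x i<..<y i}) {..<N}" and s_eq: "s = (\<Sum>i<N. \<bar>f (y i) - f (x i)\<bar>)"
      unfolding var_sums_def by blast
    have "(\<Sum>i<N. y i - x i) \<le> v - u" using xy s by (intro disjoint_intervals_length) auto
    then have "s < 1" unfolding s_eq using xy s by (intro d(2)) force+
    then show ?thesis by simp
  qed
  have bd: "s \<le> real n + 1" if "s \<in> var_sums f u v" "0 \<le> u" "u \<le> v" "v \<le> 1" "v - u \<le> real n * (d / 2)" for n s u v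
    using that
  proof (induction n arbitrary: s v)
    case 0
    then show ?case using small[of s u v] d by auto
  next
    case (Suc n)
    \<comment> \<open>Cuts off a last piece of length at most \<open>d / 2\<close>, strictly below
      the modulus \<open>d\<close>.\<close>
    define w where "w = max u (v - d / 2)"
    have w: "u \<le> w" "w \<le> v" using d Suc.prems by (auto simp: w_def)
    obtain s1 s2 where s12: "s1 \<in> var_sums f u w" "s2 \<in> var_sums f w v" "s \<le> s1 + s2"
      using var_sums_split[OF Suc.prems(1) w] .
    have "w - u \<le> real n * (d / 2)" using Suc.prems d by (auto simp: w_def max_def algebra_simps)
    then have "s1 \<le> real n + 1" using Suc.IH[OF s12(1)] Suc.prems w by auto
    moreover have "s2 \<le> 1" by (rule small[OF s12(2)]) (use Suc.prems w d in \<open>auto simp: w_def\<close>)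
    ultimately show ?case using s12 by simp
  qed
  show ?thesis
  proof (cases "u \<le> v")
    case True
    obtain n :: nat where "(v - u) / (d / 2) \<le> real n" using real_arch_simple by blast
    then have "v - u \<le> real n * (d / 2)" using d by (simp add: field_simps)
    with True show ?thesis using bd uv by (intro bdd_aboveI) blast
  next
    case False
    then have "var_sums f u v \<subseteq> {0}" unfolding var_sums_def by force
    then show ?thesis by (rule bdd_above_mono[rotated]) simp
  qed
qed

lemma variation_add:
  assumes ac: "abs_continuous_unit f" and uv: "0 \<le> u" "u \<le> w" "w \<le> v" "v \<le> 1"
  shows "variation f u v = variation f u w + variation f w v"
proof (rule antisym)
  have b: "bdd_above (var_sums f u w)" "bdd_above (var_sums f w v)" "bdd_above (var_sums f u v)"
    using var_sums_bdd[OF ac] uv by auto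
  show "variation f u v \<le> variation f u w + variation f w v"
    unfolding variation_def
  proof (rule cSup_least[OF var_sums_nonempty])
    fix s assume "s \<in> var_sums f u v"
    then obtain s1 s2 where s12: "s1 \<in> var_sums f u w" "s2 \<in> var_sums f w v" "s \<le> s1 + s2"
      using var_sums_split uv by blast
    show "s \<le> Sup (var_sums f u w) + Sup (var_sums f w v)"
      using s12 cSup_upper[OF s12(1) b(1)] cSup_upper[OF s12(2) b(2)] by linarith
  qed
  have *: "s1 + s2 \<le> variation f u v" if s: "s1 \<in> var_sums f u w" "s2 \<in> var_sums f w v" for s1 s2
  proof -
    from s(1) obtain N :: nat and x y where xy: "\<And>i. i < N \<Longrightarrow> u \<le> x i \<and> x i \<le> y i \<and> y i \<le> w"
      "disjoint_family_on (\<lambda>i. {x i<..<y i}) {..<N}" and s_eq: "s1 = (\<Sum>i<N. \<bar>f (y i) - f (x i)\<bar>)"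
      unfolding var_sums_def by blast
    from s(2) obtain N' :: nat and x' y' where xy': "\<And>i. i < N' \<Longrightarrow> w \<le> x' i \<and> x' i \<le> y' i \<and> y' i \<le> v"
      "disjoint_family_on (\<lambda>i. {x' i<..<y' i}) {..<N'}" and s_eq': "s2 = (\<Sum>i<N'. \<bar>f (y' i) - f (x' i)\<bar>)"
      unfolding var_sums_def by blast
    \<comment> \<open>The two families are merged over the sum type; they stay disjoint because
      \<open>w\<close> separates them.\<close>
    have "s1 + s2 = (\<Sum>i\<in>{..<N} <+> {..<N'}. \<bar>f (case_sum y y' i) - f (case_sum x x' i)\<bar>)"
      unfolding s_eq s_eq' by (subst sum.Plus) auto
    also have "\<dots> \<in> var_sums f u v"
    proof (rule var_sumsI)
      show "disjoint_family_on (\<lambda>i. {case_sum x x' i<..<case_sum y y' i}) ({..<N} <+> {..<N'})"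
        unfolding disjoint_family_on_def
      proof (intro ballI impI)
        fix i j assume ij: "i \<in> {..<N} <+> {..<N'}" "j \<in> {..<N} <+> {..<N'}" "i \<noteq> j"
        show "{case_sum x x' i<..<case_sum y y' i} \<inter> {case_sum x x' j<..<case_sum y y' j} = {}"
        proof (cases i; cases j)
          fix a b assume "i = Inl a" "j = Inl b"
          then show ?thesis using ij xy(2) by (auto simp: disjoint_family_on_def)
        next
          fix a b assume "i = Inr a" "j = Inr b"
          then show ?thesis using ij xy'(2) by (auto simp: disjoint_family_on_def)
        next
          fix a b assume eq: "i = Inl a" "j = Inr b"
          then show ?thesis using xy(1)[of a] xy'(1)[of b] ij by auto
        next
          fix a b assume eq: "i = Inr a" "j = Inl b"
          then show ?thesis using xy(1)[of b] xy'(1)[of a] ij by auto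
        qed
      qed
      fix i assume "i \<in> {..<N} <+> {..<N'}"
      then show "u \<le> case_sum x x' i \<and> case_sum x x' i \<le> case_sum y y' i \<and> case_sum y y' i \<le> v"
        using xy(1) xy'(1) uv by (cases i) force+
    qed simp
    finally show ?thesis unfolding variation_def using b(3) by (rule cSup_upper)
  qed
  have "s1 \<le> variation f u v - variation f w v" if "s1 \<in> var_sums f u w" for s1
  proof -
    have "variation f w v \<le> variation f u v - s1"
      unfolding variation_def[of f w v]
      by (rule cSup_least[OF var_sums_nonempty]) (use *[OF that] in force)
    then show ?thesis by simp
  qed
  then have "variation f u w \<le> variation f u v - variation f w v"
    unfolding variation_def[of f u w] by (intro cSup_least[OF var_sums_nonempty]) auto
  then show "variation f u w + variation f w v \<le> variation f u v" by simp
qed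

lemma abs_diff_le_variation:
  assumes ac: "abs_continuous_unit f" and "0 \<le> u" "u \<le> v" "v \<le> 1"
  shows "\<bar>f v - f u\<bar> \<le> variation f u v"
proof -
  have "(\<Sum>i\<in>{0::nat}. \<bar>f ((\<lambda>_. v) i) - f ((\<lambda>_. u) i)\<bar>) \<in> var_sums f u v"
    by (rule var_sumsI) (use assms in \<open>auto simp: disjoint_family_on_def\<close>)
  then show ?thesis unfolding variation_def
    using var_sums_bdd[OF ac, of u v] assms by (intro cSup_upper) auto
qed

text \<open>Nearly optimal families chosen inside the given intervals form together one disjoint
  family whose total length is no larger, so the modulus of \<open>f\<close> for
  \<open>e / 2\<close> works for the variation.\<close>

lemma abs_continuous_variation:
  assumes ac: "abs_continuous_unit f"
  shows "abs_continuous_unit (variation f 0)"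
  unfolding abs_continuous_unit_def
proof (intro allI impI)
  fix e :: real assume e: "e > 0"
  then have e2: "e / 2 > 0" by simp
  obtain d where d: "d > 0" "\<And>(I::(nat\<times>nat) set) x y. finite I \<Longrightarrow> (\<And>i. i \<in> I \<Longrightarrow> 0 \<le> x i \<and> x i \<le> y i \<and> y i \<le> 1) \<Longrightarrow>
       disjoint_family_on (\<lambda>i. {x i<..<y i}) I \<Longrightarrow> (\<Sum>i\<in>I. y i - x i) < d \<Longrightarrow>
       (\<Sum>i\<in>I. \<bar>f (y i) - f (x i)\<bar>) < e / 2"
    using abs_continuous_unitE[OF ac e2] by blast
  show "\<exists>d>0. \<forall>(N::nat) x y.
        (\<forall>i<N. 0 \<le> x i \<and> x i \<le> y i \<and> y i \<le> 1) \<and> disjoint_family_on (\<lambda>i. {x i<..<y i}) {..<N} \<and>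
        (\<Sum>i<N. y i - x i) < d \<longrightarrow> (\<Sum>i<N. \<bar>variation f 0 (y i) - variation f 0 (x i)\<bar>) < e"
  proof (intro exI[of _ d] conjI allI impI; (elim conjE)?)
    fix N :: nat and x y
    assume a: "\<forall>i<N. 0 \<le> x i \<and> x i \<le> y i \<and> y i \<le> 1" "disjoint_family_on (\<lambda>i. {x i<..<y i}) {..<N}"
        "(\<Sum>i<N. y i - x i) < d"
    \<comment> \<open>Error allowed per interval: \<open>N\<close> of them add up to at most
      \<open>e / 2\<close>. The \<open>+ 1\<close> covers \<open>N = 0\<close>.\<close>
    define r where "r = e / (2 * (real N + 1))"
    have r: "r > 0" using e by (simp add: r_def)
    have ex: "\<exists>(K::nat) p q. (\<forall>j<K. x i \<le> p j \<and> p j \<le> q j \<and> q j \<le> y i) \<and>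
        disjoint_family_on (\<lambda>j. {p j<..<q j}) {..<K} \<and>
        variation f (x i) (y i) \<le> (\<Sum>j<K. \<bar>f (q j) - f (p j)\<bar>) + r" if "i < N" for i
    proof -
      have "\<exists>s\<in>var_sums f (x i) (y i). variation f (x i) (y i) - r < s"
        using a(1) that r unfolding variation_def
        by (intro less_cSupD var_sums_nonempty) auto
      then obtain s where s: "s \<in> var_sums f (x i) (y i)" "variation f (x i) (y i) \<le> s + r"
        by force
      then show ?thesis unfolding var_sums_def by blast
    qed
    have "\<forall>i. \<exists>t::nat \<times> (nat \<Rightarrow> real) \<times> (nat \<Rightarrow> real). i < N \<longrightarrow>
        (\<forall>j<fst t. x i \<le> fst (snd t) j \<and> fst (snd t) j \<le> snd (snd t) j \<and> snd (snd t) j \<le> y i) \<and>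
        disjoint_family_on (\<lambda>j. {fst (snd t) j<..<snd (snd t) j}) {..<fst t} \<and>
        variation f (x i) (y i) \<le> (\<Sum>j<fst t. \<bar>f (snd (snd t) j) - f (fst (snd t) j)\<bar>) + r"
    proof
      fix i
      show "\<exists>t::nat \<times> (nat \<Rightarrow> real) \<times> (nat \<Rightarrow> real). i < N \<longrightarrow>
        (\<forall>j<fst t. x i \<le> fst (snd t) j \<and> fst (snd t) j \<le> snd (snd t) j \<and> snd (snd t) j \<le> y i) \<and>
        disjoint_family_on (\<lambda>j. {fst (snd t) j<..<snd (snd t) j}) {..<fst t} \<and>
        variation f (x i) (y i) \<le> (\<Sum>j<fst t. \<bar>f (snd (snd t) j) - f (fst (snd t) j)\<bar>) + r"
      proof (cases "i < N")
        case True
        then obtain K :: nat and p q where "(\<forall>j<K. x i \<le> p j \<and> p j \<le> q j \<and> q j \<le> y i) \<and>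
          disjoint_family_on (\<lambda>j. {p j<..<q j}) {..<K} \<and>
          variation f (x i) (y i) \<le> (\<Sum>j<K. \<bar>f (q j) - f (p j)\<bar>) + r"
          using ex by blast
        then show ?thesis by (intro exI[of _ "(K, p, q)"]) simp
      qed simp
    qed
    then obtain t where t: "\<forall>i<N.
        (\<forall>j<fst (t i). x i \<le> fst (snd (t i)) j \<and> fst (snd (t i)) j \<le> snd (snd (t i)) j \<and> snd (snd (t i)) j \<le> y i) \<and>
        disjoint_family_on (\<lambda>j. {fst (snd (t i)) j<..<snd (snd (t i)) j}) {..<fst (t i)} \<and>
        variation f (x i) (y i) \<le> (\<Sum>j<fst (t i :: nat \<times> (nat \<Rightarrow> real) \<times> (nat \<Rightarrow> real)). \<bar>f (snd (snd (t i)) j) - f (fst (snd (t i)) j)\<bar>) + r"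
      by (rule choice[THEN exE]) blast
    define K p q where Kpq: "K = (\<lambda>i. fst (t i))" "p = (\<lambda>i. fst (snd (t i)))" "q = (\<lambda>i. snd (snd (t i)))"
    have K: "\<And>i j. i < N \<Longrightarrow> j < K i \<Longrightarrow> x i \<le> p i j \<and> p i j \<le> q i j \<and> q i j \<le> y i"
        "\<And>i. i < N \<Longrightarrow> disjoint_family_on (\<lambda>j. {p i j<..<q i j}) {..<K i}"
        "\<And>i. i < N \<Longrightarrow> variation f (x i) (y i) \<le> (\<Sum>j<K i. \<bar>f (q i j) - f (p i j)\<bar>) + r"
      using t unfolding Kpq by auto
    let ?I = "SIGMA i:{..<N}. {..<K i}"
    have sm: "(\<Sum>ij\<in>?I. \<bar>f ((\<lambda>(i,j). q i j) ij) - f ((\<lambda>(i,j). p i j) ij)\<bar>) < e / 2"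
    proof (rule d(2))
      have "(\<Sum>ij\<in>?I. (\<lambda>(i,j). q i j) ij - (\<lambda>(i,j). p i j) ij) = (\<Sum>i<N. \<Sum>j<K i. q i j - p i j)"
        by (subst sum.Sigma) (auto intro!: sum.cong)
      also have "\<dots> \<le> (\<Sum>i<N. y i - x i)"
        by (rule sum_mono, rule disjoint_intervals_length) (use K a in auto)
      finally show "(\<Sum>ij\<in>?I. (\<lambda>(i,j). q i j) ij - (\<lambda>(i,j). p i j) ij) < d" using a(3) by simp
      show "disjoint_family_on (\<lambda>ij. {(\<lambda>(i,j). p i j) ij<..<(\<lambda>(i,j). q i j) ij}) ?I"
        unfolding disjoint_family_on_def
      proof (intro ballI impI)
        fix ij kl assume ij: "ij \<in> ?I" "kl \<in> ?I" "ij \<noteq> kl"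
        obtain i j k l where eq: "ij = (i, j)" "kl = (k, l)" by fastforce
        show "{(\<lambda>(i,j). p i j) ij<..<(\<lambda>(i,j). q i j) ij} \<inter> {(\<lambda>(i,j). p i j) kl<..<(\<lambda>(i,j). q i j) kl} = {}"
        proof (cases "i = k")
          case True
          then show ?thesis using ij K(2)[of i] unfolding eq by (auto simp: disjoint_family_on_def)
        next
          case False
          then have "{x i<..<y i} \<inter> {x k<..<y k} = {}"
            using a(2) ij unfolding eq by (auto simp: disjoint_family_on_def)
          moreover have "{p i j<..<q i j} \<subseteq> {x i<..<y i}" "{p k l<..<q k l} \<subseteq> {x k<..<y k}"
            using K(1)[of i j] K(1)[of k l] ij unfolding eq by auto
          ultimately show ?thesis unfolding eq prod.case by blast
        qed
      qed
      show "0 \<le> (\<lambda>(i,j). p i j) ij \<and> (\<lambda>(i,j). p i j) ij \<le> (\<lambda>(i,j). q i j) ij \<and> (\<lambda>(i,j). q i j) ij \<le> 1"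
        if ij: "ij \<in> ?I" for ij
      proof -
        obtain i j where eq: "ij = (i, j)" by fastforce
        with ij have "i < N" "j < K i" by auto
        then show ?thesis using K(1)[of i j] a(1) unfolding eq by force
      qed
    qed auto
    have "(\<Sum>i<N. \<bar>variation f 0 (y i) - variation f 0 (x i)\<bar>) \<le> (\<Sum>i<N. (\<Sum>j<K i. \<bar>f (q i j) - f (p i j)\<bar>) + r)"
    proof (rule sum_mono)
      fix i assume "i \<in> {..<N}" then have i: "i < N" by simp
      have xi: "0 \<le> x i" "x i \<le> y i" "y i \<le> 1" using a(1) i by auto
      have "variation f 0 (y i) - variation f 0 (x i) = variation f (x i) (y i)"
        using variation_add[OF ac, of 0 "x i" "y i"] xi by simp
      moreover have "0 \<le> variation f (x i) (y i)"
        using abs_diff_le_variation[OF ac xi] by linarith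
      ultimately show "\<bar>variation f 0 (y i) - variation f 0 (x i)\<bar> \<le> (\<Sum>j<K i. \<bar>f (q i j) - f (p i j)\<bar>) + r"
        using K(3)[OF i] by simp
    qed
    also have "\<dots> = (\<Sum>ij\<in>?I. \<bar>f ((\<lambda>(i,j). q i j) ij) - f ((\<lambda>(i,j). p i j) ij)\<bar>) + real N * r"
      unfolding sum.distrib by (subst sum.Sigma) (auto intro!: sum.cong)
    also have "\<dots> < e / 2 + e / 2"
    proof -
      have "real N * r \<le> e / 2" using e by (simp add: r_def field_simps)
      then show ?thesis using sm by simp
    qed
    finally show "(\<Sum>i<N. \<bar>variation f 0 (y i) - variation f 0 (x i)\<bar>) < e" by simp
  qed (use d in auto)
qed

section \<open>Absolutely continuous functions as indefinite integrals\<close>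

text \<open>A Lebesgue null set in \<open>{0..1}\<close> lies in a union of non-overlapping
  intervals of total length below the modulus of \<open>G\<close>. The Stieltjes mass of an interval
  is an increment of \<open>G\<close>, so the null set has mass at most \<open>e\<close>.
  \<open>F\<close> continues \<open>G\<close> by constants, which puts no mass outside
  \<open>{0..1}\<close>.\<close>

lemma absolutely_continuous_interval_measure:
  fixes G :: "real \<Rightarrow> real"
  assumes ac: "abs_continuous_unit G"
    and mono: "\<And>x y. 0 \<le> x \<Longrightarrow> x \<le> y \<Longrightarrow> y \<le> 1 \<Longrightarrow> G x \<le> G y"
  defines "F \<equiv> \<lambda>x. G (min 1 (max 0 x))"
  shows "mono F" "continuous_on UNIV F" "absolutely_continuous lborel (interval_measure F)"
proof -
  have mF: "F x \<le> F y" if "x \<le> y" for x y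
    unfolding F_def by (rule mono) (use that in auto)
  then show "mono F" by (auto simp: mono_def)
  have "continuous_on UNIV (G \<circ> (\<lambda>x. min 1 (max 0 x)))"
    by (rule continuous_on_compose)
       (auto intro!: continuous_intros continuous_on_subset[OF abs_continuous_unit_imp_continuous[OF ac]])
  then show cF: "continuous_on UNIV F" by (simp add: F_def o_def)
  have rc: "continuous (at_right a) F" for a
    using cF by (auto intro: continuous_within_subset simp: continuous_on_eq_continuous_within)
  have F0: "F x = G 0" if "x \<le> 0" for x using that by (simp add: F_def)
  have F1: "F x = G 1" if "1 \<le> x" for x using that by (simp add: F_def)
  have Ioc: "emeasure (interval_measure F) {a<..b} = F b - F a" if "a \<le> b" for a b
    using that mF rc by (rule emeasure_interval_measure_Ioc)
  have Icc: "emeasure (interval_measure F) {a..b} = F b - F a" if "a \<le> b" for a b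
    using that mF cF by (rule emeasure_interval_measure_Icc)
  show "absolutely_continuous lborel (interval_measure F)"
    unfolding absolutely_continuous_def
  proof
    fix A :: "real set" assume A: "A \<in> null_sets lborel"
    then have Ab: "A \<in> sets borel" by (auto simp: null_sets_def)
    \<comment> \<open>\<open>F\<close> is constant on either side of \<open>{0..1}\<close>, so both
      half-lines are null and only \<open>A \<inter> {0..1}\<close> matters.\<close>
    have l: "(\<Union>n::nat. {-real n<..0}) \<in> null_sets (interval_measure F)"
      by (intro null_sets_UN) (simp add: null_sets_def Ioc F0)
    have r: "(\<Union>n::nat. {1<..1 + real n}) \<in> null_sets (interval_measure F)"
      by (intro null_sets_UN) (simp add: null_sets_def Ioc F1)
    have c: "emeasure (interval_measure F) (A \<inter> {0..1}) \<le> ennreal e" if e: "e > 0" for e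
    proof -
      obtain d where d: "d > 0" "\<And>(I::real set set) x y. finite I \<Longrightarrow> (\<And>i. i \<in> I \<Longrightarrow> 0 \<le> x i \<and> x i \<le> y i \<and> y i \<le> 1) \<Longrightarrow>
         disjoint_family_on (\<lambda>i. {x i<..<y i}) I \<Longrightarrow> (\<Sum>i\<in>I. y i - x i) < d \<Longrightarrow>
         (\<Sum>i\<in>I. \<bar>G (y i) - G (x i)\<bar>) < e"
        using abs_continuous_unitE[OF ac e] by blast
      let ?S = "A \<inter> {0..1}"
      have S0: "?S \<in> null_sets lborel" using A by (rule null_set_Int2) auto
      then have Sl: "?S \<in> null_sets lebesgue" by (rule null_sets_completionI)
      then have Sm: "?S \<in> lmeasurable" and S00: "measure lebesgue ?S = 0"
        by (auto simp: fmeasurable_def null_sets_def measure_def)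
      have sub: "?S \<subseteq> cbox 0 1" by simp
      have d2: "d / 2 > 0" using d(1) by simp
      obtain \<D> where D: "countable \<D>"
        "\<And>K. K \<in> \<D> \<Longrightarrow> K \<subseteq> cbox 0 1 \<and> K \<noteq> {} \<and> (\<exists>c d. K = cbox c d)"
        "pairwise (\<lambda>A B. interior A \<inter> interior B = {}) \<D>"
        "?S \<subseteq> \<Union>\<D>" "\<Union>\<D> \<in> lmeasurable" "measure lebesgue (\<Union>\<D>) \<le> measure lebesgue ?S + d / 2"
        by (rule measurable_outer_intervals_bounded[OF Sm sub d2]; rule that; blast)
      have K: "0 \<le> Inf K" "Inf K \<le> Sup K" "Sup K \<le> 1" "K = {Inf K..Sup K}" if "K \<in> \<D>" for K
        using D(2)[OF that] by auto
      \<comment> \<open>Absolute continuity speaks of finite families, so the bound is first proved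
        for finite subfamilies of the cover. The cover has measure at most \<open>d / 2\<close>,
        which leaves room for the strict bound by \<open>d\<close>.\<close>
      have fin: "(\<Sum>K\<in>\<F>. G (Sup K) - G (Inf K)) \<le> e" if F: "finite \<F>" "\<F> \<subseteq> \<D>" for \<F>
      proof -
        have "disjoint_family_on (\<lambda>K. {Inf K<..<Sup K}) \<F>"
          unfolding disjoint_family_on_def
        proof (intro ballI impI)
          fix K L assume KL: "K \<in> \<F>" "L \<in> \<F>" "K \<noteq> L"
          then have "interior K \<inter> interior L = {}"
            using D(3) F by (auto simp: pairwise_def)
          moreover have "interior K = {Inf K<..<Sup K}" "interior L = {Inf L<..<Sup L}"
            using K(4)[of K] K(4)[of L] KL F by (metis interior_atLeastAtMost_real subsetD)+
          ultimately show "{Inf K<..<Sup K} \<inter> {Inf L<..<Sup L} = {}" by simp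
        qed
        moreover have "(\<Sum>K\<in>\<F>. Sup K - Inf K) < d"
        proof -
          have "ennreal (\<Sum>K\<in>\<F>. Sup K - Inf K) = (\<Sum>K\<in>\<F>. ennreal (Sup K - Inf K))"
            using K F by (subst sum_ennreal) (auto simp: subset_iff)
          also have "\<dots> = (\<Sum>K\<in>\<F>. emeasure lborel {Inf K<..<Sup K})"
            using K F by (intro sum.cong) (auto simp: subset_iff)
          also have "\<dots> = emeasure lborel (\<Union>K\<in>\<F>. {Inf K<..<Sup K})"
            using \<open>disjoint_family_on _ \<F>\<close> F(1) by (intro sum_emeasure) auto
          also have "\<dots> = emeasure lebesgue (\<Union>K\<in>\<F>. {Inf K<..<Sup K})"
          proof -
            have "(\<Union>K\<in>\<F>. {Inf K<..<Sup K}) \<in> sets lborel" using F(1) by (intro sets.finite_UN) auto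
            then show ?thesis by (subst emeasure_completion) (auto simp: main_part_sets)
          qed
          also have "\<dots> \<le> emeasure lebesgue (\<Union>\<D>)"
          proof (rule emeasure_mono)
            have "{Inf K<..<Sup K} \<subseteq> K" if "K \<in> \<D>" for K
              using K(4)[OF that] greaterThanLessThan_subseteq_atLeastAtMost_iff[of "Inf K" "Sup K"] by blast
            then show "(\<Union>K\<in>\<F>. {Inf K<..<Sup K}) \<subseteq> \<Union>\<D>" using F by blast
          qed (use D(5) in auto)
          also have "\<dots> = ennreal (measure lebesgue (\<Union>\<D>))"
            using D(5) by (rule emeasure_eq_measure2)
          also have "\<dots> \<le> ennreal (d / 2)"
            using D(6) S00 by (intro ennreal_leI) simp
          finally have "(\<Sum>K\<in>\<F>. Sup K - Inf K) \<le> d / 2"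
            using d(1) by (simp add: ennreal_le_iff)
          then show ?thesis using d(1) by simp
        qed
        ultimately have "(\<Sum>K\<in>\<F>. \<bar>G (Sup K) - G (Inf K)\<bar>) < e"
          using F K by (intro d(2)) auto
        moreover have "(\<Sum>K\<in>\<F>. G (Sup K) - G (Inf K)) \<le> (\<Sum>K\<in>\<F>. \<bar>G (Sup K) - G (Inf K)\<bar>)"
          by (rule sum_mono) simp
        ultimately show ?thesis by simp
      qed
      have Kb: "K \<in> sets borel" if "K \<in> \<D>" for K using K(4)[OF that] by (metis atLeastAtMost_borel)
      have "emeasure (interval_measure F) ?S \<le> emeasure (interval_measure F) (\<Union>\<D>)"
        using D(1,4) Kb by (intro emeasure_mono) (auto intro!: sets.countable_Union)
      also have "\<dots> \<le> ennreal e"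
      proof (cases "\<D> = {}")
        case False
        \<comment> \<open>Initial segments of an enumeration of the cover. They increase to it, and
          continuity from below carries the bound \<open>e\<close> over to the whole cover.\<close>
        define \<F> where "\<F> = (\<lambda>n::nat. from_nat_into \<D> ` {..<n})"
        have F: "finite (\<F> n)" "\<F> n \<subseteq> \<D>" for n
          using from_nat_into[OF False] by (auto simp: \<F>_def)
        have un: "\<Union>\<D> = (\<Union>n. \<Union>(\<F> n))"
        proof
          show "\<Union>\<D> \<subseteq> (\<Union>n. \<Union>(\<F> n))"
          proof
            fix z assume "z \<in> \<Union>\<D>"
            then obtain K where zK: "K \<in> \<D>" "z \<in> K" by blast
            then obtain n where "from_nat_into \<D> n = K" using from_nat_into_surj[OF D(1)] by blast
            then have "K \<in> \<F> (Suc n)" by (auto simp: \<F>_def)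
            with zK show "z \<in> (\<Union>n. \<Union>(\<F> n))" by blast
          qed
        qed (use F(2) in blast)
        have fe: "emeasure (interval_measure F) (\<Union>(\<F> n)) \<le> ennreal e" for n
        proof -
          have "emeasure (interval_measure F) (\<Union>(\<F> n)) \<le> (\<Sum>K\<in>\<F> n. emeasure (interval_measure F) K)"
            using emeasure_subadditive_finite[of "\<F> n" "\<lambda>K. K" "interval_measure F"] F[of n] Kb by auto
          also have "(\<Sum>K\<in>\<F> n. emeasure (interval_measure F) K) = (\<Sum>K\<in>\<F> n. ennreal (G (Sup K) - G (Inf K)))"
          proof (rule sum.cong)
            fix K assume "K \<in> \<F> n"
            then have KD: "K \<in> \<D>" using F by auto
            have "emeasure (interval_measure F) K = F (Sup K) - F (Inf K)"
              using Icc[OF K(2)[OF KD]] K(4)[OF KD] by simp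
            also have "\<dots> = G (Sup K) - G (Inf K)"
              using K[OF KD] by (simp add: F_def)
            finally show "emeasure (interval_measure F) K = ennreal (G (Sup K) - G (Inf K))" .
          qed simp
          also have "\<dots> = ennreal (\<Sum>K\<in>\<F> n. G (Sup K) - G (Inf K))"
          proof (rule sum_ennreal)
            fix K assume "K \<in> \<F> n"
            then have "K \<in> \<D>" using F by auto
            then show "0 \<le> G (Sup K) - G (Inf K)" using mono[of "Inf K" "Sup K"] K[of K] by simp
          qed
          also have "\<dots> \<le> ennreal e" by (intro ennreal_leI fin F)
          finally show ?thesis .
        qed
        have "(SUP n. emeasure (interval_measure F) (\<Union>(\<F> n))) = emeasure (interval_measure F) (\<Union>\<D>)"
          unfolding un
        proof (rule SUP_emeasure_incseq)
          show "range (\<lambda>n. \<Union>(\<F> n)) \<subseteq> sets (interval_measure F)"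
            using F Kb by (auto intro!: sets.countable_Union countable_finite)
          show "incseq (\<lambda>n. \<Union>(\<F> n))" unfolding incseq_def \<F>_def by force
        qed
        moreover have "(SUP n. emeasure (interval_measure F) (\<Union>(\<F> n))) \<le> ennreal e"
          by (rule SUP_least) (rule fe)
        ultimately show ?thesis by simp
      qed simp
      finally show ?thesis .
    qed
    have "emeasure (interval_measure F) (A \<inter> {0..1}) = 0"
    proof (rule ccontr)
      assume nz: "emeasure (interval_measure F) (A \<inter> {0..1}) \<noteq> 0"
      define z where "z = enn2real (emeasure (interval_measure F) (A \<inter> {0..1}))"
      have ez: "emeasure (interval_measure F) (A \<inter> {0..1}) = ennreal z"
        unfolding z_def using c[of 1] by (intro ennreal_enn2real[symmetric]) (auto simp: top_unique less_top[symmetric])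
      have "z > 0" using nz ez by (metis ennreal_eq_0_iff not_less)
      then show False using c[of "z / 2"] ez by (simp add: ennreal_le_iff)
    qed
    then have "A \<inter> {0..1} \<in> null_sets (interval_measure F)" using Ab by (auto simp: null_sets_def)
    then have "(A \<inter> {0..1}) \<union> ((\<Union>n::nat. {-real n<..0}) \<union> (\<Union>n::nat. {1<..1 + real n})) \<in> null_sets (interval_measure F)"
      using l r by (intro null_sets.Un)
    moreover have "A \<subseteq> (A \<inter> {0..1}) \<union> ((\<Union>n::nat. {-real n<..0}) \<union> (\<Union>n::nat. {1<..1 + real n}))"
    proof
      fix x assume "x \<in> A"
      obtain n :: nat where "\<bar>x\<bar> < real n" using reals_Archimedean2 by blast
      then show "x \<in> (A \<inter> {0..1}) \<union> ((\<Union>n::nat. {-real n<..0}) \<union> (\<Union>n::nat. {1<..1 + real n}))"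
        using \<open>x \<in> A\<close> by (cases "x \<le> 0"; cases "x \<le> 1") (auto intro!: exI[of _ n])
    qed
    ultimately show "A \<in> null_sets (interval_measure F)"
      using Ab by (auto intro: null_sets_subset)
  qed
qed

text \<open>\<open>h\<close> is the Radon--Nikodym density of the Stieltjes measure of
  \<open>G\<close>, made real-valued; it is finite almost everywhere because the total mass is
  \<open>G 1 - G 0\<close>.\<close>

lemma monotone_abs_continuous_rep:
  fixes G :: "real \<Rightarrow> real"
  assumes ac: "abs_continuous_unit G"
    and mono: "\<And>x y. 0 \<le> x \<Longrightarrow> x \<le> y \<Longrightarrow> y \<le> 1 \<Longrightarrow> G x \<le> G y"
  obtains h where "integrable unit_leb h" "\<And>x. x \<in> {0..1} \<Longrightarrow> G x = G 0 + prim h x"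
proof -
  define F where "F = (\<lambda>x. G (min 1 (max 0 x)))"
  note F = absolutely_continuous_interval_measure[OF ac mono, folded F_def]
  obtain f where f: "f \<in> borel_measurable lborel" "density lborel f = interval_measure F"
    using sigma_finite_measure.Radon_Nikodym[OF sigma_finite_lborel F(3)] by auto
  have Icc: "(\<integral>\<^sup>+s. f s * indicator {0..x} s \<partial>lborel) = ennreal (G x - G 0)" if "x \<in> {0..1}" for x
  proof -
    have "(\<integral>\<^sup>+s. f s * indicator {0..x} s \<partial>lborel) = emeasure (interval_measure F) {0..x}"
      using f by (subst f(2)[symmetric], subst emeasure_density) auto
    also have "\<dots> = F x - F 0"
      using that F(1,2) by (intro emeasure_interval_measure_Icc) (auto simp: mono_def)
    finally show ?thesis using that by (simp add: F_def)
  qed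
  have nn: "(\<integral>\<^sup>+s. f s * indicator {0..x} s \<partial>unit_leb) = ennreal (G x - G 0)" if "x \<in> {0..1}" for x
  proof -
    have "(\<integral>\<^sup>+s. f s * indicator {0..x} s \<partial>unit_leb) = (\<integral>\<^sup>+s. f s * indicator {0..x} s * indicator {0..1} s \<partial>lborel)"
      by (subst nn_integral_restrict_space) auto
    also have "\<dots> = (\<integral>\<^sup>+s. f s * indicator {0..x} s \<partial>lborel)"
      by (rule nn_integral_cong) (use that in \<open>auto simp: indicator_def\<close>)
    finally show ?thesis using Icc[OF that] by simp
  qed
  have fm: "f \<in> borel_measurable unit_leb"
    using f(1) by (auto intro: measurable_restrict_space1)
  have "(\<integral>\<^sup>+s. f s \<partial>unit_leb) = (\<integral>\<^sup>+s. f s * indicator {0..1} s \<partial>unit_leb)"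
    by (rule nn_integral_cong) auto
  then have fin: "(\<integral>\<^sup>+s. f s \<partial>unit_leb) \<noteq> \<infinity>" using nn[of 1] by simp
  have AEf: "AE s in unit_leb. f s \<noteq> \<infinity>"
    by (rule nn_integral_noteq_infinite[OF fm fin])
  define h where "h = (\<lambda>s. enn2real (f s))"
  have hm: "h \<in> borel_measurable unit_leb" unfolding h_def using fm by measurable
  have eq: "AE s in unit_leb. ennreal (h s) = f s"
    using AEf by eventually_elim (auto simp: h_def less_top)
  have hi: "integrable unit_leb h"
  proof (rule integrableI_nonneg[OF hm])
    show "AE s in unit_leb. 0 \<le> h s" by (auto simp: h_def)
    have "(\<integral>\<^sup>+s. ennreal (h s) \<partial>unit_leb) = (\<integral>\<^sup>+s. f s \<partial>unit_leb)"
      by (rule nn_integral_cong_AE[OF eq])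
    then show "(\<integral>\<^sup>+s. ennreal (h s) \<partial>unit_leb) < \<infinity>" using fin by (simp add: less_top)
  qed
  show ?thesis
  proof (rule that[OF hi])
    fix x :: real assume x: "x \<in> {0..1}"
    have "ennreal (prim h x) = (\<integral>\<^sup>+s. ennreal (h s * indicator {0..x} s) \<partial>unit_leb)"
      unfolding prim_def
      by (rule nn_integral_eq_integral[symmetric])
         (intro integrable_unit_leb_mult_indicator hi borel_closed closed_atLeastAtMost, simp add: h_def)
    also have "\<dots> = (\<integral>\<^sup>+s. f s * indicator {0..x} s \<partial>unit_leb)"
      by (rule nn_integral_cong_AE, use eq in eventually_elim) (auto simp: indicator_def)
    also have "\<dots> = ennreal (G x - G 0)" by (rule nn[OF x])
    finally have "ennreal (prim h x) = ennreal (G x - G 0)" .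
    moreover have "0 \<le> prim h x" unfolding prim_def by (rule integral_nonneg_AE) (auto simp: h_def)
    moreover have "0 \<le> G x - G 0" using mono[of 0 x] x by auto
    ultimately show "G x = G 0 + prim h x" by simp
  qed
qed

lemma prim_lincomb:
  assumes "integrable unit_leb h" "integrable unit_leb h'"
  shows "prim (\<lambda>s. c * h s + d * h' s) x = c * prim h x + d * prim h' x"
proof -
  have "prim (\<lambda>s. c * h s + d * h' s) x
      = (\<integral>s. c * (h s * indicator {0..x} s) + d * (h' s * indicator {0..x} s) \<partial>unit_leb)"
    unfolding prim_def by (simp add: algebra_simps)
  also have "\<dots> = c * prim h x + d * prim h' x"
    unfolding prim_def
    by (subst Bochner_Integration.integral_add)
       (auto intro!: integrable_unit_leb_mult_indicator assms integrable_mult_right)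
  finally show ?thesis .
qed

text \<open>Jordan decomposition: \<open>f\<close> is its variation function minus the difference of
  that function and \<open>f\<close>; both of these are monotone and absolutely continuous.\<close>

theorem abs_continuous_unit_rep:
  assumes ac: "abs_continuous_unit f"
  obtains h where "integrable unit_leb h" "\<And>x. x \<in> {0..1} \<Longrightarrow> f x = f 0 + prim h x"
proof -
  let ?V = "variation f 0"
  have acV: "abs_continuous_unit ?V" by (rule abs_continuous_variation[OF ac])
  have mV: "?V x \<le> ?V y" and mW: "?V x - f x \<le> ?V y - f y" if "0 \<le> x" "x \<le> y" "y \<le> 1" for x y
    using variation_add[OF ac, of 0 x y] abs_diff_le_variation[OF ac that] that by auto
  obtain h1 where h1: "integrable unit_leb h1" "\<And>x. x \<in> {0..1} \<Longrightarrow> ?V x = ?V 0 + prim h1 x"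
    using monotone_abs_continuous_rep[OF acV mV] by blast
  obtain h2 where h2: "integrable unit_leb h2" "\<And>x. x \<in> {0..1} \<Longrightarrow> ?V x - f x = ?V 0 - f 0 + prim h2 x"
    using monotone_abs_continuous_rep[OF abs_continuous_unit_diff[OF acV ac] mW] by blast
  show ?thesis
  proof (rule that)
    show "integrable unit_leb (\<lambda>s. 1 * h1 s + (-1) * h2 s)" using h1(1) h2(1) by auto
    fix x :: real assume x: "x \<in> {0..1}"
    show "f x = f 0 + prim (\<lambda>s. 1 * h1 s + (-1) * h2 s) x"
      using h1(2)[OF x] h2(2)[OF x] by (subst prim_lincomb[OF h1(1) h2(1)]) simp
  qed
qed

lemma abs_continuous_unit_cong:
  assumes "\<And>x. x \<in> {0..1} \<Longrightarrow> f x = g x" "abs_continuous_unit f"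
  shows "abs_continuous_unit g"
proof -
  have "(\<Sum>i<N. \<bar>g (y i) - g (x i)\<bar>) = (\<Sum>i<N. \<bar>f (y i) - f (x i)\<bar>)"
    if "\<forall>i<N. 0 \<le> x i \<and> x i \<le> y i \<and> y i \<le> 1" for N :: nat and x y
    using that by (intro sum.cong) (auto simp: assms(1)[symmetric])
  then show ?thesis using assms(2) unfolding abs_continuous_unit_def by fastforce
qed

lemma prim_diff_abs_le:
  assumes h: "integrable unit_leb h" and "0 \<le> x" "x \<le> y"
  shows "\<bar>prim h y - prim h x\<bar> \<le> (\<integral>s. \<bar>h s\<bar> * indicator {x<..y} s \<partial>unit_leb)"
proof -
  have "\<bar>prim h y - prim h x\<bar> \<le> (\<integral>s. \<bar>h s * indicator {x<..y} s\<bar> \<partial>unit_leb)"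
    unfolding prim_diff[OF assms] by (rule integral_abs_bound)
  then show ?thesis by (simp add: abs_mult)
qed

text \<open>Split \<open>\<bar>h\<bar>\<close> at a level \<open>n\<close>: the part above the level
  has small integral over the whole interval, the part below contributes at most \<open>n\<close>
  times the total length.\<close>

lemma abs_continuous_prim:
  assumes h: "integrable unit_leb h"
  shows "abs_continuous_unit (prim h)"
  unfolding abs_continuous_unit_def
proof (intro allI impI)
  fix e :: real assume e: "e > 0"
  define T where "T = (\<lambda>n::nat. \<lambda>s. \<bar>h s\<bar> * indicator {s. \<bar>h s\<bar> > real n} s)"
  have hm[measurable]: "h \<in> borel_measurable unit_leb" using h by auto
  have Tm: "T n \<in> borel_measurable unit_leb" for n
  proof -
    have "(\<lambda>s. if \<bar>h s\<bar> > real n then \<bar>h s\<bar> else 0) \<in> borel_measurable unit_leb" by measurable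
    moreover have "T n = (\<lambda>s. if \<bar>h s\<bar> > real n then \<bar>h s\<bar> else 0)"
      by (auto simp: T_def indicator_def)
    ultimately show ?thesis by simp
  qed
  have Ti: "integrable unit_leb (T n)" for n
    by (rule Bochner_Integration.integrable_bound[OF integrable_abs[OF h] Tm]) (auto simp: T_def indicator_def)
  have "(\<lambda>n. \<integral>s. T n s \<partial>unit_leb) \<longlonglongrightarrow> (\<integral>s. 0 \<partial>unit_leb)"
  proof (rule integral_dominated_convergence[where w = "\<lambda>s. \<bar>h s\<bar>"])
    show "AE s in unit_leb. (\<lambda>n. T n s) \<longlonglongrightarrow> 0"
    proof (intro AE_I2)
      fix s
      obtain n0 :: nat where "\<bar>h s\<bar> \<le> real n0" using real_arch_simple by blast
      then have "\<forall>n\<ge>n0. T n s = 0" by (auto simp: T_def indicator_def)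
      then show "(\<lambda>n. T n s) \<longlonglongrightarrow> 0"
        by (intro tendsto_eventually) (auto simp: eventually_sequentially)
    qed
  qed (use h Tm in \<open>auto simp: T_def indicator_def\<close>)
  then have "\<forall>\<^sub>F n in sequentially. (\<integral>s. T n s \<partial>unit_leb) < e / 2"
    using e by (intro order_tendstoD) auto
  then obtain n where n: "(\<integral>s. T n s \<partial>unit_leb) < e / 2"
    by (auto dest: eventually_happens'[OF sequentially_bot])
  define d where "d = e / (2 * (real n + 1))"
  have d: "d > 0" using e by (simp add: d_def)
  show "\<exists>d>0. \<forall>(N::nat) x y.
        (\<forall>i<N. 0 \<le> x i \<and> x i \<le> y i \<and> y i \<le> 1) \<and> disjoint_family_on (\<lambda>i. {x i<..<y i}) {..<N} \<and>
        (\<Sum>i<N. y i - x i) < d \<longrightarrow> (\<Sum>i<N. \<bar>prim h (y i) - prim h (x i)\<bar>) < e"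
  proof (intro exI[of _ d] conjI allI impI; (elim conjE)?)
    fix N :: nat and x y
    assume a: "\<forall>i<N. 0 \<le> x i \<and> x i \<le> y i \<and> y i \<le> 1" "disjoint_family_on (\<lambda>i. {x i<..<y i}) {..<N}"
        "(\<Sum>i<N. y i - x i) < d"
    \<comment> \<open>The hypothesis is about open intervals, but increments of \<open>prim\<close>
      integrate over half-open ones. A common point of two half-open intervals yields a common
      interior point, halfway down to the larger left end.\<close>
    have dj: "disjoint_family_on (\<lambda>i. {x i<..y i}) {..<N}"
      unfolding disjoint_family_on_def
    proof (intro ballI impI)
      fix i j assume ij: "i \<in> {..<N}" "j \<in> {..<N}" "i \<noteq> j"
      show "{x i<..y i} \<inter> {x j<..y j} = {}"
      proof (rule ccontr)
        assume "\<not> ?thesis"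
        then obtain p where "p \<in> {x i<..y i} \<inter> {x j<..y j}" by blast
        then have p: "x i < p" "p \<le> y i" "x j < p" "p \<le> y j"
          by (simp_all only: Int_iff greaterThanAtMost_iff)
        define z where "z = (max (x i) (x j) + p) / 2"
        have "x i < z" "z < y i" "x j < z" "z < y j" using p by (auto simp: z_def max_def field_simps)
        then have "z \<in> {x i<..<y i} \<inter> {x j<..<y j}" by simp
        then show False using a(2) ij unfolding disjoint_family_on_def by blast
      qed
    qed
    let ?U = "\<Union>i<N. {x i<..y i}"
    have Ub: "?U \<in> sets borel" by auto
    have me: "(\<integral>s. indicat_real {x i<..y i} s \<partial>unit_leb) = y i - x i" if "i < N" for i
    proof -
      have "(\<integral>s. indicat_real {x i<..y i} s \<partial>unit_leb) = (\<integral>s. indicator {0..1} s * indicator {x i<..y i} s \<partial>lborel)"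
        by (subst integral_restrict_space) auto
      also have "\<dots> = (\<integral>s. indicat_real {x i<..y i} s \<partial>lborel)"
        by (rule Bochner_Integration.integral_cong) (use a(1) that in \<open>force simp: indicator_def\<close>)+
      also have "\<dots> = y i - x i" using a(1) that by simp
      finally show ?thesis .
    qed
    have ii: "integrable unit_leb (\<lambda>s. indicator {x i<..y i} s :: real)" for i
      using integrable_unit_leb_mult_indicator[of "\<lambda>_. 1" "{x i<..y i}"] by simp
    have hi: "integrable unit_leb (\<lambda>s. \<bar>h s\<bar> * indicator {x i<..y i} s)" for i
      by (intro integrable_unit_leb_mult_indicator integrable_abs h) auto
    have "(\<Sum>i<N. \<bar>prim h (y i) - prim h (x i)\<bar>) \<le> (\<Sum>i<N. \<integral>s. \<bar>h s\<bar> * indicator {x i<..y i} s \<partial>unit_leb)"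
      using a(1) by (intro sum_mono prim_diff_abs_le h) auto
    also have "\<dots> = (\<integral>s. (\<Sum>i<N. \<bar>h s\<bar> * indicator {x i<..y i} s) \<partial>unit_leb)"
      by (rule Bochner_Integration.integral_sum[symmetric]) (rule hi)
    also have "\<dots> \<le> (\<integral>s. T n s + real n * (\<Sum>i<N. indicator {x i<..y i} s) \<partial>unit_leb)"
    proof (rule integral_mono)
      show "integrable unit_leb (\<lambda>s. \<Sum>i<N. \<bar>h s\<bar> * indicat_real {x i<..y i} s)"
        by (intro Bochner_Integration.integrable_sum hi)
      show "integrable unit_leb (\<lambda>s. T n s + real n * (\<Sum>i<N. indicat_real {x i<..y i} s))"
        by (intro Bochner_Integration.integrable_add Ti integrable_mult_right Bochner_Integration.integrable_sum ii)
      fix s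
      have "(\<Sum>i<N. indicat_real {x i<..y i} s) = indicator ?U s"
        by (rule indicator_UN_disjoint[symmetric]) (use dj in auto)
      then show "(\<Sum>i<N. \<bar>h s\<bar> * indicat_real {x i<..y i} s) \<le> T n s + real n * (\<Sum>i<N. indicat_real {x i<..y i} s)"
        unfolding sum_distrib_left[symmetric] by (auto simp: T_def indicator_def)
    qed
    also have "\<dots> = (\<integral>s. T n s \<partial>unit_leb) + real n * (\<Sum>i<N. y i - x i)"
      using me by (subst Bochner_Integration.integral_add)
         (auto intro!: Ti Bochner_Integration.integrable_sum ii simp: Bochner_Integration.integral_sum ii)
    also have "\<dots> < e / 2 + e / 2"
    proof -
      have "real n * (\<Sum>i<N. y i - x i) \<le> real n * d" using a(3) by (intro mult_left_mono) auto
      also have "\<dots> \<le> e / 2" using e by (simp add: d_def field_simps)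
      finally show ?thesis using n by simp
    qed
    finally show "(\<Sum>i<N. \<bar>prim h (y i) - prim h (x i)\<bar>) < e" by simp
  qed (rule d)
qed

lemma abs_continuous_const_add_prim:
  assumes "integrable unit_leb h" "\<And>x. x \<in> {0..1} \<Longrightarrow> f x = c + prim h x"
  shows "abs_continuous_unit f"
proof -
  have "abs_continuous_unit (\<lambda>x. c + prim h x)"
    using abs_continuous_prim[OF assms(1)] unfolding abs_continuous_unit_def by simp
  then show ?thesis by (rule abs_continuous_unit_cong[rotated]) (simp add: assms(2))
qed

section \<open>Derivatives and Sobolev functions\<close>

text \<open>Differentiability is a Cauchy condition on difference quotients. Continuity of the
  quotient in the increment allows testing on rational increments, so the set \<open>E\<close> is a
  countable combination of Borel sets, and on it the derivative is the limit along the increments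
  \<open>1 / (n + 1)\<close>.\<close>

lemma vector_derivative_measurable_unit:
  fixes f :: "real \<Rightarrow> real"
  assumes cf: "continuous_on {0..1} f"
  shows "(\<lambda>s. vector_derivative f (at s within {0..1})) \<in> borel_measurable unit_leb"
proof -
  define F where "F = (\<lambda>x. f (min 1 (max 0 x)))"
  have cF: "continuous_on UNIV F"
  proof -
    have "continuous_on UNIV (f \<circ> (\<lambda>x. min 1 (max 0 x)))"
      by (rule continuous_on_compose) (auto intro!: continuous_intros continuous_on_subset[OF cf])
    then show ?thesis by (simp add: F_def o_def)
  qed
  have [measurable]: "F \<in> borel_measurable borel" using cF by (rule borel_measurable_continuous_onI)
  define q where "q = (\<lambda>x h. (F (x + h) - F x) / h)"
  have [measurable]: "(\<lambda>x. q x h) \<in> borel_measurable borel" for h unfolding q_def by measurable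
  define E where "E = {x. \<forall>k::nat. \<exists>n::nat. \<forall>r r'::rat. r \<noteq> 0 \<longrightarrow> r' \<noteq> 0 \<longrightarrow>
      \<bar>real_of_rat r\<bar> < 1 / (real n + 1) \<longrightarrow> \<bar>real_of_rat r'\<bar> < 1 / (real n + 1) \<longrightarrow>
      \<bar>q x (of_rat r) - q x (of_rat r')\<bar> \<le> 1 / (real k + 1)}"
  have Em: "E \<in> sets borel"
  proof -
    have "{x \<in> space borel. \<forall>k::nat. \<exists>n::nat. \<forall>r r'::rat. r \<noteq> 0 \<longrightarrow> r' \<noteq> 0 \<longrightarrow>
      \<bar>real_of_rat r\<bar> < 1 / (real n + 1) \<longrightarrow> \<bar>real_of_rat r'\<bar> < 1 / (real n + 1) \<longrightarrow>
      \<bar>q x (of_rat r) - q x (of_rat r')\<bar> \<le> 1 / (real k + 1)} \<in> sets borel"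
      by measurable
    then show ?thesis by (simp add: E_def)
  qed
  have EI: "x \<in> E" if d: "(F has_real_derivative L) (at x)" for x L
    unfolding E_def
  proof (intro CollectI allI)
    fix k :: nat
    have "(\<lambda>h. q x h) \<midarrow>0\<rightarrow> L" using d by (simp add: q_def DERIV_def)
    then have "\<forall>\<^sub>F h in at 0. dist (q x h) L < 1 / (2 * (real k + 1))"
      by (rule tendstoD) simp
    then obtain d where d: "d > 0" "\<And>h. h \<noteq> 0 \<Longrightarrow> \<bar>h\<bar> < d \<Longrightarrow> \<bar>q x h - L\<bar> < 1 / (2 * (real k + 1))"
      unfolding eventually_at by (auto simp: dist_real_def)
    obtain n :: nat where n: "1 / (real n + 1) < d"
      using reals_Archimedean[OF d(1)] by (auto simp: inverse_eq_divide add.commute)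
    have "\<bar>q x (real_of_rat r) - q x (real_of_rat r')\<bar> \<le> 1 / (real k + 1)"
      if "r \<noteq> 0" "r' \<noteq> 0" "\<bar>real_of_rat r\<bar> < 1 / (real n + 1)" "\<bar>real_of_rat r'\<bar> < 1 / (real n + 1)" for r r'
    proof -
      have "\<bar>q x (of_rat r) - L\<bar> < 1 / (2 * (real k + 1))" "\<bar>q x (of_rat r') - L\<bar> < 1 / (2 * (real k + 1))"
        using that n by (intro d(2); simp)+
      then have "\<bar>q x (of_rat r) - q x (of_rat r')\<bar> \<le> 1 / (2 * (real k + 1)) + 1 / (2 * (real k + 1))" by linarith
      then show ?thesis by (simp add: field_simps)
    qed
    then show "\<exists>n::nat. \<forall>r r'::rat. r \<noteq> 0 \<longrightarrow> r' \<noteq> 0 \<longrightarrow>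
      \<bar>real_of_rat r\<bar> < 1 / (real n + 1) \<longrightarrow> \<bar>real_of_rat r'\<bar> < 1 / (real n + 1) \<longrightarrow>
      \<bar>q x (of_rat r) - q x (of_rat r')\<bar> \<le> 1 / (real k + 1)" by blast
  qed
  have ED: "(F has_real_derivative lim (\<lambda>n::nat. q x (1 / (real n + 1)))) (at x)" if xE: "x \<in> E" for x
  proof -
    have qc: "continuous_on (- {0}) (q x)"
      unfolding q_def by (intro continuous_intros continuous_on_compose2[OF cF]) auto
    have rr: "\<exists>n::nat. \<forall>h h'. h \<noteq> 0 \<longrightarrow> h' \<noteq> 0 \<longrightarrow> \<bar>h\<bar> < 1 / (real n + 1) \<longrightarrow> \<bar>h'\<bar> < 1 / (real n + 1) \<longrightarrow>
        \<bar>q x h - q x h'\<bar> \<le> 1 / (real k + 1)" for k :: nat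
    proof -
      obtain n :: nat where n: "\<And>r r'::rat. r \<noteq> 0 \<Longrightarrow> r' \<noteq> 0 \<Longrightarrow>
        \<bar>real_of_rat r\<bar> < 1 / (real n + 1) \<Longrightarrow> \<bar>real_of_rat r'\<bar> < 1 / (real n + 1) \<Longrightarrow>
        \<bar>q x (of_rat r) - q x (of_rat r')\<bar> \<le> 1 / (real k + 1)"
        using xE unfolding E_def by blast
      have approx: "\<exists>r::rat. r \<noteq> 0 \<and> \<bar>real_of_rat r\<bar> < 1 / (real n + 1) \<and> \<bar>q x (of_rat r) - q x h\<bar> < e"
        if h: "h \<noteq> 0" "\<bar>h\<bar> < 1 / (real n + 1)" and e: "e > 0" for h e
      proof -
        have "isCont (q x) h"
          using qc h(1) continuous_on_eq_continuous_at[of "- {0}" "q x"] by auto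
        then have "\<exists>d>0. \<forall>y. dist y h < d \<longrightarrow> dist (q x y) (q x h) < e"
          using e by (simp add: continuous_at_eps_delta)
        then obtain d where d: "d > 0" "\<And>y. dist y h < d \<Longrightarrow> dist (q x y) (q x h) < e"
          by blast
        define d' where "d' = min d (min (\<bar>h\<bar>) (1 / (real n + 1) - \<bar>h\<bar>))"
        have d': "d' > 0" using d h by (auto simp: d'_def)
        obtain r where r: "h < real_of_rat r" "real_of_rat r < h + d'"
          using of_rat_dense[of h "h + d'"] d' by auto
        have "dist (of_rat r) h < d" using r d' by (auto simp: dist_real_def d'_def)
        moreover have "r \<noteq> 0" using r h by (auto simp: d'_def abs_if split: if_splits)
        moreover have "\<bar>real_of_rat r\<bar> < 1 / (real n + 1)" using r h unfolding d'_def by linarith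
        ultimately show ?thesis using d(2)[of "of_rat r"] by (auto simp: dist_real_def)
      qed
      have "\<bar>q x h - q x h'\<bar> \<le> 1 / (real k + 1)" if h: "h \<noteq> 0" "h' \<noteq> 0" "\<bar>h\<bar> < 1 / (real n + 1)" "\<bar>h'\<bar> < 1 / (real n + 1)" for h h'
      proof (rule field_le_epsilon)
        fix e :: real assume e: "e > 0"
        obtain r where r: "r \<noteq> 0" "\<bar>real_of_rat r\<bar> < 1 / (real n + 1)" "\<bar>q x (of_rat r) - q x h\<bar> < e / 2"
          using approx[OF h(1,3), of "e / 2"] e by auto
        obtain r' where r': "r' \<noteq> 0" "\<bar>real_of_rat r'\<bar> < 1 / (real n + 1)" "\<bar>q x (of_rat r') - q x h'\<bar> < e / 2"
          using approx[OF h(2,4), of "e / 2"] e by auto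
        show "\<bar>q x h - q x h'\<bar> \<le> 1 / (real k + 1) + e"
          using n[OF r(1) r'(1) r(2) r'(2)] r(3) r'(3) by linarith
      qed
      then show ?thesis by blast
    qed
    let ?a = "\<lambda>n::nat. q x (1 / (real n + 1))"
    have small: "1 / (real i + 1) < 1 / (real n + 1)" if "i > n" for i n :: nat
      using that by (intro divide_strict_left_mono) auto
    have ex: "\<exists>k::nat. 1 / (real k + 1) < e" if "e > 0" for e :: real
      using reals_Archimedean[OF that] by (auto simp: inverse_eq_divide add.commute)
    have "Cauchy ?a"
    proof (rule metric_CauchyI)
      fix e :: real assume "0 < e"
      then obtain k :: nat where k: "1 / (real k + 1) < e" using ex by blast
      obtain n :: nat where n: "\<forall>h h'. h \<noteq> 0 \<longrightarrow> h' \<noteq> 0 \<longrightarrow> \<bar>h\<bar> < 1 / (real n + 1) \<longrightarrow> \<bar>h'\<bar> < 1 / (real n + 1) \<longrightarrow>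
        \<bar>q x h - q x h'\<bar> \<le> 1 / (real k + 1)" using rr by blast
      have "dist (?a i) (?a j) < e" if "i \<ge> Suc n" "j \<ge> Suc n" for i j
      proof -
        have "\<bar>?a i - ?a j\<bar> \<le> 1 / (real k + 1)"
          using small[of n i] small[of n j] that by (intro n[rule_format]) auto
        then show ?thesis using k by (simp add: dist_real_def)
      qed
      then show "\<exists>M. \<forall>m\<ge>M. \<forall>n\<ge>M. dist (?a m) (?a n) < e" by blast
    qed
    then have conv: "?a \<longlonglongrightarrow> lim ?a" using real_Cauchy_convergent convergent_LIMSEQ_iff by blast
    have "q x \<midarrow>0\<rightarrow> lim ?a"
    proof (rule tendstoI)
      fix e :: real assume "0 < e"
      then obtain k :: nat where k: "1 / (real k + 1) < e" using ex by blast
      obtain n :: nat where n: "\<forall>h h'. h \<noteq> 0 \<longrightarrow> h' \<noteq> 0 \<longrightarrow> \<bar>h\<bar> < 1 / (real n + 1) \<longrightarrow> \<bar>h'\<bar> < 1 / (real n + 1) \<longrightarrow>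
        \<bar>q x h - q x h'\<bar> \<le> 1 / (real k + 1)" using rr by blast
      have "\<bar>q x h - lim ?a\<bar> \<le> 1 / (real k + 1)" if h: "h \<noteq> 0" "\<bar>h\<bar> < 1 / (real n + 1)" for h
      proof (rule LIMSEQ_le_const2)
        show "(\<lambda>i. \<bar>q x h - ?a i\<bar>) \<longlonglongrightarrow> \<bar>q x h - lim ?a\<bar>" by (intro tendsto_intros conv)
        have "\<bar>q x h - ?a i\<bar> \<le> 1 / (real k + 1)" if "i \<ge> Suc n" for i
          using small[of n i] that h by (intro n[rule_format]) auto
        then show "\<exists>N. \<forall>i\<ge>N. \<bar>q x h - ?a i\<bar> \<le> 1 / (real k + 1)" by blast
      qed
      then have "\<And>h. h \<noteq> 0 \<Longrightarrow> dist h 0 < 1 / (real n + 1) \<Longrightarrow> dist (q x h) (lim ?a) < e"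
        using k by (fastforce simp: dist_real_def)
      then show "\<forall>\<^sub>F h in at 0. dist (q x h) (lim ?a) < e"
        unfolding eventually_at by (intro exI[of _ "1 / (real n + 1)"]) auto
    qed
    then show ?thesis by (simp add: DERIV_def q_def)
  qed
  \<comment> \<open>\<open>vector_derivative\<close> is a Hilbert choice. Where no derivative exists
    its predicate is identically false, so its value is this same constant at all such
    points.\<close>
  define c0 where "c0 = (SOME f'::real. False)"
  define G where "G = (\<lambda>x. if x \<in> E then lim (\<lambda>n::nat. q x (1 / (real n + 1))) else c0)"
  have Gm: "G \<in> borel_measurable borel"
    unfolding G_def using Em by measurable
  have eq: "vector_derivative f (at s within {0..1}) = G s" if s: "0 < s" "s < 1" for s
  proof -
    have at: "at s within {0..1} = at s" using s by (intro at_within_interior) auto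
    have ev: "\<forall>\<^sub>F y in nhds s. f y = F y"
    proof -
      have "\<forall>\<^sub>F y in nhds s. y \<in> {0<..<1}" using s by (intro eventually_nhds_in_open) auto
      then show ?thesis by eventually_elim (auto simp: F_def)
    qed
    have iff: "(f has_vector_derivative L) (at s) \<longleftrightarrow> (F has_real_derivative L) (at s)" for L
      unfolding has_real_derivative_iff_has_vector_derivative[symmetric]
      by (rule DERIV_cong_ev[OF refl ev refl])
    show ?thesis
    proof (cases "s \<in> E")
      case True
      then have "(f has_vector_derivative G s) (at s)" using ED[OF True] by (simp add: iff G_def)
      then show ?thesis unfolding at by (rule vector_derivative_at)
    next
      case False
      then have "(f has_vector_derivative L) (at s) = False" for L using EI iff by blast
      then show ?thesis unfolding at vector_derivative_def using False by (simp add: G_def c0_def)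
    qed
  qed
  show ?thesis
  proof (rule measurable_discrete_difference[where X = "{0, 1}" and f = G])
    show "G \<in> borel_measurable unit_leb" by (intro measurable_restrict_space1) (use Gm in simp)
    show "\<And>x. x \<in> space unit_leb \<Longrightarrow> x \<notin> {0, 1} \<Longrightarrow> G x = vector_derivative f (at x within {0..1})"
      using eq by (force simp: less_le)
  qed (auto simp: sets_restrict_space)
qed

text \<open>The recursion of \<open>nderiv\<close> peels off the last derivative; induction on the
  order of a Sobolev function needs the first one peeled off.\<close>

lemma nderiv_Suc_shift: "nderiv (Suc k) f = nderiv k (nderiv 1 f)"
  by (induction k) (simp_all del: One_nat_def add: numeral_nat)

lemma vector_derivative_within_cong:
  assumes "\<And>x. x \<in> S \<Longrightarrow> f x = g x" "s \<in> S"
  shows "vector_derivative f (at s within S) = vector_derivative g (at s within S)"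
proof -
  have "(f has_vector_derivative L) (at s within S) \<longleftrightarrow> (g has_vector_derivative L) (at s within S)" for L
    by (metis assms has_vector_derivative_transform)
  then show ?thesis by (simp add: vector_derivative_def)
qed

section \<open>Square-integrable functions and iterated indefinite integrals\<close>

lemma L2_integrable:
  assumes "f \<in> L2"
  shows "integrable unit_leb f"
proof (rule Bochner_Integration.integrable_bound[where f = "\<lambda>s. 1 + (f s)\<^sup>2"])
  show "AE s in unit_leb. norm (f s) \<le> norm (1 + (f s)\<^sup>2)"
  proof (intro AE_I2)
    fix s
    have "2 * \<bar>f s\<bar> \<le> 1 + (f s)\<^sup>2"
      using sum_squares_bound[of 1 "\<bar>f s\<bar>"] by (simp add: power2_eq_square)
    then show "norm (f s) \<le> norm (1 + (f s)\<^sup>2)" by simp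
  qed
qed (use assms in \<open>auto simp: L2_def\<close>)

lemma L2_mult_integrable:
  assumes "f \<in> L2" "g \<in> L2"
  shows "integrable unit_leb (\<lambda>s. f s * g s)"
proof (rule Bochner_Integration.integrable_bound[where f = "\<lambda>s. (f s)\<^sup>2 + (g s)\<^sup>2"])
  show "AE s in unit_leb. norm (f s * g s) \<le> norm ((f s)\<^sup>2 + (g s)\<^sup>2)"
  proof (intro AE_I2)
    fix s
    have "2 * (\<bar>f s\<bar> * \<bar>g s\<bar>) \<le> (f s)\<^sup>2 + (g s)\<^sup>2"
      using sum_squares_bound[of "\<bar>f s\<bar>" "\<bar>g s\<bar>"] by (simp add: power2_eq_square mult.assoc)
    moreover have "0 \<le> \<bar>f s\<bar> * \<bar>g s\<bar>" "norm (f s * g s) = \<bar>f s\<bar> * \<bar>g s\<bar>"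
      "norm ((f s)\<^sup>2 + (g s)\<^sup>2) = (f s)\<^sup>2 + (g s)\<^sup>2" by (auto simp: abs_mult)
    ultimately show "norm (f s * g s) \<le> norm ((f s)\<^sup>2 + (g s)\<^sup>2)" by linarith
  qed
qed (use assms in \<open>auto simp: L2_def\<close>)

lemma L2_lincomb:
  assumes "f \<in> L2" "g \<in> L2"
  shows "(\<lambda>s. c * f s + d * g s) \<in> L2"
  unfolding L2_def
proof (intro CollectI conjI)
  have "integrable unit_leb (\<lambda>s. c\<^sup>2 * (f s)\<^sup>2 + (2 * c * d) * (f s * g s) + d\<^sup>2 * (g s)\<^sup>2)"
    using assms L2_mult_integrable[OF assms]
    by (intro Bochner_Integration.integrable_add integrable_mult_right) (auto simp: L2_def)
  then show "integrable unit_leb (\<lambda>s. (c * f s + d * g s)\<^sup>2)"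
    by (simp add: power2_eq_square algebra_simps)
qed (use assms in \<open>auto simp: L2_def\<close>)

lemma L2_diff: "f \<in> L2 \<Longrightarrow> g \<in> L2 \<Longrightarrow> (\<lambda>s. f s - g s) \<in> L2"
  using L2_lincomb[of f g 1 "-1"] by simp

lemma L2_cong_AE:
  assumes "f \<in> L2" "g \<in> borel_measurable unit_leb" "AE s in unit_leb. g s = f s"
  shows "g \<in> L2"
proof -
  have "integrable unit_leb (\<lambda>s. (g s)\<^sup>2) \<longleftrightarrow> integrable unit_leb (\<lambda>s. (f s)\<^sup>2)"
    by (rule Bochner_Integration.integrable_cong_AE)
       (use assms in \<open>auto simp: L2_def elim: eventually_mono\<close>)
  then show ?thesis using assms by (auto simp: L2_def)
qed

lemma continuous_on_measurable_unit:
  assumes "continuous_on {0..1} (f :: real \<Rightarrow> real)"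
  shows "f \<in> borel_measurable unit_leb"
proof -
  have "f \<in> borel_measurable (restrict_space borel {0..1})"
    by (rule borel_measurable_continuous_on_restrict[OF assms])
  then show ?thesis
    by (subst measurable_cong_sets[OF sets_restrict_space_cong[OF sets_lborel] refl])
qed

lemma continuous_on_integrable_unit:
  assumes "continuous_on {0..1} (f :: real \<Rightarrow> real)"
  shows "integrable unit_leb f"
proof -
  have "compact (f ` {0..1})" using assms by (intro compact_continuous_image) auto
  then have "bounded (f ` {0..1})" by (rule compact_imp_bounded)
  then obtain B where "\<forall>y\<in>f ` {0..1}. norm y \<le> B" unfolding bounded_iff by blast
  then have B: "\<And>x. x \<in> {0..1} \<Longrightarrow> \<bar>f x\<bar> \<le> B" by auto
  show ?thesis
    by (rule unit_leb.integrable_const_bound[where B = B])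
       (use B continuous_on_measurable_unit[OF assms] in \<open>auto intro!: AE_I2\<close>)
qed

lemma continuous_on_L2:
  assumes "continuous_on {0..1} (f :: real \<Rightarrow> real)"
  shows "f \<in> L2"
  unfolding L2_def using assms
  by (auto intro!: continuous_on_integrable_unit continuous_on_measurable_unit continuous_intros)

lemma continuous_prim: "integrable unit_leb h \<Longrightarrow> continuous_on {0..1} (prim h)"
  by (rule abs_continuous_unit_imp_continuous[OF abs_continuous_prim])

lemma integrable_prim_power:
  assumes "integrable unit_leb h"
  shows "integrable unit_leb ((prim ^^ k) h)"
  by (induction k) (auto intro: continuous_on_integrable_unit continuous_prim assms)

lemma continuous_prim_power:
  assumes "integrable unit_leb h" "k \<ge> 1"
  shows "continuous_on {0..1} ((prim ^^ k) h)"
  using assms integrable_prim_power[OF assms(1), of "k - 1"] continuous_prim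
  by (cases k) auto

lemma prim_cong:
  assumes "\<And>s. s \<in> {0..1} \<Longrightarrow> h s = h' s"
  shows "prim h x = prim h' x"
  unfolding prim_def by (rule Bochner_Integration.integral_cong) (auto simp: assms)

lemma prim_power_lincomb:
  assumes "integrable unit_leb h" "integrable unit_leb h'"
  shows "(prim ^^ k) (\<lambda>s. c * h s + d * h' s) x = c * (prim ^^ k) h x + d * (prim ^^ k) h' x"
proof (induction k arbitrary: x)
  case (Suc k)
  have "(prim ^^ k) (\<lambda>s. c * h s + d * h' s) = (\<lambda>s. c * (prim ^^ k) h s + d * (prim ^^ k) h' s)"
    by (rule ext) (rule Suc)
  then have "(prim ^^ Suc k) (\<lambda>s. c * h s + d * h' s) x = prim (\<lambda>s. c * (prim ^^ k) h s + d * (prim ^^ k) h' s) x"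
    by simp
  also have "\<dots> = c * (prim ^^ Suc k) h x + d * (prim ^^ Suc k) h' x"
    by (simp add: prim_lincomb integrable_prim_power assms)
  finally show ?case .
qed simp

lemma abs_prim_le:
  assumes "integrable unit_leb h" "x \<ge> 0"
  shows "\<bar>prim h x\<bar> \<le> (\<integral>s. \<bar>h s\<bar> \<partial>unit_leb)"
proof -
  have "\<bar>prim h x\<bar> \<le> (\<integral>s. \<bar>h s * indicator {0..x} s\<bar> \<partial>unit_leb)"
    unfolding prim_def by (rule integral_abs_bound)
  also have "\<dots> \<le> (\<integral>s. \<bar>h s\<bar> \<partial>unit_leb)"
    by (intro integral_mono integrable_abs assms integrable_unit_leb_mult_indicator) (auto simp: indicator_def)
  finally show ?thesis .
qed

text \<open>The bound is uniform in \<open>x\<close> and in the number of integrations. In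
  \<open>sobolev_complete\<close> it turns L2 convergence of top derivatives into pointwise
  convergence of the iterated integrals.\<close>

lemma abs_prim_power_le:
  assumes "integrable unit_leb h" "x \<ge> 0" "k \<ge> 1"
  shows "\<bar>(prim ^^ k) h x\<bar> \<le> (\<integral>s. \<bar>h s\<bar> \<partial>unit_leb)"
  using assms(2,3)
proof (induction k arbitrary: x)
  case (Suc k)
  show ?case
  proof (cases "k = 0")
    case True
    then show ?thesis using abs_prim_le[OF assms(1) Suc.prems(1)] by simp
  next
    case False
    have "\<bar>(prim ^^ Suc k) h x\<bar> \<le> (\<integral>s. \<bar>(prim ^^ k) h s\<bar> \<partial>unit_leb)"
      using abs_prim_le[OF integrable_prim_power[OF assms(1)] Suc.prems(1)] by simp
    also have "\<dots> \<le> (\<integral>s. (\<integral>s. \<bar>h s\<bar> \<partial>unit_leb) \<partial>unit_leb)"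
      by (intro integral_mono integrable_abs integrable_prim_power assms) (use Suc.IH False in auto)
    also have "\<dots> = (\<integral>s. \<bar>h s\<bar> \<partial>unit_leb)" using unit_leb.prob_space by simp
    finally show ?thesis .
  qed
qed simp

lemma pderiv_sum: "pderiv (sum f A) = (\<Sum>i\<in>A. pderiv (f i))"
  by (induction A rule: infinite_finite_induct) (auto simp: pderiv_add)

lemma poly_antiderivative:
  fixes p :: "real poly"
  obtains q where "pderiv q = p" "degree q \<le> Suc (degree p)"
proof
  let ?q = "\<Sum>i\<le>degree p. monom (coeff p i / (real i + 1)) (Suc i)"
  have "pderiv ?q = (\<Sum>i\<le>degree p. monom (coeff p i) i)"
    unfolding pderiv_sum by (rule sum.cong) (auto simp: pderiv_monom field_simps)
  then show "pderiv ?q = p" by (simp add: poly_as_sum_of_monoms)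
  show "degree ?q \<le> Suc (degree p)"
    by (rule degree_sum_le) (auto intro: order_trans[OF degree_monom_le])
qed

lemma prim_eq_of_derivative:
  assumes f: "\<And>s. s \<in> {0..1} \<Longrightarrow> (f has_vector_derivative f' s) (at s within {0..1})"
    and f': "integrable unit_leb f'" and x: "x \<in> {0..1}"
  shows "prim f' x = f x - f 0"
proof -
  have "(f' has_integral (f x - f 0)) {0..x}"
    using x by (intro fundamental_theorem_of_calculus)
      (auto intro!: has_vector_derivative_within_subset[OF f])
  then have "integral {0..x} f' = f x - f 0" by (rule integral_unique)
  moreover have "integral {0..x} (\<lambda>s. indicator {0..1} s * f' s) = integral {0..x} f'"
    by (rule integral_cong) (use x in auto)
  ultimately show ?thesis using integral_eq_prim_diff[OF f', of 0 x] x by simp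
qed

section \<open>Sobolev functions through Taylor's formula\<close>

text \<open>Taylor's formula with the remainder as an iterated integral. In this form linear
  combinations and limits can be taken without differentiating.\<close>

definition sobolev_rep :: "nat \<Rightarrow> (real \<Rightarrow> real) \<Rightarrow> (real \<Rightarrow> real) \<Rightarrow> bool" where
  "sobolev_rep m f h \<longleftrightarrow> h \<in> L2 \<and>
     (\<exists>p::real poly. degree p < m \<and> (\<forall>x\<in>{0..1}. f x = poly p x + (prim ^^ m) h x))"

text \<open>\<open>sobolev m\<close> without the extension by zero: the induction passes to
  \<open>nderiv 1 f\<close>, whose values outside \<open>{0..1}\<close> are unspecified.\<close>

definition sobolev_smooth :: "nat \<Rightarrow> (real \<Rightarrow> real) \<Rightarrow> bool" where
  "sobolev_smooth m b \<longleftrightarrow>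
     (\<forall>k. Suc k < m \<longrightarrow> (\<forall>s\<in>{0..1}. nderiv k b differentiable (at s within {0..1}))) \<and>
     (\<forall>k<m. abs_continuous_unit (nderiv k b)) \<and> nderiv m b \<in> L2"

lemma mem_sobolev_iff: "b \<in> sobolev m \<longleftrightarrow> (\<forall>s. s \<notin> {0..1} \<longrightarrow> b s = 0) \<and> sobolev_smooth m b"
  by (auto simp: sobolev_def sobolev_smooth_def)

lemma nderiv_1: "nderiv 1 f = (\<lambda>s. vector_derivative f (at s within {0..1}))"
  by simp

lemma abs_continuous_nderiv_1:
  assumes ac: "abs_continuous_unit f" "\<And>x. x \<in> {0..1} \<Longrightarrow> f x = c + prim h x" "integrable unit_leb h"
  shows "AE s in unit_leb. nderiv 1 f s = h s"
  using prim_has_derivative_AE[OF assms(3)]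
proof (rule AE_mp, intro AE_I2 impI)
  fix s assume s: "s \<in> space unit_leb" and d: "(prim h has_real_derivative h s) (at s within {0..1})"
  have "((\<lambda>x. c + prim h x) has_vector_derivative h s) (at s within {0..1})"
    using d by (auto simp: has_real_derivative_iff_has_vector_derivative intro!: derivative_eq_intros)
  then have "(f has_vector_derivative h s) (at s within {0..1})"
    by (rule has_vector_derivative_transform[rotated 2]) (use s assms(2) in auto)
  then show "nderiv 1 f s = h s"
    unfolding nderiv_1 using s by (intro vector_derivative_within_cbox[of 0 1, simplified]) auto
qed

text \<open>Induction through \<open>nderiv 1 f\<close>. Order one uses the representation of
  absolutely continuous functions; above that \<open>f\<close> is differentiable at every point and
  the fundamental theorem of calculus suffices.\<close>

lemma sobolev_smooth_imp_rep:
  assumes "sobolev_smooth m f" "m \<ge> 1"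
  shows "sobolev_rep m f (nderiv m f)"
  using assms(2,1)
proof (induction m arbitrary: f rule: dec_induct)
  case base
  then have ac: "abs_continuous_unit f" and L: "nderiv 1 f \<in> L2"
    unfolding sobolev_smooth_def by (auto simp: sobolev_smooth_def dest: spec[of _ 0])
  obtain h where h: "integrable unit_leb h" "\<And>x. x \<in> {0..1} \<Longrightarrow> f x = f 0 + prim h x"
    using abs_continuous_unit_rep[OF ac] by blast
  have pe: "prim h x = prim (nderiv 1 f) x" for x
    using abs_continuous_nderiv_1[OF ac h(2,1)] h(1) L
    by (intro prim_cong_AE) (auto simp: L2_def simp del: nderiv.simps One_nat_def elim: eventually_mono)
  show ?case unfolding sobolev_rep_def
  proof (intro conjI exI[of _ "[:f 0:]"] ballI)
    fix x :: real assume "x \<in> {0..1}"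
    from h(2)[OF this] show "f x = poly [:f 0:] x + (prim ^^ 1) (nderiv 1 f) x"
      unfolding pe by (simp del: nderiv.simps)
  qed (use L in simp_all)
next
  case (step m)
  let ?f1 = "nderiv 1 f"
  have sm: "sobolev_smooth m ?f1"
    using step.prems unfolding sobolev_smooth_def
    by (auto simp del: nderiv.simps One_nat_def simp: nderiv_Suc_shift[symmetric])
  obtain p :: "real poly" where p: "degree p < m" "\<forall>x\<in>{0..1}. ?f1 x = poly p x + (prim ^^ m) (nderiv m ?f1) x"
    and L: "nderiv m ?f1 \<in> L2"
    using step.IH[OF sm] unfolding sobolev_rep_def by blast
  have d: "(f has_vector_derivative ?f1 s) (at s within {0..1})" if "s \<in> {0..1}" for s
  proof -
    have "f differentiable (at s within {0..1})"
      using step.prems that step.hyps unfolding sobolev_smooth_def by (auto dest: spec[of _ 0])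
    then show ?thesis unfolding nderiv_1
      using vector_derivative_works by blast
  qed
  obtain q where q: "pderiv q = p" "degree q \<le> Suc (degree p)" using poly_antiderivative .
  have Li: "integrable unit_leb (nderiv m ?f1)" using L by (rule L2_integrable)
  have pint: "integrable unit_leb (poly p)"
    by (intro continuous_on_integrable_unit continuous_intros)
  have f1c: "continuous_on {0..1} ?f1"
    using step.prems step.hyps unfolding sobolev_smooth_def
    by (intro abs_continuous_unit_imp_continuous) (auto dest: spec[of _ 1])
  have "f x = poly (q + [:f 0 - poly q 0:]) x + (prim ^^ Suc m) (nderiv (Suc m) f) x" if x: "x \<in> {0..1}" for x
  proof -
    have "f x - f 0 = prim ?f1 x"
      by (rule prim_eq_of_derivative[OF d continuous_on_integrable_unit[OF f1c] x, symmetric])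
    also have "\<dots> = prim (\<lambda>x. 1 * poly p x + 1 * (prim ^^ m) (nderiv m ?f1) x) x"
      by (rule prim_cong) (use p(2) in auto)
    also have "\<dots> = prim (poly p) x + prim ((prim ^^ m) (nderiv m ?f1)) x"
      by (subst prim_lincomb[OF pint integrable_prim_power[OF Li]]) simp
    also have "prim (poly p) x = poly q x - poly q 0"
      by (rule prim_eq_of_derivative[OF _ _ x])
         (auto intro!: continuous_on_integrable_unit continuous_intros has_field_derivative_at_within poly_DERIV
               simp: has_real_derivative_iff_has_vector_derivative[symmetric] simp flip: q(1))
    finally show ?thesis by (simp del: nderiv.simps One_nat_def add: nderiv_Suc_shift[of m f])
  qed
  moreover have "degree (q + [:f 0 - poly q 0:]) < Suc m"
    using q(2) p(1) by (intro le_less_trans[OF degree_add_le_max]) auto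
  moreover have "nderiv (Suc m) f \<in> L2" using L by (simp add: nderiv_Suc_shift[of m f] del: nderiv.simps One_nat_def)
  ultimately show ?case unfolding sobolev_rep_def by blast
qed

text \<open>Above order one the integrand \<open>(prim ^^ m) h\<close> is continuous, so the formula
  can be differentiated at every point. The exceptional null set enters only with the last
  derivative.\<close>

lemma sobolev_rep_imp_smooth:
  assumes "sobolev_rep m f h" "m \<ge> 1"
  shows "sobolev_smooth m f \<and> (AE s in unit_leb. nderiv m f s = h s)"
  using assms(2,1)
proof (induction m arbitrary: f rule: dec_induct)
  case base
  then obtain p :: "real poly" where p: "degree p < 1" "\<forall>x\<in>{0..1}. f x = poly p x + prim h x" and L: "h \<in> L2"
    unfolding sobolev_rep_def by auto
  obtain c where "p = [:c:]" using p(1) by (metis degree_eq_zeroE less_one)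
  then have fc: "\<And>x. x \<in> {0..1} \<Longrightarrow> f x = c + prim h x" using p(2) by auto
  have hi: "integrable unit_leb h" using L by (rule L2_integrable)
  have ac: "abs_continuous_unit f" by (rule abs_continuous_const_add_prim[OF hi fc])
  have ae: "AE s in unit_leb. nderiv 1 f s = h s" by (rule abs_continuous_nderiv_1[OF ac fc hi])
  have "nderiv 1 f \<in> L2"
    by (rule L2_cong_AE[OF L _ ae])
       (use vector_derivative_measurable_unit[OF abs_continuous_unit_imp_continuous[OF ac]] in simp)
  then show ?case using ac ae unfolding sobolev_smooth_def by auto
next
  case (step m)
  obtain p :: "real poly" where p: "degree p < Suc m" "\<forall>x\<in>{0..1}. f x = poly p x + (prim ^^ Suc m) h x" and L: "h \<in> L2"
    using step.prems unfolding sobolev_rep_def by auto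
  have hi: "integrable unit_leb h" using L by (rule L2_integrable)
  let ?g = "(prim ^^ m) h"
  have gc: "continuous_on {0..1} ?g" by (rule continuous_prim_power[OF hi step.hyps(1)])
  have gi: "integrable unit_leb ?g" by (rule integrable_prim_power[OF hi])
  have fx: "f x = poly p 0 + prim (\<lambda>x. 1 * poly (pderiv p) x + 1 * ?g x) x" if x: "x \<in> {0..1}" for x
  proof -
    have "prim (poly (pderiv p)) x = poly p x - poly p 0"
      by (rule prim_eq_of_derivative[OF _ _ x])
         (auto intro!: continuous_on_integrable_unit continuous_intros has_field_derivative_at_within poly_DERIV
               simp: has_real_derivative_iff_has_vector_derivative[symmetric])
    then show ?thesis using p(2) x
      by (subst prim_lincomb) (auto intro!: gi continuous_on_integrable_unit continuous_intros)
  qed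
  have ac: "abs_continuous_unit f"
    by (rule abs_continuous_const_add_prim[OF _ fx])
       (auto intro!: continuous_on_integrable_unit continuous_intros gc)
  have d: "(f has_vector_derivative (poly (pderiv p) s + ?g s)) (at s within {0..1})" if s: "s \<in> {0..1}" for s
  proof -
    have "((\<lambda>x. integral {0..x} (\<lambda>s. indicator {0..1} s * ?g s)) has_vector_derivative (indicator {0..1} s * ?g s)) (at s within {0..1})"
      by (rule integral_has_vector_derivative[OF _ s])
         (use gc in \<open>auto intro!: continuous_on_cong[THEN iffD1, OF refl _ gc]\<close>)
    then have "(prim ?g has_vector_derivative ?g s) (at s within {0..1})"
      by (rule_tac has_vector_derivative_transform[rotated 2, where f = "\<lambda>x. integral {0..x} (\<lambda>s. indicator {0..1} s * ?g s)"])
        (use s in \<open>auto simp: integral_eq_prim_diff[OF gi]\<close>)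
    then have "((\<lambda>x. poly p x + prim ?g x) has_vector_derivative (poly (pderiv p) s + ?g s)) (at s within {0..1})"
      by (intro has_vector_derivative_add)
         (auto simp: has_real_derivative_iff_has_vector_derivative[symmetric] intro!: has_field_derivative_at_within poly_DERIV)
    then show ?thesis
      by (rule has_vector_derivative_transform[rotated 2]) (use s p(2) in auto)
  qed
  have f1: "nderiv 1 f s = poly (pderiv p) s + ?g s" if "s \<in> {0..1}" for s
    unfolding nderiv_1 using d[OF that] that by (intro vector_derivative_within_cbox[of 0 1, simplified]) auto
  have "degree (pderiv p) < m" using p(1) step.hyps by (auto simp: degree_pderiv)
  then have "sobolev_rep m (nderiv 1 f) h" unfolding sobolev_rep_def using L f1 by blast
  from step.IH[OF this] have sm: "sobolev_smooth m (nderiv 1 f)" and ae: "AE s in unit_leb. nderiv m (nderiv 1 f) s = h s"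
    by auto
  have "sobolev_smooth (Suc m) f"
    unfolding sobolev_smooth_def
  proof (intro conjI allI impI)
    fix k assume k: "Suc k < Suc m"
    show "\<forall>s\<in>{0..1}. nderiv k f differentiable (at s within {0..1})"
    proof (cases k)
      case 0
      then show ?thesis by (auto intro!: differentiableI_vector d)
    next
      case (Suc k')
      then show ?thesis using sm k unfolding sobolev_smooth_def
        by (auto simp: nderiv_Suc_shift[of k' f] simp del: nderiv.simps One_nat_def)
    qed
  next
    fix k assume k: "k < Suc m"
    show "abs_continuous_unit (nderiv k f)"
    proof (cases k)
      case (Suc k')
      then show ?thesis using sm k unfolding sobolev_smooth_def
        by (auto simp: nderiv_Suc_shift[of k' f] simp del: nderiv.simps One_nat_def)
    qed (use ac in simp)
  next
    show "nderiv (Suc m) f \<in> L2" using sm unfolding sobolev_smooth_def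
      by (auto simp: nderiv_Suc_shift[of m f] simp del: nderiv.simps One_nat_def)
  qed
  then show ?case using ae by (simp add: nderiv_Suc_shift[of m f] del: nderiv.simps One_nat_def)
qed

section \<open>Completeness\<close>

lemma discriminant_le:
  fixes a b c :: real
  assumes "\<And>t. 0 \<le> a + 2 * t * b + t\<^sup>2 * c" "0 \<le> c"
  shows "b\<^sup>2 \<le> a * c"
proof (cases "c = 0")
  case True
  have "b = 0"
  proof (rule ccontr)
    assume "b \<noteq> 0"
    \<comment> \<open>With \<open>c = 0\<close> the expression is linear in \<open>t\<close>; this
      \<open>t\<close> gives it the value -1.\<close>
    then show False using assms(1)[of "- (a + 1) / (2 * b)"] True by (simp add: field_simps)
  qed
  then show ?thesis using True by simp
next
  case False
  with assms(2) have c: "c > 0" by simp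
  have "0 \<le> a + 2 * (- b / c) * b + (- b / c)\<^sup>2 * c" by (rule assms(1))
  also have "\<dots> = a - b\<^sup>2 / c" using c by (simp add: power2_eq_square field_simps)
  finally show ?thesis using c by (simp add: field_simps)
qed

lemma L2_inner_commute: "L2_inner f g = L2_inner g f"
  by (simp add: L2_inner_def mult.commute)

lemma L2_inner_lincomb:
  assumes "f \<in> L2" "g \<in> L2" "h \<in> L2"
  shows "L2_inner (\<lambda>s. c * f s + d * g s) h = c * L2_inner f h + d * L2_inner g h"
proof -
  have "L2_inner (\<lambda>s. c * f s + d * g s) h = (\<integral>s. c * (f s * h s) + d * (g s * h s) \<partial>unit_leb)"
    unfolding L2_inner_def by (simp add: algebra_simps)
  also have "\<dots> = c * L2_inner f h + d * L2_inner g h"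
    unfolding L2_inner_def using assms
    by (subst Bochner_Integration.integral_add) (auto intro!: L2_mult_integrable integrable_mult_right)
  finally show ?thesis .
qed

lemma L2_inner_self_nonneg: "0 \<le> L2_inner f f"
  unfolding L2_inner_def by (rule integral_nonneg_AE) auto

lemma L2_norm_nonneg: "0 \<le> L2_norm f"
  by (simp add: L2_norm_def L2_inner_self_nonneg)

lemma L2_norm_sq: "(L2_norm f)\<^sup>2 = L2_inner f f"
  by (simp add: L2_norm_def L2_inner_self_nonneg)

lemma L2_inner_expand:
  assumes "f \<in> L2" "g \<in> L2"
  shows "L2_inner (\<lambda>s. f s + t * g s) (\<lambda>s. f s + t * g s) = L2_inner f f + 2 * t * L2_inner f g + t\<^sup>2 * L2_inner g g"
proof -
  have s: "(\<lambda>s. f s + t * g s) \<in> L2" using L2_lincomb[OF assms, of 1 t] by simp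
  have e: "L2_inner (\<lambda>s. f s + t * g s) h = L2_inner f h + t * L2_inner g h" if "h \<in> L2" for h
    using L2_inner_lincomb[OF assms that, of 1 t] by simp
  show ?thesis
    unfolding e[OF s] using e[OF assms(1)] e[OF assms(2)]
    by (simp add: L2_inner_commute[of _ "\<lambda>s. f s + t * g s"] L2_inner_commute[of g f] power2_eq_square algebra_simps)
qed

lemma L2_inner_Cauchy_Schwarz:
  assumes "f \<in> L2" "g \<in> L2"
  shows "\<bar>L2_inner f g\<bar> \<le> L2_norm f * L2_norm g"
proof -
  have "(L2_inner f g)\<^sup>2 \<le> L2_inner f f * L2_inner g g"
    by (rule discriminant_le) (use L2_inner_expand[OF assms] L2_inner_self_nonneg in metis)+
  then have "(L2_inner f g)\<^sup>2 \<le> (L2_norm f * L2_norm g)\<^sup>2"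
    by (simp add: power_mult_distrib L2_norm_sq)
  then show ?thesis
    by (metis L2_norm_nonneg abs_le_square_iff abs_of_nonneg mult_nonneg_nonneg)
qed

lemma L2_norm_triangle:
  assumes "f \<in> L2" "g \<in> L2"
  shows "L2_norm (\<lambda>s. f s + g s) \<le> L2_norm f + L2_norm g"
proof -
  have "(L2_norm (\<lambda>s. f s + g s))\<^sup>2 = (L2_norm f)\<^sup>2 + 2 * L2_inner f g + (L2_norm g)\<^sup>2"
    using L2_inner_expand[OF assms, of 1] by (simp add: L2_norm_sq)
  also have "\<dots> \<le> (L2_norm f + L2_norm g)\<^sup>2"
    using L2_inner_Cauchy_Schwarz[OF assms] by (simp add: power2_sum)
  finally show ?thesis by (rule power2_le_imp_le) (simp add: L2_norm_nonneg)
qed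

lemma L2_norm_cong_AE:
  assumes "f \<in> borel_measurable unit_leb" "g \<in> borel_measurable unit_leb" "AE s in unit_leb. f s = g s"
  shows "L2_norm f = L2_norm g"
proof -
  have "L2_inner f f = L2_inner g g"
    unfolding L2_inner_def
    by (rule Bochner_Integration.integral_cong_AE) (use assms in \<open>auto elim: eventually_mono\<close>)
  then show ?thesis by (simp add: L2_norm_def)
qed

lemma L2_inner_cong_AE:
  assumes "f \<in> borel_measurable unit_leb" "f' \<in> borel_measurable unit_leb" "g \<in> borel_measurable unit_leb"
    "AE s in unit_leb. f s = f' s"
  shows "L2_inner f g = L2_inner f' g"
  unfolding L2_inner_def
  by (rule Bochner_Integration.integral_cong_AE) (use assms in \<open>auto elim: eventually_mono\<close>)

lemma integral_abs_le_L2_norm: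
  assumes "f \<in> L2"
  shows "(\<integral>s. \<bar>f s\<bar> \<partial>unit_leb) \<le> L2_norm f"
proof -
  have 1: "(\<lambda>_. 1) \<in> L2" by (rule continuous_on_L2) auto
  have a: "(\<lambda>s. \<bar>f s\<bar>) \<in> L2" using assms by (auto simp: L2_def)
  have "(\<integral>s. \<bar>f s\<bar> \<partial>unit_leb) = L2_inner (\<lambda>s. \<bar>f s\<bar>) (\<lambda>_. 1)" by (simp add: L2_inner_def)
  also have "\<dots> \<le> L2_norm (\<lambda>s. \<bar>f s\<bar>) * L2_norm (\<lambda>_. 1)"
    using L2_inner_Cauchy_Schwarz[OF a 1] by linarith
  also have "L2_norm (\<lambda>_. 1) = 1" using unit_leb.prob_space by (simp add: L2_norm_def L2_inner_def)
  also have "L2_norm (\<lambda>s. \<bar>f s\<bar>) = L2_norm f" by (simp add: L2_norm_def L2_inner_def)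
  finally show ?thesis by simp
qed

lemma L2_inner_eq_square: "L2_inner f f = (\<integral>s. (f s)\<^sup>2 \<partial>unit_leb)"
  by (simp add: L2_inner_def power2_eq_square)

section \<open>Completeness and separability of L2\<close>

text \<open>On a probability space an L2-Cauchy sequence is L1-Cauchy, hence has a subsequence
  converging almost everywhere; Fatou's lemma carries the Cauchy estimate over to the limit.\<close>

lemma L2_complete:
  fixes u :: "nat \<Rightarrow> real \<Rightarrow> real"
  assumes u: "\<And>n. u n \<in> L2"
    and cauchy: "\<And>e. e > 0 \<Longrightarrow> \<exists>N. \<forall>i\<ge>N. \<forall>j\<ge>N. L2_norm (\<lambda>s. u i s - u j s) < e"
  obtains h where "h \<in> L2" "(\<lambda>n. L2_norm (\<lambda>s. u n s - h s)) \<longlonglongrightarrow> 0"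
proof -
  have um[measurable]: "u n \<in> borel_measurable unit_leb" for n using u by (auto simp: L2_def)
  have c1: "\<exists>N. \<forall>i\<ge>N. \<forall>j\<ge>N. (LINT s|unit_leb. norm (u i s - u j s)) < e" if "e > 0" for e
    using cauchy[OF that] le_less_trans[OF integral_abs_le_L2_norm[OF L2_diff[OF u u]]]
    unfolding real_norm_def by meson
  obtain r where r: "strict_mono r" "AE s in unit_leb. Cauchy (\<lambda>i. u (r i) s)"
    by (rule cauchy_L1_AE_cauchy_subseq[of unit_leb u, OF L2_integrable[OF u] c1])
  define h where "h = (\<lambda>s. lim (\<lambda>i. u (r i) s))"
  have hm[measurable]: "h \<in> borel_measurable unit_leb" unfolding h_def by measurable
  have conv: "AE s in unit_leb. (\<lambda>i. u (r i) s) \<longlonglongrightarrow> h s"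
    using r(2) by eventually_elim (auto simp: h_def Cauchy_convergent_iff convergent_LIMSEQ_iff)
  have bound: "(\<integral>\<^sup>+s. ennreal ((u n s - h s)\<^sup>2) \<partial>unit_leb) \<le> ennreal (e\<^sup>2)"
    if N: "\<forall>i\<ge>N. \<forall>j\<ge>N. L2_norm (\<lambda>s. u i s - u j s) < e" and n: "n \<ge> N" for n N e
  proof -
    have "(\<integral>\<^sup>+s. ennreal ((u n s - h s)\<^sup>2) \<partial>unit_leb) = (\<integral>\<^sup>+s. liminf (\<lambda>i. ennreal ((u n s - u (r i) s)\<^sup>2)) \<partial>unit_leb)"
    proof (rule nn_integral_cong_AE, use conv in eventually_elim)
      fix s assume "(\<lambda>i. u (r i) s) \<longlonglongrightarrow> h s"
      then have "(\<lambda>i. ennreal ((u n s - u (r i) s)\<^sup>2)) \<longlonglongrightarrow> ennreal ((u n s - h s)\<^sup>2)"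
        by (intro tendsto_intros)
      then show "ennreal ((u n s - h s)\<^sup>2) = liminf (\<lambda>i. ennreal ((u n s - u (r i) s)\<^sup>2))"
        by (intro lim_imp_Liminf[symmetric]) auto
    qed
    also have "\<dots> \<le> liminf (\<lambda>i. \<integral>\<^sup>+s. ennreal ((u n s - u (r i) s)\<^sup>2) \<partial>unit_leb)"
      by (rule nn_integral_liminf) measurable
    also have "\<dots> \<le> ennreal (e\<^sup>2)"
    proof (rule Liminf_le)
      show "\<forall>\<^sub>F i in sequentially. (\<integral>\<^sup>+s. ennreal ((u n s - u (r i) s)\<^sup>2) \<partial>unit_leb) \<le> ennreal (e\<^sup>2)"
        unfolding eventually_sequentially
      proof (intro exI[of _ N] allI impI)
        fix i assume "N \<le> i"
        then have ri: "r i \<ge> N" using seq_suble[OF r(1), of i] by simp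
        have "(\<integral>\<^sup>+s. ennreal ((u n s - u (r i) s)\<^sup>2) \<partial>unit_leb) = ennreal (\<integral>s. (u n s - u (r i) s)\<^sup>2 \<partial>unit_leb)"
          using L2_diff[OF u[of n] u[of "r i"]] by (intro nn_integral_eq_integral) (auto simp: L2_def)
        also have "\<dots> = ennreal ((L2_norm (\<lambda>s. u n s - u (r i) s))\<^sup>2)"
          by (simp add: L2_norm_sq L2_inner_eq_square)
        also have "\<dots> \<le> ennreal (e\<^sup>2)"
          using N n ri L2_norm_nonneg by (intro ennreal_leI power_mono) (auto intro: less_imp_le)
        finally show "(\<integral>\<^sup>+s. ennreal ((u n s - u (r i) s)\<^sup>2) \<partial>unit_leb) \<le> ennreal (e\<^sup>2)" .
      qed
    qed simp
    finally show ?thesis .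
  qed
  have dL: "(\<lambda>s. u n s - h s) \<in> L2" if "\<forall>i\<ge>N. \<forall>j\<ge>N. L2_norm (\<lambda>s. u i s - u j s) < e" "n \<ge> N" for n N e
    unfolding L2_def using bound[OF that]
    by (auto intro!: integrableI_nonneg simp: top_unique less_top[symmetric])
  obtain N0 where N0: "\<forall>i\<ge>N0. \<forall>j\<ge>N0. L2_norm (\<lambda>s. u i s - u j s) < 1" using cauchy[of 1] by auto
  have hL: "h \<in> L2"
    using L2_diff[OF u[of N0] dL[OF N0 order_refl]] by simp
  show ?thesis
  proof (rule that[OF hL], rule LIMSEQ_I)
    fix e :: real assume e: "0 < e"
    then obtain N where N: "\<forall>i\<ge>N. \<forall>j\<ge>N. L2_norm (\<lambda>s. u i s - u j s) < e / 2" using cauchy[of "e / 2"] by auto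
    have "norm (L2_norm (\<lambda>s. u n s - h s) - 0) < e" if "n \<ge> N" for n
    proof -
      have "ennreal (\<integral>s. (u n s - h s)\<^sup>2 \<partial>unit_leb) \<le> ennreal ((e / 2)\<^sup>2)"
        using bound[OF N that] L2_diff[OF u[of n] hL]
        by (subst nn_integral_eq_integral[symmetric]) (auto simp: L2_def)
      then have "(L2_norm (\<lambda>s. u n s - h s))\<^sup>2 \<le> (e / 2)\<^sup>2"
        by (simp add: L2_norm_sq L2_inner_eq_square ennreal_le_iff)
      then have "L2_norm (\<lambda>s. u n s - h s) \<le> e / 2" by (rule power2_le_imp_le) (use e in simp)
      then show ?thesis using e L2_norm_nonneg by simp
    qed
    then show "\<exists>N. \<forall>n\<ge>N. norm (L2_norm (\<lambda>s. u n s - h s) - 0) < e" by blast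
  qed
qed

text \<open>Separability is what makes the distance of two random elements of L2 measurable, see
  \<open>measurable_L2_distance\<close>. Bernstein polynomials with rational coefficients
  approximate continuous functions, and truncated continuous functions approximate truncations of
  any L2 function.\<close>

lemma L2_dense_countable:
  obtains B :: "(real \<Rightarrow> real) set" where "countable B" "B \<subseteq> L2"
    "\<And>f e. f \<in> L2 \<Longrightarrow> e > 0 \<Longrightarrow> \<exists>b\<in>B. L2_norm (\<lambda>s. f s - b s) < e"
proof -
  \<comment> \<open>The length of the rational list encodes the degree \<open>n\<close>. The list
    holds the coefficients for \<open>k < n\<close>; the last one, of \<open>x ^ n\<close>, is the
    extra rational in \<open>Q\<close>.\<close>
  define P where "P = (\<lambda>rs::rat list. \<lambda>x::real. \<Sum>k\<le>length rs. real_of_rat (if k < length rs then rs ! k else 0) * Bernstein (length rs) k x)"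
  define Q where "Q = (\<lambda>(r::rat, rs) x. P rs x + of_rat r * x ^ length rs)"
  have Pc: "continuous_on {0..1} (Q p)" for p
    unfolding Q_def P_def Bernstein_def by (cases p) (auto intro!: continuous_intros)
  have QL: "Q p \<in> L2" for p by (rule continuous_on_L2[OF Pc])
  have cont: "\<exists>b\<in>range Q. L2_norm (\<lambda>s. g s - b s) < e" if g: "continuous_on {0..1} g" and e: "e > 0" for g e
  proof -
    obtain N where N: "\<forall>n x. N \<le> n \<and> x \<in> {0..1} \<longrightarrow> \<bar>g x - (\<Sum>k\<le>n. g (real k / real n) * Bernstein n k x)\<bar> < e / 4"
      using Bernstein_Weierstrass[OF g, of "e / 4"] e by auto
    have "\<forall>y::real. \<exists>q::rat. \<bar>y - of_rat q\<bar> \<le> e / 4"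
    proof
      fix y :: real
      obtain q where "y < real_of_rat q" "real_of_rat q < y + e / 4" using of_rat_dense[of y "y + e / 4"] e by auto
      then show "\<exists>q::rat. \<bar>y - of_rat q\<bar> \<le> e / 4" by (intro exI[of _ q]) auto
    qed
    then obtain R :: "real \<Rightarrow> rat" where R: "\<And>y. \<bar>y - of_rat (R y)\<bar> \<le> e / 4" by metis
    define n where "n = N"
    define rs where "rs = map (\<lambda>k. R (g (real k / real n))) [0..<n]"
    have lrs: "length rs = n" by (simp add: rs_def)
    let ?b = "Q (R (g (real n / real n)), rs)"
    have bx: "?b x = (\<Sum>k\<le>n. of_rat (R (g (real k / real n))) * Bernstein n k x)" for x
    proof -
      have "?b x = (\<Sum>k\<le>n. real_of_rat (if k < n then rs ! k else 0) * Bernstein n k x) + of_rat (R (g (real n / real n))) * x ^ n"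
        by (simp add: Q_def P_def lrs)
      also have "(\<Sum>k\<le>n. real_of_rat (if k < n then rs ! k else 0) * Bernstein n k x) = (\<Sum>k<n. of_rat (R (g (real k / real n))) * Bernstein n k x)"
        unfolding lessThan_Suc_atMost[symmetric] sum.lessThan_Suc by (simp add: rs_def)
      also have "\<dots> + of_rat (R (g (real n / real n))) * x ^ n = (\<Sum>k\<le>n. of_rat (R (g (real k / real n))) * Bernstein n k x)"
        unfolding lessThan_Suc_atMost[symmetric] sum.lessThan_Suc by (simp add: Bernstein_def)
      finally show ?thesis .
    qed
    have diff: "\<bar>g x - ?b x\<bar> \<le> e / 2" if x: "x \<in> {0..1}" for x
    proof -
      have "\<bar>(\<Sum>k\<le>n. g (real k / real n) * Bernstein n k x) - ?b x\<bar>
          = \<bar>\<Sum>k\<le>n. (g (real k / real n) - of_rat (R (g (real k / real n)))) * Bernstein n k x\<bar>"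
        unfolding bx by (simp add: sum_subtractf left_diff_distrib)
      also have "\<dots> \<le> (\<Sum>k\<le>n. \<bar>(g (real k / real n) - of_rat (R (g (real k / real n)))) * Bernstein n k x\<bar>)"
        by (rule sum_abs)
      also have "\<dots> \<le> (\<Sum>k\<le>n. e / 4 * Bernstein n k x)"
      proof (rule sum_mono)
        fix k
        have "0 \<le> Bernstein n k x" using x by (auto intro: Bernstein_nonneg)
        then show "\<bar>(g (real k / real n) - of_rat (R (g (real k / real n)))) * Bernstein n k x\<bar> \<le> e / 4 * Bernstein n k x"
          unfolding abs_mult abs_of_nonneg[OF \<open>0 \<le> Bernstein n k x\<close>] by (intro mult_right_mono R)
      qed
      also have "\<dots> = e / 4" unfolding sum_distrib_left[symmetric] by simp
      finally have "\<bar>(\<Sum>k\<le>n. g (real k / real n) * Bernstein n k x) - ?b x\<bar> \<le> e / 4" .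
      moreover have "\<bar>g x - (\<Sum>k\<le>n. g (real k / real n) * Bernstein n k x)\<bar> < e / 4" using N x by (simp add: n_def)
      ultimately show ?thesis by linarith
    qed
    have "L2_inner (\<lambda>s. g s - ?b s) (\<lambda>s. g s - ?b s) \<le> (\<integral>s. (e / 2)\<^sup>2 \<partial>unit_leb)"
      unfolding L2_inner_eq_square
    proof (rule integral_mono)
      show "integrable unit_leb (\<lambda>s. (g s - ?b s)\<^sup>2)"
        using L2_diff[OF continuous_on_L2[OF g] QL] by (auto simp: L2_def)
      fix s assume "s \<in> space unit_leb"
      then show "(g s - ?b s)\<^sup>2 \<le> (e / 2)\<^sup>2" using diff[of s] by (subst abs_le_square_iff[symmetric]) auto
    qed simp
    also have "\<dots> = (e / 2)\<^sup>2" using unit_leb.prob_space by simp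
    finally have "L2_norm (\<lambda>s. g s - ?b s) \<le> e / 2"
      using e unfolding L2_norm_def by (intro real_le_lsqrt) (auto simp: L2_inner_self_nonneg)
    then show ?thesis using e by (intro bexI[of _ ?b]) auto
  qed
  have dense: "\<exists>b\<in>range Q. L2_norm (\<lambda>s. f s - b s) < e" if f: "f \<in> L2" and e: "e > 0" for f e
  proof -
    have fm[measurable]: "f \<in> borel_measurable unit_leb" using f by (auto simp: L2_def)
    let ?F = "\<lambda>s. indicator {0..1} s * f s"
    have "?F \<in> borel_measurable lborel"
      using fm by (subst (asm) borel_measurable_restrict_space_iff) (auto simp: mult.commute)
    then have "?F \<in> borel_measurable lebesgue" by (rule measurable_completion)
    then have "?F measurable_on UNIV" by (rule lebesgue_measurable_imp_measurable_on) simp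
    then obtain N g where N: "negligible N" "\<And>n. continuous_on UNIV (g n)"
        "\<And>x. x \<notin> N \<Longrightarrow> (\<lambda>n. g n x) \<longlonglongrightarrow> ?F x"
      unfolding measurable_on_def by auto
    have "AE x in lebesgue. x \<notin> N" by (rule AE_not_in) (use N(1) in \<open>simp only: negligible_iff_null_sets\<close>)
    then have "AE x in lborel. x \<notin> N" by (simp add: AE_completion_iff)
    then have AEN: "AE x in unit_leb. x \<notin> N" by (subst AE_restrict_space_iff) auto
    \<comment> \<open>Truncation at level \<open>K\<close>. Applied to \<open>f\<close> and to its
      continuous approximants alike, it lets convergence almost everywhere become L2 convergence by
      domination.\<close>
    define c where "c = (\<lambda>K y. max (- real K) (min (real K) y))"
    have cK: "\<bar>c K y\<bar> \<le> real K" "\<bar>c K y\<bar> \<le> \<bar>y\<bar>" for K y by (auto simp: c_def)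
    have cL: "(\<lambda>s. c K (f s)) \<in> L2" for K
      unfolding L2_def using fm
      by (auto simp: c_def intro!: unit_leb.integrable_const_bound[where B = "(real K)\<^sup>2"] AE_I2)
         (auto simp: abs_le_square_iff[symmetric])
    have "(\<lambda>K. \<integral>s. (f s - c K (f s))\<^sup>2 \<partial>unit_leb) \<longlonglongrightarrow> (\<integral>s. 0 \<partial>unit_leb)"
    proof (rule integral_dominated_convergence[where w = "\<lambda>s. (f s)\<^sup>2"])
      show "AE s in unit_leb. (\<lambda>K. (f s - c K (f s))\<^sup>2) \<longlonglongrightarrow> 0"
      proof (intro AE_I2)
        fix s
        obtain n0 :: nat where "\<bar>f s\<bar> \<le> real n0" using real_arch_simple by blast
        then have "\<forall>n\<ge>n0. (f s - c n (f s))\<^sup>2 = 0" by (auto simp: c_def)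
        then show "(\<lambda>K. (f s - c K (f s))\<^sup>2) \<longlonglongrightarrow> 0"
          by (intro tendsto_eventually) (auto simp: eventually_sequentially)
      qed
      show "AE s in unit_leb. norm ((f s - c K (f s))\<^sup>2) \<le> (f s)\<^sup>2" for K
        by (intro AE_I2) (auto simp: c_def abs_le_square_iff[symmetric])
    qed (use f in \<open>auto simp: L2_def c_def\<close>)
    then have "\<forall>\<^sub>F K in sequentially. (\<integral>s. (f s - c K (f s))\<^sup>2 \<partial>unit_leb) < (e / 3)\<^sup>2"
      using e by (intro order_tendstoD) auto
    then obtain K where K: "(\<integral>s. (f s - c K (f s))\<^sup>2 \<partial>unit_leb) < (e / 3)\<^sup>2"
      by (auto dest: eventually_happens'[OF sequentially_bot])
    have gm: "g n \<in> borel_measurable unit_leb" for n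
      by (rule continuous_on_measurable_unit) (rule continuous_on_subset[OF N(2)], simp)
    have "(\<lambda>n. \<integral>s. (c K (f s) - c K (g n s))\<^sup>2 \<partial>unit_leb) \<longlonglongrightarrow> (\<integral>s. 0 \<partial>unit_leb)"
    proof (rule integral_dominated_convergence[where w = "\<lambda>s. (2 * real K)\<^sup>2"])
      show "AE s in unit_leb. (\<lambda>n. (c K (f s) - c K (g n s))\<^sup>2) \<longlonglongrightarrow> 0"
        using AEN
      proof (rule AE_mp, intro AE_I2 impI)
        fix s assume s: "s \<in> space unit_leb" "s \<notin> N"
        have "(\<lambda>n. g n s) \<longlonglongrightarrow> f s" using N(3)[OF s(2)] s(1) by simp
        then have "(\<lambda>n. (c K (f s) - c K (g n s))\<^sup>2) \<longlonglongrightarrow> (c K (f s) - c K (f s))\<^sup>2"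
          unfolding c_def by (intro tendsto_intros)
        then show "(\<lambda>n. (c K (f s) - c K (g n s))\<^sup>2) \<longlonglongrightarrow> 0" by simp
      qed
      show "AE s in unit_leb. norm ((c K (f s) - c K (g n s))\<^sup>2) \<le> (2 * real K)\<^sup>2" for n
      proof (intro AE_I2)
        fix s
        have "\<bar>c K (f s) - c K (g n s)\<bar> \<le> \<bar>2 * real K\<bar>" using cK(1)[of K "f s"] cK(1)[of K "g n s"] by linarith
        then show "norm ((c K (f s) - c K (g n s))\<^sup>2) \<le> (2 * real K)\<^sup>2" by (simp only: abs_le_square_iff) simp
      qed
    qed (use gm in \<open>auto simp: c_def\<close>)
    then have "\<forall>\<^sub>F n in sequentially. (\<integral>s. (c K (f s) - c K (g n s))\<^sup>2 \<partial>unit_leb) < (e / 3)\<^sup>2"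
      using e by (intro order_tendstoD) auto
    then obtain n where n: "(\<integral>s. (c K (f s) - c K (g n s))\<^sup>2 \<partial>unit_leb) < (e / 3)\<^sup>2"
      by (auto dest: eventually_happens'[OF sequentially_bot])
    have gc: "continuous_on {0..1} (\<lambda>s. c K (g n s))"
      unfolding c_def by (intro continuous_intros continuous_on_subset[OF N(2)]) auto
    obtain b where b: "b \<in> range Q" "L2_norm (\<lambda>s. c K (g n s) - b s) < e / 3" using cont[OF gc, of "e / 3"] e by auto
    have bL: "b \<in> L2" using b QL by auto
    have gL: "(\<lambda>s. c K (g n s)) \<in> L2" by (rule continuous_on_L2[OF gc])
    have "L2_norm (\<lambda>s. f s - b s) \<le> L2_norm (\<lambda>s. f s - c K (f s)) + L2_norm (\<lambda>s. c K (f s) - b s)"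
      using L2_norm_triangle[OF L2_diff[OF f cL] L2_diff[OF cL bL], of K K] by simp
    also have "L2_norm (\<lambda>s. c K (f s) - b s) \<le> L2_norm (\<lambda>s. c K (f s) - c K (g n s)) + L2_norm (\<lambda>s. c K (g n s) - b s)"
      using L2_norm_triangle[OF L2_diff[OF cL gL] L2_diff[OF gL bL], of K] by simp
    also have "L2_norm (\<lambda>s. f s - c K (f s)) < e / 3"
      unfolding L2_norm_def L2_inner_eq_square using K e by (intro real_less_lsqrt) auto
    also have "L2_norm (\<lambda>s. c K (f s) - c K (g n s)) < e / 3"
      unfolding L2_norm_def L2_inner_eq_square using n e by (intro real_less_lsqrt) auto
    finally have "L2_norm (\<lambda>s. f s - b s) < e" using b(2) by linarith
    then show ?thesis using b(1) by blast
  qed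
  show ?thesis
    by (rule that[of "range Q"]) (use QL dense in auto)
qed

section \<open>The Sobolev space: vector space operations, the form \<open>J_form\<close>,
  completeness\<close>

lemma sobolev_rep_nderiv:
  assumes "f \<in> sobolev m" "m \<ge> 1"
  shows "sobolev_rep m f (nderiv m f)"
  using assms by (auto simp: mem_sobolev_iff intro: sobolev_smooth_imp_rep)

lemma sobolev_nderiv_L2: "f \<in> sobolev m \<Longrightarrow> nderiv m f \<in> L2"
  by (simp add: sobolev_def)

lemma sobolev_continuous:
  assumes "f \<in> sobolev m" "m \<ge> 1"
  shows "continuous_on {0..1} f"
  using assms by (intro abs_continuous_unit_imp_continuous) (auto simp: sobolev_def dest: spec[of _ 0])

lemma sobolev_L2: "f \<in> sobolev m \<Longrightarrow> m \<ge> 1 \<Longrightarrow> f \<in> L2"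
  by (rule continuous_on_L2[OF sobolev_continuous])

lemma sobolev_zero_outside: "f \<in> sobolev m \<Longrightarrow> s \<notin> {0..1} \<Longrightarrow> f s = 0"
  by (simp add: sobolev_def)

text \<open>The Taylor form is linear in the pair of polynomial and top derivative, so no sum of
  merely almost everywhere differentiable functions has to be differentiated. The top derivative is
  additive almost everywhere.\<close>

lemma sobolev_lincomb:
  assumes f: "f \<in> sobolev m" and g: "g \<in> sobolev m" and m: "m \<ge> 1"
  shows "(\<lambda>s. c * f s + d * g s) \<in> sobolev m"
    and "AE s in unit_leb. nderiv m (\<lambda>s. c * f s + d * g s) s = c * nderiv m f s + d * nderiv m g s"
proof -
  obtain p :: "real poly" where p: "degree p < m" "\<forall>x\<in>{0..1}. f x = poly p x + (prim ^^ m) (nderiv m f) x"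
    using sobolev_rep_nderiv[OF f m] unfolding sobolev_rep_def by blast
  obtain q :: "real poly" where q: "degree q < m" "\<forall>x\<in>{0..1}. g x = poly q x + (prim ^^ m) (nderiv m g) x"
    using sobolev_rep_nderiv[OF g m] unfolding sobolev_rep_def by blast
  have L: "nderiv m f \<in> L2" "nderiv m g \<in> L2" using f g by (auto intro: sobolev_nderiv_L2)
  let ?h = "\<lambda>s. c * nderiv m f s + d * nderiv m g s"
  have "c * f x + d * g x = poly (smult c p + smult d q) x + (prim ^^ m) ?h x" if "x \<in> {0..1}" for x
    using p(2) q(2) that
    by (simp add: prim_power_lincomb L2_integrable L algebra_simps)
  moreover have "degree (smult c p + smult d q) < m"
    using p(1) q(1) m by (intro degree_add_less) (auto intro: le_less_trans[OF degree_smult_le])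
  ultimately have "sobolev_rep m (\<lambda>s. c * f s + d * g s) ?h"
    unfolding sobolev_rep_def using L2_lincomb[OF L] by blast
  from sobolev_rep_imp_smooth[OF this m]
  show "(\<lambda>s. c * f s + d * g s) \<in> sobolev m"
    and "AE s in unit_leb. nderiv m (\<lambda>s. c * f s + d * g s) s = c * nderiv m f s + d * nderiv m g s"
    using f g by (auto simp: mem_sobolev_iff)
qed

lemma sobolev_rep_mem:
  assumes "sobolev_rep m f h" "m \<ge> 1" "\<And>s. s \<notin> {0..1} \<Longrightarrow> f s = 0"
  shows "f \<in> sobolev m" "AE s in unit_leb. nderiv m f s = h s"
  using sobolev_rep_imp_smooth[OF assms(1,2)] assms(3) by (auto simp: mem_sobolev_iff)

lemma zero_sobolev: "m \<ge> 1 \<Longrightarrow> (\<lambda>_. 0) \<in> sobolev m"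
proof (rule sobolev_rep_mem(1))
  assume m: "m \<ge> 1"
  have p0: "(prim ^^ m) (\<lambda>_. 0) x = 0" for x
    using prim_power_lincomb[of "\<lambda>_. 0" "\<lambda>_. 0" m 0 0] by simp
  then show "sobolev_rep m (\<lambda>_. 0) (\<lambda>_. 0)"
    unfolding sobolev_rep_def using m by (auto intro!: continuous_on_L2 exI[of _ 0])
qed auto

lemma J_form_eq_L2: "J_form m f g = L2_inner (nderiv m f) (nderiv m g)"
  by (simp add: J_form_def L2_inner_def)

lemma J_form_lincomb:
  assumes "f \<in> sobolev m" "g \<in> sobolev m" "b \<in> sobolev m" "m \<ge> 1"
  shows "J_form m (\<lambda>s. c * f s + d * g s) b = c * J_form m f b + d * J_form m g b"
proof -
  note L = sobolev_nderiv_L2[OF assms(1)] sobolev_nderiv_L2[OF assms(2)] sobolev_nderiv_L2[OF assms(3)]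
  have "J_form m (\<lambda>s. c * f s + d * g s) b = L2_inner (\<lambda>s. c * nderiv m f s + d * nderiv m g s) (nderiv m b)"
    unfolding J_form_eq_L2
    using sobolev_lincomb[OF assms(1,2,4), of c d] sobolev_nderiv_L2[OF sobolev_lincomb(1)[OF assms(1,2,4)], of c d]
      L2_lincomb[OF L(1,2), of c d] L(3)
    by (intro L2_inner_cong_AE) (auto simp: L2_def)
  also have "\<dots> = c * J_form m f b + d * J_form m g b"
    unfolding J_form_eq_L2 by (rule L2_inner_lincomb[OF L])
  finally show ?thesis .
qed

lemma J_form_commute: "J_form m f g = J_form m g f"
  by (simp add: J_form_eq_L2 L2_inner_commute)

lemma J_form_nonneg: "0 \<le> J_form m f f"
  by (simp add: J_form_eq_L2 L2_inner_self_nonneg)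

text \<open>Induction on the degree bound: synthetic division by \<open>x - x0\<close> leaves
  polynomials of smaller degree that still converge at every point of
  \<open>S - {x0}\<close>.\<close>

lemma poly_pointwise_limit:
  fixes p :: "nat \<Rightarrow> real poly"
  assumes "infinite S" "\<And>n. degree (p n) \<le> k" "\<And>x. x \<in> S \<Longrightarrow> convergent (\<lambda>n. poly (p n) x)"
  shows "\<exists>q. degree q \<le> k \<and> (\<forall>x\<in>S. (\<lambda>n. poly (p n) x) \<longlonglongrightarrow> poly q x)"
  using assms
proof (induction k arbitrary: p S)
  case 0
  then obtain x0 where x0: "x0 \<in> S" by (metis finite.emptyI equals0I)
  obtain L where L: "(\<lambda>n. poly (p n) x0) \<longlonglongrightarrow> L" using 0(3)[OF x0] by (auto simp: convergent_def)
  have c: "poly (p n) x = poly (p n) x0" for n x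
  proof -
    obtain a where "p n = [:a:]" using degree_eq_zeroE[of "p n"] 0(2)[of n] by auto
    then show ?thesis by simp
  qed
  have "(\<lambda>n. poly (p n) x) \<longlonglongrightarrow> poly [:L:] x" for x
  proof -
    have "(\<lambda>n. poly (p n) x) = (\<lambda>n. poly (p n) x0)" by (rule ext) (rule c)
    then show ?thesis using L by simp
  qed
  then show ?case by (intro exI[of _ "[:L:]"]) auto
next
  case (Suc k)
  then obtain x0 where x0: "x0 \<in> S" by (metis finite.emptyI equals0I)
  obtain L where L: "(\<lambda>n. poly (p n) x0) \<longlonglongrightarrow> L" using Suc.prems(3)[OF x0] by (auto simp: convergent_def)
  have eq: "poly (p n) x = (x - x0) * poly (synthetic_div (p n) x0) x + poly (p n) x0" for n x
    using arg_cong[OF synthetic_div_correct'[of x0 "p n"], of "\<lambda>r. poly r x"] by (simp add: algebra_simps)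
  have "\<exists>q. degree q \<le> k \<and> (\<forall>x\<in>S - {x0}. (\<lambda>n. poly (synthetic_div (p n) x0) x) \<longlonglongrightarrow> poly q x)"
  proof (rule Suc.IH)
    show "infinite (S - {x0})" using Suc.prems(1) by simp
    show "degree (synthetic_div (p n) x0) \<le> k" for n using Suc.prems(2)[of n] by (simp add: degree_synthetic_div)
    show "convergent (\<lambda>n. poly (synthetic_div (p n) x0) x)" if x: "x \<in> S - {x0}" for x
    proof -
      obtain l where l: "(\<lambda>n. poly (p n) x) \<longlonglongrightarrow> l" using Suc.prems(3)[of x] x by (auto simp: convergent_def)
      have "(\<lambda>n. (poly (p n) x - poly (p n) x0) / (x - x0)) \<longlonglongrightarrow> (l - L) / (x - x0)"
        using x by (intro tendsto_intros l L) auto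
      moreover have "(poly (p n) x - poly (p n) x0) / (x - x0) = poly (synthetic_div (p n) x0) x" for n
        using x by (subst (1) eq) auto
      ultimately show ?thesis by (auto simp: convergent_def)
    qed
  qed
  then obtain q where q: "degree q \<le> k" "\<And>x. x \<in> S - {x0} \<Longrightarrow> (\<lambda>n. poly (synthetic_div (p n) x0) x) \<longlonglongrightarrow> poly q x"
    by blast
  show ?case
  proof (intro exI[of _ "[:-x0, 1:] * q + [:L:]"] conjI ballI)
    have "degree ([:-x0, 1:] * q) \<le> Suc k" using q(1) by (intro order_trans[OF degree_mult_le]) auto
    then show "degree ([:-x0, 1:] * q + [:L:]) \<le> Suc k" by (intro degree_add_le) auto
    fix x assume x: "x \<in> S"
    show "(\<lambda>n. poly (p n) x) \<longlonglongrightarrow> poly ([:-x0, 1:] * q + [:L:]) x"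
    proof (cases "x = x0")
      case True
      then show ?thesis using L by simp
    next
      case False
      then have "(\<lambda>n. (x - x0) * poly (synthetic_div (p n) x0) x + poly (p n) x0) \<longlonglongrightarrow> (x - x0) * poly q x + L"
        using x by (intro tendsto_intros q L) auto
      then have "(\<lambda>n. poly (p n) x) \<longlonglongrightarrow> (x - x0) * poly q x + L" by (simp only: eq[symmetric])
      then show ?thesis by (simp add: algebra_simps)
    qed
  qed
qed

text \<open>The top derivatives converge in L2, which makes the iterated integrals converge
  pointwise. Hence the polynomial parts converge pointwise too, and their limit is again a
  polynomial of degree below \<open>m\<close>.\<close>

theorem sobolev_complete:
  fixes u :: "nat \<Rightarrow> real \<Rightarrow> real"
  assumes m: "m \<ge> 1" and u: "\<And>n. u n \<in> sobolev m"
    and lim: "\<And>x. x \<in> {0..1} \<Longrightarrow> (\<lambda>n. u n x) \<longlonglongrightarrow> f x"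
    and zero: "\<And>x. x \<notin> {0..1} \<Longrightarrow> f x = 0"
    and cauchy: "\<And>e. e > 0 \<Longrightarrow> \<exists>N. \<forall>i\<ge>N. \<forall>j\<ge>N. L2_norm (\<lambda>s. nderiv m (u i) s - nderiv m (u j) s) < e"
  shows "f \<in> sobolev m" "(\<lambda>n. L2_norm (\<lambda>s. nderiv m (u n) s - nderiv m f s)) \<longlonglongrightarrow> 0"
proof -
  have uL: "nderiv m (u n) \<in> L2" for n by (rule sobolev_nderiv_L2[OF u])
  obtain h where h: "h \<in> L2" "(\<lambda>n. L2_norm (\<lambda>s. nderiv m (u n) s - h s)) \<longlonglongrightarrow> 0"
    using L2_complete[OF uL cauchy] by blast
  have "\<forall>n. \<exists>p::real poly. degree p < m \<and> (\<forall>x\<in>{0..1}. u n x = poly p x + (prim ^^ m) (nderiv m (u n)) x)"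
    using sobolev_rep_nderiv[OF u m] unfolding sobolev_rep_def by blast
  then obtain p :: "nat \<Rightarrow> real poly" where p: "\<And>n. degree (p n) < m"
      "\<And>n x. x \<in> {0..1} \<Longrightarrow> u n x = poly (p n) x + (prim ^^ m) (nderiv m (u n)) x" by metis
  have pl: "(\<lambda>n. (prim ^^ m) (nderiv m (u n)) x) \<longlonglongrightarrow> (prim ^^ m) h x" if x: "x \<in> {0..1}" for x
  proof -
    have "\<bar>(prim ^^ m) (nderiv m (u n)) x - (prim ^^ m) h x\<bar> \<le> L2_norm (\<lambda>s. nderiv m (u n) s - h s)" for n
    proof -
      have "(prim ^^ m) (nderiv m (u n)) x - (prim ^^ m) h x = (prim ^^ m) (\<lambda>s. nderiv m (u n) s - h s) x"
        using prim_power_lincomb[OF L2_integrable[OF uL[of n]] L2_integrable[OF h(1)], of m 1 "-1" x] by simp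
      also have "\<bar>\<dots>\<bar> \<le> (\<integral>s. \<bar>nderiv m (u n) s - h s\<bar> \<partial>unit_leb)"
        by (rule abs_prim_power_le) (use x m in \<open>auto intro!: L2_integrable[OF L2_diff[OF uL h(1)]]\<close>)
      also have "\<dots> \<le> L2_norm (\<lambda>s. nderiv m (u n) s - h s)"
        by (rule integral_abs_le_L2_norm[OF L2_diff[OF uL h(1)]])
      finally show ?thesis .
    qed
    then have "(\<lambda>n. (prim ^^ m) (nderiv m (u n)) x - (prim ^^ m) h x) \<longlonglongrightarrow> 0"
      by (intro Lim_null_comparison[OF _ h(2)]) auto
    then show ?thesis by (simp add: LIM_zero_iff)
  qed
  have pc: "(\<lambda>n. poly (p n) x) \<longlonglongrightarrow> f x - (prim ^^ m) h x" if x: "x \<in> {0..1}" for x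
    using tendsto_diff[OF lim[OF x] pl[OF x]] p(2)[OF x] by simp
  have "\<exists>q. degree q \<le> m - 1 \<and> (\<forall>x\<in>{0..1}. (\<lambda>n. poly (p n) x) \<longlonglongrightarrow> poly q x)"
    by (rule poly_pointwise_limit)
       (use p(1) pc m in \<open>auto simp: convergent_def infinite_Icc intro: Nat.less_Suc_eq_le[THEN iffD1]\<close>)
  then obtain q where q: "degree q \<le> m - 1" "\<And>x. x \<in> {0..1} \<Longrightarrow> (\<lambda>n. poly (p n) x) \<longlonglongrightarrow> poly q x" by blast
  have "f x = poly q x + (prim ^^ m) h x" if x: "x \<in> {0..1}" for x
    using LIMSEQ_unique[OF pc[OF x] q(2)[OF x]] by simp
  then have rep: "sobolev_rep m f h" unfolding sobolev_rep_def using h(1) q(1) m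
    by (intro conjI exI[of _ q]) auto
  show fs: "f \<in> sobolev m" using sobolev_rep_mem[OF rep m zero] by blast
  have ae: "AE s in unit_leb. nderiv m f s = h s" using sobolev_rep_mem[OF rep m zero] by blast
  have "L2_norm (\<lambda>s. nderiv m (u n) s - nderiv m f s) = L2_norm (\<lambda>s. nderiv m (u n) s - h s)" for n
    by (rule L2_norm_cong_AE)
       (use L2_diff[OF uL[of n] h(1)] L2_diff[OF uL[of n] sobolev_nderiv_L2[OF fs]] ae in \<open>auto simp: L2_def\<close>)
  then show "(\<lambda>n. L2_norm (\<lambda>s. nderiv m (u n) s - nderiv m f s)) \<longlonglongrightarrow> 0" using h(2) by simp
qed

section \<open>The covariance form\<close>

lemma L2_norm_le_sup:
  assumes f: "f \<in> L2" and B: "\<And>s. s \<in> {0..1} \<Longrightarrow> \<bar>f s\<bar> \<le> B" and "0 \<le> B"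
  shows "L2_norm f \<le> B"
proof -
  have "L2_inner f f \<le> (\<integral>s. B\<^sup>2 \<partial>unit_leb)"
    unfolding L2_inner_eq_square
  proof (rule integral_mono)
    fix s assume "s \<in> space unit_leb"
    then have "\<bar>f s\<bar> \<le> \<bar>B\<bar>" using B[of s] by simp
    then show "(f s)\<^sup>2 \<le> B\<^sup>2" by (simp only: abs_le_square_iff)
  qed (use f in \<open>auto simp: L2_def\<close>)
  also have "\<dots> = B\<^sup>2" using unit_leb.prob_space by simp
  finally show ?thesis unfolding L2_norm_def using assms(3) by (intro real_le_lsqrt) auto
qed

lemma continuous_AE_zero:
  assumes f: "continuous_on {0..1} (f :: real \<Rightarrow> real)" and ae: "AE s in unit_leb. f s = 0" and x: "x \<in> {0..1}"
  shows "f x = 0"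
proof (rule ccontr)
  assume nz: "f x \<noteq> 0"
  obtain d where d: "d > 0" "\<And>y. y \<in> {0..1} \<Longrightarrow> dist y x < d \<Longrightarrow> dist (f y) (f x) < \<bar>f x\<bar>"
    using f x nz unfolding continuous_on_iff by (metis zero_less_abs_iff)
  have ny: "f y \<noteq> 0" if "y \<in> {0..1}" "dist y x < d" for y
    using d(2)[OF that] by (auto simp: dist_real_def)
  define l where "l = max 0 (x - d)" define u where "u = min 1 (x + d)"
  have lu: "l < u" using x d by (auto simp: l_def u_def)
  have "AE s in lborel. s \<in> {0..1} \<longrightarrow> f s = 0"
    using ae by (subst (asm) AE_restrict_space_iff) auto
  then have "AE s in lborel. s \<notin> {l<..<u}"
    by eventually_elim (use ny in \<open>auto simp: l_def u_def dist_real_def\<close>)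
  then have "emeasure lborel {l<..<u} = 0"
    by (subst (asm) AE_iff_null_sets[symmetric]) (auto simp: null_sets_def)
  then show False using lu by simp
qed

locale functional_regression =
  fixes M :: "'w measure" and X :: "int \<Rightarrow> 'w \<Rightarrow> real \<Rightarrow> real" and \<epsilon> :: "int \<Rightarrow> 'w \<Rightarrow> real"
  assumes model: "regression_model M X \<epsilon>"
begin

sublocale prob_space M
  using model by (simp add: regression_model_def)

sublocale P: pair_sigma_finite M unit_leb ..

lemma X_measurable[measurable]: "(\<lambda>(\<omega>, s). X i \<omega> s) \<in> borel_measurable (M \<Otimes>\<^sub>M unit_leb)"
  using model by (simp add: regression_model_def)

lemma X_L2: "\<omega> \<in> space M \<Longrightarrow> X i \<omega> \<in> L2"
  using model by (simp add: regression_model_def)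

lemma X_norm_sq_integrable: "integrable M (\<lambda>\<omega>. (L2_norm (X i \<omega>))\<^sup>2)"
  using model by (simp add: regression_model_def)

lemma X_sq_integrable: "s \<in> {0..1} \<Longrightarrow> integrable M (\<lambda>\<omega>. (X i \<omega> s)\<^sup>2)"
  and X_mean: "s \<in> {0..1} \<Longrightarrow> (\<integral>\<omega>. X i \<omega> s \<partial>M) = 0"
  using model by (auto simp: regression_model_def)

lemma X_at_measurable: "s \<in> {0..1} \<Longrightarrow> (\<lambda>\<omega>. X i \<omega> s) \<in> borel_measurable M"
  using measurable_compose[OF measurable_Pair2'[of s unit_leb M] X_measurable] by simp

lemma X_inner_measurable:
  assumes "b \<in> L2"
  shows "(\<lambda>\<omega>. L2_inner (X i \<omega>) b) \<in> borel_measurable M"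
proof -
  have [measurable]: "b \<in> borel_measurable unit_leb" using assms by (simp add: L2_def)
  have "(\<lambda>(\<omega>, s). X i \<omega> s * b s) \<in> borel_measurable (M \<Otimes>\<^sub>M unit_leb)"
    unfolding split_beta' by measurable
  then show ?thesis unfolding L2_inner_def by (rule unit_leb.borel_measurable_lebesgue_integral)
qed

lemma X_norm_diff_measurable:
  assumes "b \<in> L2"
  shows "(\<lambda>\<omega>. L2_norm (\<lambda>s. X i \<omega> s - b s)) \<in> borel_measurable M"
proof -
  have [measurable]: "b \<in> borel_measurable unit_leb" using assms by (simp add: L2_def)
  have "(\<lambda>(\<omega>, s). (X i \<omega> s - b s) * (X i \<omega> s - b s)) \<in> borel_measurable (M \<Otimes>\<^sub>M unit_leb)"
    unfolding split_beta' by measurable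
  then have "(\<lambda>\<omega>. \<integral>s. (X i \<omega> s - b s) * (X i \<omega> s - b s) \<partial>unit_leb) \<in> borel_measurable M"
    by (rule unit_leb.borel_measurable_lebesgue_integral)
  then show ?thesis unfolding L2_norm_def L2_inner_def by measurable
qed

lemma X_norm_measurable: "(\<lambda>\<omega>. L2_norm (X i \<omega>)) \<in> borel_measurable M"
  using X_norm_diff_measurable[of "\<lambda>_. 0" i] by (simp add: continuous_on_L2)

lemma X_inner_le: "\<omega> \<in> space M \<Longrightarrow> b \<in> L2 \<Longrightarrow> \<bar>L2_inner (X i \<omega>) b\<bar> \<le> L2_norm (X i \<omega>) * L2_norm b"
  by (rule L2_inner_Cauchy_Schwarz[OF X_L2])

lemma X_inner_mult_integrable:
  assumes "b1 \<in> L2" "b2 \<in> L2"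
  shows "integrable M (\<lambda>\<omega>. L2_inner (X i \<omega>) b1 * L2_inner (X i \<omega>) b2)"
proof (rule Bochner_Integration.integrable_bound)
  show "integrable M (\<lambda>\<omega>. (L2_norm (X i \<omega>))\<^sup>2 * (L2_norm b1 * L2_norm b2))"
    by (intro integrable_mult_left X_norm_sq_integrable)
  show "AE \<omega> in M. norm (L2_inner (X i \<omega>) b1 * L2_inner (X i \<omega>) b2) \<le> norm ((L2_norm (X i \<omega>))\<^sup>2 * (L2_norm b1 * L2_norm b2))"
  proof (intro AE_I2)
    fix \<omega> assume w: "\<omega> \<in> space M"
    have "\<bar>L2_inner (X i \<omega>) b1\<bar> * \<bar>L2_inner (X i \<omega>) b2\<bar> \<le> (L2_norm (X i \<omega>) * L2_norm b1) * (L2_norm (X i \<omega>) * L2_norm b2)"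
      by (intro mult_mono X_inner_le w assms) (auto simp: L2_norm_nonneg)
    then show "norm (L2_inner (X i \<omega>) b1 * L2_inner (X i \<omega>) b2) \<le> norm ((L2_norm (X i \<omega>))\<^sup>2 * (L2_norm b1 * L2_norm b2))"
      by (simp add: abs_mult L2_norm_nonneg power2_eq_square mult_ac)
  qed
qed (use X_inner_measurable assms in measurable)

lemma C_X_eq:
  assumes "s \<in> {0..1}" "t \<in> {0..1}"
  shows "C_X M X s t = (\<integral>\<omega>. X 1 \<omega> s * X 1 \<omega> t \<partial>M)"
  using assms by (simp add: C_X_def covariance_def X_mean)

lemma C_X_commute: "C_X M X s t = C_X M X t s"
  by (simp add: C_X_def covariance_def mult.commute)

lemma X_at_inner:
  assumes s: "s \<in> {0..1}" and b: "b \<in> L2"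
  shows "(\<integral>t. C_X M X s t * b t \<partial>unit_leb) = (\<integral>\<omega>. X 1 \<omega> s * L2_inner (X 1 \<omega>) b \<partial>M)"
proof -
  have [measurable]: "b \<in> borel_measurable unit_leb" using b by (simp add: L2_def)
  note [measurable] = X_at_measurable[OF s]
  let ?f = "\<lambda>(\<omega>, t). X 1 \<omega> s * (X 1 \<omega> t * b t)"
  have fm: "?f \<in> borel_measurable (M \<Otimes>\<^sub>M unit_leb)" unfolding split_beta' by measurable
  have int: "integrable (M \<Otimes>\<^sub>M unit_leb) ?f"
  proof (rule P.Fubini_integrable[OF fm])
    have a: "(\<integral>t. norm (?f (\<omega>, t)) \<partial>unit_leb) = \<bar>X 1 \<omega> s\<bar> * L2_inner (\<lambda>t. \<bar>X 1 \<omega> t\<bar>) (\<lambda>t. \<bar>b t\<bar>)" for \<omega>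
      by (simp add: abs_mult L2_inner_def)
    have m: "(\<lambda>\<omega>. \<integral>t. norm (?f (\<omega>, t)) \<partial>unit_leb) \<in> borel_measurable M"
      using fm by (intro unit_leb.borel_measurable_lebesgue_integral) simp
    show "integrable M (\<lambda>\<omega>. \<integral>t. norm (?f (\<omega>, t)) \<partial>unit_leb)"
    proof (rule Bochner_Integration.integrable_bound[OF _ m])
      show "integrable M (\<lambda>\<omega>. (X 1 \<omega> s)\<^sup>2 + (L2_norm (X 1 \<omega>))\<^sup>2 * (L2_norm b)\<^sup>2)"
        by (intro Bochner_Integration.integrable_add integrable_mult_left X_norm_sq_integrable X_sq_integrable s)
      show "AE \<omega> in M. norm (\<integral>t. norm (?f (\<omega>, t)) \<partial>unit_leb) \<le> norm ((X 1 \<omega> s)\<^sup>2 + (L2_norm (X 1 \<omega>))\<^sup>2 * (L2_norm b)\<^sup>2)"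
      proof (intro AE_I2)
        fix \<omega> assume w: "\<omega> \<in> space M"
        have L: "(\<lambda>t. \<bar>X 1 \<omega> t\<bar>) \<in> L2" "(\<lambda>t. \<bar>b t\<bar>) \<in> L2" using X_L2[OF w, of 1] b by (auto simp: L2_def)
        have e: "L2_norm (\<lambda>t. \<bar>X 1 \<omega> t\<bar>) = L2_norm (X 1 \<omega>)" "L2_norm (\<lambda>t. \<bar>b t\<bar>) = L2_norm b"
          by (simp_all add: L2_norm_def L2_inner_def)
        have nn: "0 \<le> L2_inner (\<lambda>t. \<bar>X 1 \<omega> t\<bar>) (\<lambda>t. \<bar>b t\<bar>)" unfolding L2_inner_def by (rule integral_nonneg_AE) auto
        let ?u = "\<bar>X 1 \<omega> s\<bar>" and ?v = "L2_norm (X 1 \<omega>) * L2_norm b"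
        have "\<bar>X 1 \<omega> s\<bar> * L2_inner (\<lambda>t. \<bar>X 1 \<omega> t\<bar>) (\<lambda>t. \<bar>b t\<bar>) \<le> ?u * ?v"
          using L2_inner_Cauchy_Schwarz[OF L] unfolding e by (intro mult_left_mono) auto
        also have "\<dots> \<le> ?u\<^sup>2 + ?v\<^sup>2"
        proof -
          have "0 \<le> ?u * ?v" by (simp add: L2_norm_nonneg)
          then show ?thesis using sum_squares_bound[of ?u ?v] by linarith
        qed
        finally show "norm (\<integral>t. norm (?f (\<omega>, t)) \<partial>unit_leb) \<le> norm ((X 1 \<omega> s)\<^sup>2 + (L2_norm (X 1 \<omega>))\<^sup>2 * (L2_norm b)\<^sup>2)"
          unfolding a using nn by (simp add: power_mult_distrib)
      qed
    qed
    show "AE \<omega> in M. integrable unit_leb (\<lambda>t. ?f (\<omega>, t))"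
      by (intro AE_I2) (auto intro!: integrable_mult_right L2_mult_integrable X_L2 b)
  qed
  have "(\<integral>t. C_X M X s t * b t \<partial>unit_leb) = (\<integral>t. (\<integral>\<omega>. ?f (\<omega>, t) \<partial>M) \<partial>unit_leb)"
  proof (rule Bochner_Integration.integral_cong[OF refl])
    fix t assume "t \<in> space unit_leb"
    then have "C_X M X s t * b t = (\<integral>\<omega>. X 1 \<omega> s * X 1 \<omega> t * b t \<partial>M)"
      using C_X_eq[OF s, of t] by simp
    then show "C_X M X s t * b t = (\<integral>\<omega>. ?f (\<omega>, t) \<partial>M)" by (simp add: mult.assoc)
  qed
  also have "\<dots> = (\<integral>\<omega>. (\<integral>t. ?f (\<omega>, t) \<partial>unit_leb) \<partial>M)"
    using P.Fubini_integral[of "\<lambda>\<omega> t. ?f (\<omega>, t)"] int by simp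
  also have "\<dots> = (\<integral>\<omega>. X 1 \<omega> s * L2_inner (X 1 \<omega>) b \<partial>M)"
    by (simp add: L2_inner_def)
  finally show ?thesis .
qed

text \<open>Turns the iterated kernel integral into a second moment of scores, from which
  bilinearity, symmetry and positivity are read off. Fubini is applied one variable at a time;
  \<open>X_at_inner\<close> is the inner integral.\<close>

lemma V_form_eq:
  assumes b1: "b1 \<in> L2" and b2: "b2 \<in> L2"
  shows "V_form M X b1 b2 = (\<integral>\<omega>. L2_inner (X 1 \<omega>) b1 * L2_inner (X 1 \<omega>) b2 \<partial>M)"
proof -
  have [measurable]: "b1 \<in> borel_measurable unit_leb" "b2 \<in> borel_measurable unit_leb"
    using b1 b2 by (auto simp: L2_def)
  note [measurable] = X_inner_measurable[OF b2]
  let ?f = "\<lambda>(\<omega>, s). X 1 \<omega> s * b1 s * L2_inner (X 1 \<omega>) b2"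
  have fm: "?f \<in> borel_measurable (M \<Otimes>\<^sub>M unit_leb)" unfolding split_beta' by measurable
  have int: "integrable (M \<Otimes>\<^sub>M unit_leb) ?f"
  proof (rule P.Fubini_integrable[OF fm])
    have a: "(\<integral>t. norm (?f (\<omega>, t)) \<partial>unit_leb) = L2_inner (\<lambda>t. \<bar>X 1 \<omega> t\<bar>) (\<lambda>t. \<bar>b1 t\<bar>) * \<bar>L2_inner (X 1 \<omega>) b2\<bar>" for \<omega>
      by (simp add: abs_mult L2_inner_def)
    have m: "(\<lambda>\<omega>. \<integral>t. norm (?f (\<omega>, t)) \<partial>unit_leb) \<in> borel_measurable M"
      using fm by (intro unit_leb.borel_measurable_lebesgue_integral) simp
    show "integrable M (\<lambda>\<omega>. \<integral>t. norm (?f (\<omega>, t)) \<partial>unit_leb)"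
    proof (rule Bochner_Integration.integrable_bound[OF _ m])
      show "integrable M (\<lambda>\<omega>. (L2_norm (X 1 \<omega>))\<^sup>2 * (L2_norm b1 * L2_norm b2))"
        by (intro integrable_mult_left X_norm_sq_integrable)
      show "AE \<omega> in M. norm (\<integral>t. norm (?f (\<omega>, t)) \<partial>unit_leb) \<le> norm ((L2_norm (X 1 \<omega>))\<^sup>2 * (L2_norm b1 * L2_norm b2))"
      proof (intro AE_I2)
        fix \<omega> assume w: "\<omega> \<in> space M"
        have L: "(\<lambda>t. \<bar>X 1 \<omega> t\<bar>) \<in> L2" "(\<lambda>t. \<bar>b1 t\<bar>) \<in> L2" using X_L2[OF w, of 1] b1 by (auto simp: L2_def)
        have e: "L2_norm (\<lambda>t. \<bar>X 1 \<omega> t\<bar>) = L2_norm (X 1 \<omega>)" "L2_norm (\<lambda>t. \<bar>b1 t\<bar>) = L2_norm b1"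
          by (simp_all add: L2_norm_def L2_inner_def)
        have nn: "0 \<le> L2_inner (\<lambda>t. \<bar>X 1 \<omega> t\<bar>) (\<lambda>t. \<bar>b1 t\<bar>)" unfolding L2_inner_def by (rule integral_nonneg_AE) auto
        have "L2_inner (\<lambda>t. \<bar>X 1 \<omega> t\<bar>) (\<lambda>t. \<bar>b1 t\<bar>) * \<bar>L2_inner (X 1 \<omega>) b2\<bar> \<le> (L2_norm (X 1 \<omega>) * L2_norm b1) * (L2_norm (X 1 \<omega>) * L2_norm b2)"
          using L2_inner_Cauchy_Schwarz[OF L] unfolding e
          by (intro mult_mono X_inner_le w b2) (auto simp: L2_norm_nonneg)
        then show "norm (\<integral>t. norm (?f (\<omega>, t)) \<partial>unit_leb) \<le> norm ((L2_norm (X 1 \<omega>))\<^sup>2 * (L2_norm b1 * L2_norm b2))"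
          unfolding a using nn by (simp add: power2_eq_square L2_norm_nonneg mult_ac)
      qed
    qed
    show "AE \<omega> in M. integrable unit_leb (\<lambda>t. ?f (\<omega>, t))"
      by (intro AE_I2) (auto intro!: integrable_mult_left L2_mult_integrable X_L2 b1)
  qed
  have "V_form M X b1 b2 = (\<integral>s. (\<integral>\<omega>. ?f (\<omega>, s) \<partial>M) \<partial>unit_leb)"
    unfolding V_form_def
  proof (rule Bochner_Integration.integral_cong[OF refl])
    fix s assume "s \<in> space unit_leb"
    then have s: "s \<in> {0..1}" by simp
    have "(\<integral>t. C_X M X s t * b1 s * b2 t \<partial>unit_leb) = b1 s * (\<integral>t. C_X M X s t * b2 t \<partial>unit_leb)"
      by (subst integral_mult_right_zero[symmetric]) (simp add: mult_ac)
    also have "\<dots> = b1 s * (\<integral>\<omega>. X 1 \<omega> s * L2_inner (X 1 \<omega>) b2 \<partial>M)"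
      using X_at_inner[OF s b2] by simp
    also have "\<dots> = (\<integral>\<omega>. ?f (\<omega>, s) \<partial>M)"
      by (subst integral_mult_right_zero[symmetric]) (simp add: mult_ac)
    finally show "(\<integral>t. C_X M X s t * b1 s * b2 t \<partial>unit_leb) = (\<integral>\<omega>. ?f (\<omega>, s) \<partial>M)" .
  qed
  also have "\<dots> = (\<integral>\<omega>. (\<integral>s. ?f (\<omega>, s) \<partial>unit_leb) \<partial>M)"
    using P.Fubini_integral[of "\<lambda>\<omega> t. ?f (\<omega>, t)"] int by simp
  also have "\<dots> = (\<integral>\<omega>. L2_inner (X 1 \<omega>) b1 * L2_inner (X 1 \<omega>) b2 \<partial>M)"
    by (simp add: L2_inner_def)
  finally show ?thesis .
qed

lemma V_form_commute: "b1 \<in> L2 \<Longrightarrow> b2 \<in> L2 \<Longrightarrow> V_form M X b1 b2 = V_form M X b2 b1"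
  by (simp add: V_form_eq mult.commute)

lemma V_form_nonneg: "b \<in> L2 \<Longrightarrow> 0 \<le> V_form M X b b"
  by (simp add: V_form_eq)

lemma X_inner_lincomb:
  assumes "\<omega> \<in> space M" "f \<in> L2" "g \<in> L2"
  shows "L2_inner (X i \<omega>) (\<lambda>s. c * f s + d * g s) = c * L2_inner (X i \<omega>) f + d * L2_inner (X i \<omega>) g"
  using L2_inner_lincomb[OF assms(2,3) X_L2[OF assms(1)], of c d i] by (simp add: L2_inner_commute)

lemma V_form_lincomb:
  assumes "f \<in> L2" "g \<in> L2" "h \<in> L2"
  shows "V_form M X (\<lambda>s. c * f s + d * g s) h = c * V_form M X f h + d * V_form M X g h"
proof -
  have "V_form M X (\<lambda>s. c * f s + d * g s) h
      = (\<integral>\<omega>. c * (L2_inner (X 1 \<omega>) f * L2_inner (X 1 \<omega>) h) + d * (L2_inner (X 1 \<omega>) g * L2_inner (X 1 \<omega>) h) \<partial>M)"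
    unfolding V_form_eq[OF L2_lincomb[OF assms(1,2)] assms(3)]
    by (rule Bochner_Integration.integral_cong) (auto simp: X_inner_lincomb assms algebra_simps)
  also have "\<dots> = c * V_form M X f h + d * V_form M X g h"
    unfolding V_form_eq[OF assms(1,3)] V_form_eq[OF assms(2,3)]
    by (subst Bochner_Integration.integral_add)
       (auto intro!: integrable_mult_right X_inner_mult_integrable assms)
  finally show ?thesis .
qed

lemma V_form_le_norm:
  assumes "b \<in> L2"
  shows "V_form M X b b \<le> (\<integral>\<omega>. (L2_norm (X 1 \<omega>))\<^sup>2 \<partial>M) * (L2_norm b)\<^sup>2"
proof -
  have "V_form M X b b \<le> (\<integral>\<omega>. (L2_norm (X 1 \<omega>))\<^sup>2 * (L2_norm b)\<^sup>2 \<partial>M)"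
    unfolding V_form_eq[OF assms assms]
  proof (rule integral_mono)
    fix \<omega> assume w: "\<omega> \<in> space M"
    have "\<bar>L2_inner (X 1 \<omega>) b\<bar> * \<bar>L2_inner (X 1 \<omega>) b\<bar> \<le> (L2_norm (X 1 \<omega>) * L2_norm b) * (L2_norm (X 1 \<omega>) * L2_norm b)"
      by (intro mult_mono X_inner_le w assms) (auto simp: L2_norm_nonneg)
    then show "L2_inner (X 1 \<omega>) b * L2_inner (X 1 \<omega>) b \<le> (L2_norm (X 1 \<omega>))\<^sup>2 * (L2_norm b)\<^sup>2"
      by (simp add: power2_eq_square mult_ac)
  qed (intro X_inner_mult_integrable assms integrable_mult_left X_norm_sq_integrable)+
  then show ?thesis by simp
qed

text \<open>A vanishing second moment forces the score \<open>L2_inner (X 1 \<omega>) b\<close> to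
  vanish almost surely, so \<open>b\<close> lies in the kernel of the covariance operator, which
  \<open>A1\<close> makes trivial.\<close>

lemma V_form_zero:
  assumes A1: "A1 M X" and b: "b \<in> L2" and z: "V_form M X b b = 0"
  shows "AE s in unit_leb. b s = 0"
proof -
  have "AE \<omega> in M. L2_inner (X 1 \<omega>) b * L2_inner (X 1 \<omega>) b = 0"
    using z X_inner_mult_integrable[OF b b] unfolding V_form_eq[OF b b]
    by (subst (asm) integral_nonneg_eq_0_iff_AE) auto
  then have ae: "AE \<omega> in M. L2_inner (X 1 \<omega>) b = 0" by eventually_elim simp
  have "(\<integral>s. C_X M X s t * b s \<partial>unit_leb) = 0" if t: "t \<in> {0..1}" for t
  proof -
    have "(\<integral>s. C_X M X s t * b s \<partial>unit_leb) = (\<integral>s. C_X M X t s * b s \<partial>unit_leb)"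
      by (simp add: C_X_commute[of _ t])
    also have "\<dots> = (\<integral>\<omega>. X 1 \<omega> t * L2_inner (X 1 \<omega>) b \<partial>M)" by (rule X_at_inner[OF t b])
    also have "\<dots> = 0" by (rule integral_eq_zero_AE) (use ae in eventually_elim, auto)
    finally show ?thesis .
  qed
  then show ?thesis using A1 b unfolding A1_def by blast
qed

end

section \<open>The regularized inner product\<close>

lemma powr_le_one_add:
  fixes x \<theta> :: real
  assumes "x > 0" "0 \<le> \<theta>" "\<theta> \<le> 1"
  shows "x powr \<theta> \<le> 1 + x"
proof (cases "x \<le> 1")
  case True
  then have "x powr \<theta> \<le> 1" using assms by (intro powr_le1) auto
  then show ?thesis using assms by simp
next
  case False
  then have "x powr \<theta> \<le> x powr 1" using assms by (intro powr_mono) auto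
  then show ?thesis using assms by simp
qed

lemma mult_le_weighted_squares:
  fixes x y q :: real
  assumes "q > 0"
  shows "\<bar>x\<bar> * \<bar>y\<bar> \<le> x\<^sup>2 * q + y\<^sup>2 / q"
proof -
  have "2 * ((q * \<bar>x\<bar>) * \<bar>y\<bar>) \<le> (q * \<bar>x\<bar>)\<^sup>2 + \<bar>y\<bar>\<^sup>2"
    using sum_squares_bound[of "q * \<bar>x\<bar>" "\<bar>y\<bar>"] by simp
  moreover have "0 \<le> (q * \<bar>x\<bar>) * \<bar>y\<bar>" using assms by simp
  moreover have "q * (x\<^sup>2 * q + y\<^sup>2 / q) = (q * \<bar>x\<bar>)\<^sup>2 + \<bar>y\<bar>\<^sup>2"
    using assms by (simp add: field_simps power2_eq_square)
  moreover have "q * (\<bar>x\<bar> * \<bar>y\<bar>) = (q * \<bar>x\<bar>) * \<bar>y\<bar>" by simp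
  ultimately have "q * (\<bar>x\<bar> * \<bar>y\<bar>) \<le> q * (x\<^sup>2 * q + y\<^sup>2 / q)" by linarith
  then show ?thesis using assms by simp
qed

text \<open>With \<open>x\<close> of order \<open>l * k powr (2 * D)\<close> this trades powers of
  \<open>l\<close> for decay in \<open>k\<close>: a larger \<open>\<theta>\<close> gives more
  summability and a worse factor \<open>l powr (- \<theta>)\<close>. The exponents
  \<open>\<theta>\<close> and \<open>\<theta>'\<close> of the final argument are such
  choices.\<close>

lemma inverse_one_add_le:
  fixes x \<theta> :: real
  assumes "x > 0" "0 \<le> \<theta>" "\<theta> \<le> 1"
  shows "1 / (1 + x) \<le> 1 / (x powr \<theta>)"
  using powr_le_one_add[OF assms] assms by (intro divide_left_mono) auto

locale regularized_regression = functional_regression M X \<epsilon>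
  for M :: "'w measure" and X :: "int \<Rightarrow> 'w \<Rightarrow> real \<Rightarrow> real" and \<epsilon> :: "int \<Rightarrow> 'w \<Rightarrow> real" +
  fixes m :: nat and \<phi> :: "nat \<Rightarrow> real \<Rightarrow> real" and \<rho> :: "nat \<Rightarrow> real" and a D :: real
  assumes m: "m \<ge> 1" and A1: "A1 M X" and A2: "A2 M X m \<phi> \<rho> a D"
begin

abbreviation "H \<equiv> sobolev m"
abbreviation "V \<equiv> V_form M X"
abbreviation "J \<equiv> J_form m"
abbreviation "K \<equiv> K_inner M X m"
abbreviation "Kn \<equiv> K_norm M X m"

text \<open>The eigensystem is re-indexed from \<open>0\<close>, so that partial sums run over \<open>{..<N}\<close>.\<close>

definition ev :: "nat \<Rightarrow> real \<Rightarrow> real" where "ev k = \<phi> (Suc k)"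
definition er :: "nat \<Rightarrow> real" where "er k = \<rho> (Suc k)"
definition wt :: "real \<Rightarrow> nat \<Rightarrow> real" where "wt l k = 1 / (1 + l * er k)"
definition csup :: real where "csup = (SOME c. c > 0 \<and> (\<forall>k\<ge>1. \<forall>s\<in>{0..1}. \<bar>\<phi> k s\<bar> \<le> c * real k powr a))"

lemma a_nonneg: "a \<ge> 0" and D_gt: "D > a + 1/2"
  using A2 by (auto simp: A2_def)

lemma ev_H: "ev k \<in> H"
  using A2 by (auto simp: A2_def ev_def)

lemma csup: "csup > 0" "s \<in> {0..1} \<Longrightarrow> \<bar>ev k s\<bar> \<le> csup * real (Suc k) powr a"
proof -
  have ex: "\<exists>c. c > 0 \<and> (\<forall>k\<ge>1. \<forall>s\<in>{0..1}. \<bar>\<phi> k s\<bar> \<le> c * real k powr a)"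
    using A2 by (auto simp: A2_def)
  note c = someI_ex[OF ex, folded csup_def]
  show "csup > 0" using c by blast
  show "\<bar>ev k s\<bar> \<le> csup * real (Suc k) powr a" if "s \<in> {0..1}"
    using conjunct2[OF c, rule_format, of "Suc k" s] that by (simp add: ev_def)
qed

lemma V_ev: "V (ev k) (ev j) = (if k = j then 1 else 0)"
  and J_ev: "J (ev k) (ev j) = (if k = j then er k else 0)"
  using A2 by (auto simp: A2_def ev_def er_def)

lemma er_nonneg: "er k \<ge> 0"
  using J_form_nonneg[of m "ev k"] by (simp add: J_ev)

lemma q_pos: "l > 0 \<Longrightarrow> 1 + l * er k > 0"
  using er_nonneg[of k] by (simp add: add_pos_nonneg)

lemma wt_pos: "l > 0 \<Longrightarrow> wt l k > 0"
  using q_pos by (simp add: wt_def)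

lemma wt_le_1: "l > 0 \<Longrightarrow> wt l k \<le> 1"
  using er_nonneg[of k] q_pos[of l k] by (simp add: wt_def)

section \<open>Spectral weights and their sums\<close>

lemma er_lower: "\<exists>c>0. \<exists>k0. \<forall>k\<ge>k0. c * real (Suc k) powr (2 * D) \<le> er k"
proof -
  have "\<rho> \<in> \<Omega>(\<lambda>k. real k powr (2 * D))" using A2 by (auto simp: A2_def bigtheta_def)
  then obtain c where c: "c > 0" "\<forall>\<^sub>F k in sequentially. norm (\<rho> k) \<ge> c * norm (real k powr (2 * D))"
    by (auto simp: bigomega_def)
  then obtain k0 where k0: "\<And>k. k \<ge> k0 \<Longrightarrow> norm (\<rho> k) \<ge> c * norm (real k powr (2 * D))"
    by (auto simp: eventually_sequentially)
  have "c * real (Suc k) powr (2 * D) \<le> er k" if "k \<ge> k0" for k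
    using k0[of "Suc k"] that er_nonneg[of k] by (simp add: er_def)
  with c(1) show ?thesis by blast
qed

text \<open>The condition on \<open>p\<close> says that \<open>p - 2 * D * \<theta>\<close> is below
  -1. For the finitely many \<open>k\<close> before the lower bound on \<open>er k\<close> sets in,
  where \<open>er k\<close> may be zero, the bound \<open>wt l k \<le> 1\<close> has to do; this
  explains the \<open>max 1\<close>.\<close>

lemma weighted_sum_bound:
  assumes \<theta>: "0 \<le> \<theta>" "\<theta> \<le> 1" and p: "p + 1 < 2 * D * \<theta>"
  obtains G where "summable G" "\<And>k. 0 \<le> G k"
    "\<And>l k. l > 0 \<Longrightarrow> real (Suc k) powr p * wt l k \<le> max 1 (l powr (- \<theta>)) * G k"
proof -
  obtain c k0 where c: "c > 0" "\<And>k. k \<ge> k0 \<Longrightarrow> c * real (Suc k) powr (2 * D) \<le> er k"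
    using er_lower by blast
  define G where "G = (\<lambda>k. if k < k0 then real (Suc k) powr p else c powr (- \<theta>) * real (Suc k) powr (p - 2 * D * \<theta>))"
  have "summable (\<lambda>k. real k powr (p - 2 * D * \<theta>))"
    using p by (subst summable_real_powr_iff) auto
  then have "summable (\<lambda>k. c powr (- \<theta>) * real (Suc k) powr (p - 2 * D * \<theta>))"
    by (intro summable_mult) (subst summable_Suc_iff[of "\<lambda>k. real k powr (p - 2 * D * \<theta>)"])
  then have "summable G"
    by (rule summable_cong[THEN iffD1, rotated])
       (auto simp: G_def eventually_sequentially intro!: exI[of _ k0])
  moreover have G0: "0 \<le> G k" for k by (simp add: G_def)
  moreover have "real (Suc k) powr p * wt l k \<le> max 1 (l powr (- \<theta>)) * G k" if l: "l > 0" for l k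
  proof (cases "k < k0")
    case True
    have "real (Suc k) powr p * wt l k \<le> real (Suc k) powr p * 1"
      by (intro mult_left_mono wt_le_1 l) auto
    also have "\<dots> = 1 * G k" using True by (simp add: G_def)
    also have "\<dots> \<le> max 1 (l powr (- \<theta>)) * G k" by (intro mult_right_mono G0) auto
    finally show ?thesis .
  next
    case False
    let ?x = "l * (c * real (Suc k) powr (2 * D))"
    have x: "?x > 0" using l c by simp
    have "wt l k \<le> 1 / (1 + ?x)"
      unfolding wt_def using c(2)[of k] False l x by (intro divide_left_mono) (auto simp: add_pos_nonneg q_pos)
    also have "\<dots> \<le> 1 / (?x powr \<theta>)"
      by (rule inverse_one_add_le[OF x \<theta>])
    also have "\<dots> = l powr (- \<theta>) * (c powr (- \<theta>) * real (Suc k) powr (- 2 * D * \<theta>))"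
      using l c by (simp add: powr_mult powr_powr powr_minus divide_inverse)
    finally have "real (Suc k) powr p * wt l k \<le> real (Suc k) powr p * (l powr (- \<theta>) * (c powr (- \<theta>) * real (Suc k) powr (- 2 * D * \<theta>)))"
      by (rule mult_left_mono) simp
    also have "\<dots> = l powr (- \<theta>) * G k"
      using False by (simp add: G_def powr_add[symmetric] powr_diff powr_minus divide_inverse)
    also have "\<dots> \<le> max 1 (l powr (- \<theta>)) * G k" by (intro mult_right_mono G0) auto
    finally show ?thesis .
  qed
  ultimately show ?thesis by (rule that)
qed

lemma summable_sup_weights:
  assumes l: "l > 0"
  shows "summable (\<lambda>k. real (Suc k) powr (2 * a) * wt l k)"
proof -
  have pre: "2 * a + 1 < 2 * D * 1" using D_gt by simp
  obtain G where G: "summable G" "\<And>k. 0 \<le> G k"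
    "\<And>l k. l > 0 \<Longrightarrow> real (Suc k) powr (2 * a) * wt l k \<le> max 1 (l powr (- 1)) * G k"
    by (rule weighted_sum_bound[OF zero_le_one order_refl pre]; rule that; blast)
  show ?thesis
  proof (rule summable_comparison_test'[where N = 0])
    show "summable (\<lambda>k. max 1 (l powr (- 1)) * G k)" by (intro summable_mult G)
    fix k show "norm (real (Suc k) powr (2 * a) * wt l k) \<le> max 1 (l powr (- 1)) * G k"
      using G(3)[OF l, of k] wt_pos[OF l, of k] by simp
  qed
qed

section \<open>Finite eigenexpansions and bilinear forms on \<open>H\<close>\<close>

definition partial :: "(nat \<Rightarrow> real) \<Rightarrow> nat \<Rightarrow> real \<Rightarrow> real" where
  "partial f N = (\<lambda>s. \<Sum>k<N. f k * ev k s)"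

lemma partial_Suc: "partial f (Suc N) = (\<lambda>s. 1 * partial f N s + f N * ev N s)"
  by (simp add: partial_def)

lemma partial_H: "partial f N \<in> H"
proof (induction N)
  case 0
  then show ?case using zero_sobolev[OF m] by (simp add: partial_def)
next
  case (Suc N)
  then show ?case unfolding partial_Suc by (intro sobolev_lincomb(1) ev_H m)
qed

lemma H_L2: "b \<in> H \<Longrightarrow> b \<in> L2"
  using sobolev_L2 m by blast

lemma H_diff: "f \<in> H \<Longrightarrow> g \<in> H \<Longrightarrow> (\<lambda>s. f s - g s) \<in> H"
  using sobolev_lincomb(1)[of f m g 1 "-1"] m by simp

text \<open>Restricted to \<open>H\<close> because additivity of \<open>nderiv m\<close>, even
  almost everywhere, is available there only.\<close>

definition linear_on_H :: "((real \<Rightarrow> real) \<Rightarrow> real) \<Rightarrow> bool" where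
  "linear_on_H F \<longleftrightarrow> (\<forall>f\<in>H. \<forall>g\<in>H. \<forall>c d. F (\<lambda>s. c * f s + d * g s) = c * F f + d * F g)"

lemma linear_on_HD: "linear_on_H F \<Longrightarrow> f \<in> H \<Longrightarrow> g \<in> H \<Longrightarrow> F (\<lambda>s. c * f s + d * g s) = c * F f + d * F g"
  by (simp add: linear_on_H_def)

lemma linear_diff: "linear_on_H F \<Longrightarrow> f \<in> H \<Longrightarrow> g \<in> H \<Longrightarrow> F (\<lambda>s. f s - g s) = F f - F g"
  using linear_on_HD[of F f g 1 "-1"] by simp

lemma linear_partial:
  assumes "linear_on_H F"
  shows "F (partial f N) = (\<Sum>k<N. f k * F (ev k))"
proof (induction N)
  case 0
  have "F (\<lambda>s. 0 * ev 0 s + 0 * ev 0 s) = 0 * F (ev 0) + 0 * F (ev 0)"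
    by (rule linear_on_HD[OF assms ev_H ev_H])
  then show ?case by (simp add: partial_def)
next
  case (Suc N)
  then show ?case unfolding partial_Suc using linear_on_HD[OF assms partial_H ev_H, of 1 f N "f N" N] by simp
qed

lemma linear_V: "b \<in> H \<Longrightarrow> linear_on_H (\<lambda>f. V f b)"
  unfolding linear_on_H_def by (auto intro!: V_form_lincomb H_L2)

lemma linear_J: "b \<in> H \<Longrightarrow> linear_on_H (\<lambda>f. J f b)"
  unfolding linear_on_H_def using m by (auto intro!: J_form_lincomb)

lemma linear_K: "b \<in> H \<Longrightarrow> linear_on_H (\<lambda>f. K l f b)"
  using linear_V[of b] linear_J[of b] unfolding linear_on_H_def K_inner_def by (simp add: algebra_simps)

lemma V_commute: "f \<in> H \<Longrightarrow> g \<in> H \<Longrightarrow> V f g = V g f"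
  by (simp add: V_form_commute H_L2)

lemma K_commute: "f \<in> H \<Longrightarrow> g \<in> H \<Longrightarrow> K l f g = K l g f"
  by (simp add: K_inner_def V_commute J_form_commute)

lemma V_nonneg: "f \<in> H \<Longrightarrow> 0 \<le> V f f"
  by (simp add: V_form_nonneg H_L2)

lemma K_nonneg: "f \<in> H \<Longrightarrow> l > 0 \<Longrightarrow> 0 \<le> K l f f"
  by (simp add: K_inner_def V_nonneg J_form_nonneg)

lemma Kn_sq: "f \<in> H \<Longrightarrow> l > 0 \<Longrightarrow> (Kn l f)\<^sup>2 = K l f f"
  by (simp add: K_norm_def K_nonneg)

lemma Kn_nonneg: "f \<in> H \<Longrightarrow> l > 0 \<Longrightarrow> 0 \<le> Kn l f"
  by (simp add: K_norm_def K_nonneg)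

lemma form_expand:
  assumes lin: "\<And>b. b \<in> H \<Longrightarrow> linear_on_H (\<lambda>f. B f b)" and sym: "\<And>f g. f \<in> H \<Longrightarrow> g \<in> H \<Longrightarrow> B f g = B g f"
    and f: "f \<in> H" and g: "g \<in> H"
  shows "B (\<lambda>s. c * f s + d * g s) (\<lambda>s. c * f s + d * g s) = c\<^sup>2 * B f f + 2 * c * d * B f g + d\<^sup>2 * B g g"
proof -
  let ?h = "\<lambda>s. c * f s + d * g s"
  have h: "?h \<in> H" by (intro sobolev_lincomb f g m)
  have "B ?h ?h = c * B f ?h + d * B g ?h" by (rule linear_on_HD[OF lin[OF h] f g])
  also have "B f ?h = c * B f f + d * B g f" using linear_on_HD[OF lin[OF f] f g, of c d] sym[OF f h] by simp
  also have "B g ?h = c * B f g + d * B g g" using linear_on_HD[OF lin[OF g] f g, of c d] sym[OF g h] by simp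
  finally show ?thesis using sym[OF f g] by (simp add: power2_eq_square algebra_simps)
qed

text \<open>Stated for semidefinite forms, since \<open>J\<close> vanishes on polynomials of degree
  below \<open>m\<close>; \<open>discriminant_le\<close> covers the degenerate case.\<close>

lemma form_Cauchy_Schwarz:
  assumes lin: "\<And>b. b \<in> H \<Longrightarrow> linear_on_H (\<lambda>f. B f b)" and sym: "\<And>f g. f \<in> H \<Longrightarrow> g \<in> H \<Longrightarrow> B f g = B g f"
    and pos: "\<And>f. f \<in> H \<Longrightarrow> 0 \<le> B f f" and f: "f \<in> H" and g: "g \<in> H"
  shows "\<bar>B f g\<bar> \<le> sqrt (B f f) * sqrt (B g g)"
proof -
  have "(B f g)\<^sup>2 \<le> B f f * B g g"
  proof (rule discriminant_le)
    fix t
    show "0 \<le> B f f + 2 * t * B f g + t\<^sup>2 * B g g"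
      using form_expand[where B = B, OF lin sym f g, of 1 t] pos[OF sobolev_lincomb(1)[OF f g m, of 1 t]] by simp
  qed (rule pos[OF g])
  then have "sqrt ((B f g)\<^sup>2) \<le> sqrt (B f f * B g g)" by (rule real_sqrt_le_mono)
  then show ?thesis by (simp add: real_sqrt_mult)
qed

lemma K_Cauchy_Schwarz:
  assumes "f \<in> H" "g \<in> H" "l > 0"
  shows "\<bar>K l f g\<bar> \<le> Kn l f * Kn l g"
  unfolding K_norm_def
  by (rule form_Cauchy_Schwarz[where B = "K l", OF linear_K K_commute K_nonneg]) (use assms in auto)

lemma J_Cauchy_Schwarz:
  assumes "f \<in> H" "g \<in> H"
  shows "\<bar>J f g\<bar> \<le> sqrt (J f f) * sqrt (J g g)"
  by (rule form_Cauchy_Schwarz[where B = J, OF linear_J J_form_commute J_form_nonneg]) (use assms in auto)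

lemma V_Cauchy_Schwarz:
  assumes "f \<in> H" "g \<in> H"
  shows "\<bar>V f g\<bar> \<le> sqrt (V f f) * sqrt (V g g)"
  by (rule form_Cauchy_Schwarz[where B = V, OF linear_V V_commute V_nonneg]) (use assms in auto)

lemma Kn_lincomb_le:
  assumes f: "f \<in> H" and g: "g \<in> H" and l: "l > 0"
  shows "Kn l (\<lambda>s. c * f s + d * g s) \<le> \<bar>c\<bar> * Kn l f + \<bar>d\<bar> * Kn l g"
proof (rule power2_le_imp_le)
  have h: "(\<lambda>s. c * f s + d * g s) \<in> H" by (intro sobolev_lincomb f g m)
  have "2 * c * d * K l f g \<le> \<bar>2 * c * d * K l f g\<bar>" by simp
  also have "\<dots> \<le> 2 * (\<bar>c\<bar> * \<bar>d\<bar>) * (Kn l f * Kn l g)"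
    using K_Cauchy_Schwarz[OF f g l] by (simp add: abs_mult mult_left_mono mult.assoc)
  finally show "(Kn l (\<lambda>s. c * f s + d * g s))\<^sup>2 \<le> (\<bar>c\<bar> * Kn l f + \<bar>d\<bar> * Kn l g)\<^sup>2"
    using form_expand[where B = "K l" and c = c and d = d, OF linear_K K_commute f g]
      Kn_sq[OF f l] Kn_sq[OF g l] Kn_sq[OF h l] by (simp add: power2_sum power_mult_distrib mult_ac)
  show "0 \<le> \<bar>c\<bar> * Kn l f + \<bar>d\<bar> * Kn l g" by (simp add: Kn_nonneg f g l)
qed

lemma Kn_triangle:
  assumes f: "f \<in> H" and g: "g \<in> H" and h: "h \<in> H" and l: "l > 0"
  shows "Kn l (\<lambda>s. f s - h s) \<le> Kn l (\<lambda>s. f s - g s) + Kn l (\<lambda>s. g s - h s)"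
  using Kn_lincomb_le[OF H_diff[OF f g] H_diff[OF g h] l, of 1 1] by simp

lemma Kn_diff_commute:
  assumes f: "f \<in> H" and g: "g \<in> H" and l: "l > 0"
  shows "Kn l (\<lambda>s. f s - g s) = Kn l (\<lambda>s. g s - f s)"
  using Kn_lincomb_le[OF H_diff[OF f g] H_diff[OF f g] l, of "-1" 0]
    Kn_lincomb_le[OF H_diff[OF g f] H_diff[OF g f] l, of "-1" 0] by simp

text \<open>\<open>V f f = 0\<close> gives \<open>f = 0\<close> almost everywhere. Continuity makes
  this pointwise on \<open>{0..1}\<close>, and extension by zero makes it an equality of functions,
  as uniqueness in \<open>W_op\<close> and \<open>tau\<close> requires.\<close>

lemma K_definite:
  assumes f: "f \<in> H" and l: "l > 0" and z: "K l f f = 0"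
  shows "f = (\<lambda>_. 0)"
proof -
  have "0 \<le> l * J f f" using J_form_nonneg[of m f] l by simp
  then have "V f f = 0" using z V_nonneg[OF f] unfolding K_inner_def by linarith
  then have "AE s in unit_leb. f s = 0" by (rule V_form_zero[OF A1 H_L2[OF f]])
  then have "f s = 0" if "s \<in> {0..1}" for s
    using continuous_AE_zero[OF sobolev_continuous[OF f m] _ that] by blast
  then show ?thesis using sobolev_zero_outside[OF f] by (intro ext) blast
qed

lemma H_eqI:
  assumes f: "f \<in> H" and g: "g \<in> H" and l: "l > 0" and z: "Kn l (\<lambda>s. f s - g s) = 0"
  shows "f = g"
proof -
  have "K l (\<lambda>s. f s - g s) (\<lambda>s. f s - g s) = 0" using z Kn_sq[OF H_diff[OF f g] l] by simp
  from K_definite[OF H_diff[OF f g] l this] show ?thesis by (simp add: fun_eq_iff)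
qed

lemma V_partial: "V (partial f N) (partial g N) = (\<Sum>k<N. f k * g k)"
  and J_partial: "J (partial f N) (partial g N) = (\<Sum>k<N. f k * g k * er k)"
proof -
  have "V (partial f N) (partial g N) = (\<Sum>k<N. f k * V (partial g N) (ev k))"
    by (simp add: linear_partial[OF linear_V[OF partial_H]] V_commute ev_H partial_H)
  also have "\<dots> = (\<Sum>k<N. f k * (\<Sum>j<N. g j * V (ev j) (ev k)))"
    by (simp add: linear_partial[OF linear_V[OF ev_H]])
  also have "\<dots> = (\<Sum>k<N. f k * g k)"
    by (intro sum.cong refl) (simp add: V_ev if_distrib[of "(*) _"] cong: if_cong)
  finally show "V (partial f N) (partial g N) = (\<Sum>k<N. f k * g k)" .
  have "J (partial f N) (partial g N) = (\<Sum>k<N. f k * J (partial g N) (ev k))"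
    by (simp add: linear_partial[OF linear_J[OF partial_H]] J_form_commute[of m "partial g N"])
  also have "\<dots> = (\<Sum>k<N. f k * (\<Sum>j<N. g j * J (ev j) (ev k)))"
    by (simp add: linear_partial[OF linear_J[OF ev_H]])
  also have "\<dots> = (\<Sum>k<N. f k * g k * er k)"
    by (intro sum.cong refl) (simp add: J_ev if_distrib[of "(*) _"] cong: if_cong)
  finally show "J (partial f N) (partial g N) = (\<Sum>k<N. f k * g k * er k)" .
qed

lemma K_partial: "K l (partial f N) (partial g N) = (\<Sum>k<N. f k * g k * (1 + l * er k))"
  unfolding K_inner_def V_partial J_partial
  by (simp add: sum_distrib_left sum.distrib[symmetric] algebra_simps)

lemma L2_nderiv_diff:
  assumes f: "f \<in> H" and g: "g \<in> H"
  shows "(L2_norm (\<lambda>s. nderiv m f s - nderiv m g s))\<^sup>2 = J (\<lambda>s. f s - g s) (\<lambda>s. f s - g s)"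
proof -
  have "AE s in unit_leb. nderiv m (\<lambda>s. f s - g s) s = nderiv m f s - nderiv m g s"
    using sobolev_lincomb(2)[OF f g m, of 1 "-1"] by simp
  then have "L2_norm (nderiv m (\<lambda>s. f s - g s)) = L2_norm (\<lambda>s. nderiv m f s - nderiv m g s)"
    using sobolev_nderiv_L2[OF H_diff[OF f g]] L2_diff[OF sobolev_nderiv_L2[OF f] sobolev_nderiv_L2[OF g]]
    by (intro L2_norm_cong_AE) (auto simp: L2_def)
  then show ?thesis unfolding J_form_eq_L2 L2_norm_sq[symmetric] by (simp only:)
qed

section \<open>Eigenseries, the supremum bound and the Riesz representation\<close>

lemma sum_split_at:
  fixes g :: "nat \<Rightarrow> real"
  assumes "i \<le> j"
  shows "(\<Sum>k<j. g k) = (\<Sum>k<i. g k) + (\<Sum>k\<in>{i..<j}. g k)"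
  using sum.atLeastLessThan_concat[of 0 i j g] assms by (simp add: atLeast0LessThan)

text \<open>The \<open>J\<close> part of the convergence comes from Cauchy top derivatives and
  \<open>sobolev_complete\<close>, the \<open>V\<close> part from uniform convergence of the series,
  which is dominated by \<open>T\<close>.\<close>

lemma series_in_H:
  assumes l: "l > 0" and sm: "summable (\<lambda>k. (f k)\<^sup>2 * (1 + l * er k))"
  obtains g where "g \<in> H" "\<And>s. s \<in> {0..1} \<Longrightarrow> (\<lambda>N. partial f N s) \<longlonglongrightarrow> g s"
    "(\<lambda>N. Kn l (\<lambda>s. partial f N s - g s)) \<longlonglongrightarrow> 0"
proof -
  \<comment> \<open>A weighted arithmetic-geometric inequality with weight
    \<open>1 + l * er k\<close> bounds the \<open>k\<close>-th term by a term of the given series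
    plus \<open>real (Suc k) powr (2 * a) * wt l k\<close>, which is summable because
    \<open>D > a + 1 / 2\<close>.\<close>
  define T where "T = (\<lambda>k. csup * ((f k)\<^sup>2 * (1 + l * er k) + real (Suc k) powr (2 * a) * wt l k))"
  have sT: "summable T" unfolding T_def by (intro summable_mult summable_add sm summable_sup_weights l)
  have T: "\<bar>f k * ev k s\<bar> \<le> T k" if s: "s \<in> {0..1}" for k s
  proof -
    have "\<bar>f k * ev k s\<bar> \<le> \<bar>f k\<bar> * (csup * real (Suc k) powr a)"
      unfolding abs_mult by (intro mult_left_mono csup s) auto
    also have "\<dots> = csup * (\<bar>f k\<bar> * \<bar>real (Suc k) powr a\<bar>)" by simp
    also have "\<dots> \<le> csup * ((f k)\<^sup>2 * (1 + l * er k) + (real (Suc k) powr a)\<^sup>2 / (1 + l * er k))"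
      using csup(1) by (intro mult_left_mono mult_le_weighted_squares q_pos l) auto
    also have "(real (Suc k) powr a)\<^sup>2 = real (Suc k) powr (2 * a)"
      by (simp add: power2_eq_square powr_add[symmetric])
    finally show ?thesis by (simp add: T_def wt_def)
  qed
  have T0: "0 \<le> T k" for k using T[of 0 k] abs_ge_zero order_trans by fastforce
  define g where "g = (\<lambda>s. if s \<in> {0..1} then (\<Sum>k. f k * ev k s) else 0)"
  have sf: "summable (\<lambda>k. f k * ev k s)" if "s \<in> {0..1}" for s
    by (rule summable_comparison_test'[OF sT, of 0]) (use T[OF that] in auto)
  have lim: "(\<lambda>N. partial f N s) \<longlonglongrightarrow> g s" if "s \<in> {0..1}" for s
    using summable_LIMSEQ[OF sf[OF that]] that by (simp add: partial_def g_def)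
  have unif: "\<bar>partial f N s - g s\<bar> \<le> (\<Sum>k. T (k + N))" if s: "s \<in> {0..1}" for N s
  proof -
    have "g s - partial f N s = (\<Sum>k. f (k + N) * ev (k + N) s)"
      using suminf_minus_initial_segment[OF sf[OF s], of N] s by (simp add: g_def partial_def)
    also have "\<bar>\<dots>\<bar> \<le> (\<Sum>k. T (k + N))"
    proof -
      have "norm (\<Sum>k. f (k + N) * ev (k + N) s) \<le> (\<Sum>k. T (k + N))"
        by (rule norm_suminf_le) (use T[OF s] sT in \<open>auto simp: summable_iff_shift\<close>)
      then show ?thesis by simp
    qed
    finally show ?thesis by (simp add: abs_minus_commute)
  qed
  have tail: "(\<lambda>N. \<Sum>k. T (k + N)) \<longlonglongrightarrow> 0"
    by (rule suminf_exist_split2[OF sT])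
  have sm': "summable (\<lambda>k. (f k)\<^sup>2 * er k)"
  proof (rule summable_comparison_test'[of "\<lambda>k. 1 / l * ((f k)\<^sup>2 * (1 + l * er k))" 0])
    show "summable (\<lambda>k. 1 / l * ((f k)\<^sup>2 * (1 + l * er k)))" by (intro summable_mult sm)
    fix k
    have "l * ((f k)\<^sup>2 * er k) \<le> (f k)\<^sup>2 * (1 + l * er k)" by (simp add: algebra_simps)
    then show "norm ((f k)\<^sup>2 * er k) \<le> 1 / l * ((f k)\<^sup>2 * (1 + l * er k))"
      using l er_nonneg[of k] by (simp add: field_simps)
  qed
  have cauchy: "\<exists>N. \<forall>i\<ge>N. \<forall>j\<ge>N. L2_norm (\<lambda>s. nderiv m (partial f i) s - nderiv m (partial f j) s) < e" if e: "e > 0" for e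
  proof -
    have c: "Cauchy (\<lambda>n. \<Sum>k<n. (f k)\<^sup>2 * er k)" using sm' by (simp add: summable_iff_convergent Cauchy_convergent_iff)
    have e2: "0 < e\<^sup>2" using e by simp
    obtain N where "\<forall>i\<ge>N. \<forall>j\<ge>N. dist (\<Sum>k<i. (f k)\<^sup>2 * er k) (\<Sum>k<j. (f k)\<^sup>2 * er k) < e\<^sup>2"
      using metric_CauchyD[OF c e2] by blast
    then have N: "\<bar>(\<Sum>k<i. (f k)\<^sup>2 * er k) - (\<Sum>k<j. (f k)\<^sup>2 * er k)\<bar> < e\<^sup>2" if "i \<ge> N" "j \<ge> N" for i j
      using that by (simp add: dist_real_def)
    have main: "L2_norm (\<lambda>s. nderiv m (partial f j) s - nderiv m (partial f i) s) < e" if ij: "i \<ge> N" "j \<ge> N" "i \<le> j" for i j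
    proof -
      \<comment> \<open>The difference of two partial sums is a partial sum whose first
        \<open>i\<close> coefficients are zero, so \<open>J_partial\<close> evaluates it.\<close>
      let ?f = "\<lambda>k. if k < i then 0 else f k"
      have eq: "(\<lambda>s. partial f j s - partial f i s) = partial ?f j"
      proof
        fix s
        have "partial f j s = (\<Sum>k<i. f k * ev k s) + (\<Sum>k\<in>{i..<j}. f k * ev k s)"
          unfolding partial_def by (rule sum_split_at[OF ij(3)])
        moreover have "partial ?f j s = (\<Sum>k\<in>{i..<j}. f k * ev k s)"
          unfolding partial_def sum_split_at[OF ij(3)] by simp
        ultimately show "partial f j s - partial f i s = partial ?f j s" by (simp add: partial_def)
      qed
      have "(L2_norm (\<lambda>s. nderiv m (partial f j) s - nderiv m (partial f i) s))\<^sup>2 = (\<Sum>k<j. ?f k * ?f k * er k)"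
        unfolding L2_nderiv_diff[OF partial_H partial_H] eq J_partial ..
      also have "\<dots> = (\<Sum>k\<in>{i..<j}. (f k)\<^sup>2 * er k)"
        unfolding sum_split_at[OF ij(3)] by (simp add: power2_eq_square)
      also have "\<dots> = (\<Sum>k<j. (f k)\<^sup>2 * er k) - (\<Sum>k<i. (f k)\<^sup>2 * er k)"
        unfolding sum_split_at[OF ij(3)] by simp
      also have "\<dots> < e\<^sup>2" using N[OF ij(2,1)] by linarith
      finally show ?thesis by (rule power2_less_imp_less) (use e in simp)
    qed
    have "L2_norm (\<lambda>s. nderiv m (partial f i) s - nderiv m (partial f j) s) < e" if ij: "i \<ge> N" "j \<ge> N" for i j
    proof (cases "j \<le> i")
      case True then show ?thesis using main[of j i] ij by simp
    next
      case False
      have "L2_norm (\<lambda>s. nderiv m (partial f i) s - nderiv m (partial f j) s) = L2_norm (\<lambda>s. nderiv m (partial f j) s - nderiv m (partial f i) s)"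
        unfolding L2_norm_def L2_inner_eq_square by (simp add: power2_commute)
      then show ?thesis using main[of i j] ij False by simp
    qed
    then show ?thesis by blast
  qed
  have gz: "g x = 0" if "x \<notin> {0..1}" for x using that unfolding g_def by (rule if_not_P)
  note sc = sobolev_complete[OF m partial_H lim gz cauchy]
  have gH: "g \<in> H" by (rule sc(1))
  have "(\<lambda>N. J (\<lambda>s. partial f N s - g s) (\<lambda>s. partial f N s - g s)) \<longlonglongrightarrow> 0"
    using tendsto_power[OF sc(2), of 2] by (simp add: L2_nderiv_diff[OF partial_H gH])
  moreover have "(\<lambda>N. V (\<lambda>s. partial f N s - g s) (\<lambda>s. partial f N s - g s)) \<longlonglongrightarrow> 0"
  proof (rule Lim_null_comparison)
    show "(\<lambda>N. (\<integral>\<omega>. (L2_norm (X 1 \<omega>))\<^sup>2 \<partial>M) * (\<Sum>k. T (k + N))\<^sup>2) \<longlonglongrightarrow> 0"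
      using tendsto_mult_left[OF tendsto_power[OF tail, of 2], of "\<integral>\<omega>. (L2_norm (X 1 \<omega>))\<^sup>2 \<partial>M"] by simp
    have "V (\<lambda>s. partial f N s - g s) (\<lambda>s. partial f N s - g s) \<le> (\<integral>\<omega>. (L2_norm (X 1 \<omega>))\<^sup>2 \<partial>M) * (\<Sum>k. T (k + N))\<^sup>2" for N
    proof -
      have nn: "0 \<le> (\<Sum>k. T (k + N))" by (intro suminf_nonneg) (use sT T0 in \<open>auto simp: summable_iff_shift\<close>)
      have "V (\<lambda>s. partial f N s - g s) (\<lambda>s. partial f N s - g s) \<le> (\<integral>\<omega>. (L2_norm (X 1 \<omega>))\<^sup>2 \<partial>M) * (L2_norm (\<lambda>s. partial f N s - g s))\<^sup>2"
        by (rule V_form_le_norm[OF H_L2[OF H_diff[OF partial_H gH]]])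
      also have "\<dots> \<le> (\<integral>\<omega>. (L2_norm (X 1 \<omega>))\<^sup>2 \<partial>M) * (\<Sum>k. T (k + N))\<^sup>2"
        by (intro mult_left_mono power_mono L2_norm_le_sup[OF H_L2[OF H_diff[OF partial_H gH]] unif nn] L2_norm_nonneg) auto
      finally show ?thesis .
    qed
    then show "\<forall>\<^sub>F N in sequentially. norm (V (\<lambda>s. partial f N s - g s) (\<lambda>s. partial f N s - g s)) \<le> (\<integral>\<omega>. (L2_norm (X 1 \<omega>))\<^sup>2 \<partial>M) * (\<Sum>k. T (k + N))\<^sup>2"
      using V_nonneg[OF H_diff[OF partial_H gH]] by (intro always_eventually) auto
  qed
  ultimately have "(\<lambda>N. K l (\<lambda>s. partial f N s - g s) (\<lambda>s. partial f N s - g s)) \<longlonglongrightarrow> 0 + l * 0"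
    unfolding K_inner_def by (intro tendsto_intros)
  then have "(\<lambda>N. Kn l (\<lambda>s. partial f N s - g s)) \<longlonglongrightarrow> 0"
    unfolding K_norm_def using tendsto_real_sqrt by fastforce
  then show ?thesis using that[OF gH lim] by blast
qed

definition coef :: "(real \<Rightarrow> real) \<Rightarrow> nat \<Rightarrow> real" where "coef b k = V b (ev k)"

lemma expansion:
  assumes b: "b \<in> H" and l: "l > 0"
  shows "(\<lambda>N. Kn l (\<lambda>s. b s - partial (coef b) N s)) \<longlonglongrightarrow> 0"
proof -
  have "(\<lambda>N. K_norm M X m l (\<lambda>s. b s - (\<Sum>k=1..N. V_form M X b (\<phi> k) * \<phi> k s))) \<longlonglongrightarrow> 0"
    using A2 b l by (auto simp: A2_def)
  then show ?thesis by (simp add: partial_def coef_def ev_def sum.atLeast1_atMost_eq)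
qed

lemma J_le_K: "f \<in> H \<Longrightarrow> l > 0 \<Longrightarrow> l * J f f \<le> K l f f"
  by (simp add: K_inner_def V_nonneg)

lemma sqrt_J_le: "f \<in> H \<Longrightarrow> l > 0 \<Longrightarrow> sqrt (J f f) \<le> Kn l f / sqrt l"
  unfolding K_norm_def real_sqrt_divide[symmetric]
  using J_le_K[of f l] by (intro real_sqrt_le_mono) (simp add: field_simps)

text \<open>The \<open>J\<close>-product with \<open>ev k\<close> is continuous in the
  \<open>K\<close>-norm, and along the expansion of \<open>b\<close> it is constant from index
  \<open>Suc k\<close> on. Hence the coefficient \<open>coef b k\<close>, defined through
  \<open>V\<close>, determines the \<open>J\<close>-product as well.\<close>

lemma J_coef:
  assumes b: "b \<in> H"
  shows "J b (ev k) = er k * coef b k"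
proof -
  have "(\<lambda>N. J b (ev k) - J (partial (coef b) N) (ev k)) \<longlonglongrightarrow> 0"
  proof (rule Lim_null_comparison)
    show "(\<lambda>N. Kn 1 (\<lambda>s. b s - partial (coef b) N s) * sqrt (J (ev k) (ev k))) \<longlonglongrightarrow> 0"
      using tendsto_mult_left_zero[OF expansion[OF b, of 1]] by simp
    have "\<bar>J b (ev k) - J (partial (coef b) N) (ev k)\<bar> \<le> Kn 1 (\<lambda>s. b s - partial (coef b) N s) * sqrt (J (ev k) (ev k))" for N
    proof -
      have h: "(\<lambda>s. b s - partial (coef b) N s) \<in> H" by (intro H_diff b partial_H)
      have "\<bar>J b (ev k) - J (partial (coef b) N) (ev k)\<bar> = \<bar>J (\<lambda>s. b s - partial (coef b) N s) (ev k)\<bar>"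
        using linear_diff[OF linear_J[OF ev_H] b partial_H] by simp
      also have "\<dots> \<le> sqrt (J (\<lambda>s. b s - partial (coef b) N s) (\<lambda>s. b s - partial (coef b) N s)) * sqrt (J (ev k) (ev k))"
        by (rule J_Cauchy_Schwarz[OF h ev_H])
      also have "\<dots> \<le> Kn 1 (\<lambda>s. b s - partial (coef b) N s) * sqrt (J (ev k) (ev k))"
        using sqrt_J_le[OF h, of 1] by (intro mult_right_mono) (auto simp: J_form_nonneg)
      finally show ?thesis .
    qed
    then show "\<forall>\<^sub>F N in sequentially. norm (J b (ev k) - J (partial (coef b) N) (ev k)) \<le> Kn 1 (\<lambda>s. b s - partial (coef b) N s) * sqrt (J (ev k) (ev k))"
      by simp
  qed
  moreover have "\<forall>\<^sub>F N in sequentially. J b (ev k) - J (partial (coef b) N) (ev k) = J b (ev k) - er k * coef b k"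
    unfolding eventually_sequentially
  proof (intro exI[of _ "Suc k"] allI impI)
    fix N assume "Suc k \<le> N"
    then show "J b (ev k) - J (partial (coef b) N) (ev k) = J b (ev k) - er k * coef b k"
      by (simp add: linear_partial[OF linear_J[OF ev_H]] J_ev if_distrib[of "(*) _"] cong: if_cong)
  qed
  ultimately have "(\<lambda>N. J b (ev k) - er k * coef b k) \<longlonglongrightarrow> 0"
    by (rule Lim_transform_eventually)
  then show ?thesis by (simp add: LIMSEQ_const_iff)
qed

lemma K_coef: "b \<in> H \<Longrightarrow> K l b (ev k) = (1 + l * er k) * coef b k"
  by (simp add: K_inner_def J_coef coef_def[symmetric] algebra_simps)

lemma Bessel:
  assumes b: "b \<in> H" and l: "l > 0"
  shows "(\<Sum>k<N. (coef b k)\<^sup>2 * (1 + l * er k)) \<le> (Kn l b)\<^sup>2"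
proof -
  let ?u = "partial (coef b) N"
  have uH: "?u \<in> H" by (rule partial_H)
  have uu: "K l ?u ?u = (\<Sum>k<N. (coef b k)\<^sup>2 * (1 + l * er k))"
    unfolding K_partial by (simp add: power2_eq_square)
  have "K l b ?u = K l ?u b" by (rule K_commute[OF b uH])
  also have "\<dots> = (\<Sum>k<N. coef b k * K l (ev k) b)" by (rule linear_partial[OF linear_K[OF b]])
  also have "\<dots> = (\<Sum>k<N. (coef b k)\<^sup>2 * (1 + l * er k))"
    by (intro sum.cong refl) (simp add: K_commute[OF ev_H b] K_coef[OF b] power2_eq_square)
  finally have bu: "K l b ?u = (\<Sum>k<N. (coef b k)\<^sup>2 * (1 + l * er k))" .
  have "0 \<le> K l (\<lambda>s. 1 * b s + (-1) * ?u s) (\<lambda>s. 1 * b s + (-1) * ?u s)"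
    by (intro K_nonneg l sobolev_lincomb b uH m)
  also have "\<dots> = K l b b - (\<Sum>k<N. (coef b k)\<^sup>2 * (1 + l * er k))"
    using form_expand[where B = "K l" and c = 1 and d = "-1", OF linear_K K_commute b uH] bu uu by simp
  finally show ?thesis using Kn_sq[OF b l] by simp
qed

text \<open>\<open>A2\<close> asserts convergence in the \<open>K\<close>-norm. By Bessel's
  inequality and \<open>series_in_H\<close> the series also converges pointwise to some
  \<open>g\<close>, and \<open>g = b\<close> since both are limits in the same norm.\<close>

lemma expansion_pointwise:
  assumes b: "b \<in> H" and s: "s \<in> {0..1}"
  shows "(\<lambda>N. partial (coef b) N s) \<longlonglongrightarrow> b s"
proof -
  have l: "(1::real) > 0" by simp
  have "summable (\<lambda>k. (coef b k)\<^sup>2 * (1 + 1 * er k))"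
    by (rule summableI_nonneg_bounded[where x = "(Kn 1 b)\<^sup>2"])
       (use Bessel[OF b l] er_nonneg in \<open>auto simp: add_nonneg_nonneg\<close>)
  from series_in_H[OF l this] obtain g where g: "g \<in> H"
    "\<And>s. s \<in> {0..1} \<Longrightarrow> (\<lambda>N. partial (coef b) N s) \<longlonglongrightarrow> g s"
    "(\<lambda>N. Kn 1 (\<lambda>s. partial (coef b) N s - g s)) \<longlonglongrightarrow> 0" by blast
  have "(\<lambda>N::nat. Kn 1 (\<lambda>s. b s - g s)) \<longlonglongrightarrow> 0"
  proof (rule Lim_null_comparison)
    show "(\<lambda>N. Kn 1 (\<lambda>s. b s - partial (coef b) N s) + Kn 1 (\<lambda>s. partial (coef b) N s - g s)) \<longlonglongrightarrow> 0"
      using tendsto_add[OF expansion[OF b l] g(3)] by simp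
    show "\<forall>\<^sub>F N in sequentially. norm (Kn 1 (\<lambda>s. b s - g s)) \<le> Kn 1 (\<lambda>s. b s - partial (coef b) N s) + Kn 1 (\<lambda>s. partial (coef b) N s - g s)"
      using Kn_triangle[OF b partial_H g(1) l] Kn_nonneg[OF H_diff[OF b g(1)] l] by (intro always_eventually) auto
  qed
  then have "Kn 1 (\<lambda>s. b s - g s) = 0" by (simp add: LIMSEQ_const_iff)
  then have "b = g" by (rule H_eqI[OF b g(1) l])
  then show ?thesis using g(2)[OF s] by simp
qed

text \<open>Its square bounds the diagonal of the reproducing kernel of \<open>K\<close>, the sum
  over \<open>k\<close> of \<open>(ev k s)\<^sup>2 * wt l k\<close>, uniformly in
  \<open>s\<close>.\<close>

definition supw :: "real \<Rightarrow> real" where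
  "supw l = csup * sqrt (\<Sum>k. real (Suc k) powr (2 * a) * wt l k)"

lemma supw_nonneg: "l > 0 \<Longrightarrow> 0 \<le> supw l"
  unfolding supw_def using csup(1) wt_pos[of l] by (intro mult_nonneg_nonneg real_sqrt_ge_zero suminf_nonneg summable_sup_weights) (auto intro: less_imp_le)

lemma sup_le_Kn:
  assumes b: "b \<in> H" and l: "l > 0" and s: "s \<in> {0..1}"
  shows "\<bar>b s\<bar> \<le> supw l * Kn l b"
proof (rule LIMSEQ_le_const2)
  show "(\<lambda>N. \<bar>partial (coef b) N s\<bar>) \<longlonglongrightarrow> \<bar>b s\<bar>"
    by (intro tendsto_intros expansion_pointwise b s)
  have "\<bar>partial (coef b) N s\<bar> \<le> supw l * Kn l b" for N
  proof -
    let ?q = "\<lambda>k. 1 + l * er k"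
    have S0: "0 \<le> (\<Sum>k. real (Suc k) powr (2 * a) * wt l k)"
      using wt_pos[OF l] by (intro suminf_nonneg summable_sup_weights l) (auto intro: less_imp_le)
    have "\<bar>partial (coef b) N s\<bar> \<le> (\<Sum>k<N. \<bar>coef b k * ev k s\<bar>)" unfolding partial_def by (rule sum_abs)
    \<comment> \<open>Inserts \<open>sqrt (1 + l * er k) * sqrt (wt l k) = 1\<close>, so that
      Cauchy--Schwarz separates the Bessel sum from the kernel sum.\<close>
    also have "\<dots> \<le> (\<Sum>k<N. (\<bar>coef b k\<bar> * sqrt (?q k)) * (csup * (real (Suc k) powr a * sqrt (wt l k))))"
    proof (rule sum_mono)
      fix k
      have "sqrt (?q k) * sqrt (wt l k) = 1"
        using q_pos[OF l, of k] by (simp add: wt_def real_sqrt_mult[symmetric] real_sqrt_divide)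
      moreover have "(\<bar>coef b k\<bar> * sqrt (?q k)) * (csup * (real (Suc k) powr a * sqrt (wt l k)))
          = (\<bar>coef b k\<bar> * (csup * real (Suc k) powr a)) * (sqrt (?q k) * sqrt (wt l k))"
        by (simp only: mult_ac)
      ultimately have eqk: "(\<bar>coef b k\<bar> * sqrt (?q k)) * (csup * (real (Suc k) powr a * sqrt (wt l k))) = \<bar>coef b k\<bar> * (csup * real (Suc k) powr a)"
        by (simp only: mult_1_right)
      have lek: "\<bar>coef b k * ev k s\<bar> \<le> \<bar>coef b k\<bar> * (csup * real (Suc k) powr a)"
        unfolding abs_mult by (intro mult_left_mono csup(2) s) simp
      show "\<bar>coef b k * ev k s\<bar> \<le> (\<bar>coef b k\<bar> * sqrt (?q k)) * (csup * (real (Suc k) powr a * sqrt (wt l k)))"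
        unfolding eqk by (rule lek)
    qed
    also have "\<dots> \<le> sqrt ((\<Sum>k<N. (\<bar>coef b k\<bar> * sqrt (?q k))\<^sup>2) * (\<Sum>k<N. (csup * (real (Suc k) powr a * sqrt (wt l k)))\<^sup>2))"
      by (rule real_le_rsqrt) (rule Cauchy_Schwarz_ineq_sum)
    also have "\<dots> \<le> sqrt ((Kn l b)\<^sup>2 * (supw l)\<^sup>2)"
    proof (intro real_sqrt_le_mono mult_mono)
      have "(\<Sum>k<N. (\<bar>coef b k\<bar> * sqrt (?q k))\<^sup>2) = (\<Sum>k<N. (coef b k)\<^sup>2 * ?q k)"
        using q_pos[OF l] by (intro sum.cong refl) (simp add: power_mult_distrib less_imp_le)
      then show "(\<Sum>k<N. (\<bar>coef b k\<bar> * sqrt (?q k))\<^sup>2) \<le> (Kn l b)\<^sup>2" using Bessel[OF b l] by simp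
      have "(csup * (real (Suc k) powr a * sqrt (wt l k)))\<^sup>2 = csup\<^sup>2 * (real (Suc k) powr (2 * a) * wt l k)" for k
      proof -
        have "(real (Suc k) powr a)\<^sup>2 = real (Suc k) powr (2 * a)"
          by (simp add: power2_eq_square powr_add[symmetric])
        then show ?thesis
          by (simp only: power_mult_distrib real_sqrt_pow2[OF less_imp_le[OF wt_pos[OF l]]])
      qed
      then have "(\<Sum>k<N. (csup * (real (Suc k) powr a * sqrt (wt l k)))\<^sup>2) = csup\<^sup>2 * (\<Sum>k<N. real (Suc k) powr (2 * a) * wt l k)"
        unfolding sum_distrib_left by (intro sum.cong refl)
      also have "\<dots> \<le> csup\<^sup>2 * (\<Sum>k. real (Suc k) powr (2 * a) * wt l k)"
        using wt_pos[OF l] by (intro mult_left_mono sum_le_suminf summable_sup_weights l) (auto intro: less_imp_le)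
      also have "\<dots> = (supw l)\<^sup>2"
        unfolding supw_def power_mult_distrib real_sqrt_pow2[OF S0] ..
      finally show "(\<Sum>k<N. (csup * (real (Suc k) powr a * sqrt (wt l k)))\<^sup>2) \<le> (supw l)\<^sup>2" .
    qed (auto intro: sum_nonneg)
    also have "\<dots> = supw l * Kn l b"
      using supw_nonneg[OF l] Kn_nonneg[OF b l] by (simp add: real_sqrt_mult)
    finally show ?thesis .
  qed
  then show "\<exists>N. \<forall>n\<ge>N. \<bar>partial (coef b) n s\<bar> \<le> supw l * Kn l b" by blast
qed

lemma L2_norm_le_Kn:
  assumes b: "b \<in> H" and l: "l > 0"
  shows "L2_norm b \<le> supw l * Kn l b"
  by (rule L2_norm_le_sup[OF H_L2[OF b] sup_le_Kn[OF b l]])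
     (auto simp: supw_nonneg l Kn_nonneg b)

lemma bounded_linear_limit:
  assumes lin: "linear_on_H F" and bd: "\<And>b. b \<in> H \<Longrightarrow> \<bar>F b\<bar> \<le> C * Kn l b"
    and u: "\<And>N. u N \<in> H" and g: "g \<in> H" and lim: "(\<lambda>N. Kn l (\<lambda>s. u N s - g s)) \<longlonglongrightarrow> 0"
  shows "(\<lambda>N. F (u N)) \<longlonglongrightarrow> F g"
proof -
  have "(\<lambda>N. F (u N) - F g) \<longlonglongrightarrow> 0"
  proof (rule Lim_null_comparison)
    show "(\<lambda>N. C * Kn l (\<lambda>s. u N s - g s)) \<longlonglongrightarrow> 0" using tendsto_mult_right_zero[OF lim] by simp
    show "\<forall>\<^sub>F N in sequentially. norm (F (u N) - F g) \<le> C * Kn l (\<lambda>s. u N s - g s)"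
      using bd[OF H_diff[OF u g]] linear_diff[OF lin u g] by (intro always_eventually) simp
  qed
  then show ?thesis by (simp add: LIM_zero_iff)
qed

lemma bounded_linear_expansion:
  assumes lin: "linear_on_H F" and l: "l > 0" and bd: "\<And>b. b \<in> H \<Longrightarrow> \<bar>F b\<bar> \<le> C * Kn l b" and b: "b \<in> H"
  shows "(\<lambda>N. F (partial (coef b) N)) \<longlonglongrightarrow> F b"
proof (rule bounded_linear_limit[OF lin bd partial_H b])
  show "(\<lambda>N. Kn l (\<lambda>s. partial (coef b) N s - b s)) \<longlonglongrightarrow> 0"
    using expansion[OF b l] Kn_diff_commute[OF b partial_H l] by simp
qed

text \<open>The representative is the eigenseries with coefficients
  \<open>F (ev k) * wt l k\<close>. Testing \<open>F\<close> on its partial sums gives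
  \<open>S \<le> C * sqrt S\<close> for their squared norms \<open>S\<close>, and this boundedness
  makes the series converge.\<close>

theorem Riesz:
  assumes lin: "linear_on_H F" and l: "l > 0" and bd: "\<And>b. b \<in> H \<Longrightarrow> \<bar>F b\<bar> \<le> C * Kn l b"
  shows "\<exists>!w. w \<in> H \<and> (\<forall>b\<in>H. K l w b = F b)"
proof (rule ex_ex1I)
  define f where "f = (\<lambda>k. F (ev k) * wt l k)"
  have fq: "f k * (1 + l * er k) = F (ev k)" for k using q_pos[OF l, of k] by (simp add: f_def wt_def)
  have bound: "(\<Sum>k<N. (f k)\<^sup>2 * (1 + l * er k)) \<le> C\<^sup>2" for N
  proof -
    let ?S = "\<Sum>k<N. (f k)\<^sup>2 * (1 + l * er k)"
    have S0: "0 \<le> ?S" using q_pos[OF l] by (intro sum_nonneg mult_nonneg_nonneg) (auto intro: less_imp_le)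
    have "?S = F (partial f N)"
      unfolding linear_partial[OF lin] using fq by (intro sum.cong refl) (metis power2_eq_square mult.assoc)
    also have "\<dots> \<le> C * Kn l (partial f N)" using bd[OF partial_H, of f N] by linarith
    also have "Kn l (partial f N) = sqrt ?S"
      unfolding K_norm_def K_partial by (simp add: power2_eq_square)
    finally have S: "?S \<le> C * sqrt ?S" .
    show ?thesis
    proof (cases "?S = 0")
      case False
      then have "sqrt ?S > 0" using S0 by simp
      moreover have "sqrt ?S * sqrt ?S \<le> C * sqrt ?S" using S S0 by simp
      ultimately have "sqrt ?S \<le> C" by (rule_tac mult_right_le_imp_le)
      then have "(sqrt ?S)\<^sup>2 \<le> C\<^sup>2" using S0 by (intro power_mono) auto
      then show ?thesis using S0 by simp
    qed simp
  qed
  have "summable (\<lambda>k. (f k)\<^sup>2 * (1 + l * er k))"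
    by (rule summableI_nonneg_bounded[OF _ bound]) (use q_pos[OF l] in \<open>auto intro!: mult_nonneg_nonneg intro: less_imp_le\<close>)
  from series_in_H[OF l this] obtain g where g: "g \<in> H" "(\<lambda>N. Kn l (\<lambda>s. partial f N s - g s)) \<longlonglongrightarrow> 0" by blast
  have bK: "\<bar>K l f b\<bar> \<le> Kn l b * Kn l f" if "b \<in> H" "f \<in> H" for f b
    using K_Cauchy_Schwarz[OF that(2,1) l] by (simp add: mult.commute)
  have ge: "K l g (ev k) = F (ev k)" for k
  proof -
    have "(\<lambda>N. K l (partial f N) (ev k)) \<longlonglongrightarrow> K l g (ev k)"
      by (rule bounded_linear_limit[OF linear_K[OF ev_H] bK[OF ev_H] partial_H g])
    moreover have "\<forall>\<^sub>F N in sequentially. K l (partial f N) (ev k) = F (ev k)"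
      unfolding eventually_sequentially
    proof (intro exI[of _ "Suc k"] allI impI)
      fix N assume N: "Suc k \<le> N"
      have "K l (ev j) (ev k) = (if j = k then 1 + l * er k else 0)" for j
        by (simp add: K_inner_def V_ev J_ev)
      then show "K l (partial f N) (ev k) = F (ev k)"
        using N by (simp add: linear_partial[OF linear_K[OF ev_H]] fq if_distrib[of "(*) _"] cong: if_cong)
    qed
    ultimately have "(\<lambda>N::nat. F (ev k)) \<longlonglongrightarrow> K l g (ev k)" by (rule Lim_transform_eventually)
    then show ?thesis by (simp add: LIMSEQ_const_iff)
  qed
  have "K l g b = F b" if b: "b \<in> H" for b
  proof -
    have "(\<lambda>N. K l (partial (coef b) N) g) \<longlonglongrightarrow> K l b g"
      by (rule bounded_linear_expansion[OF linear_K[OF g(1)] l bK[OF g(1)] b])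
    moreover have "(\<lambda>N. F (partial (coef b) N)) \<longlonglongrightarrow> F b"
      by (rule bounded_linear_expansion[OF lin l bd b])
    moreover have "K l (partial (coef b) N) g = F (partial (coef b) N)" for N
      unfolding linear_partial[OF lin] linear_partial[OF linear_K[OF g(1)]]
      using ge by (simp add: K_commute[OF ev_H g(1)])
    ultimately have "K l b g = F b" using LIMSEQ_unique by simp
    then show ?thesis using K_commute[OF b g(1)] by simp
  qed
  then show "\<exists>w. w \<in> H \<and> (\<forall>b\<in>H. K l w b = F b)" using g(1) by blast
next
  fix w w' assume w: "w \<in> H \<and> (\<forall>b\<in>H. K l w b = F b)" and w': "w' \<in> H \<and> (\<forall>b\<in>H. K l w' b = F b)"
  then have h: "(\<lambda>s. w s - w' s) \<in> H" by (intro H_diff) auto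
  have "K l (\<lambda>s. w s - w' s) (\<lambda>s. w s - w' s) = 0"
    using linear_diff[OF linear_K[OF h], of w w'] w w' h by simp
  from K_definite[OF h l this] show "w = w'" by (simp add: fun_eq_iff)
qed

lemma linear_L2_inner: "z \<in> L2 \<Longrightarrow> linear_on_H (\<lambda>b. L2_inner b z)"
  unfolding linear_on_H_def by (auto intro!: L2_inner_lincomb H_L2)

lemma L2_inner_bounded:
  assumes z: "z \<in> L2" and b: "b \<in> H" and l: "l > 0"
  shows "\<bar>L2_inner b z\<bar> \<le> (L2_norm z * supw l) * Kn l b"
proof -
  have "\<bar>L2_inner b z\<bar> \<le> L2_norm b * L2_norm z" by (rule L2_inner_Cauchy_Schwarz[OF H_L2[OF b] z])
  also have "\<dots> \<le> (supw l * Kn l b) * L2_norm z" by (intro mult_right_mono L2_norm_le_Kn b l L2_norm_nonneg)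
  finally show ?thesis by (simp add: mult_ac)
qed

lemma tau_spec:
  assumes z: "z \<in> L2" and l: "l > 0"
  shows "tau M X m l z \<in> H" "\<And>b. b \<in> H \<Longrightarrow> K l (tau M X m l z) b = L2_inner b z"
  using theI'[OF Riesz[OF linear_L2_inner[OF z] l L2_inner_bounded[OF z _ l]], folded tau_def] by auto

text \<open>The factor \<open>sqrt l\<close> is the size of the regularization bias; it is the
  source of \<open>lam n powr (1 / 2)\<close> in the rate.\<close>

lemma lJ_bounded:
  assumes b1: "b1 \<in> H" and b: "b \<in> H" and l: "l > 0"
  shows "\<bar>l * J b1 b\<bar> \<le> (sqrt l * sqrt (J b1 b1)) * Kn l b"
proof -
  have "\<bar>J b1 b\<bar> \<le> sqrt (J b1 b1) * sqrt (J b b)" by (rule J_Cauchy_Schwarz[OF b1 b])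
  also have "\<dots> \<le> sqrt (J b1 b1) * (Kn l b / sqrt l)"
    by (intro mult_left_mono sqrt_J_le b l) (simp add: J_form_nonneg)
  finally have "l * \<bar>J b1 b\<bar> \<le> l * (sqrt (J b1 b1) * (Kn l b / sqrt l))"
    using l by (intro mult_left_mono) auto
  then have "\<bar>l * J b1 b\<bar> \<le> l * (sqrt (J b1 b1) * (Kn l b / sqrt l))"
    using l by (simp add: abs_mult)
  also have "\<dots> = (sqrt l * sqrt (J b1 b1)) * Kn l b"
    using l real_sqrt_mult_self[of l] by (simp add: field_simps)
  finally show ?thesis .
qed

lemma W_spec:
  assumes b1: "b1 \<in> H" and l: "l > 0"
  shows "W_op M X m l b1 \<in> H" "\<And>b. b \<in> H \<Longrightarrow> K l (W_op M X m l b1) b = l * J b1 b"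
proof -
  have lin: "linear_on_H (\<lambda>b. l * J b1 b)"
    using linear_J[OF b1] unfolding linear_on_H_def J_form_commute[of m b1] by (simp add: algebra_simps)
  show "W_op M X m l b1 \<in> H" "\<And>b. b \<in> H \<Longrightarrow> K l (W_op M X m l b1) b = l * J b1 b"
    using theI'[OF Riesz[OF lin l lJ_bounded[OF b1 _ l]], folded W_op_def] by auto
qed

end

section \<open>A maximal inequality and the deterministic expansion\<close>

lemma two_mult_le_weighted:
  fixes x y q :: real
  assumes "q > 0"
  shows "2 * (x * y) \<le> q * x\<^sup>2 + y\<^sup>2 / q"
proof -
  have "0 \<le> (q * x - y)\<^sup>2 / q" using assms by simp
  also have "\<dots> = q * x\<^sup>2 - 2 * (x * y) + y\<^sup>2 / q"
    using assms by (simp add: power2_eq_square field_simps)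
  finally show ?thesis by simp
qed

lemma linear_coeff_zero:
  fixes A B :: real
  assumes "\<And>t. 0 \<le> t * A + t\<^sup>2 * B"
  shows "A = 0"
proof (rule ccontr)
  assume nz: "A \<noteq> 0"
  define c where "c = \<bar>B\<bar> + 1"
  have c: "c > 0" "B \<le> c" by (auto simp: c_def)
  \<comment> \<open>Minimiser of \<open>t * A + t\<^sup>2 * c\<close>, whose value there is
    negative.\<close>
  define t where "t = - A / (2 * c)"
  have "t * A + t\<^sup>2 * B \<le> t * A + t\<^sup>2 * c" using c by (intro add_left_mono mult_left_mono) auto
  also have "\<dots> = - (A\<^sup>2 / (4 * c))"
    using c by (simp add: t_def power2_eq_square field_simps)
  also have "\<dots> < 0" using nz c by simp
  finally show False using assms[of t] by simp
qed

lemma quadratic_absorb: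
  fixes x :: real
  shows "x * x \<le> 1 / 2 * (x * x) + a * x + b * x \<Longrightarrow> x * x \<le> 2 * (a + b) * x"
  by (simp add: algebra_simps)

section \<open>The Rademacher--Menshov inequality\<close>

text \<open>The squared sums over all dyadic subblocks of \<open>{a..<a + 2 ^ L}\<close>, added up.
  This single quantity dominates all initial blocks at once.\<close>

primrec dyadic_sq :: "(nat \<Rightarrow> real) \<Rightarrow> nat \<Rightarrow> nat \<Rightarrow> real" where
  "dyadic_sq x 0 a = (x a)\<^sup>2"
| "dyadic_sq x (Suc L) a = (\<Sum>i\<in>{a..<a + 2 ^ L}. x i)\<^sup>2 + dyadic_sq x L a + dyadic_sq x L (a + 2 ^ L)"

lemma dyadic_sq_nonneg: "0 \<le> dyadic_sq x L a"
  by (induction L arbitrary: a) auto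

text \<open>Deterministic core of the Rademacher--Menshov inequality: an initial block splits into at
  most one dyadic block of each size.\<close>

lemma block_sum_sq_le:
  "k \<le> 2 ^ L \<Longrightarrow> (\<Sum>i\<in>{a..<a + k}. x i)\<^sup>2 \<le> (real L + 1) * dyadic_sq x L a"
proof (induction L arbitrary: a k)
  case 0
  then have "k = 0 \<or> k = 1" by auto
  then show ?case by auto
next
  case (Suc L)
  let ?T = "dyadic_sq x L a" and ?T' = "dyadic_sq x L (a + 2 ^ L)" and ?B = "\<Sum>i\<in>{a..<a + 2 ^ L}. x i"
  have nn: "0 \<le> ?T" "0 \<le> ?T'" "0 \<le> ?B\<^sup>2" by (auto simp: dyadic_sq_nonneg)
  show ?case
  proof (cases "k \<le> 2 ^ L")
    case True
    have "(\<Sum>i\<in>{a..<a + k}. x i)\<^sup>2 \<le> (real L + 1) * ?T" by (rule Suc.IH[OF True])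
    also have "\<dots> \<le> (real (Suc L) + 1) * (?B\<^sup>2 + ?T + ?T')" using nn by (intro mult_mono) auto
    finally show ?thesis by simp
  next
    case False
    define k' where "k' = k - 2 ^ L"
    have k: "k = 2 ^ L + k'" "k' \<le> 2 ^ L" using False Suc.prems by (auto simp: k'_def)
    define y where "y = (\<Sum>i\<in>{a + 2 ^ L..<a + 2 ^ L + k'}. x i)"
    have "(\<Sum>i\<in>{a..<a + k}. x i) = ?B + y"
      unfolding y_def k(1) using sum.atLeastLessThan_concat[of a "a + 2 ^ L" "a + 2 ^ L + k'" x] by (simp add: add.assoc)
    moreover have "y\<^sup>2 \<le> (real L + 1) * ?T'" unfolding y_def by (rule Suc.IH[OF k(2)])
    \<comment> \<open>This weight makes the factor grow by exactly one per level: both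
      \<open>?B\<^sup>2\<close> and \<open>?T'\<close> end up with the factor
      \<open>real L + 2\<close>.\<close>
    moreover have "2 * (?B * y) \<le> (real L + 1) * ?B\<^sup>2 + y\<^sup>2 / (real L + 1)"
      by (rule two_mult_le_weighted) simp
    moreover have "y\<^sup>2 / (real L + 1) \<le> ?T'"
      using \<open>y\<^sup>2 \<le> (real L + 1) * ?T'\<close> by (simp add: field_simps)
    moreover have "(?B + y)\<^sup>2 = ?B\<^sup>2 + 2 * (?B * y) + y\<^sup>2" by (simp add: power2_sum)
    ultimately have "(\<Sum>i\<in>{a..<a + k}. x i)\<^sup>2 \<le> (real L + 2) * ?B\<^sup>2 + (real L + 2) * ?T'"
      by (simp add: algebra_simps)
    also have "\<dots> \<le> (real L + 2) * (?B\<^sup>2 + ?T + ?T')" using nn by (simp add: distrib_left)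
    finally show ?thesis by (simp add: algebra_simps)
  qed
qed

text \<open>Each of the \<open>L + 1\<close> levels consists of blocks of total length
  \<open>2 ^ L\<close>.\<close>

lemma (in prob_space) expectation_dyadic_sq:
  assumes int: "\<And>a k. integrable M (\<lambda>\<omega>. (\<Sum>i\<in>{a..<a + k}. x i \<omega>)\<^sup>2)"
    and bd: "\<And>a k. expectation (\<lambda>\<omega>. (\<Sum>i\<in>{a..<a + k}. x i \<omega>)\<^sup>2) \<le> C * real k" and C: "C \<ge> 0"
  shows "integrable M (\<lambda>\<omega>. dyadic_sq (\<lambda>i. x i \<omega>) L a)
    \<and> expectation (\<lambda>\<omega>. dyadic_sq (\<lambda>i. x i \<omega>) L a) \<le> (real L + 1) * 2 ^ L * C"
proof (induction L arbitrary: a)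
  case 0
  then show ?case using int[of a 1] bd[of a 1] by simp
next
  case (Suc L)
  note IH = Suc.IH[of a] Suc.IH[of "a + 2 ^ L"]
  have "expectation (\<lambda>\<omega>. dyadic_sq (\<lambda>i. x i \<omega>) (Suc L) a)
     = expectation (\<lambda>\<omega>. (\<Sum>i\<in>{a..<a + 2 ^ L}. x i \<omega>)\<^sup>2) + expectation (\<lambda>\<omega>. dyadic_sq (\<lambda>i. x i \<omega>) L a)
      + expectation (\<lambda>\<omega>. dyadic_sq (\<lambda>i. x i \<omega>) L (a + 2 ^ L))"
    using IH int[of a "2 ^ L"] by simp
  also have "\<dots> \<le> C * 2 ^ L + (real L + 1) * 2 ^ L * C + (real L + 1) * 2 ^ L * C"
    using IH bd[of a "2 ^ L"] by (intro add_mono) auto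
  also have "\<dots> \<le> (real (Suc L) + 1) * 2 ^ Suc L * C"
    using C by (simp add: algebra_simps)
  finally show ?case using IH int[of a "2 ^ L"] by simp
qed

text \<open>Markov's inequality for the whole weighted series of dyadic sums, so that one event
  serves every block length and every finite set of indices. One factor \<open>real L + 1\<close>
  comes from splitting a block, the other from the number of levels in the expectation.\<close>

lemma (in prob_space) weighted_maximal_inequality:
  fixes x :: "nat \<Rightarrow> nat \<Rightarrow> 'a \<Rightarrow> real"
  assumes int: "\<And>\<iota> a k. integrable M (\<lambda>\<omega>. (\<Sum>i\<in>{a..<a + k}. x \<iota> i \<omega>)\<^sup>2)"
    and bd: "\<And>\<iota> a k. expectation (\<lambda>\<omega>. (\<Sum>i\<in>{a..<a + k}. x \<iota> i \<omega>)\<^sup>2) \<le> C \<iota> * real k"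
    and C: "\<And>\<iota>. 0 \<le> C \<iota>" and w: "\<And>\<iota>. 0 \<le> w \<iota>"
    and c: "\<And>F. finite F \<Longrightarrow> (\<Sum>\<iota>\<in>F. w \<iota> * C \<iota>) \<le> c" "c > 0"
    and n: "n \<le> 2 ^ L" and B: "B > 0"
  shows "\<exists>A\<in>events. prob A \<ge> 1 - 1 / B \<and> (\<forall>\<omega>\<in>A. \<forall>k\<le>n. \<forall>F. finite F \<longrightarrow>
     (\<Sum>\<iota>\<in>F. w \<iota> * (\<Sum>i\<in>{a..<a + k}. x \<iota> i \<omega>)\<^sup>2) \<le> B * ((real L + 1)\<^sup>2 * 2 ^ L * c))"
proof -
  define T where "T = (\<lambda>\<iota> \<omega>. dyadic_sq (\<lambda>i. x \<iota> i \<omega>) L a)"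
  have T: "integrable M (T \<iota>)" "expectation (T \<iota>) \<le> (real L + 1) * 2 ^ L * C \<iota>" for \<iota>
    using expectation_dyadic_sq[OF int bd C, of \<iota> L a] by (auto simp: T_def)
  have T0: "0 \<le> T \<iota> \<omega>" for \<iota> \<omega> by (simp add: T_def dyadic_sq_nonneg)
  have Tm[measurable]: "T \<iota> \<in> borel_measurable M" for \<iota> using T(1) by auto
  \<comment> \<open>Extended nonnegative values allow the infinite sum to be formed before its
    finiteness is known.\<close>
  define Z where "Z = (\<lambda>\<omega>. \<Sum>\<iota>. ennreal (w \<iota> * T \<iota> \<omega>))"
  let ?c = "(real L + 1) * 2 ^ L * c"
  have c0: "?c > 0" using c(2) by simp
  have Zm: "Z \<in> borel_measurable M"
    unfolding Z_def by measurable
  have "(\<integral>\<^sup>+\<omega>. Z \<omega> \<partial>M) = (\<Sum>\<iota>. \<integral>\<^sup>+\<omega>. ennreal (w \<iota> * T \<iota> \<omega>) \<partial>M)"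
    unfolding Z_def by (rule nn_integral_suminf) measurable
  also have "\<dots> \<le> ennreal ?c"
  proof (rule suminf_le_const[OF summableI])
    fix N
    have "(\<integral>\<^sup>+\<omega>. ennreal (w \<iota> * T \<iota> \<omega>) \<partial>M) \<le> ennreal ((real L + 1) * 2 ^ L * (w \<iota> * C \<iota>))" for \<iota>
    proof -
      have "(\<integral>\<^sup>+\<omega>. ennreal (w \<iota> * T \<iota> \<omega>) \<partial>M) = ennreal (w \<iota> * expectation (T \<iota>))"
        using T(1) T0 w by (subst nn_integral_eq_integral) auto
      also have "\<dots> \<le> ennreal ((real L + 1) * 2 ^ L * (w \<iota> * C \<iota>))"
        using mult_left_mono[OF T(2) w, of \<iota> \<iota>] by (intro ennreal_leI) (simp add: mult_ac)
      finally show ?thesis .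
    qed
    then have "(\<Sum>\<iota><N. \<integral>\<^sup>+\<omega>. ennreal (w \<iota> * T \<iota> \<omega>) \<partial>M) \<le> (\<Sum>\<iota><N. ennreal ((real L + 1) * 2 ^ L * (w \<iota> * C \<iota>)))"
      by (rule sum_mono)
    also have "\<dots> = ennreal ((real L + 1) * 2 ^ L * (\<Sum>\<iota><N. w \<iota> * C \<iota>))"
      using w C by (subst sum_ennreal) (auto simp: sum_distrib_left)
    also have "\<dots> \<le> ennreal ?c" using c(1)[of "{..<N}"] by (intro ennreal_leI mult_left_mono) auto
    finally show "(\<Sum>\<iota><N. \<integral>\<^sup>+\<omega>. ennreal (w \<iota> * T \<iota> \<omega>) \<partial>M) \<le> ennreal ?c" .
  qed
  finally have EZ: "(\<integral>\<^sup>+\<omega>. Z \<omega> \<partial>M) \<le> ennreal ?c" .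
  define A where "A = {\<omega> \<in> space M. Z \<omega> < ennreal (B * ?c)}"
  have Am: "A \<in> events" unfolding A_def using Zm by measurable
  have Bc: "B * ?c > 0" using B c0 by simp
  \<comment> \<open>Rescaled to the threshold 1, the form in which Markov's inequality is
    applied.\<close>
  have "emeasure M (space M - A) = emeasure M {\<omega> \<in> space M. 1 \<le> ennreal (1 / (B * ?c)) * Z \<omega>}"
  proof (rule arg_cong[where f = "emeasure M"], rule Collect_cong[THEN trans[rotated]])
    show "space M - A = {\<omega>. \<omega> \<in> space M \<and> ennreal (B * ?c) \<le> Z \<omega>}" by (auto simp: A_def not_less)
    fix \<omega>
    have "ennreal (B * ?c) \<le> Z \<omega> \<longleftrightarrow> 1 \<le> ennreal (1 / (B * ?c)) * Z \<omega>"
    proof (cases "Z \<omega>" rule: ennreal_cases)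
      case (real r)
      then show ?thesis using Bc
        by (simp add: ennreal_mult[symmetric] ennreal_le_iff ennreal_1[symmetric] field_simps del: ennreal_1)
    next
      case top
      then show ?thesis using Bc B c(2) by (simp add: ennreal_mult_top)
    qed
    then show "(\<omega> \<in> space M \<and> ennreal (B * ?c) \<le> Z \<omega>) = (\<omega> \<in> space M \<and> 1 \<le> ennreal (1 / (B * ?c)) * Z \<omega>)" by simp
  qed
  also have "\<dots> \<le> ennreal (1 / (B * ?c)) * (\<integral>\<^sup>+\<omega>. Z \<omega> * indicator (space M) \<omega> \<partial>M)"
    using Zm by (intro nn_integral_Markov_inequality) auto
  also have "\<dots> \<le> ennreal (1 / (B * ?c)) * ennreal ?c"
    using EZ by (intro mult_left_mono) (simp_all cong: nn_integral_cong)
  also have "\<dots> = ennreal (1 / B)"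
    using B c0 c(2) by (simp add: ennreal_mult[symmetric])
  finally have "prob (space M - A) \<le> 1 / B"
    using B by (simp add: emeasure_eq_measure ennreal_le_iff)
  then have "prob A \<ge> 1 - 1 / B" using prob_compl[OF Am] by simp
  moreover have "(\<Sum>\<iota>\<in>F. w \<iota> * (\<Sum>i\<in>{a..<a + k}. x \<iota> i \<omega>)\<^sup>2) \<le> B * ((real L + 1)\<^sup>2 * 2 ^ L * c)"
    if "\<omega> \<in> A" "k \<le> n" "finite F" for \<omega> k F
  proof -
    have "(\<Sum>\<iota>\<in>F. w \<iota> * (\<Sum>i\<in>{a..<a + k}. x \<iota> i \<omega>)\<^sup>2) \<le> (\<Sum>\<iota>\<in>F. w \<iota> * ((real L + 1) * T \<iota> \<omega>))"
      unfolding T_def using that(2) n by (intro sum_mono mult_left_mono block_sum_sq_le w) auto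
    also have "\<dots> = (real L + 1) * (\<Sum>\<iota>\<in>F. w \<iota> * T \<iota> \<omega>)" by (simp add: sum_distrib_left mult_ac)
    also have "\<dots> \<le> (real L + 1) * (B * ?c)"
    proof (rule mult_left_mono)
      have "ennreal (\<Sum>\<iota>\<in>F. w \<iota> * T \<iota> \<omega>) = (\<Sum>\<iota>\<in>F. ennreal (w \<iota> * T \<iota> \<omega>))"
        using w T0 by (subst sum_ennreal) auto
      also have "\<dots> \<le> Z \<omega>" unfolding Z_def by (rule sum_le_suminf) (use that(3) in auto)
      also have "\<dots> \<le> ennreal (B * ?c)" using that(1) by (auto simp: A_def)
      finally show "(\<Sum>\<iota>\<in>F. w \<iota> * T \<iota> \<omega>) \<le> B * ?c" using Bc by (simp add: ennreal_le_iff)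
    qed simp
    finally show ?thesis by (simp add: power2_eq_square mult_ac)
  qed
  ultimately show ?thesis using Am by blast
qed

section \<open>Deterministic expansion of the estimator\<close>

context regularized_regression
begin

text \<open>The subtracted term is the mean of the product under stationarity, by orthonormality of
  \<open>ev\<close> for \<open>V\<close>.\<close>

definition cross :: "'w \<Rightarrow> nat \<Rightarrow> nat \<Rightarrow> nat \<Rightarrow> real" where
  "cross \<omega> i j k = L2_inner (X (int i) \<omega>) (ev j) * L2_inner (X (int i) \<omega>) (ev k) - (if j = k then 1 else 0)"

lemma X_inner_expansion:
  assumes w: "\<omega> \<in> space M" and b: "b \<in> H"
  shows "(\<lambda>N. \<Sum>k<N. coef b k * L2_inner (X i \<omega>) (ev k)) \<longlonglongrightarrow> L2_inner (X i \<omega>) b"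
proof -
  have z: "X i \<omega> \<in> L2" by (rule X_L2[OF w])
  have l: "(1::real) > 0" by simp
  have "(\<lambda>N. L2_inner (partial (coef b) N) (X i \<omega>)) \<longlonglongrightarrow> L2_inner b (X i \<omega>)"
    by (rule bounded_linear_expansion[OF linear_L2_inner[OF z] l L2_inner_bounded[OF z _ l] b])
  then show ?thesis
    by (simp only: linear_partial[OF linear_L2_inner[OF z]] L2_inner_commute[of "X i \<omega>"])
qed

lemma V_expansion:
  assumes f: "f \<in> H" and g: "g \<in> H"
  shows "(\<lambda>N. \<Sum>k<N. coef f k * coef g k) \<longlonglongrightarrow> V f g"
proof -
  have l: "(1::real) > 0" by simp
  have bd: "\<bar>V b g\<bar> \<le> sqrt (V g g) * Kn 1 b" if b: "b \<in> H" for b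
  proof -
    have "sqrt (V b b) \<le> Kn 1 b" unfolding K_norm_def K_inner_def using J_form_nonneg[of m b] by simp
    then have "sqrt (V b b) * sqrt (V g g) \<le> Kn 1 b * sqrt (V g g)" using V_nonneg[OF g] by (intro mult_right_mono) auto
    then show ?thesis using V_Cauchy_Schwarz[OF b g] by (simp add: mult.commute)
  qed
  have "(\<lambda>N. V (partial (coef f) N) g) \<longlonglongrightarrow> V f g"
    by (rule bounded_linear_expansion[OF linear_V[OF g] l bd f])
  then show ?thesis
    by (simp add: linear_partial[OF linear_V[OF g]] V_commute[OF ev_H g] coef_def[symmetric])
qed

lemma weighted_coef_bound:
  assumes f: "f \<in> H" and l: "l > 0"
  shows "(\<Sum>k<N. (coef f k)\<^sup>2 / wt l k) \<le> (Kn l f)\<^sup>2"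
  using Bessel[OF f l, of N] q_pos[OF l] by (simp add: wt_def)

text \<open>Cauchy--Schwarz over pairs of indices: an operator norm is at most the Hilbert--Schmidt
  norm, here \<open>sqrt Q\<close>. The hypothesis is uniform in the truncation \<open>N\<close>
  because \<open>f\<close> and \<open>g\<close> are reached as limits of finite expansions.\<close>

lemma empirical_covariance_deviation:
  assumes w: "\<omega> \<in> space M" and l: "l > 0" and f: "f \<in> H" and g: "g \<in> H"
    and Q: "\<And>N. (\<Sum>(j,i)\<in>{..<N} \<times> {..<N}. wt l j * wt l i * (\<Sum>n=1..k. cross \<omega> n j i)\<^sup>2) \<le> Q"
  shows "\<bar>(\<Sum>n=1..k. L2_inner (X (int n) \<omega>) f * L2_inner (X (int n) \<omega>) g) - real k * V f g\<bar> \<le> sqrt Q * (Kn l f * Kn l g)"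
proof (rule LIMSEQ_le_const2)
  let ?S = "\<lambda>h n N. \<Sum>j<N. coef h j * L2_inner (X (int n) \<omega>) (ev j)"
  let ?E = "\<lambda>N. (\<Sum>n=1..k. ?S f n N * ?S g n N) - real k * (\<Sum>j<N. coef f j * coef g j)"
  show "(\<lambda>N. \<bar>?E N\<bar>) \<longlonglongrightarrow> \<bar>(\<Sum>n=1..k. L2_inner (X (int n) \<omega>) f * L2_inner (X (int n) \<omega>) g) - real k * V f g\<bar>"
    by (intro tendsto_intros X_inner_expansion V_expansion w f g)
  have "\<bar>?E N\<bar> \<le> sqrt Q * (Kn l f * Kn l g)" for N
  proof -
    let ?I = "{..<N} \<times> {..<N}"
    have "?E N = (\<Sum>n=1..k. ?S f n N * ?S g n N - (\<Sum>j<N. coef f j * coef g j))"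
      by (simp add: sum_subtractf)
    also have "\<dots> = (\<Sum>n=1..k. \<Sum>(j,i)\<in>?I. coef f j * coef g i * cross \<omega> n j i)"
    proof (rule sum.cong[OF refl])
      fix n
      have "?S f n N * ?S g n N = (\<Sum>j<N. \<Sum>i<N. coef f j * coef g i * (L2_inner (X (int n) \<omega>) (ev j) * L2_inner (X (int n) \<omega>) (ev i)))"
        by (simp add: sum_product mult_ac)
      moreover have "(\<Sum>j<N. coef f j * coef g j) = (\<Sum>j<N. \<Sum>i<N. coef f j * coef g i * (if j = i then 1 else 0))"
        by (simp add: if_distrib[of "(*) _"] cong: if_cong)
      ultimately show "?S f n N * ?S g n N - (\<Sum>j<N. coef f j * coef g j) = (\<Sum>(j,i)\<in>?I. coef f j * coef g i * cross \<omega> n j i)"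
        by (simp add: sum.cartesian_product[symmetric] cross_def right_diff_distrib sum_subtractf)
    qed
    also have "\<dots> = (\<Sum>(j,i)\<in>?I. coef f j * coef g i * (\<Sum>n=1..k. cross \<omega> n j i))"
      by (subst sum.swap) (simp add: sum_distrib_left split_beta')
    \<comment> \<open>The inserted weights turn the coefficient factor into the two Bessel sums of
      \<open>weighted_coef_bound\<close>.\<close>
    also have "\<dots> = (\<Sum>(j,i)\<in>?I. (sqrt (wt l j * wt l i) * (\<Sum>n=1..k. cross \<omega> n j i)) * (coef f j * coef g i / sqrt (wt l j * wt l i)))"
      using wt_pos[OF l] by (intro sum.cong refl) (auto simp: less_imp_neq[THEN not_sym])
    finally have E: "?E N = (\<Sum>p\<in>?I. (case p of (j,i) \<Rightarrow> sqrt (wt l j * wt l i) * (\<Sum>n=1..k. cross \<omega> n j i)) * (case p of (j,i) \<Rightarrow> coef f j * coef g i / sqrt (wt l j * wt l i)))"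
      by (simp add: split_beta')
    have "(?E N)\<^sup>2 \<le> (\<Sum>p\<in>?I. (case p of (j,i) \<Rightarrow> sqrt (wt l j * wt l i) * (\<Sum>n=1..k. cross \<omega> n j i))\<^sup>2) * (\<Sum>p\<in>?I. (case p of (j,i) \<Rightarrow> coef f j * coef g i / sqrt (wt l j * wt l i))\<^sup>2)"
      unfolding E by (rule Cauchy_Schwarz_ineq_sum)
    also have "(\<Sum>p\<in>?I. (case p of (j,i) \<Rightarrow> sqrt (wt l j * wt l i) * (\<Sum>n=1..k. cross \<omega> n j i))\<^sup>2) = (\<Sum>(j,i)\<in>?I. wt l j * wt l i * (\<Sum>n=1..k. cross \<omega> n j i)\<^sup>2)"
      using wt_pos[OF l] by (intro sum.cong refl) (auto simp: power_mult_distrib less_imp_le)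
    also have "(\<Sum>p\<in>?I. (case p of (j,i) \<Rightarrow> coef f j * coef g i / sqrt (wt l j * wt l i))\<^sup>2) = (\<Sum>j<N. (coef f j)\<^sup>2 / wt l j) * (\<Sum>i<N. (coef g i)\<^sup>2 / wt l i)"
      using wt_pos[OF l] unfolding sum_product sum.cartesian_product
      by (intro sum.cong refl) (auto simp: power_mult_distrib power_divide less_imp_le)
    also have "(\<Sum>(j,i)\<in>?I. wt l j * wt l i * (\<Sum>n=1..k. cross \<omega> n j i)\<^sup>2) * \<dots> \<le> Q * ((Kn l f)\<^sup>2 * (Kn l g)\<^sup>2)"
    proof (intro mult_mono Q weighted_coef_bound f g l)
      show "0 \<le> Q" using Q[of 0] by simp
    qed (use wt_pos[OF l] in \<open>auto intro!: sum_nonneg mult_nonneg_nonneg divide_nonneg_pos less_imp_le[OF wt_pos[OF l]]\<close>)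
    finally have "sqrt ((?E N)\<^sup>2) \<le> sqrt (Q * ((Kn l f)\<^sup>2 * (Kn l g)\<^sup>2))" by (rule real_sqrt_le_mono)
    then show ?thesis using Kn_nonneg[OF f l] Kn_nonneg[OF g l] by (simp add: real_sqrt_mult)
  qed
  then show "\<exists>N. \<forall>n\<ge>N. \<bar>?E n\<bar> \<le> sqrt Q * (Kn l f * Kn l g)" by blast
qed

lemma noise_bound:
  assumes w: "\<omega> \<in> space M" and l: "l > 0" and b: "b \<in> H"
    and R: "\<And>N. (\<Sum>j<N. wt l j * (\<Sum>n=1..k. \<epsilon> (int n) \<omega> * L2_inner (X (int n) \<omega>) (ev j))\<^sup>2) \<le> R"
  shows "\<bar>\<Sum>n=1..k. \<epsilon> (int n) \<omega> * L2_inner (X (int n) \<omega>) b\<bar> \<le> sqrt R * Kn l b"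
proof (rule LIMSEQ_le_const2)
  let ?S = "\<lambda>n N. \<Sum>j<N. coef b j * L2_inner (X (int n) \<omega>) (ev j)"
  let ?E = "\<lambda>N. \<Sum>n=1..k. \<epsilon> (int n) \<omega> * ?S n N"
  let ?x = "\<lambda>j. \<Sum>n=1..k. \<epsilon> (int n) \<omega> * L2_inner (X (int n) \<omega>) (ev j)"
  show "(\<lambda>N. \<bar>?E N\<bar>) \<longlonglongrightarrow> \<bar>\<Sum>n=1..k. \<epsilon> (int n) \<omega> * L2_inner (X (int n) \<omega>) b\<bar>"
    by (intro tendsto_intros X_inner_expansion w b)
  have "\<bar>?E N\<bar> \<le> sqrt R * Kn l b" for N
  proof -
    have "?E N = (\<Sum>j<N. coef b j * ?x j)"
      unfolding sum_distrib_left by (subst sum.swap) (simp add: mult_ac)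
    also have "\<dots> = (\<Sum>j<N. (sqrt (wt l j) * ?x j) * (coef b j / sqrt (wt l j)))"
      using wt_pos[OF l] by (intro sum.cong refl) (auto simp: less_imp_neq[THEN not_sym])
    finally have E: "?E N = (\<Sum>j<N. (sqrt (wt l j) * ?x j) * (coef b j / sqrt (wt l j)))" .
    have "(?E N)\<^sup>2 \<le> (\<Sum>j<N. (sqrt (wt l j) * ?x j)\<^sup>2) * (\<Sum>j<N. (coef b j / sqrt (wt l j))\<^sup>2)"
      unfolding E by (rule Cauchy_Schwarz_ineq_sum)
    also have "\<dots> = (\<Sum>j<N. wt l j * (?x j)\<^sup>2) * (\<Sum>j<N. (coef b j)\<^sup>2 / wt l j)"
      using wt_pos[OF l] by (simp add: power_mult_distrib power_divide less_imp_le)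
    also have "\<dots> \<le> R * (Kn l b)\<^sup>2"
    proof (intro mult_mono R weighted_coef_bound b l)
      show "0 \<le> R" using R[of 0] by simp
    qed (auto intro!: sum_nonneg divide_nonneg_pos wt_pos[OF l])
    finally have "sqrt ((?E N)\<^sup>2) \<le> sqrt (R * (Kn l b)\<^sup>2)" by (rule real_sqrt_le_mono)
    then show ?thesis using Kn_nonneg[OF b l] by (simp add: real_sqrt_mult)
  qed
  then show "\<exists>N. \<forall>n\<ge>N. \<bar>?E n\<bar> \<le> sqrt R * Kn l b" by blast
qed

text \<open>Along the line \<open>b0 + t * b\<close> the criterion is a quadratic polynomial in
  \<open>t\<close> with its minimum at 0, so the linear coefficient vanishes.\<close>

lemma first_order_condition:
  assumes w: "\<omega> \<in> space M" and b0: "is_arg_min (criterion X Y m l k \<omega>) (\<lambda>b. b \<in> H) b0" and b: "b \<in> H"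
  shows "1 / real k * (\<Sum>i=1..k. (Y (int i) \<omega> - L2_inner (X (int i) \<omega>) b0) * L2_inner (X (int i) \<omega>) b) = l * J b0 b"
proof -
  have b0H: "b0 \<in> H" and min: "\<And>b. b \<in> H \<Longrightarrow> criterion X Y m l k \<omega> b0 \<le> criterion X Y m l k \<omega> b"
    using b0 by (auto simp: is_arg_min_def not_less)
  let ?c = "criterion X Y m l k \<omega>"
  let ?e = "\<lambda>i. Y (int i) \<omega> - L2_inner (X (int i) \<omega>) b0" and ?x = "\<lambda>i. L2_inner (X (int i) \<omega>) b"
  let ?A = "l * J b0 b - 1 / real k * (\<Sum>i=1..k. ?e i * ?x i)"
  let ?B = "1 / (2 * real k) * (\<Sum>i=1..k. (?x i)\<^sup>2) + l / 2 * J b b"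
  have crit: "?c h = 1 / (2 * real k) * (\<Sum>i=1..k. (Y (int i) \<omega> - L2_inner (X (int i) \<omega>) h)\<^sup>2) + l / 2 * J h h" for h
    by (simp add: criterion_def L2_inner_def)
  have q: "?c (\<lambda>s. 1 * b0 s + t * b s) = ?c b0 + t * ?A + t\<^sup>2 * ?B" for t
  proof -
    have "(Y (int i) \<omega> - L2_inner (X (int i) \<omega>) (\<lambda>s. 1 * b0 s + t * b s))\<^sup>2 = (?e i)\<^sup>2 - 2 * t * (?e i * ?x i) + t\<^sup>2 * (?x i)\<^sup>2" for i
      unfolding X_inner_lincomb[OF w H_L2[OF b0H] H_L2[OF b]] by (simp add: power2_eq_square algebra_simps)
    then have "(\<Sum>i=1..k. (Y (int i) \<omega> - L2_inner (X (int i) \<omega>) (\<lambda>s. 1 * b0 s + t * b s))\<^sup>2)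
        = (\<Sum>i=1..k. (?e i)\<^sup>2) - 2 * t * (\<Sum>i=1..k. ?e i * ?x i) + t\<^sup>2 * (\<Sum>i=1..k. (?x i)\<^sup>2)"
      by (simp only: sum.distrib sum_subtractf sum_distrib_left)
    moreover have "J (\<lambda>s. 1 * b0 s + t * b s) (\<lambda>s. 1 * b0 s + t * b s) = J b0 b0 + 2 * t * J b0 b + t\<^sup>2 * J b b"
      using form_expand[where B = J and c = 1 and d = t, OF linear_J J_form_commute b0H b] by simp
    \<comment> \<open>For \<open>kk = 0\<close> both sides agree because division by zero yields
      zero.\<close>
    moreover have "1 / (2 * kk) * (S1 - 2 * t * S2 + t\<^sup>2 * S3) + l / 2 * (x + 2 * t * y + t\<^sup>2 * z)
        = 1 / (2 * kk) * S1 + l / 2 * x + t * (l * y - 1 / kk * S2) + t\<^sup>2 * (1 / (2 * kk) * S3 + l / 2 * z)"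
      for kk S1 S2 S3 x y z :: real
      by (cases "kk = 0") (auto simp: field_simps)
    ultimately show ?thesis unfolding crit by (simp only:)
  qed
  have ge: "0 \<le> t * ?A + t\<^sup>2 * ?B" for t
    using min[OF sobolev_lincomb(1)[OF b0H b m, of 1 t]] unfolding q by simp
  have "?A = 0" by (rule linear_coeff_zero[OF ge])
  then show ?thesis by simp
qed

lemma linear_sum:
  assumes "finite I" "\<And>i. i \<in> I \<Longrightarrow> h i \<in> H"
  shows "(\<lambda>s. \<Sum>i\<in>I. c i * h i s) \<in> H" and "linear_on_H F \<Longrightarrow> F (\<lambda>s. \<Sum>i\<in>I. c i * h i s) = (\<Sum>i\<in>I. c i * F (h i))"
proof -
  have "(\<lambda>s. \<Sum>i\<in>I. c i * h i s) \<in> H \<and> (linear_on_H F \<longrightarrow> F (\<lambda>s. \<Sum>i\<in>I. c i * h i s) = (\<Sum>i\<in>I. c i * F (h i)))"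
    using assms
  proof (induction I rule: finite_induct)
    case empty
    have "linear_on_H F \<Longrightarrow> F (\<lambda>_. 0) = 0"
      using linear_partial[of F "\<lambda>_. 0" 0] by (simp add: partial_def)
    then show ?case using zero_sobolev[OF m] by simp
  next
    case (insert x I)
    then have IH: "(\<lambda>s. \<Sum>i\<in>I. c i * h i s) \<in> H" "linear_on_H F \<longrightarrow> F (\<lambda>s. \<Sum>i\<in>I. c i * h i s) = (\<Sum>i\<in>I. c i * F (h i))"
      and hx: "h x \<in> H" by auto
    have eq: "(\<lambda>s. \<Sum>i\<in>insert x I. c i * h i s) = (\<lambda>s. c x * h x s + 1 * (\<Sum>i\<in>I. c i * h i s))"
      using insert by simp
    show ?case unfolding eq
      using sobolev_lincomb(1)[OF hx IH(1) m, of "c x" 1] linear_on_HD[OF _ hx IH(1), of F "c x" 1] IH(2) insert(1,2) by auto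
  qed
  then show "(\<lambda>s. \<Sum>i\<in>I. c i * h i s) \<in> H" and "linear_on_H F \<Longrightarrow> F (\<lambda>s. \<Sum>i\<in>I. c i * h i s) = (\<Sum>i\<in>I. c i * F (h i))"
    by auto
qed

text \<open>The optimality condition is tested twice. With the estimation error
  \<open>\<Delta>\<close> it gives an a priori bound, the quadratic deviation term being absorbed
  through \<open>small\<close>; with the remainder \<open>U\<close> itself it gives the
  claim.\<close>

theorem Bahadur_deterministic:
  assumes w: "\<omega> \<in> space M" and l: "l > 0" and \<beta>0: "\<beta>0 \<in> H" and k: "k \<ge> 1"
    and bh: "is_arg_min (criterion X (response X \<epsilon> \<beta>0) m l k \<omega>) (\<lambda>b. b \<in> H) bh"
    and Q: "\<And>N. (\<Sum>(j,i)\<in>{..<N} \<times> {..<N}. wt l j * wt l i * (\<Sum>n=1..k. cross \<omega> n j i)\<^sup>2) \<le> Q"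
    and R: "\<And>N. (\<Sum>j<N. wt l j * (\<Sum>n=1..k. \<epsilon> (int n) \<omega> * L2_inner (X (int n) \<omega>) (ev j))\<^sup>2) \<le> R"
    and small: "sqrt Q / real k \<le> 1 / 2" and n: "n > 0"
    and \<nu>: "0 \<le> \<nu>" "\<nu> \<le> 1" "real k \<le> real n * \<nu>" "real n * \<nu> \<le> real k + 1"
  shows "\<bar>Kn l (\<lambda>s. \<nu> * (bh s - \<beta>0 s + W_op M X m l \<beta>0 s)
       - 1 / real n * (\<Sum>i=1..k. \<epsilon> (int i) \<omega> * tau M X m l (X (int i) \<omega>) s))\<bar>
     \<le> sqrt Q / real k * (2 * (sqrt R / real k + sqrt l * sqrt (J \<beta>0 \<beta>0))) + sqrt R / (real n * real k)"
proof -
  have bhH: "bh \<in> H" using bh by (simp add: is_arg_min_def)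
  define \<Delta> where "\<Delta> = (\<lambda>s. bh s - \<beta>0 s)"
  have \<Delta>: "\<Delta> \<in> H" unfolding \<Delta>_def by (rule H_diff[OF bhH \<beta>0])
  define E where "E = (\<lambda>b. \<Sum>i=1..k. \<epsilon> (int i) \<omega> * L2_inner (X (int i) \<omega>) b)"
  define G where "G = (\<lambda>b. \<Sum>n=1..k. L2_inner (X (int n) \<omega>) \<Delta> * L2_inner (X (int n) \<omega>) b)"
  have k0: "real k > 0" using k by simp
  have Q0: "0 \<le> Q" "0 \<le> R" using Q[of 0] R[of 0] by auto
  \<comment> \<open>By \<open>W_spec\<close> the left side is the \<open>K\<close>-product of
    \<open>\<Delta> + W_op M X m l \<beta>0\<close> with \<open>b\<close>. The bracket on the right
    is the deviation of the empirical covariance form at \<open>\<Delta>\<close> and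
    \<open>b\<close>.\<close>
  have foc: "K l \<Delta> b + l * J \<beta>0 b = (V \<Delta> b - G b / real k) + E b / real k" if b: "b \<in> H" for b
  proof -
    have d: "L2_inner (X (int i) \<omega>) \<Delta> = L2_inner (X (int i) \<omega>) bh - L2_inner (X (int i) \<omega>) \<beta>0" for i
      using X_inner_lincomb[OF w H_L2[OF bhH] H_L2[OF \<beta>0], of "int i" 1 "-1"] by (simp add: \<Delta>_def)
    have r: "response X \<epsilon> \<beta>0 (int i) \<omega> = L2_inner (X (int i) \<omega>) \<beta>0 + \<epsilon> (int i) \<omega>" for i
      by (simp add: response_def L2_inner_def)
    have e: "(response X \<epsilon> \<beta>0 (int i) \<omega> - L2_inner (X (int i) \<omega>) bh) * L2_inner (X (int i) \<omega>) b
       = \<epsilon> (int i) \<omega> * L2_inner (X (int i) \<omega>) b - L2_inner (X (int i) \<omega>) \<Delta> * L2_inner (X (int i) \<omega>) b" for i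
      unfolding r d by (simp add: algebra_simps)
    have "l * J bh b = E b / real k - G b / real k"
      using first_order_condition[OF w bh b] unfolding e by (simp add: sum_subtractf E_def G_def diff_divide_distrib)
    moreover have "J \<Delta> b = J bh b - J \<beta>0 b"
      unfolding \<Delta>_def by (rule linear_diff[OF linear_J[OF b] bhH \<beta>0])
    then have "l * J bh b = l * J \<Delta> b + l * J \<beta>0 b" by (simp add: right_diff_distrib)
    ultimately show ?thesis by (simp add: K_inner_def)
  qed
  have dev: "\<bar>V \<Delta> b - G b / real k\<bar> \<le> sqrt Q / real k * (Kn l \<Delta> * Kn l b)" if b: "b \<in> H" for b
  proof -
    have "\<bar>G b - real k * V \<Delta> b\<bar> \<le> sqrt Q * (Kn l \<Delta> * Kn l b)"
      unfolding G_def by (rule empirical_covariance_deviation[OF w l \<Delta> b Q])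
    then have "\<bar>G b - real k * V \<Delta> b\<bar> / real k \<le> sqrt Q * (Kn l \<Delta> * Kn l b) / real k"
      using k0 by (intro divide_right_mono) auto
    moreover have "V \<Delta> b - G b / real k = - ((G b - real k * V \<Delta> b) / real k)"
      using k0 by (simp add: field_simps)
    then have "\<bar>V \<Delta> b - G b / real k\<bar> = \<bar>G b - real k * V \<Delta> b\<bar> / real k"
      using k0 by (simp only: abs_minus_cancel abs_divide abs_of_pos)
    ultimately show ?thesis by simp
  qed
  have noise: "\<bar>E b\<bar> \<le> sqrt R * Kn l b" if b: "b \<in> H" for b
    unfolding E_def by (rule noise_bound[OF w l b R])
  \<comment> \<open>The factor 2 results from moving half of the squared norm to the left.\<close>
  have \<Delta>n: "Kn l \<Delta> \<le> 2 * (sqrt R / real k + sqrt l * sqrt (J \<beta>0 \<beta>0))"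
  proof (cases "Kn l \<Delta> = 0")
    case True
    then show ?thesis using Q0 l by (simp add: J_form_nonneg)
  next
    case False
    then have pos: "Kn l \<Delta> > 0" using Kn_nonneg[OF \<Delta> l] by simp
    have "(Kn l \<Delta>)\<^sup>2 = (V \<Delta> \<Delta> - G \<Delta> / real k) + E \<Delta> / real k - l * J \<beta>0 \<Delta>"
      using foc[OF \<Delta>] Kn_sq[OF \<Delta> l] by simp
    also have "\<dots> \<le> sqrt Q / real k * (Kn l \<Delta> * Kn l \<Delta>) + sqrt R / real k * Kn l \<Delta> + sqrt l * sqrt (J \<beta>0 \<beta>0) * Kn l \<Delta>"
    proof -
      have "E \<Delta> / real k \<le> sqrt R / real k * Kn l \<Delta>"
        using noise[OF \<Delta>] k0 by (simp add: divide_right_mono abs_le_iff)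
      moreover have "- (l * J \<beta>0 \<Delta>) \<le> sqrt l * sqrt (J \<beta>0 \<beta>0) * Kn l \<Delta>" using lJ_bounded[OF \<beta>0 \<Delta> l] by linarith
      moreover have "V \<Delta> \<Delta> - G \<Delta> / real k \<le> sqrt Q / real k * (Kn l \<Delta> * Kn l \<Delta>)" using dev[OF \<Delta>] by linarith
      ultimately show ?thesis by linarith
    qed
    also have "\<dots> \<le> 1 / 2 * (Kn l \<Delta> * Kn l \<Delta>) + sqrt R / real k * Kn l \<Delta> + sqrt l * sqrt (J \<beta>0 \<beta>0) * Kn l \<Delta>"
      using small by (intro add_right_mono mult_right_mono) auto
    finally have "(Kn l \<Delta>) * (Kn l \<Delta>) \<le> 2 * (sqrt R / real k + sqrt l * sqrt (J \<beta>0 \<beta>0)) * Kn l \<Delta>"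
      unfolding power2_eq_square by (rule quadratic_absorb)
    then show ?thesis using pos by (rule mult_right_le_imp_le)
  qed
  let ?\<tau> = "\<lambda>i. tau M X m l (X (int i) \<omega>)"
  define N where "N = (\<lambda>s. \<Sum>i=1..k. \<epsilon> (int i) \<omega> * ?\<tau> i s)"
  have \<tau>H: "?\<tau> i \<in> H" for i by (rule tau_spec(1)[OF X_L2[OF w] l])
  have NH: "N \<in> H" unfolding N_def by (rule linear_sum(1)) (auto simp: \<tau>H)
  have NK: "K l N b = E b" if b: "b \<in> H" for b
  proof -
    have "K l N b = (\<Sum>i=1..k. \<epsilon> (int i) \<omega> * K l (?\<tau> i) b)"
      unfolding N_def by (rule linear_sum(2)) (auto simp: \<tau>H linear_K[OF b])
    then show ?thesis by (simp add: E_def tau_spec(2)[OF X_L2[OF w] l b] L2_inner_commute[of b])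
  qed
  let ?W = "W_op M X m l \<beta>0"
  note W = W_spec[OF \<beta>0 l]
  define U1 where "U1 = (\<lambda>s. 1 * \<Delta> s + 1 * ?W s)"
  have U1: "U1 \<in> H" unfolding U1_def by (rule sobolev_lincomb(1)[OF \<Delta> W(1) m])
  define U where "U = (\<lambda>s. \<nu> * U1 s + (- (1 / real n)) * N s)"
  have U: "U \<in> H" unfolding U_def by (rule sobolev_lincomb(1)[OF U1 NH m])
  \<comment> \<open>The noise cancels up to the factor \<open>\<nu> / real k - 1 / real n\<close>,
    which measures how far \<open>real k\<close> is from \<open>real n * \<nu>\<close>. As that is
    at most one, the factor is at most \<open>1 / (real n * real k)\<close>.\<close>
  have "K l U b = \<nu> * (V \<Delta> b - G b / real k) + (\<nu> / real k - 1 / real n) * E b" if b: "b \<in> H" for b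
  proof -
    have "K l U b = \<nu> * K l U1 b - 1 / real n * K l N b"
      using linear_on_HD[OF linear_K[OF b] U1 NH, of l \<nu> "- (1 / real n)"] by (simp add: U_def)
    also have "K l U1 b = K l \<Delta> b + l * J \<beta>0 b"
      using linear_on_HD[OF linear_K[OF b] \<Delta> W(1), of l 1 1] W(2)[OF b] by (simp add: U1_def)
    finally show ?thesis unfolding NK[OF b] foc[OF b] by (simp add: algebra_simps)
  qed
  from this[OF U] have "(Kn l U)\<^sup>2 \<le> \<bar>\<nu>\<bar> * \<bar>V \<Delta> U - G U / real k\<bar> + \<bar>\<nu> / real k - 1 / real n\<bar> * \<bar>E U\<bar>"
    unfolding Kn_sq[OF U l] using abs_ge_self[of "\<nu> * (V \<Delta> U - G U / real k)"] abs_ge_self[of "(\<nu> / real k - 1 / real n) * E U"]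
    by (simp add: abs_mult)
  also have "\<dots> \<le> 1 * (sqrt Q / real k * (Kn l \<Delta> * Kn l U)) + 1 / (real n * real k) * (sqrt R * Kn l U)"
  proof (intro add_mono mult_mono dev U noise)
    have "\<nu> / real k - 1 / real n = (real n * \<nu> - real k) / (real n * real k)"
      using k0 n by (simp add: field_simps)
    then show "\<bar>\<nu> / real k - 1 / real n\<bar> \<le> 1 / (real n * real k)"
      using \<nu>(3,4) k0 n by (simp add: divide_right_mono)
  qed (use \<nu> in auto)
  finally have "Kn l U * Kn l U \<le> (sqrt Q / real k * Kn l \<Delta> + sqrt R / (real n * real k)) * Kn l U"
    by (simp add: power2_eq_square algebra_simps)
  then have "Kn l U \<le> sqrt Q / real k * Kn l \<Delta> + sqrt R / (real n * real k)"
  proof (cases "Kn l U = 0")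
    case True
    have "0 \<le> sqrt Q / real k * Kn l \<Delta> + sqrt R / (real n * real k)"
      using Kn_nonneg[OF \<Delta> l] Q0 by (intro add_nonneg_nonneg mult_nonneg_nonneg divide_nonneg_nonneg) auto
    then show ?thesis unfolding True .
  next
    case False
    then have "Kn l U > 0" using Kn_nonneg[OF U l] by simp
    with \<open>Kn l U * Kn l U \<le> _\<close> show ?thesis by (rule mult_right_le_imp_le)
  qed
  also have "\<dots> \<le> sqrt Q / real k * (2 * (sqrt R / real k + sqrt l * sqrt (J \<beta>0 \<beta>0))) + sqrt R / (real n * real k)"
    using \<Delta>n Q0 k0 by (intro add_right_mono mult_left_mono) auto
  finally have "\<bar>Kn l U\<bar> \<le> sqrt Q / real k * (2 * (sqrt R / real k + sqrt l * sqrt (J \<beta>0 \<beta>0))) + sqrt R / (real n * real k)"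
    using Kn_nonneg[OF U l] by simp
  then show ?thesis unfolding U_def U1_def \<Delta>_def N_def by simp
qed

end

section \<open>Innovations and their coupled copies\<close>

lemma sets_PiM_cylinder:
  assumes "finite J" "\<And>i. i \<in> J \<Longrightarrow> E i \<in> sets T"
  shows "{a \<in> space (PiM UNIV (\<lambda>_. T)). \<forall>i\<in>J. a i \<in> E i} \<in> sets (PiM UNIV (\<lambda>_. T))"
proof (rule sets.sets_Collect_finite_All)
  fix i assume "i \<in> J"
  then have "(\<lambda>a. a i) -` E i \<inter> space (PiM UNIV (\<lambda>_. T)) \<in> sets (PiM UNIV (\<lambda>_. T))"
    by (intro measurable_sets[OF measurable_component_singleton] assms) auto
  moreover have "(\<lambda>a. a i) -` E i \<inter> space (PiM UNIV (\<lambda>_. T)) = {a \<in> space (PiM UNIV (\<lambda>_. T)). a i \<in> E i}" by auto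
  ultimately show "{a \<in> space (PiM UNIV (\<lambda>_. T)). a i \<in> E i} \<in> sets (PiM UNIV (\<lambda>_. T))" by simp
qed (rule assms)

lemma (in prob_space) prob_cylinder:
  assumes A: "indep_vars (\<lambda>_. T) A UNIV" and J: "finite J" and E: "\<And>i. i \<in> J \<Longrightarrow> E i \<in> sets T"
  shows "prob {\<omega> \<in> space M. \<forall>i\<in>J. A i \<omega> \<in> E i} = (\<Prod>i\<in>J. prob {\<omega> \<in> space M. A i \<omega> \<in> E i})"
proof (cases "J = {}")
  case True
  then show ?thesis by (simp add: prob_space)
next
  case False
  have "indep_sets (\<lambda>i. {A i -` E \<inter> space M | E. E \<in> sets T}) UNIV"
    using A by (auto simp: indep_vars_def2)
  then have "prob (\<Inter>i\<in>J. {\<omega> \<in> space M. A i \<omega> \<in> E i}) = (\<Prod>i\<in>J. prob {\<omega> \<in> space M. A i \<omega> \<in> E i})"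
    by (rule indep_setsD) (use False J E in \<open>auto simp: vimage_def Int_def conj_commute\<close>)
  moreover have "(\<Inter>i\<in>J. {\<omega> \<in> space M. A i \<omega> \<in> E i}) = {\<omega> \<in> space M. \<forall>i\<in>J. A i \<omega> \<in> E i}"
    using False by auto
  ultimately show ?thesis by simp
qed

lemma (in prob_space) indep_elements_compose:
  assumes FG: "indep_elements M N F N' G" and f: "f \<in> measurable N K" and g: "g \<in> measurable N' K'"
  shows "indep_elements M K (\<lambda>\<omega>. f (F \<omega>)) K' (\<lambda>\<omega>. g (G \<omega>))"
proof -
  have Fm: "F \<in> measurable M N" and Gm: "G \<in> measurable M N'"
    and ind: "indep_set {F -` A \<inter> space M | A. A \<in> sets N} {G -` B \<inter> space M | B. B \<in> sets N'}"
    using FG by (auto simp: indep_elements_def)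
  have sub1: "{(\<lambda>\<omega>. f (F \<omega>)) -` A \<inter> space M | A. A \<in> sets K} \<subseteq> {F -` A \<inter> space M | A. A \<in> sets N}"
  proof safe
    fix A assume "A \<in> sets K"
    then have "f -` A \<inter> space N \<in> sets N" by (rule measurable_sets[OF f])
    moreover have "(\<lambda>\<omega>. f (F \<omega>)) -` A \<inter> space M = F -` (f -` A \<inter> space N) \<inter> space M"
      using measurable_space[OF Fm] by auto
    ultimately show "\<exists>Aa. (\<lambda>\<omega>. f (F \<omega>)) -` A \<inter> space M = F -` Aa \<inter> space M \<and> Aa \<in> sets N" by blast
  qed
  have sub2: "{(\<lambda>\<omega>. g (G \<omega>)) -` A \<inter> space M | A. A \<in> sets K'} \<subseteq> {G -` A \<inter> space M | A. A \<in> sets N'}"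
  proof safe
    fix A assume "A \<in> sets K'"
    then have "g -` A \<inter> space N' \<in> sets N'" by (rule measurable_sets[OF g])
    moreover have "(\<lambda>\<omega>. g (G \<omega>)) -` A \<inter> space M = G -` (g -` A \<inter> space N') \<inter> space M"
      using measurable_space[OF Gm] by auto
    ultimately show "\<exists>Aa. (\<lambda>\<omega>. g (G \<omega>)) -` A \<inter> space M = G -` Aa \<inter> space M \<and> Aa \<in> sets N'" by blast
  qed
  have "indep_set {(\<lambda>\<omega>. f (F \<omega>)) -` A \<inter> space M | A. A \<in> sets K} {(\<lambda>\<omega>. g (G \<omega>)) -` A \<inter> space M | A. A \<in> sets K'}"
    using ind sub1 sub2 unfolding indep_sets2_eq by (meson subsetD subset_trans)
  then show ?thesis
    unfolding indep_elements_def using measurable_compose[OF Fm f] measurable_compose[OF Gm g] by blast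
qed

lemma (in prob_space) indep_elements_imp_indep_var:
  assumes "indep_elements M N F N G"
  shows "indep_var N F N G"
proof -
  have "(\<lambda>b. {case_bool F G b -` A \<inter> space M | A. A \<in> sets (case_bool N N b)})
      = case_bool {F -` A \<inter> space M | A. A \<in> sets N} {G -` B \<inter> space M | B. B \<in> sets N}"
    by (auto simp: fun_eq_iff split: bool.split)
  then show ?thesis
    using assms unfolding indep_elements_def indep_var_def indep_vars_def2 indep_set_def
    by (auto split: bool.split)
qed

text \<open>Independence inside each family and independence of the two families as whole sequences
  combine into one independent family over the sum type. Later arguments about pasts and copies are
  then reindexing.\<close>

lemma (in prob_space) indep_vars_case_sum:
  fixes A :: "'i \<Rightarrow> 'a \<Rightarrow> 'b" and B :: "'j \<Rightarrow> 'a \<Rightarrow> 'b"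
  assumes A: "indep_vars (\<lambda>_. T) A UNIV" and B: "indep_vars (\<lambda>_. T) B UNIV"
    and AB: "indep_elements M (PiM UNIV (\<lambda>_. T)) (\<lambda>\<omega> i. A i \<omega>) (PiM UNIV (\<lambda>_. T)) (\<lambda>\<omega> j. B j \<omega>)"
  shows "indep_vars (\<lambda>_. T) (case_sum A B) UNIV"
  unfolding indep_vars_def2
proof (intro conjI ballI)
  have Am: "A i \<in> measurable M T" and Bm: "B j \<in> measurable M T" for i j
    using A B by (auto simp: indep_vars_def2)
  fix x show "random_variable T (case_sum A B x)" using Am Bm by (cases x) auto
next
  have Am: "A i \<in> measurable M T" and Bm: "B j \<in> measurable M T" for i j
    using A B by (auto simp: indep_vars_def2)
  let ?F = "\<lambda>x. {case_sum A B x -` E \<inter> space M | E. E \<in> sets T}"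
  show "indep_sets ?F UNIV"
  proof (rule indep_setsI)
    fix x show "?F x \<subseteq> events" using Am Bm by (cases x) (auto intro: measurable_sets)
  next
    fix Q J assume J: "J \<noteq> {}" "J \<subseteq> UNIV" "finite (J :: ('i + 'j) set)" and Q: "\<forall>x\<in>J. Q x \<in> ?F x"
    have "\<forall>x\<in>J. \<exists>E. E \<in> sets T \<and> Q x = case_sum A B x -` E \<inter> space M" using Q by auto
    then obtain E where E: "\<forall>x\<in>J. E x \<in> sets T \<and> Q x = case_sum A B x -` E x \<inter> space M"
      by (rule bchoice[THEN exE])
    \<comment> \<open>A finite set of mixed indices splits into its two sides; each side gives a
      cylinder event of one sequence.\<close>
    define JA where "JA = {i. Inl i \<in> J}" define JB where "JB = {j. Inr j \<in> J}"
    have fin: "finite JA" "finite JB"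
      unfolding JA_def JB_def
      using finite_vimageI[OF J(3), of Inl] finite_vimageI[OF J(3), of Inr] by (auto simp: vimage_def)
    have Jeq: "J = Inl ` JA \<union> Inr ` JB"
    proof (intro set_eqI)
      fix x show "x \<in> J \<longleftrightarrow> x \<in> Inl ` JA \<union> Inr ` JB" by (cases x) (auto simp: JA_def JB_def)
    qed
    have EA: "E (Inl i) \<in> sets T" if "i \<in> JA" for i using E that by (auto simp: JA_def)
    have EB: "E (Inr i) \<in> sets T" if "i \<in> JB" for i using E that by (auto simp: JB_def)
    let ?SA = "{a \<in> space (PiM UNIV (\<lambda>_. T)). \<forall>i\<in>JA. a i \<in> E (Inl i)}"
    let ?SB = "{a \<in> space (PiM UNIV (\<lambda>_. T)). \<forall>i\<in>JB. a i \<in> E (Inr i)}"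
    let ?CA = "{\<omega> \<in> space M. \<forall>i\<in>JA. A i \<omega> \<in> E (Inl i)}"
    let ?CB = "{\<omega> \<in> space M. \<forall>i\<in>JB. B i \<omega> \<in> E (Inr i)}"
    have vA: "(\<lambda>\<omega> i. A i \<omega>) \<in> measurable M (PiM UNIV (\<lambda>_. T))" and vB: "(\<lambda>\<omega> i. B i \<omega>) \<in> measurable M (PiM UNIV (\<lambda>_. T))"
      using AB by (auto simp: indep_elements_def)
    have CA: "?CA = (\<lambda>\<omega> i. A i \<omega>) -` ?SA \<inter> space M" using measurable_space[OF vA] by auto
    have CB: "?CB = (\<lambda>\<omega> i. B i \<omega>) -` ?SB \<inter> space M" using measurable_space[OF vB] by auto
    have SA: "?SA \<in> sets (PiM UNIV (\<lambda>_. T))" by (rule sets_PiM_cylinder[OF fin(1) EA])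
    have SB: "?SB \<in> sets (PiM UNIV (\<lambda>_. T))" by (rule sets_PiM_cylinder[OF fin(2) EB])
    have QA: "Q (Inl i) = {\<omega> \<in> space M. A i \<omega> \<in> E (Inl i)}" if "i \<in> JA" for i
      using E that by (auto simp: JA_def)
    have QB: "Q (Inr i) = {\<omega> \<in> space M. B i \<omega> \<in> E (Inr i)}" if "i \<in> JB" for i
      using E that by (auto simp: JB_def)
    have "(\<Inter>x\<in>J. Q x) = ?CA \<inter> ?CB"
    proof
      show "?CA \<inter> ?CB \<subseteq> (\<Inter>x\<in>J. Q x)" unfolding Jeq using QA QB by auto
      obtain x where x: "x \<in> J" using J(1) by blast
      have "(\<Inter>x\<in>J. Q x) \<subseteq> space M" using x E by fastforce
      then show "(\<Inter>x\<in>J. Q x) \<subseteq> ?CA \<inter> ?CB" unfolding Jeq using QA QB by fastforce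
    qed
    also have "prob (?CA \<inter> ?CB) = prob ?CA * prob ?CB"
    proof (rule indep_setD)
      show "indep_set {(\<lambda>\<omega> i. A i \<omega>) -` S \<inter> space M | S. S \<in> sets (PiM UNIV (\<lambda>_. T))} {(\<lambda>\<omega> i. B i \<omega>) -` S \<inter> space M | S. S \<in> sets (PiM UNIV (\<lambda>_. T))}"
        using AB by (simp add: indep_elements_def)
    qed (use CA CB SA SB in blast)+
    also have "prob ?CA = (\<Prod>i\<in>JA. prob (Q (Inl i)))"
      by (subst prob_cylinder[where E = "\<lambda>i. E (Inl i)", OF A fin(1) EA]) (auto simp: QA)
    also have "prob ?CB = (\<Prod>i\<in>JB. prob (Q (Inr i)))"
      by (subst prob_cylinder[where E = "\<lambda>i. E (Inr i)", OF B fin(2) EB]) (auto simp: QB)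
    also have "(\<Prod>i\<in>JA. prob (Q (Inl i))) * (\<Prod>i\<in>JB. prob (Q (Inr i))) = (\<Prod>x\<in>J. prob (Q x))"
      unfolding Jeq using fin by (subst prod.union_disjoint) (auto simp: prod.reindex)
    finally show "prob (\<Inter>x\<in>J. Q x) = (\<Prod>x\<in>J. prob (Q x))" .
  qed
qed

locale iid_with_copies = prob_space M for M :: "'w measure" +
  fixes T :: "'b measure" and \<zeta> :: "int \<Rightarrow> 'w \<Rightarrow> 'b" and \<zeta>s :: "int \<Rightarrow> nat \<Rightarrow> int \<Rightarrow> 'w \<Rightarrow> 'b"
  assumes ind: "indep_vars (\<lambda>_. T) \<zeta> UNIV" and law: "\<And>i. distr M T (\<zeta> i) = distr M T (\<zeta> 0)"
    and inds: "indep_vars (\<lambda>_. T) (\<lambda>(i, l, k). \<zeta>s i l k) UNIV"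
    and laws: "\<And>i l k. distr M T (\<zeta>s i l k) = distr M T (\<zeta> 0)"
    and indc: "indep_elements M (PiM UNIV (\<lambda>_. T)) (\<lambda>\<omega> i. \<zeta> i \<omega>)
      (PiM UNIV (\<lambda>_. T)) (\<lambda>\<omega> (i, l, k). \<zeta>s i l k \<omega>)"
begin

definition joint :: "int + (int \<times> nat \<times> int) \<Rightarrow> 'w \<Rightarrow> 'b" where
  "joint = case_sum \<zeta> (\<lambda>(i, l, k). \<zeta>s i l k)"

lemma indep_joint: "indep_vars (\<lambda>_. T) joint UNIV"
  unfolding joint_def
proof (rule indep_vars_case_sum[OF ind inds])
  have "(\<lambda>\<omega> (i, l, k). \<zeta>s i l k \<omega>) = (\<lambda>\<omega> j. (case j of (i, l, k) \<Rightarrow> \<zeta>s i l k) \<omega>)"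
    by (auto simp: fun_eq_iff)
  then show "indep_elements M (PiM UNIV (\<lambda>_. T)) (\<lambda>\<omega> i. \<zeta> i \<omega>)
      (PiM UNIV (\<lambda>_. T)) (\<lambda>\<omega> j. (case j of (i, l, k) \<Rightarrow> \<zeta>s i l k) \<omega>)" using indc by simp
qed

lemma joint_measurable: "joint x \<in> measurable M T"
  using indep_joint by (auto simp: indep_vars_def2)

lemma distr_joint: "distr M T (joint x) = distr M T (\<zeta> 0)"
  using law laws by (auto simp: joint_def split: sum.split)

lemma reindex_measurable: "(\<lambda>\<omega> j. joint (idx j) \<omega>) \<in> measurable M (PiM UNIV (\<lambda>_. T))"
  by (intro measurable_PiM_single') (auto intro: joint_measurable measurable_space[OF joint_measurable])

text \<open>An injective selection from an i.i.d. family has the product law. Pasts, coupled pasts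
  and their joint family are such selections, so their laws do not depend on the time.\<close>

lemma distr_reindex:
  assumes "inj idx"
  shows "distr M (PiM UNIV (\<lambda>_. T)) (\<lambda>\<omega> j. joint (idx j) \<omega>) = PiM UNIV (\<lambda>_. distr M T (\<zeta> 0))"
proof -
  let ?P = "distr M T (\<zeta> 0)"
  have z0: "\<zeta> 0 \<in> measurable M T" using ind by (auto simp: indep_vars_def2)
  have pP: "prob_space ?P" by (rule prob_space_distr[OF z0])
  have "distr M (PiM UNIV (\<lambda>_. T)) (\<lambda>\<omega>. \<lambda>i\<in>UNIV. joint i \<omega>) = PiM UNIV (\<lambda>i. distr M T (joint i))"
    using indep_joint by (subst (asm) indep_vars_iff_distr_eq_PiM) (auto intro: joint_measurable)
  then have full: "distr M (PiM UNIV (\<lambda>_. T)) (\<lambda>\<omega> i. joint i \<omega>) = PiM UNIV (\<lambda>_. ?P)"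
    by (simp add: distr_joint restrict_UNIV)
  have setsP: "sets (PiM UNIV (\<lambda>_. ?P)) = sets (PiM UNIV (\<lambda>_. T))" for U :: "'x set"
    by (intro sets_PiM_cong) auto
  have rm: "(\<lambda>a j. a (idx j)) \<in> measurable (PiM UNIV (\<lambda>_. T)) (PiM UNIV (\<lambda>_. T))"
    by (intro measurable_PiM_single') (auto simp: space_PiM)
  have "distr M (PiM UNIV (\<lambda>_. T)) (\<lambda>\<omega> j. joint (idx j) \<omega>)
      = distr (distr M (PiM UNIV (\<lambda>_. T)) (\<lambda>\<omega> i. joint i \<omega>)) (PiM UNIV (\<lambda>_. T)) (\<lambda>a j. a (idx j))"
    using reindex_measurable[of "\<lambda>x. x"] by (subst distr_distr[OF rm]) (auto simp: o_def)
  also have "\<dots> = distr (PiM UNIV (\<lambda>_. ?P)) (PiM UNIV (\<lambda>_. ?P)) (\<lambda>a. \<lambda>j\<in>UNIV. a (idx j))"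
    unfolding full restrict_UNIV by (rule distr_cong) (auto intro!: sets_PiM_cong)
  also have "\<dots> = PiM UNIV (\<lambda>_. ?P)"
    using distr_PiM_reindex[of UNIV "\<lambda>_. ?P" idx UNIV] pP assms by simp
  finally show ?thesis .
qed

lemma indep_reindex:
  assumes "range idx \<inter> range idx' = {}"
  shows "indep_var (PiM UNIV (\<lambda>_. T)) (\<lambda>\<omega> j. joint (idx j) \<omega>) (PiM UNIV (\<lambda>_. T)) (\<lambda>\<omega> j. joint (idx' j) \<omega>)"
proof -
  have rm: "(\<lambda>a j. a (f j)) \<in> measurable (PiM (range f) (\<lambda>_. T)) (PiM UNIV (\<lambda>_. T))" for f :: "'x \<Rightarrow> int + (int \<times> nat \<times> int)"
    by (intro measurable_PiM_single') (auto simp: space_PiM PiE_def Pi_def)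
  have "indep_var (PiM (range idx) (\<lambda>_. T)) (\<lambda>\<omega>. restrict (\<lambda>i. joint i \<omega>) (range idx))
     (PiM (range idx') (\<lambda>_. T)) (\<lambda>\<omega>. restrict (\<lambda>i. joint i \<omega>) (range idx'))"
    by (rule indep_var_restrict[OF indep_joint assms]) auto
  from indep_var_compose[OF this rm rm] show ?thesis by (simp add: o_def)
qed

text \<open>\<open>Inl j\<close> is the innovation \<open>j\<close> steps back from
  \<open>i\<close>, \<open>Inr j\<close> the copy that can replace it. Past and coupled past thereby
  become fixed functions of one i.i.d. family, whose law does not depend on
  \<open>i\<close>.\<close>

definition pair_index :: "int \<Rightarrow> nat \<Rightarrow> nat + nat \<Rightarrow> int + (int \<times> nat \<times> int)" where
  "pair_index i l = case_sum (\<lambda>j. Inl (i - int j)) (\<lambda>j. Inr (i, l, i - int j))"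

definition couple :: "nat \<Rightarrow> (nat + nat \<Rightarrow> 'b) \<Rightarrow> nat \<Rightarrow> 'b" where
  "couple l z = (\<lambda>j. if j < l then z (Inl j) else z (Inr j))"

lemma inj_pair_index: "inj (pair_index i l)"
  by (rule injI) (auto simp: pair_index_def split: sum.splits)

lemma past_eq: "past \<zeta> i \<omega> = (\<lambda>j. joint (pair_index i l (Inl j)) \<omega>)"
  by (simp add: past_def joint_def pair_index_def)

lemma coupled_past_eq: "coupled_past \<zeta> \<zeta>s i l \<omega> = couple l (\<lambda>x. joint (pair_index i l x) \<omega>)"
  by (auto simp: coupled_past_def couple_def joint_def pair_index_def fun_eq_iff)

lemma past_measurable: "past \<zeta> i \<in> measurable M (PiM UNIV (\<lambda>_. T))"
  using reindex_measurable[of "\<lambda>j. pair_index i 0 (Inl j)"] by (simp add: past_eq[of _ _ 0, abs_def])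

lemma couple_measurable: "couple l \<in> measurable (PiM UNIV (\<lambda>_. T)) (PiM UNIV (\<lambda>_. T))"
  by (intro measurable_PiM_single') (auto simp: couple_def space_PiM PiE_def Pi_def)

lemma coupled_past_measurable: "coupled_past \<zeta> \<zeta>s i l \<in> measurable M (PiM UNIV (\<lambda>_. T))"
  using measurable_compose[OF reindex_measurable[of "pair_index i l"] couple_measurable[of l]]
  by (simp add: coupled_past_eq[abs_def])

abbreviation "past_law \<equiv> PiM (UNIV :: nat set) (\<lambda>_. distr M T (\<zeta> 0))"

lemma distr_past: "distr M (PiM UNIV (\<lambda>_. T)) (past \<zeta> i) = past_law"
proof -
  have "inj (\<lambda>j. pair_index i 0 (Inl j))" using inj_pair_index[of i 0] by (auto simp: inj_def)
  from distr_reindex[OF this] show ?thesis by (simp add: past_eq[of _ _ 0, abs_def])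
qed

lemma distr_coupled_past: "distr M (PiM UNIV (\<lambda>_. T)) (coupled_past \<zeta> \<zeta>s i l) = past_law"
proof -
  have "inj (\<lambda>j. pair_index i l (if j < l then Inl j else Inr j))"
    using inj_pair_index[of i l] by (auto simp: inj_def split: if_splits)
  from distr_reindex[OF this] show ?thesis
    by (simp add: coupled_past_eq[abs_def] couple_def if_distrib[of "pair_index _ _"] if_distrib[of joint] if_distribR cong: if_cong)
qed

lemma distr_pair: "distr M (PiM UNIV (\<lambda>_. T)) (\<lambda>\<omega> x. joint (pair_index i l x) \<omega>) = PiM UNIV (\<lambda>_. distr M T (\<zeta> 0))"
  by (rule distr_reindex[OF inj_pair_index])

text \<open>At lag \<open>i' - i\<close> the coupled past of \<open>i'\<close> retains only
  innovations after time \<open>i\<close>; everything earlier is a copy. Its index range is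
  therefore disjoint from that of the past of \<open>i\<close>.\<close>

lemma indep_past_coupled_past:
  assumes "i < i'"
  shows "indep_var (PiM UNIV (\<lambda>_. T)) (past \<zeta> i) (PiM UNIV (\<lambda>_. T)) (coupled_past \<zeta> \<zeta>s i' (nat (i' - i)))"
proof -
  let ?l = "nat (i' - i)"
  have "range (\<lambda>j. pair_index i 0 (Inl j)) \<inter> range (\<lambda>j. pair_index i' ?l (if j < ?l then Inl j else Inr j)) = {}"
    using assms by (auto simp: pair_index_def split: if_splits)
  from indep_reindex[OF this] show ?thesis
    by (simp add: past_eq[of _ _ 0, abs_def] coupled_past_eq[abs_def] couple_def if_distrib[of "pair_index _ _"] if_distrib[of joint] if_distribR cong: if_cong)
qed

end

section \<open>Moments and covariances\<close>

lemma space_L2_borel [simp]: "space L2_borel = L2"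
  unfolding L2_borel_def by (rule space_measure_of) auto

section \<open>Measurability of functionals of random elements of L2\<close>

lemma L2_open_in_borel:
  assumes "U \<subseteq> L2" "\<And>f. f \<in> U \<Longrightarrow> \<exists>r>0. \<forall>h\<in>L2. L2_norm (\<lambda>s. h s - f s) < r \<longrightarrow> h \<in> U"
  shows "U \<in> sets L2_borel"
  unfolding L2_borel_def using assms by (subst sets_measure_of) (auto intro!: sigma_sets.Basic)

lemma L2_norm_minus_commute: "L2_norm (\<lambda>s. f s - g s) = L2_norm (\<lambda>s. g s - f s)"
  unfolding L2_norm_def L2_inner_eq_square by (simp add: power2_commute)

lemma L2_norm_diff_triangle:
  assumes "f \<in> L2" "g \<in> L2" "h \<in> L2"
  shows "L2_norm (\<lambda>s. f s - h s) \<le> L2_norm (\<lambda>s. f s - g s) + L2_norm (\<lambda>s. g s - h s)"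
  using L2_norm_triangle[OF L2_diff[OF assms(1,2)] L2_diff[OF assms(2,3)]] by simp

text \<open>Strict sublevel sets are open by the triangle inequality, and open sets generate
  \<open>L2_borel\<close>.\<close>

lemma measurable_L2_norm_diff:
  assumes b: "b \<in> L2"
  shows "(\<lambda>f. L2_norm (\<lambda>s. f s - b s)) \<in> borel_measurable L2_borel"
  unfolding borel_measurable_iff_less
proof
  fix c
  show "{f \<in> space L2_borel. L2_norm (\<lambda>s. f s - b s) < c} \<in> sets L2_borel"
  proof (rule L2_open_in_borel)
    fix f assume f: "f \<in> {f \<in> space L2_borel. L2_norm (\<lambda>s. f s - b s) < c}"
    then have fL: "f \<in> L2" by simp
    show "\<exists>r>0. \<forall>h\<in>L2. L2_norm (\<lambda>s. h s - f s) < r \<longrightarrow> h \<in> {f \<in> space L2_borel. L2_norm (\<lambda>s. f s - b s) < c}"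
    proof (intro exI[of _ "c - L2_norm (\<lambda>s. f s - b s)"] conjI ballI impI)
      fix h assume h: "h \<in> L2" "L2_norm (\<lambda>s. h s - f s) < c - L2_norm (\<lambda>s. f s - b s)"
      then show "h \<in> {f \<in> space L2_borel. L2_norm (\<lambda>s. f s - b s) < c}"
        using L2_norm_diff_triangle[OF h(1) fL b] by simp
    qed (use f in simp)
  qed auto
qed

lemma measurable_L2_norm: "L2_norm \<in> borel_measurable L2_borel"
  using measurable_L2_norm_diff[of "\<lambda>_. 0"] by (simp add: continuous_on_L2)

lemma measurable_L2_inner:
  assumes b: "b \<in> L2"
  shows "(\<lambda>f. L2_inner f b) \<in> borel_measurable L2_borel"
  unfolding borel_measurable_iff_greater
proof
  fix c
  show "{f \<in> space L2_borel. c < L2_inner f b} \<in> sets L2_borel"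
  proof (rule L2_open_in_borel)
    fix f assume f: "f \<in> {f \<in> space L2_borel. c < L2_inner f b}"
    then have fL: "f \<in> L2" by simp
    let ?n = "L2_norm b + 1"
    have n: "?n > 0" using L2_norm_nonneg[of b] by simp
    show "\<exists>r>0. \<forall>h\<in>L2. L2_norm (\<lambda>s. h s - f s) < r \<longrightarrow> h \<in> {f \<in> space L2_borel. c < L2_inner f b}"
    proof (intro exI[of _ "(L2_inner f b - c) / ?n"] conjI ballI impI)
      fix h assume h: "h \<in> L2" "L2_norm (\<lambda>s. h s - f s) < (L2_inner f b - c) / ?n"
      have "L2_inner f b - L2_inner h b = - L2_inner (\<lambda>s. h s - f s) b"
        using L2_inner_lincomb[OF h(1) fL b, of 1 "-1"] by simp
      also have "\<dots> \<le> L2_norm (\<lambda>s. h s - f s) * L2_norm b"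
        using L2_inner_Cauchy_Schwarz[OF L2_diff[OF h(1) fL] b] by linarith
      also have "\<dots> \<le> L2_norm (\<lambda>s. h s - f s) * ?n"
        by (intro mult_left_mono) (auto simp: L2_norm_nonneg)
      also have "\<dots> < L2_inner f b - c" using h(2) n by (simp add: field_simps)
      finally show "h \<in> {f \<in> space L2_borel. c < L2_inner f b}" using h(1) by simp
    qed (use f n in simp)
  qed auto
qed

text \<open>By separability the distance is below \<open>c\<close> iff some \<open>b\<close> of a
  countable dense set and some rational \<open>q\<close> witness it: one of the two distances to
  \<open>b\<close> is below \<open>q\<close> and the other below \<open>c - q\<close>. This is a
  countable union of measurable sets.\<close>

lemma measurable_L2_distance:
  assumes u: "\<And>\<omega>. \<omega> \<in> space N \<Longrightarrow> u \<omega> \<in> L2" and v: "\<And>\<omega>. \<omega> \<in> space N \<Longrightarrow> v \<omega> \<in> L2"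
    and um: "\<And>b. b \<in> L2 \<Longrightarrow> (\<lambda>\<omega>. L2_norm (\<lambda>s. u \<omega> s - b s)) \<in> borel_measurable N"
    and vm: "\<And>b. b \<in> L2 \<Longrightarrow> (\<lambda>\<omega>. L2_norm (\<lambda>s. v \<omega> s - b s)) \<in> borel_measurable N"
  shows "(\<lambda>\<omega>. L2_norm (\<lambda>s. u \<omega> s - v \<omega> s)) \<in> borel_measurable N"
  unfolding borel_measurable_iff_less
proof
  fix c
  obtain B where B: "countable B" "B \<subseteq> L2" "\<And>f e. f \<in> L2 \<Longrightarrow> e > 0 \<Longrightarrow> \<exists>b\<in>B. L2_norm (\<lambda>s. f s - b s) < e"
    by (rule L2_dense_countable; rule that; blast)
  let ?A = "\<lambda>b q. {\<omega> \<in> space N. L2_norm (\<lambda>s. u \<omega> s - b s) < q} \<inter> {\<omega> \<in> space N. L2_norm (\<lambda>s. v \<omega> s - b s) < c - q}"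
  have "{\<omega> \<in> space N. L2_norm (\<lambda>s. u \<omega> s - v \<omega> s) < c} = (\<Union>b\<in>B. \<Union>q\<in>\<rat>. ?A b q)" (is "?L = ?R")
  proof
    show "?L \<subseteq> ?R"
    proof
      fix \<omega> assume w: "\<omega> \<in> ?L"
      then have uL: "u \<omega> \<in> L2" and vL: "v \<omega> \<in> L2" using u v by auto
      \<comment> \<open>A third of the gap: if \<open>b\<close> is within \<open>e\<close> of
        \<open>u \<omega>\<close>, then \<open>v \<omega>\<close> has distance below
        \<open>c - 2 * e\<close> from \<open>b\<close>, hence below \<open>c - q\<close> as
        \<open>q < e\<close>.\<close>
      define e where "e = (c - L2_norm (\<lambda>s. u \<omega> s - v \<omega> s)) / 3"
      have e: "e > 0" using w by (simp add: e_def)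
      obtain b where b: "b \<in> B" "L2_norm (\<lambda>s. u \<omega> s - b s) < e" using B(3)[OF uL e] by blast
      obtain q where q: "q \<in> \<rat>" "L2_norm (\<lambda>s. u \<omega> s - b s) < q" "q < e" using Rats_dense_in_real[OF b(2)] by blast
      have "L2_norm (\<lambda>s. v \<omega> s - b s) \<le> L2_norm (\<lambda>s. u \<omega> s - v \<omega> s) + L2_norm (\<lambda>s. u \<omega> s - b s)"
        using L2_norm_diff_triangle[OF vL uL, of b] B(2) b(1) by (auto simp: L2_norm_minus_commute[of "v \<omega>" "u \<omega>"])
      also have "\<dots> < c - q" using b(2) q(3) e by (simp add: e_def field_simps)
      finally show "\<omega> \<in> ?R" using w b(1) q by auto
    qed
    show "?R \<subseteq> ?L"
    proof
      fix \<omega> assume "\<omega> \<in> ?R"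
      then obtain b q where b: "b \<in> B" and w: "\<omega> \<in> space N" "L2_norm (\<lambda>s. u \<omega> s - b s) < q" "L2_norm (\<lambda>s. v \<omega> s - b s) < c - q" by auto
      have "L2_norm (\<lambda>s. u \<omega> s - v \<omega> s) \<le> L2_norm (\<lambda>s. u \<omega> s - b s) + L2_norm (\<lambda>s. v \<omega> s - b s)"
        using L2_norm_diff_triangle[OF u[OF w(1)] _ v[OF w(1)], of b] B(2) b by (auto simp: L2_norm_minus_commute[of b])
      then show "\<omega> \<in> ?L" using w by auto
    qed
  qed
  moreover have "?R \<in> sets N"
  proof (intro sets.countable_UN'' B(1) countable_rat)
    fix b q assume "b \<in> B"
    then have bL: "b \<in> L2" using B(2) by auto
    show "?A b q \<in> sets N"
      using um[OF bL] vm[OF bL] unfolding borel_measurable_iff_less by (intro sets.Int) auto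
  qed
  ultimately show "?L \<in> sets N" by simp
qed

text \<open>Each row of the covariance matrix of a block sums to at most \<open>C\<close> on either
  side of the diagonal; hence the factor 2 and growth linear in the block length.\<close>

lemma (in prob_space) second_moment_sum:
  fixes z :: "nat \<Rightarrow> 'a \<Rightarrow> real" and c :: "nat \<Rightarrow> real"
  assumes int: "\<And>i j. integrable M (\<lambda>\<omega>. z i \<omega> * z j \<omega>)"
    and cov: "\<And>i j. i \<le> j \<Longrightarrow> expectation (\<lambda>\<omega>. z i \<omega> * z j \<omega>) \<le> c (j - i)"
    and c: "\<And>r. 0 \<le> c r" "\<And>N. (\<Sum>r<N. c r) \<le> C"
  shows "integrable M (\<lambda>\<omega>. (\<Sum>i\<in>{a..<a + k}. z i \<omega>)\<^sup>2)"
    and "expectation (\<lambda>\<omega>. (\<Sum>i\<in>{a..<a + k}. z i \<omega>)\<^sup>2) \<le> 2 * C * real k"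
proof -
  let ?I = "{a..<a + k}"
  have sq: "(\<Sum>i\<in>?I. z i \<omega>)\<^sup>2 = (\<Sum>i\<in>?I. \<Sum>j\<in>?I. z i \<omega> * z j \<omega>)" for \<omega>
    by (simp add: power2_eq_square sum_product)
  show "integrable M (\<lambda>\<omega>. (\<Sum>i\<in>?I. z i \<omega>)\<^sup>2)"
    unfolding sq by (intro Bochner_Integration.integrable_sum int)
  have sub: "(\<Sum>j\<in>A. c (f j)) \<le> C" if "inj_on f A" "finite A" for A :: "nat set" and f
  proof -
    have "finite (f ` A)" using that(2) by simp
    then obtain N where N: "f ` A \<subseteq> {..<N}" by (rule finite_nat_bounded[THEN exE])
    have "(\<Sum>j\<in>A. c (f j)) = (\<Sum>r\<in>f ` A. c r)" using that by (simp add: sum.reindex)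
    also have "\<dots> \<le> (\<Sum>r<N. c r)" using N c(1) by (intro sum_mono2) auto
    finally show ?thesis using c(2)[of N] by simp
  qed
  have one: "(\<Sum>j\<in>?I. expectation (\<lambda>\<omega>. z i \<omega> * z j \<omega>)) \<le> 2 * C" if i: "i \<in> ?I" for i
  proof -
    have "(\<Sum>j\<in>?I. expectation (\<lambda>\<omega>. z i \<omega> * z j \<omega>)) = (\<Sum>j\<in>{a..<i}. expectation (\<lambda>\<omega>. z i \<omega> * z j \<omega>)) + (\<Sum>j\<in>{i..<a + k}. expectation (\<lambda>\<omega>. z i \<omega> * z j \<omega>))"
      using i by (intro sum.atLeastLessThan_concat[symmetric]) auto
    also have "\<dots> \<le> (\<Sum>j\<in>{a..<i}. c (i - j)) + (\<Sum>j\<in>{i..<a + k}. c (j - i))"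
    proof (intro add_mono sum_mono)
      fix j assume "j \<in> {a..<i}"
      then show "expectation (\<lambda>\<omega>. z i \<omega> * z j \<omega>) \<le> c (i - j)" using cov[of j i] by (simp add: mult.commute)
    qed (use cov in auto)
    also have "\<dots> \<le> C + C" by (intro add_mono sub) (auto simp: inj_on_def)
    finally show ?thesis by simp
  qed
  have "expectation (\<lambda>\<omega>. (\<Sum>i\<in>?I. z i \<omega>)\<^sup>2) = (\<Sum>i\<in>?I. \<Sum>j\<in>?I. expectation (\<lambda>\<omega>. z i \<omega> * z j \<omega>))"
    unfolding sq by (simp add: Bochner_Integration.integral_sum int Bochner_Integration.integrable_sum)
  also have "\<dots> \<le> (\<Sum>i\<in>?I. 2 * C)" by (rule sum_mono) (rule one)
  finally show "expectation (\<lambda>\<omega>. (\<Sum>i\<in>?I. z i \<omega>)\<^sup>2) \<le> 2 * C * real k" by (simp add: mult.commute)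
qed

section \<open>Elementary moment inequalities\<close>

text \<open>Gives moments of every order of the norm of \<open>X\<close> from the exponential
  moment. The constant comes from \<open>y \<le> exp y\<close> at
  \<open>y = q * t\<^sup>2 / n\<close>, raised to the power \<open>n\<close>; its summand 1 covers
  \<open>t \<le> 1\<close>.\<close>

lemma powr_le_exp_square:
  fixes p q :: real
  assumes "p \<ge> 0" "q > 0"
  obtains C where "C > 0" "\<And>t. t \<ge> 0 \<Longrightarrow> t powr p \<le> C * exp (q * t\<^sup>2)"
proof -
  obtain n :: nat where n: "p / 2 \<le> real n" "n \<ge> 1"
    using real_arch_simple[of "max 1 (p / 2)"] by (metis le_max_iff_disj max.bounded_iff of_nat_1 of_nat_le_iff)
  let ?C = "1 + (real n / q) ^ n"
  have "t powr p \<le> ?C * exp (q * t\<^sup>2)" if t: "t \<ge> 0" for t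
  proof (cases "t \<le> 1")
    case True
    have "t powr p \<le> 1" using t True assms(1) by (intro powr_le1) auto
    also have "\<dots> \<le> ?C * exp (q * t\<^sup>2)"
      using assms(2) by (intro mult_ge1_I[THEN order_trans[rotated]] order_refl) auto
    finally show ?thesis .
  next
    case False
    have "t powr p \<le> t powr (real (2 * n))" using False n by (intro powr_mono) auto
    also have "\<dots> = (t\<^sup>2) ^ n"
      using False powr_realpow[of t "2 * n"] power_mult[of t 2 n] by (simp del: of_nat_mult)
    also have "\<dots> = (real n / q) ^ n * (q * t\<^sup>2 / real n) ^ n"
    proof -
      have "(real n / q) * (q * t\<^sup>2 / real n) = t\<^sup>2" using n(2) assms(2) by simp
      then show ?thesis by (simp only: power_mult_distrib[symmetric])
    qed
    also have "\<dots> \<le> (real n / q) ^ n * exp (q * t\<^sup>2 / real n) ^ n"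
    proof (intro mult_left_mono power_mono)
      show "q * t\<^sup>2 / real n \<le> exp (q * t\<^sup>2 / real n)"
        using exp_ge_add_one_self[of "q * t\<^sup>2 / real n"] by linarith
    qed (use assms(2) in auto)
    also have "exp (q * t\<^sup>2 / real n) ^ n = exp (q * t\<^sup>2)"
      using n(2) by (simp add: exp_of_nat_mult[symmetric])
    also have "(real n / q) ^ n * exp (q * t\<^sup>2) \<le> ?C * exp (q * t\<^sup>2)" by (intro mult_right_mono) auto
    finally show ?thesis .
  qed
  moreover have "?C > 0" using assms(2) by (simp add: add_pos_nonneg)
  ultimately show ?thesis using that by blast
qed

text \<open>Separates a factor with moments of order \<open>2 + \<delta>\<close> from one with
  moments of all orders. If \<open>v\<^sup>2\<close> exceeds \<open>u powr \<delta>\<close>, then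
  \<open>u\<^sup>2\<close> is at most \<open>v powr (4 / \<delta>)\<close>, which explains the
  exponent of \<open>v\<close>.\<close>

lemma square_mult_le_powr_add:
  fixes u v :: real
  assumes \<delta>: "\<delta> > 0" and uv: "u \<ge> 0" "v \<ge> 0"
  shows "u\<^sup>2 * v\<^sup>2 \<le> u powr (2 + \<delta>) + v powr (4 / \<delta> + 2)"
proof (cases "u = 0 \<or> v = 0")
  case True then show ?thesis by auto
next
  case False
  then have pos: "u > 0" "v > 0" using uv by auto
  show ?thesis
  proof (cases "v\<^sup>2 \<le> u powr \<delta>")
    case True
    then have "u\<^sup>2 * v\<^sup>2 \<le> u\<^sup>2 * u powr \<delta>" by (rule mult_left_mono) simp
    also have "\<dots> = u powr (2 + \<delta>)" using pos by (simp add: powr_add)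
    finally show ?thesis by (simp add: add_increasing2)
  next
    case False
    then have "(u powr \<delta>) powr (2 / \<delta>) \<le> (v\<^sup>2) powr (2 / \<delta>)" using pos \<delta> by (intro powr_mono2) auto
    moreover have "(u powr \<delta>) powr (2 / \<delta>) = u\<^sup>2" using pos \<delta> by (simp add: powr_powr)
    moreover have "(v\<^sup>2) powr (2 / \<delta>) = v powr (4 / \<delta>)"
      using pos by (simp add: powr_powr flip: powr_numeral)
    ultimately have "u\<^sup>2 * v\<^sup>2 \<le> v powr (4 / \<delta>) * v\<^sup>2" by (intro mult_right_mono) auto
    also have "\<dots> = v powr (4 / \<delta> + 2)" using pos by (simp add: powr_add)
    finally show ?thesis by (simp add: add_increasing)
  qed
qed

lemma abs_prod4_le:
  fixes p q r s :: real
  shows "\<bar>p * q * (r * s)\<bar> \<le> (p ^ 4 + q ^ 4 + r ^ 4 + s ^ 4) / 4"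
proof -
  have h: "\<bar>x * y\<bar> \<le> (x\<^sup>2 + y\<^sup>2) / 2" for x y :: real
    using sum_squares_bound[of "\<bar>x\<bar>" "\<bar>y\<bar>"] by (simp add: abs_mult)
  have "\<bar>p * q * (r * s)\<bar> \<le> ((p * q)\<^sup>2 + (r * s)\<^sup>2) / 2" by (rule h)
  moreover have "(p * q)\<^sup>2 \<le> ((p\<^sup>2)\<^sup>2 + (q\<^sup>2)\<^sup>2) / 2" using h[of "p\<^sup>2" "q\<^sup>2"] by (simp add: power_mult_distrib)
  moreover have "(r * s)\<^sup>2 \<le> ((r\<^sup>2)\<^sup>2 + (s\<^sup>2)\<^sup>2) / 2" using h[of "r\<^sup>2" "s\<^sup>2"] by (simp add: power_mult_distrib)
  moreover have "((x\<^sup>2)\<^sup>2) = x ^ 4" for x :: real by (simp flip: power_mult)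
  note this[of p] this[of q] this[of r] this[of s]
  ultimately show ?thesis by argo
qed

section \<open>Laws of regressors, pasts and coupled pasts\<close>

lemma (in iid_with_copies) integral_law:
  assumes \<Phi>: "\<Phi> \<in> borel_measurable (PiM UNIV (\<lambda>_. T))"
  shows "integrable M (\<lambda>\<omega>. \<Phi> (past \<zeta> i \<omega>)) \<longleftrightarrow> integrable past_law \<Phi>"
    and "integrable M (\<lambda>\<omega>. \<Phi> (coupled_past \<zeta> \<zeta>s i l \<omega>)) \<longleftrightarrow> integrable past_law \<Phi>"
    and "(\<integral>\<omega>. \<Phi> (past \<zeta> i \<omega>) \<partial>M) = (\<integral>z. \<Phi> z \<partial>past_law :: real)"
    and "(\<integral>\<omega>. \<Phi> (coupled_past \<zeta> \<zeta>s i l \<omega>) \<partial>M) = (\<integral>z. \<Phi> z \<partial>past_law :: real)"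
  using integrable_distr_eq[OF past_measurable[of i] \<Phi>] integrable_distr_eq[OF coupled_past_measurable[of i l] \<Phi>]
    integral_distr[OF past_measurable[of i] \<Phi>] integral_distr[OF coupled_past_measurable[of i l] \<Phi>]
  unfolding distr_past distr_coupled_past by auto

lemma (in prob_space) indep_elements_commute:
  "indep_elements M N F N' G \<Longrightarrow> indep_elements M N' G N F"
proof -
  assume "indep_elements M N F N' G"
  then have F: "F \<in> measurable M N" and G: "G \<in> measurable M N'"
    and i: "indep_set {F -` A \<inter> space M | A. A \<in> sets N} {G -` B \<inter> space M | B. B \<in> sets N'}" (is "indep_set ?A ?B")
    by (auto simp: indep_elements_def)
  have "indep_set ?B ?A"
    unfolding indep_sets2_eq
  proof (intro conjI ballI)
    fix b a assume "b \<in> ?B" "a \<in> ?A"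
    then show "prob (b \<inter> a) = prob b * prob a"
      using indep_setD[OF i, of a b] by (simp only: Int_commute[of b] mult.commute[of "prob b"])
  qed (use i in \<open>simp_all only: indep_sets2_eq\<close>)
  then show ?thesis using F G by (simp add: indep_elements_def)
qed

locale dependent_regression = regularized_regression M X \<epsilon> m \<phi> \<rho> a D
  for M :: "'w measure" and X :: "int \<Rightarrow> 'w \<Rightarrow> real \<Rightarrow> real" and \<epsilon> :: "int \<Rightarrow> 'w \<Rightarrow> real"
    and m :: nat and \<phi> :: "nat \<Rightarrow> real \<Rightarrow> real" and \<rho> :: "nat \<Rightarrow> real" and a D :: real +
  fixes \<beta>0 :: "real \<Rightarrow> real" and S :: "(real \<Rightarrow> 'r) measure" and R :: "'r measure"
    and g :: "(nat \<Rightarrow> real \<Rightarrow> 'r) \<Rightarrow> real \<Rightarrow> real" and h :: "(nat \<Rightarrow> real) \<Rightarrow> real"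
    and \<xi> :: "int \<Rightarrow> 'w \<Rightarrow> real \<Rightarrow> 'r" and \<eta> :: "int \<Rightarrow> 'w \<Rightarrow> real"
    and \<xi>s :: "int \<Rightarrow> nat \<Rightarrow> int \<Rightarrow> 'w \<Rightarrow> real \<Rightarrow> 'r"
    and \<eta>s :: "int \<Rightarrow> nat \<Rightarrow> int \<Rightarrow> 'w \<Rightarrow> real"
  assumes A3: "A3 M X \<epsilon> \<beta>0 m \<phi> \<rho> a D" and A5: "A5 M X \<epsilon> S R g h \<xi> \<eta> \<xi>s \<eta>s"
begin

lemma indep_xi_eta: "indep_elements M (PiM UNIV (\<lambda>_. S)) (\<lambda>\<omega> i. \<xi> i \<omega>) (PiM UNIV (\<lambda>_. borel)) (\<lambda>\<omega> i. \<eta> i \<omega>)"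
  using A5 by (simp add: A5_def innovations_def)

sublocale Xi: iid_with_copies M S \<xi> \<xi>s
proof
  show "indep_elements M (PiM UNIV (\<lambda>_. S)) (\<lambda>\<omega> i. \<xi> i \<omega>) (PiM UNIV (\<lambda>_. S)) (\<lambda>\<omega> (i, l, k). \<xi>s i l k \<omega>)"
  proof (rule indep_elements_commute)
    \<comment> \<open>The copies are assumed independent of the pair of both innovation sequences;
      projecting the pair gives independence from \<open>\<xi>\<close> alone.\<close>
    have "indep_elements M (PiM UNIV (\<lambda>_. S)) (\<lambda>\<omega> (i, l, k). \<xi>s i l k \<omega>)
       ((PiM UNIV (\<lambda>_. S)) \<Otimes>\<^sub>M (PiM UNIV (\<lambda>_. borel))) (\<lambda>\<omega>. (\<lambda>i. \<xi> i \<omega>, \<lambda>i. \<eta> i \<omega>))"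
      using A5 by (simp add: A5_def independent_copies_def)
    from indep_elements_compose[OF this measurable_ident measurable_fst]
    show "indep_elements M (PiM UNIV (\<lambda>_. S)) (\<lambda>\<omega> (i, l, k). \<xi>s i l k \<omega>) (PiM UNIV (\<lambda>_. S)) (\<lambda>\<omega> i. \<xi> i \<omega>)"
      by (simp add: split_beta')
  qed
qed (use A5 in \<open>auto simp: A5_def innovations_def independent_copies_def\<close>)

sublocale Eta: iid_with_copies M borel \<eta> \<eta>s
proof
  show "indep_elements M (PiM UNIV (\<lambda>_. borel)) (\<lambda>\<omega> i. \<eta> i \<omega>) (PiM UNIV (\<lambda>_. borel)) (\<lambda>\<omega> (i, l, k). \<eta>s i l k \<omega>)"
  proof (rule indep_elements_commute)
    have "indep_elements M (PiM UNIV (\<lambda>_. borel)) (\<lambda>\<omega> (i, l, k). \<eta>s i l k \<omega>)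
       ((PiM UNIV (\<lambda>_. S)) \<Otimes>\<^sub>M (PiM UNIV (\<lambda>_. borel))) (\<lambda>\<omega>. (\<lambda>i. \<xi> i \<omega>, \<lambda>i. \<eta> i \<omega>))"
      using A5 by (simp add: A5_def independent_copies_def)
    from indep_elements_compose[OF this measurable_ident measurable_snd]
    show "indep_elements M (PiM UNIV (\<lambda>_. borel)) (\<lambda>\<omega> (i, l, k). \<eta>s i l k \<omega>) (PiM UNIV (\<lambda>_. borel)) (\<lambda>\<omega> i. \<eta> i \<omega>)"
      by (simp add: split_beta')
  qed
qed (use A5 in \<open>auto simp: A5_def innovations_def independent_copies_def\<close>)

lemma g_measurable: "g \<in> measurable (PiM UNIV (\<lambda>_. S)) L2_borel"
  and h_measurable: "h \<in> borel_measurable (PiM UNIV (\<lambda>_. borel))"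
  and X_AE: "AE \<omega> in M. AE s in unit_leb. X i \<omega> s = g (past \<xi> i \<omega>) s"
  and eps_AE: "AE \<omega> in M. \<epsilon> i \<omega> = h (past \<eta> i \<omega>)"
  using A5 by (auto simp: A5_def)

lemma g_past_L2: "\<omega> \<in> space M \<Longrightarrow> g (past \<xi> i \<omega>) \<in> L2"
  using measurable_space[OF g_measurable measurable_space[OF Xi.past_measurable]] by simp

lemma g_coupled_L2: "\<omega> \<in> space M \<Longrightarrow> g (coupled_past \<xi> \<xi>s i l \<omega>) \<in> L2"
  using measurable_space[OF g_measurable measurable_space[OF Xi.coupled_past_measurable]] by simp

lemma X_inner_AE:
  assumes "b \<in> L2"
  shows "AE \<omega> in M. L2_inner (X i \<omega>) b = L2_inner (g (past \<xi> i \<omega>)) b"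
  using X_AE[of i] AE_space
proof eventually_elim
  case (elim \<omega>)
  then show ?case
    using X_L2[of \<omega> i] g_past_L2[of \<omega> i] assms by (intro L2_inner_cong_AE) (auto simp: L2_def)
qed

lemma X_norm_AE: "AE \<omega> in M. L2_norm (X i \<omega>) = L2_norm (g (past \<xi> i \<omega>))"
  using X_AE[of i] AE_space
proof eventually_elim
  case (elim \<omega>)
  then show ?case
    using X_L2[of \<omega> i] g_past_L2[of \<omega> i] by (intro L2_norm_cong_AE) (auto simp: L2_def)
qed

text \<open>Almost surely \<open>X i\<close> is \<open>g\<close> of a past whose law is free of
  \<open>i\<close>, and coupling does not change that law. Moments of \<open>X i\<close> and of its
  coupled version therefore agree for all times.\<close>

lemma transfer_law:
  assumes \<Phi>: "\<Phi> \<in> borel_measurable L2_borel" and m: "(\<lambda>\<omega>. \<Phi> (X i \<omega>)) \<in> borel_measurable M"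
    and ae: "AE \<omega> in M. \<Phi> (X i \<omega>) = \<Phi> (g (past \<xi> i \<omega>))"
  shows "integrable M (\<lambda>\<omega>. \<Phi> (X i \<omega>)) \<longleftrightarrow> integrable Xi.past_law (\<lambda>z. \<Phi> (g z))"
    and "(\<integral>\<omega>. \<Phi> (X i \<omega>) \<partial>M) = (\<integral>z. \<Phi> (g z) \<partial>Xi.past_law :: real)"
    and "integrable M (\<lambda>\<omega>. \<Phi> (g (coupled_past \<xi> \<xi>s j l \<omega>))) \<longleftrightarrow> integrable Xi.past_law (\<lambda>z. \<Phi> (g z))"
    and "(\<integral>\<omega>. \<Phi> (g (coupled_past \<xi> \<xi>s j l \<omega>)) \<partial>M) = (\<integral>z. \<Phi> (g z) \<partial>Xi.past_law :: real)"
proof -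
  have gm: "(\<lambda>z. \<Phi> (g z)) \<in> borel_measurable (PiM UNIV (\<lambda>_. S))"
    by (rule measurable_compose[OF g_measurable \<Phi>])
  have gpm: "(\<lambda>\<omega>. \<Phi> (g (past \<xi> i \<omega>))) \<in> borel_measurable M"
    by (rule measurable_compose[OF Xi.past_measurable gm])
  note L = Xi.integral_law[OF gm]
  show "integrable M (\<lambda>\<omega>. \<Phi> (X i \<omega>)) \<longleftrightarrow> integrable Xi.past_law (\<lambda>z. \<Phi> (g z))"
    using Bochner_Integration.integrable_cong_AE[OF m gpm ae] L(1)[of i] by simp
  show "(\<integral>\<omega>. \<Phi> (X i \<omega>) \<partial>M) = (\<integral>z. \<Phi> (g z) \<partial>Xi.past_law)"
    using Bochner_Integration.integral_cong_AE[OF m gpm ae] L(3)[of i] by simp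
  show "integrable M (\<lambda>\<omega>. \<Phi> (g (coupled_past \<xi> \<xi>s j l \<omega>))) \<longleftrightarrow> integrable Xi.past_law (\<lambda>z. \<Phi> (g z))"
    by (rule L(2))
  show "(\<integral>\<omega>. \<Phi> (g (coupled_past \<xi> \<xi>s j l \<omega>)) \<partial>M) = (\<integral>z. \<Phi> (g z) \<partial>Xi.past_law)"
    by (rule L(4))
qed

lemma X_norm_powr_integrable:
  assumes "p \<ge> 0"
  shows "integrable Xi.past_law (\<lambda>z. L2_norm (g z) powr p)"
    and "integrable M (\<lambda>\<omega>. L2_norm (X i \<omega>) powr p)"
    and "(\<integral>\<omega>. L2_norm (X i \<omega>) powr p \<partial>M) = (\<integral>z. L2_norm (g z) powr p \<partial>Xi.past_law)"
    and "integrable M (\<lambda>\<omega>. L2_norm (g (coupled_past \<xi> \<xi>s i l \<omega>)) powr p)"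
proof -
  obtain q where q: "q > 0" "integrable M (\<lambda>\<omega>. exp (q * (L2_norm (X 0 \<omega>))\<^sup>2))"
    using A3 by (auto simp: A3_def)
  obtain C where C: "C > 0" "\<And>t. t \<ge> 0 \<Longrightarrow> t powr p \<le> C * exp (q * t\<^sup>2)"
    using powr_le_exp_square[OF assms q(1)] by blast
  have \<Phi>: "(\<lambda>f. L2_norm f powr p) \<in> borel_measurable L2_borel"
    using measurable_L2_norm by measurable
  have m: "(\<lambda>\<omega>. L2_norm (X i \<omega>) powr p) \<in> borel_measurable M" for i
    using X_norm_measurable[of i] by measurable
  have ae: "AE \<omega> in M. L2_norm (X i \<omega>) powr p = L2_norm (g (past \<xi> i \<omega>)) powr p" for i
    using X_norm_AE[of i] by eventually_elim simp
  have "integrable M (\<lambda>\<omega>. L2_norm (X 0 \<omega>) powr p)"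
  proof (rule Bochner_Integration.integrable_bound[OF _ m])
    show "integrable M (\<lambda>\<omega>. C * exp (q * (L2_norm (X 0 \<omega>))\<^sup>2))" by (intro integrable_mult_right q)
    show "AE \<omega> in M. norm (L2_norm (X 0 \<omega>) powr p) \<le> norm (C * exp (q * (L2_norm (X 0 \<omega>))\<^sup>2))"
      using C L2_norm_nonneg by (intro AE_I2) (auto simp: abs_mult)
  qed
  then show law: "integrable Xi.past_law (\<lambda>z. L2_norm (g z) powr p)"
    using transfer_law(1)[OF \<Phi> m ae] by simp
  show "integrable M (\<lambda>\<omega>. L2_norm (X i \<omega>) powr p)"
    using transfer_law(1)[OF \<Phi> m ae] law by simp
  show "(\<integral>\<omega>. L2_norm (X i \<omega>) powr p \<partial>M) = (\<integral>z. L2_norm (g z) powr p \<partial>Xi.past_law)"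
    by (rule transfer_law(2)[OF \<Phi> m ae])
  show "integrable M (\<lambda>\<omega>. L2_norm (g (coupled_past \<xi> \<xi>s i l \<omega>)) powr p)"
    using transfer_law(3)[OF \<Phi> m ae] law by simp
qed

lemma fourth_moment:
  assumes b: "b \<in> H"
  shows "integrable M (\<lambda>\<omega>. (L2_inner (X i \<omega>) b) ^ 4)"
    and "integrable M (\<lambda>\<omega>. (L2_inner (g (coupled_past \<xi> \<xi>s j l \<omega>)) b) ^ 4)"
    and "(\<integral>\<omega>. (L2_inner (g (coupled_past \<xi> \<xi>s j l \<omega>)) b) ^ 4 \<partial>M) = (\<integral>\<omega>. (L2_inner (X 0 \<omega>) b) ^ 4 \<partial>M)"
    and "(\<integral>\<omega>. (L2_inner (X i \<omega>) b) ^ 4 \<partial>M) = (\<integral>\<omega>. (L2_inner (X 0 \<omega>) b) ^ 4 \<partial>M)"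
proof -
  have bL: "b \<in> L2" by (rule H_L2[OF b])
  have \<Phi>: "(\<lambda>f. (L2_inner f b) ^ 4) \<in> borel_measurable L2_borel"
    using measurable_L2_inner[OF bL] by measurable
  have m: "(\<lambda>\<omega>. (L2_inner (X i \<omega>) b) ^ 4) \<in> borel_measurable M" for i
    using X_inner_measurable[OF bL, of i] by measurable
  have ae: "AE \<omega> in M. (L2_inner (X i \<omega>) b) ^ 4 = (L2_inner (g (past \<xi> i \<omega>)) b) ^ 4" for i
    using X_inner_AE[OF bL, of i] by eventually_elim simp
  have i0: "integrable M (\<lambda>\<omega>. (L2_inner (X i \<omega>) b) ^ 4)" for i
  proof (rule Bochner_Integration.integrable_bound[OF _ m])
    show "integrable M (\<lambda>\<omega>. L2_norm (X i \<omega>) powr 4 * (L2_norm b) ^ 4)"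
      by (intro integrable_mult_left X_norm_powr_integrable) auto
    show "AE \<omega> in M. norm ((L2_inner (X i \<omega>) b) ^ 4) \<le> norm (L2_norm (X i \<omega>) powr 4 * (L2_norm b) ^ 4)"
    proof (intro AE_I2)
      fix \<omega> assume w: "\<omega> \<in> space M"
      have "\<bar>L2_inner (X i \<omega>) b\<bar> ^ 4 \<le> (L2_norm (X i \<omega>) * L2_norm b) ^ 4"
        by (intro power_mono X_inner_le w bL) auto
      moreover have "L2_norm (X i \<omega>) powr 4 = L2_norm (X i \<omega>) ^ 4"
        using L2_norm_nonneg[of "X i \<omega>"] by (cases "L2_norm (X i \<omega>) = 0") auto
      ultimately have "norm ((L2_inner (X i \<omega>) b) ^ 4) \<le> L2_norm (X i \<omega>) powr 4 * (L2_norm b) ^ 4"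
        by (simp only: power_mult_distrib real_norm_def power_abs)
      then show "norm ((L2_inner (X i \<omega>) b) ^ 4) \<le> norm (L2_norm (X i \<omega>) powr 4 * (L2_norm b) ^ 4)"
        by (rule order_trans) (simp only: real_norm_def abs_ge_self)
    qed
  qed
  then show "integrable M (\<lambda>\<omega>. (L2_inner (X i \<omega>) b) ^ 4)" .
  show "integrable M (\<lambda>\<omega>. (L2_inner (g (coupled_past \<xi> \<xi>s j l \<omega>)) b) ^ 4)"
    using transfer_law(1,3)[OF \<Phi> m ae] i0 by simp
  show "(\<integral>\<omega>. (L2_inner (g (coupled_past \<xi> \<xi>s j l \<omega>)) b) ^ 4 \<partial>M) = (\<integral>\<omega>. (L2_inner (X 0 \<omega>) b) ^ 4 \<partial>M)"
    using transfer_law(2,4)[OF \<Phi> m ae] by simp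
  show "(\<integral>\<omega>. (L2_inner (X i \<omega>) b) ^ 4 \<partial>M) = (\<integral>\<omega>. (L2_inner (X 0 \<omega>) b) ^ 4 \<partial>M)"
    using transfer_law(2)[OF \<Phi> m ae] by simp
qed

lemma second_moment:
  assumes b1: "b1 \<in> L2" and b2: "b2 \<in> L2"
  shows "(\<integral>\<omega>. L2_inner (X i \<omega>) b1 * L2_inner (X i \<omega>) b2 \<partial>M) = V b1 b2"
    and "integrable M (\<lambda>\<omega>. L2_inner (g (coupled_past \<xi> \<xi>s j l \<omega>)) b1 * L2_inner (g (coupled_past \<xi> \<xi>s j l \<omega>)) b2)"
    and "(\<integral>\<omega>. L2_inner (g (coupled_past \<xi> \<xi>s j l \<omega>)) b1 * L2_inner (g (coupled_past \<xi> \<xi>s j l \<omega>)) b2 \<partial>M) = V b1 b2"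
proof -
  have \<Phi>: "(\<lambda>f. L2_inner f b1 * L2_inner f b2) \<in> borel_measurable L2_borel"
    using measurable_L2_inner[OF b1] measurable_L2_inner[OF b2] by measurable
  have m: "(\<lambda>\<omega>. L2_inner (X i \<omega>) b1 * L2_inner (X i \<omega>) b2) \<in> borel_measurable M" for i
    using X_inner_measurable[OF b1, of i] X_inner_measurable[OF b2, of i] by measurable
  have ae: "AE \<omega> in M. L2_inner (X i \<omega>) b1 * L2_inner (X i \<omega>) b2 = L2_inner (g (past \<xi> i \<omega>)) b1 * L2_inner (g (past \<xi> i \<omega>)) b2" for i
    using X_inner_AE[OF b1, of i] X_inner_AE[OF b2, of i] by eventually_elim simp
  note t = transfer_law[OF \<Phi> m ae]
  show "(\<integral>\<omega>. L2_inner (X i \<omega>) b1 * L2_inner (X i \<omega>) b2 \<partial>M) = V b1 b2"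
    unfolding V_form_eq[OF b1 b2] using t(2)[of i] t(2)[of 1] by simp
  show "integrable M (\<lambda>\<omega>. L2_inner (g (coupled_past \<xi> \<xi>s j l \<omega>)) b1 * L2_inner (g (coupled_past \<xi> \<xi>s j l \<omega>)) b2)"
    using t(1)[of 1] t(3)[of j l] X_inner_mult_integrable[OF b1 b2, of 1] by simp
  show "(\<integral>\<omega>. L2_inner (g (coupled_past \<xi> \<xi>s j l \<omega>)) b1 * L2_inner (g (coupled_past \<xi> \<xi>s j l \<omega>)) b2 \<partial>M) = V b1 b2"
    unfolding V_form_eq[OF b1 b2] using t(4)[of j l] t(2)[of 1] by simp
qed

end

section \<open>Coupling rates and the coupling distance of the regressors\<close>

text \<open>Up to a correction, \<open>t\<close> is \<open>d powr (1 / \<kappa>)\<close>: it is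
  summable by assumption, and \<open>d / t powr p\<close> is then at most
  \<open>t powr (\<kappa> - p)\<close>, which stays bounded because
  \<open>p < \<kappa>\<close>.\<close>

lemma coupling_rates:
  fixes d :: "nat \<Rightarrow> real" and \<kappa> p :: real
  assumes d: "\<And>r. 0 \<le> d r" and p: "0 < p" "p < \<kappa>" and s: "(\<lambda>r. d r powr (1 / \<kappa>)) summable_on {1..}"
  obtains t T where "\<And>r. (t r :: real) > 0" "T \<ge> 0" "\<And>N. (\<Sum>r<N. t r) \<le> T"
    "\<And>r. 1 \<le> r \<Longrightarrow> d r / t r powr p \<le> T powr (\<kappa> - p)"
proof -
  let ?f = "\<lambda>r. d r powr (1 / \<kappa>)"
  \<comment> \<open>The summand \<open>(1 / 2) ^ r\<close> keeps \<open>t r\<close> positive when \<open>d r = 0\<close>.\<close>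
  define t where "t = (\<lambda>r. (if r = 0 then 0 else ?f r) + (1 / 2) ^ r)"
  define T where "T = infsum ?f {1..} + 2"
  have t0: "t r > 0" for r by (simp add: t_def add_nonneg_pos)
  have tT: "(\<Sum>r<N. t r) \<le> T" for N
  proof -
    have "(\<Sum>r<N. t r) = (\<Sum>r<N. if r = 0 then 0 else ?f r) + (\<Sum>r<N. (1 / 2) ^ r)"
      by (simp add: t_def sum.distrib)
    also have "(\<Sum>r<N. if r = 0 then 0 else ?f r) = sum ?f ({..<N} \<inter> {1..})"
      by (simp add: sum.inter_restrict) (intro sum.cong, auto)
    also have "\<dots> \<le> infsum ?f {1..}" by (intro finite_sum_le_infsum s) auto
    also have "(\<Sum>r<N. (1 / 2) ^ r) \<le> (2 :: real)" by (simp add: geometric_sum)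
    finally show ?thesis by (simp add: T_def)
  qed
  have le: "t r \<le> T" for r
    using tT[of "Suc r"] sum_nonneg[of "{..<r}" t] less_imp_le[OF t0] by fastforce
  have "d r / t r powr p \<le> T powr (\<kappa> - p)" if r: "1 \<le> r" for r
  proof -
    have "d r = ?f r powr \<kappa>" using p d[of r] by (simp add: powr_powr)
    also have "\<dots> \<le> t r powr \<kappa>" using p r by (intro powr_mono2) (auto simp: t_def)
    finally have "d r / t r powr p \<le> t r powr \<kappa> / t r powr p" by (rule divide_right_mono) simp
    also have "\<dots> = t r powr (\<kappa> - p)" by (simp add: powr_diff)
    also have "\<dots> \<le> T powr (\<kappa> - p)" using le[of r] t0[of r] p by (intro powr_mono2) auto
    finally show ?thesis .
  qed
  moreover have "T \<ge> 0" using tT[of 0] by simp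
  ultimately show ?thesis using t0 tT that by blast
qed

text \<open>Telescope \<open>u * v - u' * v'\<close> into two differences. In each term the
  difference and one of \<open>x\<close>, \<open>y\<close> are bounded by norms, producing
  \<open>e * f\<close> once, and the remaining two scores go into fourth powers. The scale enters
  through \<open>D = t * (D / t)\<close>.\<close>

lemma coupled_product_le:
  fixes D N e f x y u v u' v' \<delta> t :: real
  assumes \<delta>: "\<delta> > 0" and t: "t > 0" and nn: "D \<ge> 0" "N \<ge> 0" "e \<ge> 0" "f \<ge> 0"
    and u: "\<bar>u - u'\<bar> \<le> D * e" and v: "\<bar>v - v'\<bar> \<le> D * f" and x: "\<bar>x\<bar> \<le> N * e" and y: "\<bar>y\<bar> \<le> N * f"
  shows "x * y * (u * v - u' * v')
    \<le> e * f * (t * (D powr (2 + \<delta>) / t powr (2 + \<delta>) + N powr (4 / \<delta> + 2) + (x ^ 4 + v ^ 4 + y ^ 4 + u' ^ 4) / 4))"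
proof -
  have h: "\<bar>z * w\<bar> * 2 \<le> z\<^sup>2 + w\<^sup>2" for z w :: real
    using sum_squares_bound[of "\<bar>z\<bar>" "\<bar>w\<bar>"] by (simp add: abs_mult)
  let ?P = "D powr (2 + \<delta>) / t powr (2 + \<delta>)" and ?Q = "N powr (4 / \<delta> + 2)"
  have key: "D * N * \<bar>z * w\<bar> \<le> t * ((?P + ?Q) / 2 + (z ^ 4 + w ^ 4) / 4)" for z w
  proof -
    have 1: "(D / t * N)\<^sup>2 \<le> ?P + ?Q"
      using square_mult_le_powr_add[OF \<delta>, of "D / t" N] nn t by (simp only: power_mult_distrib powr_divide divide_nonneg_pos)
    have 2: "(z * w)\<^sup>2 \<le> (z ^ 4 + w ^ 4) / 2"
      using h[of "z\<^sup>2" "w\<^sup>2"] by (simp add: power_mult_distrib flip: power_mult)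
    have 3: "(D / t * N) * \<bar>z * w\<bar> * 2 \<le> (D / t * N)\<^sup>2 + (z * w)\<^sup>2"
      using h[of "D / t * N" "z * w"] nn t by (simp add: abs_mult)
    have "(D / t * N) * \<bar>z * w\<bar> \<le> (?P + ?Q) / 2 + (z ^ 4 + w ^ 4) / 4" using 1 2 3 by argo
    then have "t * ((D / t * N) * \<bar>z * w\<bar>) \<le> t * ((?P + ?Q) / 2 + (z ^ 4 + w ^ 4) / 4)"
      using t by (intro mult_left_mono) auto
    moreover have "t * ((D / t * N) * \<bar>z * w\<bar>) = D * N * \<bar>z * w\<bar>" using t by simp
    ultimately show ?thesis by simp
  qed
  have "x * y * (u * v - u' * v') = x * v * (y * (u - u')) + y * u' * (x * (v - v'))"
    by (simp add: algebra_simps)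
  also have "\<dots> \<le> \<bar>x * v\<bar> * (\<bar>y\<bar> * \<bar>u - u'\<bar>) + \<bar>y * u'\<bar> * (\<bar>x\<bar> * \<bar>v - v'\<bar>)"
    by (intro add_mono) (auto simp flip: abs_mult)
  also have "\<dots> \<le> \<bar>x * v\<bar> * ((N * f) * (D * e)) + \<bar>y * u'\<bar> * ((N * e) * (D * f))"
    by (intro add_mono mult_left_mono mult_mono u v x y) (use nn in auto)
  also have "\<dots> = e * f * (D * N * \<bar>x * v\<bar> + D * N * \<bar>y * u'\<bar>)" by (simp add: algebra_simps)
  also have "\<dots> \<le> e * f * (t * ((?P + ?Q) / 2 + (x ^ 4 + v ^ 4) / 4) + t * ((?P + ?Q) / 2 + (y ^ 4 + u' ^ 4) / 4))"
    by (intro mult_left_mono add_mono key) (use nn in auto)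
  also have "\<dots> = e * f * (t * (?P + ?Q + (x ^ 4 + v ^ 4 + y ^ 4 + u' ^ 4) / 4))"
    by (simp add: field_simps)
  finally show ?thesis .
qed

lemma integrable_prod4:
  fixes f1 f2 f3 f4 :: "'a \<Rightarrow> real"
  assumes "f1 \<in> borel_measurable M" "f2 \<in> borel_measurable M" "f3 \<in> borel_measurable M" "f4 \<in> borel_measurable M"
    and "integrable M (\<lambda>\<omega>. f1 \<omega> ^ 4)" "integrable M (\<lambda>\<omega>. f2 \<omega> ^ 4)" "integrable M (\<lambda>\<omega>. f3 \<omega> ^ 4)" "integrable M (\<lambda>\<omega>. f4 \<omega> ^ 4)"
  shows "integrable M (\<lambda>\<omega>. f1 \<omega> * f2 \<omega> * (f3 \<omega> * f4 \<omega>))"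
proof (rule Bochner_Integration.integrable_bound)
  show "integrable M (\<lambda>\<omega>. (f1 \<omega> ^ 4 + f2 \<omega> ^ 4 + f3 \<omega> ^ 4 + f4 \<omega> ^ 4) / 4)"
    by (intro integrable_divide Bochner_Integration.integrable_add assms)
  show "(\<lambda>\<omega>. f1 \<omega> * f2 \<omega> * (f3 \<omega> * f4 \<omega>)) \<in> borel_measurable M" using assms(1-4) by measurable
  show "AE \<omega> in M. norm (f1 \<omega> * f2 \<omega> * (f3 \<omega> * f4 \<omega>)) \<le> norm ((f1 \<omega> ^ 4 + f2 \<omega> ^ 4 + f3 \<omega> ^ 4 + f4 \<omega> ^ 4) / 4)"
    by (intro AE_I2) (simp only: real_norm_def order_trans[OF abs_prod4_le abs_ge_self])
qed

context iid_with_copies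
begin

text \<open>\<open>A5\<close> states its summability for each time separately; independence of
  \<open>i\<close> turns the series at time 0 into a bound for all times.\<close>

lemma coupled_integral_stationary:
  fixes f :: "(nat \<Rightarrow> 'b) \<Rightarrow> (nat \<Rightarrow> 'b) \<Rightarrow> real"
  assumes m: "(\<lambda>z. f (\<lambda>j. z (Inl j)) (couple l z)) \<in> borel_measurable (PiM UNIV (\<lambda>_. T))"
  shows "(\<integral>\<omega>. f (past \<zeta> i \<omega>) (coupled_past \<zeta> \<zeta>s i l \<omega>) \<partial>M) = (\<integral>\<omega>. f (past \<zeta> 0 \<omega>) (coupled_past \<zeta> \<zeta>s 0 l \<omega>) \<partial>M)"
proof -
  have "(\<integral>\<omega>. f (past \<zeta> i \<omega>) (coupled_past \<zeta> \<zeta>s i l \<omega>) \<partial>M)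
      = (\<integral>z. f (\<lambda>j. z (Inl j)) (couple l z) \<partial>PiM UNIV (\<lambda>_. distr M T (\<zeta> 0)))" for i
    unfolding distr_pair[symmetric, of i l] integral_distr[OF reindex_measurable m]
    by (simp only: past_eq[of i _ l] coupled_past_eq)
  from this[of i] this[of 0] show ?thesis by simp
qed

lemma past_coupled_product:
  fixes f f' :: "(nat \<Rightarrow> 'b) \<Rightarrow> real"
  assumes f: "f \<in> borel_measurable (PiM UNIV (\<lambda>_. T))" "integrable past_law f"
    and f': "f' \<in> borel_measurable (PiM UNIV (\<lambda>_. T))" "integrable past_law f'" and i: "i < i'"
  shows "(\<integral>\<omega>. f (past \<zeta> i \<omega>) * f' (coupled_past \<zeta> \<zeta>s i' (nat (i' - i)) \<omega>) \<partial>M) = (\<integral>z. f z \<partial>past_law) * (\<integral>z. f' z \<partial>past_law)"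
proof -
  let ?l = "nat (i' - i)"
  have "indep_var borel (f \<circ> past \<zeta> i) borel (f' \<circ> coupled_past \<zeta> \<zeta>s i' ?l)"
    by (rule indep_var_compose[OF indep_past_coupled_past[OF i] f(1) f'(1)])
  from indep_var_lebesgue_integral[OF this] show ?thesis
    using integral_law(1,3)[OF f(1), of i] integral_law(2,4)[OF f'(1), of i' ?l] f(2) f'(2) by (simp add: o_def)
qed

end

context dependent_regression
begin

lemma ev_L2: "ev j \<in> L2"
  by (rule H_L2[OF ev_H])

lemma ev_norm_le: "L2_norm (ev j) \<le> csup * real (Suc j) powr a"
  by (rule L2_norm_le_sup[OF ev_L2]) (use csup in auto)

text \<open>The scores along \<open>ev j\<close> have second moment one by orthonormality, so the
  fourth moment condition in \<open>A3\<close> gives a bound uniform in \<open>j\<close>.\<close>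

lemma ev_fourth_moments:
  obtains c where "c \<ge> 0" "\<And>i j. (\<integral>\<omega>. (L2_inner (X i \<omega>) (ev j)) ^ 4 \<partial>M) \<le> c"
    "\<And>i r j. (\<integral>\<omega>. (L2_inner (g (coupled_past \<xi> \<xi>s i r \<omega>)) (ev j)) ^ 4 \<partial>M) \<le> c"
proof -
  obtain c where c: "c > 0" "\<And>b. b \<in> H \<Longrightarrow> (\<integral>\<omega>. (L2_inner (X 0 \<omega>) b) ^ 4 \<partial>M) \<le> c * (\<integral>\<omega>. (L2_inner (X 0 \<omega>) b)\<^sup>2 \<partial>M)\<^sup>2"
    using A3 unfolding A3_def by blast
  have "(\<integral>\<omega>. (L2_inner (X 0 \<omega>) (ev j))\<^sup>2 \<partial>M) = 1" for j
    using second_moment(1)[OF ev_L2 ev_L2, of 0 j j] by (simp add: V_ev power2_eq_square)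
  then have "(\<integral>\<omega>. (L2_inner (X 0 \<omega>) (ev j)) ^ 4 \<partial>M) \<le> c" for j using c(2)[OF ev_H[of j]] by simp
  then have "(\<integral>\<omega>. (L2_inner (X i \<omega>) (ev j)) ^ 4 \<partial>M) \<le> c"
    "(\<integral>\<omega>. (L2_inner (g (coupled_past \<xi> \<xi>s i r \<omega>)) (ev j)) ^ 4 \<partial>M) \<le> c" for i r j
    unfolding fourth_moment(3)[OF ev_H, of i r j] fourth_moment(4)[OF ev_H, of i j] by auto
  then show ?thesis using c(1) by (intro that[of c]) auto
qed

definition coupling_distance :: "int \<Rightarrow> nat \<Rightarrow> 'w \<Rightarrow> real" where
  "coupling_distance i r \<omega> = L2_norm (\<lambda>s. X i \<omega> s - g (coupled_past \<xi> \<xi>s i r \<omega>) s)"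

lemma coupling_distance_nonneg: "0 \<le> coupling_distance i r \<omega>"
  by (simp add: coupling_distance_def L2_norm_nonneg)

lemma coupling_distance_measurable: "coupling_distance i r \<in> borel_measurable M"
  unfolding coupling_distance_def
proof (rule measurable_L2_distance)
  show "(\<lambda>\<omega>. L2_norm (\<lambda>s. g (coupled_past \<xi> \<xi>s i r \<omega>) s - b s)) \<in> borel_measurable M" if "b \<in> L2" for b
    using measurable_compose[OF Xi.coupled_past_measurable measurable_compose[OF g_measurable measurable_L2_norm_diff[OF that]]] .
qed (auto intro: X_L2 g_coupled_L2 X_norm_diff_measurable)

lemma coupling_distance_le:
  assumes "\<omega> \<in> space M"
  shows "coupling_distance i r \<omega> \<le> L2_norm (X i \<omega>) + L2_norm (g (coupled_past \<xi> \<xi>s i r \<omega>))"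
  using L2_norm_diff_triangle[OF X_L2[OF assms, of i] _ g_coupled_L2[OF assms], of "\<lambda>_. 0" i r]
    L2_norm_minus_commute[of "\<lambda>_. 0" "g (coupled_past \<xi> \<xi>s i r \<omega>)"]
  by (simp add: coupling_distance_def continuous_on_L2)

lemma coupling_distance_integrable:
  assumes p: "p \<ge> 0"
  shows "integrable M (\<lambda>\<omega>. coupling_distance i r \<omega> powr p)"
proof (rule Bochner_Integration.integrable_bound)
  let ?u = "\<lambda>\<omega>. L2_norm (X i \<omega>)" and ?v = "\<lambda>\<omega>. L2_norm (g (coupled_past \<xi> \<xi>s i r \<omega>))"
  show "integrable M (\<lambda>\<omega>. 2 powr p * (?u \<omega> powr p + ?v \<omega> powr p))"
    by (intro integrable_mult_right Bochner_Integration.integrable_add X_norm_powr_integrable p)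
  show "(\<lambda>\<omega>. coupling_distance i r \<omega> powr p) \<in> borel_measurable M"
    using coupling_distance_measurable by measurable
  show "AE \<omega> in M. norm (coupling_distance i r \<omega> powr p) \<le> norm (2 powr p * (?u \<omega> powr p + ?v \<omega> powr p))"
  proof (intro AE_I2)
    fix \<omega> assume w: "\<omega> \<in> space M"
    have "coupling_distance i r \<omega> powr p \<le> (2 * max (?u \<omega>) (?v \<omega>)) powr p"
      using coupling_distance_le[OF w, of i r] p by (intro powr_mono2 coupling_distance_nonneg) auto
    also have "\<dots> = 2 powr p * max (?u \<omega>) (?v \<omega>) powr p" by (simp add: powr_mult le_max_iff_disj L2_norm_nonneg)
    also have "\<dots> \<le> 2 powr p * (?u \<omega> powr p + ?v \<omega> powr p)" by (intro mult_left_mono) (auto simp: max_def)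
    finally show "norm (coupling_distance i r \<omega> powr p) \<le> norm (2 powr p * (?u \<omega> powr p + ?v \<omega> powr p))" by simp
  qed
qed

lemma coupling_distance_stationary:
  "(\<integral>\<omega>. coupling_distance i r \<omega> powr p \<partial>M) = (\<integral>\<omega>. coupling_distance 0 r \<omega> powr p \<partial>M)"
proof -
  let ?f = "\<lambda>q q'. L2_norm (\<lambda>s. g q s - g q' s) powr p"
  have m1: "(\<lambda>z. g (\<lambda>j. z (Inl j))) \<in> measurable (PiM (UNIV :: (nat + nat) set) (\<lambda>_. S)) L2_borel"
    by (rule measurable_compose[OF _ g_measurable], intro measurable_PiM_single') (auto simp: space_PiM)
  have m2: "(\<lambda>z. g (Xi.couple r z)) \<in> measurable (PiM (UNIV :: (nat + nat) set) (\<lambda>_. S)) L2_borel"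
    by (rule measurable_compose[OF Xi.couple_measurable g_measurable])
  have "(\<lambda>z. L2_norm (\<lambda>s. g (\<lambda>j. z (Inl j)) s - g (Xi.couple r z) s)) \<in> borel_measurable (PiM UNIV (\<lambda>_. S))"
  proof (rule measurable_L2_distance)
    fix z assume z: "z \<in> space (PiM (UNIV :: (nat + nat) set) (\<lambda>_. S))"
    show "g (\<lambda>j. z (Inl j)) \<in> L2" using measurable_space[OF m1 z] by simp
    show "g (Xi.couple r z) \<in> L2" using measurable_space[OF m2 z] by simp
  next
    fix b assume b: "b \<in> L2"
    show "(\<lambda>z. L2_norm (\<lambda>s. g (\<lambda>j. z (Inl j)) s - b s)) \<in> borel_measurable (PiM (UNIV :: (nat + nat) set) (\<lambda>_. S))"
      by (rule measurable_compose[OF m1 measurable_L2_norm_diff[OF b]])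
    show "(\<lambda>z. L2_norm (\<lambda>s. g (Xi.couple r z) s - b s)) \<in> borel_measurable (PiM (UNIV :: (nat + nat) set) (\<lambda>_. S))"
      by (rule measurable_compose[OF m2 measurable_L2_norm_diff[OF b]])
  qed
  then have m: "(\<lambda>z. ?f (\<lambda>j. z (Inl j)) (Xi.couple r z)) \<in> borel_measurable (PiM UNIV (\<lambda>_. S))" by measurable
  have "(\<integral>\<omega>. coupling_distance i r \<omega> powr p \<partial>M) = (\<integral>\<omega>. ?f (past \<xi> i \<omega>) (coupled_past \<xi> \<xi>s i r \<omega>) \<partial>M)" for i
  proof (rule Bochner_Integration.integral_cong_AE)
    show "(\<lambda>\<omega>. coupling_distance i r \<omega> powr p) \<in> borel_measurable M"
      using coupling_distance_measurable by measurable
    show "(\<lambda>\<omega>. ?f (past \<xi> i \<omega>) (coupled_past \<xi> \<xi>s i r \<omega>)) \<in> borel_measurable M"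
      using measurable_compose[OF Xi.reindex_measurable[of "Xi.pair_index i r"] m]
      by (simp only: Xi.past_eq[of i _ r] Xi.coupled_past_eq)
    show "AE \<omega> in M. coupling_distance i r \<omega> powr p = ?f (past \<xi> i \<omega>) (coupled_past \<xi> \<xi>s i r \<omega>)"
      using X_AE[of i] AE_space
    proof eventually_elim
      case (elim \<omega>)
      have "L2_norm (\<lambda>s. X i \<omega> s - g (coupled_past \<xi> \<xi>s i r \<omega>) s) = L2_norm (\<lambda>s. g (past \<xi> i \<omega>) s - g (coupled_past \<xi> \<xi>s i r \<omega>) s)"
      proof (rule L2_norm_cong_AE)
        show "AE s in unit_leb. X i \<omega> s - g (coupled_past \<xi> \<xi>s i r \<omega>) s = g (past \<xi> i \<omega>) s - g (coupled_past \<xi> \<xi>s i r \<omega>) s"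
          using elim(1) by eventually_elim simp
      qed (use L2_diff[OF X_L2[OF elim(2), of i] g_coupled_L2[OF elim(2), of i r]] L2_diff[OF g_past_L2[OF elim(2), of i] g_coupled_L2[OF elim(2), of i r]] in \<open>simp_all add: L2_def\<close>)
      then show ?case by (simp add: coupling_distance_def)
    qed
  qed
  from this[of i] this[of 0] Xi.coupled_integral_stationary[of ?f, OF m, of i] show ?thesis by simp
qed

end

lemma integral_weighted_combination:
  fixes A B F1 F2 F3 F4 :: "'a \<Rightarrow> real"
  assumes "integrable M A" "integrable M B" "integrable M F1" "integrable M F2" "integrable M F3" "integrable M F4"
  shows "integrable M (\<lambda>\<omega>. e * (t * (A \<omega> / s + B \<omega> + (F1 \<omega> + F2 \<omega> + F3 \<omega> + F4 \<omega>) / 4)))"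
    and "(\<integral>\<omega>. e * (t * (A \<omega> / s + B \<omega> + (F1 \<omega> + F2 \<omega> + F3 \<omega> + F4 \<omega>) / 4)) \<partial>M)
      = e * (t * (integral\<^sup>L M A / s + integral\<^sup>L M B + (integral\<^sup>L M F1 + integral\<^sup>L M F2 + integral\<^sup>L M F3 + integral\<^sup>L M F4) / 4))"
  using assms by simp_all

section \<open>Covariances of centred products of scores\<close>

context dependent_regression
begin

abbreviation "sc j i \<omega> \<equiv> L2_inner (X i \<omega>) (ev j)"
abbreviation "sc' j i r \<omega> \<equiv> L2_inner (g (coupled_past \<xi> \<xi>s i r \<omega>)) (ev j)"

lemma sc_measurable: "sc j i \<in> borel_measurable M"
  by (rule X_inner_measurable[OF ev_L2])

lemma sc'_measurable: "sc' j i r \<in> borel_measurable M"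
  by (rule measurable_compose[OF Xi.coupled_past_measurable measurable_compose[OF g_measurable measurable_L2_inner[OF ev_L2]]])

lemmas sc4 = fourth_moment(1)[OF ev_H] fourth_moment(2)[OF ev_H]

lemma sc_quad_integrable:
  "integrable M (\<lambda>\<omega>. sc j1 i1 \<omega> * sc j2 i2 \<omega> * (sc j3 i3 \<omega> * sc j4 i4 \<omega>))"
  "integrable M (\<lambda>\<omega>. sc j1 i1 \<omega> * sc j2 i2 \<omega> * (sc' j3 i3 r \<omega> * sc' j4 i3 r \<omega>))"
  by (intro integrable_prod4 sc_measurable sc'_measurable sc4)+

lemma sc_pair_integrable: "integrable M (\<lambda>\<omega>. sc j i \<omega> * sc l i \<omega>)"
  and sc_pair_integral: "(\<integral>\<omega>. sc j i \<omega> * sc l i \<omega> \<partial>M) = (if j = l then 1 else 0)"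
  using X_inner_mult_integrable[OF ev_L2 ev_L2] second_moment(1)[OF ev_L2 ev_L2] by (auto simp: V_ev)

lemma sc_coupled_integral:
  assumes "i < i'"
  shows "(\<integral>\<omega>. sc j i \<omega> * sc l i \<omega> * (sc' j i' (nat (i' - i)) \<omega> * sc' l i' (nat (i' - i)) \<omega>) \<partial>M) = (if j = l then 1 else 0)"
proof -
  let ?r = "nat (i' - i)"
  let ?f = "\<lambda>q. L2_inner (g q) (ev j) * L2_inner (g q) (ev l)"
  have fm: "?f \<in> borel_measurable (PiM UNIV (\<lambda>_. S))"
    using measurable_compose[OF g_measurable measurable_L2_inner[OF ev_L2[of j]]]
      measurable_compose[OF g_measurable measurable_L2_inner[OF ev_L2[of l]]] by (rule borel_measurable_times)
  have fi: "integrable Xi.past_law ?f"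
    using second_moment(2)[OF ev_L2 ev_L2, of i' ?r j l] Xi.integral_law(2)[OF fm, of i' ?r] by simp
  have fv: "(\<integral>z. ?f z \<partial>Xi.past_law) = (if j = l then 1 else 0)"
    using second_moment(3)[OF ev_L2 ev_L2, of i' ?r j l] Xi.integral_law(4)[OF fm, of i' ?r] by (simp add: V_ev)
  have "(\<integral>\<omega>. sc j i \<omega> * sc l i \<omega> * (sc' j i' ?r \<omega> * sc' l i' ?r \<omega>) \<partial>M) = (\<integral>\<omega>. ?f (past \<xi> i \<omega>) * ?f (coupled_past \<xi> \<xi>s i' ?r \<omega>) \<partial>M)"
  proof (rule Bochner_Integration.integral_cong_AE)
    show "(\<lambda>\<omega>. sc j i \<omega> * sc l i \<omega> * (sc' j i' ?r \<omega> * sc' l i' ?r \<omega>)) \<in> borel_measurable M"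
      by (rule borel_measurable_integrable[OF sc_quad_integrable(2)])
    show "(\<lambda>\<omega>. ?f (past \<xi> i \<omega>) * ?f (coupled_past \<xi> \<xi>s i' ?r \<omega>)) \<in> borel_measurable M"
      by (intro borel_measurable_times measurable_compose[OF Xi.past_measurable fm] measurable_compose[OF Xi.coupled_past_measurable fm])
         (rule measurable_compose[OF Xi.past_measurable measurable_compose[OF g_measurable measurable_L2_inner[OF ev_L2]]]
          sc'_measurable)+
    show "AE \<omega> in M. sc j i \<omega> * sc l i \<omega> * (sc' j i' ?r \<omega> * sc' l i' ?r \<omega>) = ?f (past \<xi> i \<omega>) * ?f (coupled_past \<xi> \<xi>s i' ?r \<omega>)"
      using X_inner_AE[OF ev_L2[of j], of i] X_inner_AE[OF ev_L2[of l], of i] by eventually_elim simp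
  qed
  then show ?thesis unfolding Xi.past_coupled_product[OF fm fi fm fi assms] fv by simp
qed

lemma sc_diff_le:
  assumes "\<omega> \<in> space M"
  shows "\<bar>sc j i \<omega> - sc' j i r \<omega>\<bar> \<le> coupling_distance i r \<omega> * L2_norm (ev j)"
  using L2_inner_lincomb[OF X_L2[OF assms, of i] g_coupled_L2[OF assms, of i r] ev_L2, of 1 "-1" j]
    L2_inner_Cauchy_Schwarz[OF L2_diff[OF X_L2[OF assms, of i] g_coupled_L2[OF assms, of i r]] ev_L2[of j]]
  by (simp add: coupling_distance_def)

text \<open>Replacing \<open>X i'\<close> by a copy independent of \<open>X i\<close> gives covariance zero.  In the remaining term one
  factor of each index is bounded by a norm, which keeps the dependence on \<open>j\<close> and \<open>l\<close> at \<open>L2_norm (ev j) * L2_norm (ev l)\<close>;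
  the scale \<open>t\<close> balances the coupling distance against moments of all orders of the norm.\<close>

lemma cross_covariance_le:
  assumes i: "i < i'" and \<delta>: "\<delta> > 0" and t: "t > 0"
    and c: "\<And>i j. (\<integral>\<omega>. (sc j i \<omega>) ^ 4 \<partial>M) \<le> c" "\<And>i r j. (\<integral>\<omega>. (sc' j i r \<omega>) ^ 4 \<partial>M) \<le> c"
  shows "(\<integral>\<omega>. (sc j i \<omega> * sc l i \<omega> - (if j = l then 1 else 0)) * (sc j i' \<omega> * sc l i' \<omega> - (if j = l then 1 else 0)) \<partial>M)
    \<le> L2_norm (ev j) * L2_norm (ev l) * (t * ((\<integral>\<omega>. coupling_distance 0 (nat (i' - i)) \<omega> powr (2 + \<delta>) \<partial>M) / t powr (2 + \<delta>)
        + (\<integral>\<omega>. L2_norm (X 0 \<omega>) powr (4 / \<delta> + 2) \<partial>M) + c))" (is "?L \<le> ?e * ?f * (t * (?d / ?s + ?q + c))")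
proof -
  let ?r = "nat (i' - i)" and ?k = "if j = l then 1 else 0 :: real"
  let ?A = "\<lambda>\<omega>. sc j i \<omega> * sc l i \<omega> * (sc j i' \<omega> * sc l i' \<omega>)"
  let ?B = "\<lambda>\<omega>. sc j i \<omega> * sc l i \<omega> * (sc' j i' ?r \<omega> * sc' l i' ?r \<omega>)"
  let ?N = "\<lambda>\<omega>. L2_norm (X i \<omega>) powr (4 / \<delta> + 2)" and ?D = "\<lambda>\<omega>. coupling_distance i' ?r \<omega> powr (2 + \<delta>)"
  let ?G = "\<lambda>\<omega>. ?e * ?f * (t * (?D \<omega> / ?s + ?N \<omega> + ((sc j i \<omega>) ^ 4 + (sc l i' \<omega>) ^ 4 + (sc l i \<omega>) ^ 4 + (sc' j i' ?r \<omega>) ^ 4) / 4))"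
  have "?L = (\<integral>\<omega>. ?A \<omega> - ?k * (sc j i \<omega> * sc l i \<omega>) - ?k * (sc j i' \<omega> * sc l i' \<omega>) + ?k * ?k \<partial>M)"
    by (intro Bochner_Integration.integral_cong refl) (simp only: algebra_simps)
  \<comment> \<open>The mixed terms and the constant add up to \<open>- ?k * ?k\<close>, and
    \<open>?k * ?k = ?k\<close> because \<open>?k\<close> is 0 or 1.\<close>
  also have "\<dots> = (\<integral>\<omega>. ?A \<omega> \<partial>M) - ?k"
    using sc_quad_integrable(1)[of i j i l i' j i' l] sc_pair_integrable[of i j l] sc_pair_integrable[of i' j l]
      sc_pair_integral[of i j l] sc_pair_integral[of i' j l]
    by (simp add: prob_space)
  \<comment> \<open>By independence of the copy the mean of \<open>?B\<close> is exactly
    \<open>?k\<close>, so the covariance is the mean of a difference that is controlled by the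
    coupling distance.\<close>
  also have "\<dots> = (\<integral>\<omega>. ?A \<omega> - ?B \<omega> \<partial>M)"
    unfolding Bochner_Integration.integral_diff[OF sc_quad_integrable] sc_coupled_integral[OF i] by simp
  also have "\<dots> \<le> (\<integral>\<omega>. ?G \<omega> \<partial>M)"
  proof (rule integral_mono)
    show "integrable M (\<lambda>\<omega>. ?A \<omega> - ?B \<omega>)" by (intro Bochner_Integration.integrable_diff sc_quad_integrable)
    show "integrable M ?G"
      using \<delta> by (intro integral_weighted_combination(1) coupling_distance_integrable X_norm_powr_integrable sc4) auto
    fix \<omega> assume w: "\<omega> \<in> space M"
    have "sc j i \<omega> * sc l i \<omega> * (sc j i' \<omega> * sc l i' \<omega> - sc' j i' ?r \<omega> * sc' l i' ?r \<omega>) \<le> ?G \<omega>"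
      by (rule coupled_product_le[OF \<delta> t])
         (intro coupling_distance_nonneg L2_norm_nonneg sc_diff_le w X_inner_le ev_L2)+
    then show "?A \<omega> - ?B \<omega> \<le> ?G \<omega>" by (simp only: right_diff_distrib)
  qed
  also have "(\<integral>\<omega>. ?G \<omega> \<partial>M) = ?e * ?f * (t * ((\<integral>\<omega>. ?D \<omega> \<partial>M) / ?s + (\<integral>\<omega>. ?N \<omega> \<partial>M)
      + ((\<integral>\<omega>. (sc j i \<omega>) ^ 4 \<partial>M) + (\<integral>\<omega>. (sc l i' \<omega>) ^ 4 \<partial>M) + (\<integral>\<omega>. (sc l i \<omega>) ^ 4 \<partial>M) + (\<integral>\<omega>. (sc' j i' ?r \<omega>) ^ 4 \<partial>M)) / 4))"
    using \<delta> by (intro integral_weighted_combination(2) coupling_distance_integrable X_norm_powr_integrable sc4) auto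
  also have "\<dots> \<le> ?e * ?f * (t * (?d / ?s + ?q + c))"
  proof (intro mult_left_mono add_mono)
    show "(\<integral>\<omega>. ?D \<omega> \<partial>M) / ?s \<le> ?d / ?s" using coupling_distance_stationary[of i' ?r "2 + \<delta>"] by simp
    show "(\<integral>\<omega>. ?N \<omega> \<partial>M) \<le> ?q" using X_norm_powr_integrable(3)[of "4 / \<delta> + 2"] \<delta> by simp
    show "((\<integral>\<omega>. (sc j i \<omega>) ^ 4 \<partial>M) + (\<integral>\<omega>. (sc l i' \<omega>) ^ 4 \<partial>M) + (\<integral>\<omega>. (sc l i \<omega>) ^ 4 \<partial>M) + (\<integral>\<omega>. (sc' j i' ?r \<omega>) ^ 4 \<partial>M)) / 4 \<le> c"
      using c(1)[of i j] c(1)[of i' l] c(1)[of i l] c(2)[of i' ?r j] by argo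
  qed (use t L2_norm_nonneg in auto)
  finally show ?thesis .
qed

text \<open>Lag zero, where coupling offers nothing, is brought to the same shape as the covariance
  bound, so that both fit one function of the lag.\<close>

lemma cross_variance_le:
  assumes c: "\<And>i j. (\<integral>\<omega>. (sc j i \<omega>) ^ 4 \<partial>M) \<le> c"
  shows "(\<integral>\<omega>. (sc j i \<omega> * sc l i \<omega> - (if j = l then 1 else 0)) * (sc j i \<omega> * sc l i \<omega> - (if j = l then 1 else 0)) \<partial>M)
    \<le> L2_norm (ev j) * L2_norm (ev l) * ((\<integral>\<omega>. L2_norm (X 0 \<omega>) powr 4 \<partial>M) + c)" (is "?L \<le> ?e * ?f * (?q + c)")
proof -
  let ?k = "if j = l then 1 else 0 :: real"
  let ?A = "\<lambda>\<omega>. sc j i \<omega> * sc l i \<omega> * (sc j i \<omega> * sc l i \<omega>)"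
  let ?G = "\<lambda>\<omega>. ?e * ?f * (L2_norm (X i \<omega>) powr 4 + ((sc j i \<omega>) ^ 4 + (sc l i \<omega>) ^ 4) / 2)"
  have "?L = (\<integral>\<omega>. ?A \<omega> - 2 * ?k * (sc j i \<omega> * sc l i \<omega>) + ?k * ?k \<partial>M)"
    by (intro Bochner_Integration.integral_cong refl) (simp add: algebra_simps)
  also have "\<dots> = (\<integral>\<omega>. ?A \<omega> \<partial>M) - ?k"
    using sc_quad_integrable(1)[of i j i l i j i l] sc_pair_integrable[of i j l] sc_pair_integral[of i j l]
    by (simp add: prob_space)
  also have "\<dots> \<le> (\<integral>\<omega>. ?A \<omega> \<partial>M)" by simp
  also have "\<dots> \<le> (\<integral>\<omega>. ?G \<omega> \<partial>M)"
  proof (rule integral_mono[OF sc_quad_integrable(1)])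
    show "integrable M ?G"
      by (intro integrable_mult_right Bochner_Integration.integrable_add integrable_divide sc4 X_norm_powr_integrable) simp
    fix \<omega> assume w: "\<omega> \<in> space M"
    let ?n = "L2_norm (X i \<omega>)" and ?x = "sc j i \<omega>" and ?y = "sc l i \<omega>"
    have n4: "?n powr 4 = ?n ^ 4" using L2_norm_nonneg[of "X i \<omega>"] by (cases "?n = 0") auto
    have h: "\<bar>z * w\<bar> * 2 \<le> z\<^sup>2 + w\<^sup>2" for z w :: real
      using sum_squares_bound[of "\<bar>z\<bar>" "\<bar>w\<bar>"] by (simp add: abs_mult)
    have "?x * ?y * (?x * ?y) = \<bar>?x\<bar> * \<bar>?y\<bar> * \<bar>?x * ?y\<bar>"
      by (simp only: abs_mult[symmetric]) (simp add: abs_mult)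
    also have "\<dots> \<le> (?n * ?e) * (?n * ?f) * \<bar>?x * ?y\<bar>"
      by (intro mult_right_mono mult_mono X_inner_le w ev_L2) (auto simp: L2_norm_nonneg)
    also have "\<dots> = ?e * ?f * (?n\<^sup>2 * \<bar>?x * ?y\<bar>)" by (simp add: power2_eq_square)
    also have "\<dots> \<le> ?e * ?f * (?n powr 4 + (?x ^ 4 + ?y ^ 4) / 2)"
    proof (intro mult_left_mono)
      have "?n\<^sup>2 * \<bar>?x * ?y\<bar> * 2 \<le> ?n ^ 4 + (?x * ?y)\<^sup>2"
        using h[of "?n\<^sup>2" "?x * ?y"] by (simp add: abs_mult flip: power_mult)
      moreover have "(?x * ?y)\<^sup>2 * 2 \<le> ?x ^ 4 + ?y ^ 4"
        using h[of "?x\<^sup>2" "?y\<^sup>2"] by (simp add: power_mult_distrib flip: power_mult)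
      moreover have "0 \<le> ?n ^ 4" "0 \<le> (?x * ?y)\<^sup>2" by simp_all
      ultimately show "?n\<^sup>2 * \<bar>?x * ?y\<bar> \<le> ?n powr 4 + (?x ^ 4 + ?y ^ 4) / 2" unfolding n4 by argo
    qed (simp add: L2_norm_nonneg)
    finally show "?A \<omega> \<le> ?G \<omega>" .
  qed
  also have "\<dots> = ?e * ?f * ((\<integral>\<omega>. L2_norm (X i \<omega>) powr 4 \<partial>M) + ((\<integral>\<omega>. (sc j i \<omega>) ^ 4 \<partial>M) + (\<integral>\<omega>. (sc l i \<omega>) ^ 4 \<partial>M)) / 2)"
    using X_norm_powr_integrable(2)[of 4 i] sc4(1)[of i j] sc4(1)[of i l] by simp
  also have "\<dots> \<le> ?e * ?f * (?q + c)"
  proof (intro mult_left_mono add_mono)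
    show "(\<integral>\<omega>. L2_norm (X i \<omega>) powr 4 \<partial>M) \<le> ?q" using X_norm_powr_integrable(3)[of 4] by simp
    show "((\<integral>\<omega>. (sc j i \<omega>) ^ 4 \<partial>M) + (\<integral>\<omega>. (sc l i \<omega>) ^ 4 \<partial>M)) / 2 \<le> c" using c[of i j] c[of i l] by argo
  qed (simp add: L2_norm_nonneg)
  finally show ?thesis .
qed

text \<open>The growth \<open>real (Suc j) powr a\<close> in each index comes from the sup-norm
  bound on \<open>ev j\<close> in \<open>A2\<close>, through \<open>ev_norm_le\<close>.\<close>

lemma cross_second_moment:
  obtains C where "C \<ge> 0"
    "\<And>j l b k. integrable M (\<lambda>\<omega>. (\<Sum>n\<in>{b..<b + k}. cross \<omega> n j l)\<^sup>2)"
    "\<And>j l b k. (\<integral>\<omega>. (\<Sum>n\<in>{b..<b + k}. cross \<omega> n j l)\<^sup>2 \<partial>M) \<le> C * (real (Suc j) powr a * real (Suc l) powr a) * real k"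
proof -
  obtain \<delta> \<kappa> where \<delta>: "0 < \<delta>" and \<kappa>: "2 + \<delta> < \<kappa>"
    and sm: "(\<lambda>r. (\<integral>\<omega>. coupling_distance 0 r \<omega> powr (2 + \<delta>) \<partial>M) powr (1 / \<kappa>)) summable_on {1..}"
    using A5 unfolding A5_def coupling_distance_def by auto
  obtain c where c: "c \<ge> 0" "\<And>i j. (\<integral>\<omega>. (sc j i \<omega>) ^ 4 \<partial>M) \<le> c" "\<And>i r j. (\<integral>\<omega>. (sc' j i r \<omega>) ^ 4 \<partial>M) \<le> c"
    by (rule ev_fourth_moments; rule that; blast)
  define d where "d = (\<lambda>r. \<integral>\<omega>. coupling_distance 0 r \<omega> powr (2 + \<delta>) \<partial>M)"
  have d0: "0 \<le> d r" for r by (simp add: d_def)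
  obtain t T where t: "\<And>r. (t r :: real) > 0" and T: "T \<ge> 0" "\<And>N. (\<Sum>r<N. t r) \<le> T"
    and tT: "\<And>r. 1 \<le> r \<Longrightarrow> d r / t r powr (2 + \<delta>) \<le> T powr (\<kappa> - (2 + \<delta>))"
    by (rule coupling_rates[of d "2 + \<delta>" \<kappa>]) (use d0 \<delta> \<kappa> sm in \<open>auto simp: d_def\<close>)
  define q where "q = (\<integral>\<omega>. L2_norm (X 0 \<omega>) powr (4 / \<delta> + 2) \<partial>M)"
  define q4 where "q4 = (\<integral>\<omega>. L2_norm (X 0 \<omega>) powr 4 \<partial>M)"
  have q0: "q \<ge> 0" "q4 \<ge> 0" by (simp_all add: q_def q4_def)
  define U where "U = T powr (\<kappa> - (2 + \<delta>)) + q + c"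
  have U0: "U \<ge> 0" using q0 c by (simp add: U_def)
  \<comment> \<open>Bound on covariances by lag: the variance constant enters at lag zero, and
    \<open>t r\<close> times a constant at every lag, summable because \<open>t\<close> is.\<close>
  define \<gamma> where "\<gamma> = (\<lambda>r. (if r = 0 then q4 + c else 0) + t r * U)"
  define \<Gamma> where "\<Gamma> = q4 + c + T * U"
  have \<gamma>0: "0 \<le> \<gamma> r" for r using q0 c U0 t[of r] by (simp add: \<gamma>_def)
  have \<gamma>\<Gamma>: "(\<Sum>r<N. \<gamma> r) \<le> \<Gamma>" for N
  proof -
    have "(\<Sum>r<N. if r = 0 then q4 + c else 0) \<le> q4 + c" using q0 c by (simp add: sum.delta)
    moreover have "(\<Sum>r<N. t r) * U \<le> T * U" by (intro mult_right_mono T U0)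
    ultimately show ?thesis by (simp add: \<gamma>_def \<Gamma>_def sum.distrib sum_distrib_right)
  qed
  have \<Gamma>0: "\<Gamma> \<ge> 0" using \<gamma>\<Gamma>[of 0] by simp
  let ?e = "\<lambda>j. L2_norm (ev j)"
  have int: "integrable M (\<lambda>\<omega>. cross \<omega> n j l * cross \<omega> n' j l)" for n n' j l
  proof -
    have "integrable M (\<lambda>\<omega>. sc j n \<omega> * sc l n \<omega> * (sc j n' \<omega> * sc l n' \<omega>) - (if j = l then 1 else 0) * (sc j n \<omega> * sc l n \<omega>)
       - (if j = l then 1 else 0) * (sc j n' \<omega> * sc l n' \<omega>) + (if j = l then 1 else 0) * (if j = l then 1 else 0))"
      by (intro Bochner_Integration.integrable_add Bochner_Integration.integrable_diff integrable_mult_right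
        sc_quad_integrable sc_pair_integrable integrable_const)
    then show ?thesis unfolding cross_def by (simp only: algebra_simps)
  qed
  have cov: "(\<integral>\<omega>. cross \<omega> n j l * cross \<omega> n' j l \<partial>M) \<le> ?e j * ?e l * \<gamma> (n' - n)" if n: "n \<le> n'" for n n' j l
  proof (cases "n = n'")
    case True
    have "(\<integral>\<omega>. cross \<omega> n j l * cross \<omega> n' j l \<partial>M) \<le> ?e j * ?e l * (q4 + c)"
      unfolding True cross_def q4_def by (rule cross_variance_le[OF c(2)])
    also have "\<dots> \<le> ?e j * ?e l * \<gamma> (n' - n)"
      using t[of 0] U0 True by (intro mult_left_mono) (auto simp: \<gamma>_def L2_norm_nonneg)
    finally show ?thesis .
  next
    case False
    then have lt: "int n < int n'" and r: "nat (int n' - int n) = n' - n" "1 \<le> n' - n" using n by auto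
    have "(\<integral>\<omega>. cross \<omega> n j l * cross \<omega> n' j l \<partial>M) \<le> ?e j * ?e l * (t (n' - n) * (d (n' - n) / t (n' - n) powr (2 + \<delta>) + q + c))"
      using cross_covariance_le[OF lt \<delta> t[of "n' - n"] c(2,3), of j l] unfolding cross_def q_def d_def r(1) .
    also have "\<dots> \<le> ?e j * ?e l * (t (n' - n) * U)"
      using tT[OF r(2)] t[of "n' - n"] by (intro mult_left_mono) (auto simp: U_def L2_norm_nonneg)
    also have "\<dots> = ?e j * ?e l * \<gamma> (n' - n)" using r(2) by (simp add: \<gamma>_def)
    finally show ?thesis .
  qed
  have "0 \<le> ?e j * ?e l * \<gamma> r" "(\<Sum>r<N. ?e j * ?e l * \<gamma> r) \<le> ?e j * ?e l * \<Gamma>" for r N j l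
    using \<gamma>0 \<gamma>\<Gamma> by (auto simp: L2_norm_nonneg simp flip: sum_distrib_left intro!: mult_left_mono)
  note sms = second_moment_sum[of "\<lambda>n \<omega>. cross \<omega> n j l" "\<lambda>r. ?e j * ?e l * \<gamma> r" "?e j * ?e l * \<Gamma>" for j l, OF int cov this]
  define C where "C = 2 * \<Gamma> * (csup * csup)"
  have "(\<integral>\<omega>. (\<Sum>n\<in>{b..<b + k}. cross \<omega> n j l)\<^sup>2 \<partial>M) \<le> C * (real (Suc j) powr a * real (Suc l) powr a) * real k" for j l b k
  proof -
    have "?e j * ?e l \<le> (csup * real (Suc j) powr a) * (csup * real (Suc l) powr a)"
      using csup(1) by (intro mult_mono ev_norm_le) (auto simp: L2_norm_nonneg)
    then have "2 * \<Gamma> * real k * (?e j * ?e l) \<le> 2 * \<Gamma> * real k * ((csup * real (Suc j) powr a) * (csup * real (Suc l) powr a))"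
      using \<Gamma>0 by (intro mult_left_mono) auto
    then show ?thesis using sms(2)[of j l b k] by (simp add: C_def mult_ac)
  qed
  moreover have "C \<ge> 0" using \<Gamma>0 by (simp add: C_def)
  ultimately show ?thesis using sms(1) that by blast
qed

end

section \<open>Covariances of the noise scores\<close>

lemma square_le_powr:
  fixes w p :: real
  assumes p: "p \<ge> 2"
  shows "w\<^sup>2 \<le> 1 + \<bar>w\<bar> powr p"
proof (cases "\<bar>w\<bar> \<le> 1")
  case True
  then have "w\<^sup>2 \<le> 1" by (simp only: abs_square_le_1)
  then show ?thesis by (simp add: add_increasing2)
next
  case False
  then have "\<bar>w\<bar> powr 2 \<le> \<bar>w\<bar> powr p" using p by (intro powr_mono) auto
  moreover have "\<bar>w\<bar> powr 2 = w\<^sup>2" using False by simp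
  ultimately show ?thesis by linarith
qed

text \<open>Counterpart of \<open>coupled_product_le\<close> for the noise: the coupling error
  \<open>w\<close> is rescaled by \<open>t\<close>, and the square of \<open>w / t\<close> is
  bounded by 1 plus its \<open>p\<close>-th absolute power.\<close>

lemma abs_mult_le_coupling:
  fixes u w t p :: real
  assumes t: "t > 0" and p: "p \<ge> 2"
  shows "\<bar>u * w\<bar> \<le> t * (u\<^sup>2 + 1 + \<bar>w\<bar> powr p / t powr p)"
proof -
  have "(w / t)\<^sup>2 \<le> 1 + \<bar>w / t\<bar> powr p" by (rule square_le_powr[OF p])
  moreover have "\<bar>w / t\<bar> powr p = \<bar>w\<bar> powr p / t powr p" using t by (simp add: powr_divide)
  moreover have "\<bar>u\<bar> * \<bar>w / t\<bar> * 2 \<le> u\<^sup>2 + (w / t)\<^sup>2"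
    using sum_squares_bound[of "\<bar>u\<bar>" "\<bar>w / t\<bar>"] unfolding power2_abs by (simp only: mult_ac)
  moreover have "0 \<le> u\<^sup>2" "0 \<le> (w / t)\<^sup>2" "0 \<le> \<bar>u\<bar> * \<bar>w / t\<bar>" by simp_all
  ultimately have "\<bar>u\<bar> * \<bar>w / t\<bar> \<le> u\<^sup>2 + 1 + \<bar>w\<bar> powr p / t powr p" by argo
  then have "t * (\<bar>u\<bar> * \<bar>w / t\<bar>) \<le> t * (u\<^sup>2 + 1 + \<bar>w\<bar> powr p / t powr p)"
    using t by (intro mult_left_mono) auto
  moreover have "t * (\<bar>u\<bar> * \<bar>w / t\<bar>) = \<bar>u * w\<bar>" using t by (simp add: abs_mult)
  ultimately show ?thesis by simp
qed

context dependent_regression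
begin

lemma eps_measurable: "\<epsilon> i \<in> borel_measurable M"
  using model by (auto simp: regression_model_def)

lemma eps'_measurable: "(\<lambda>\<omega>. h (coupled_past \<eta> \<eta>s i r \<omega>)) \<in> borel_measurable M"
  by (rule measurable_compose[OF Eta.coupled_past_measurable h_measurable])

lemma eps_law:
  assumes \<Phi>: "\<Phi> \<in> borel_measurable borel"
  shows "integrable M (\<lambda>\<omega>. \<Phi> (\<epsilon> i \<omega>)) \<longleftrightarrow> integrable Eta.past_law (\<lambda>z. \<Phi> (h z))"
    and "(\<integral>\<omega>. \<Phi> (\<epsilon> i \<omega>) \<partial>M) = (\<integral>z. \<Phi> (h z) \<partial>Eta.past_law :: real)"
    and "integrable M (\<lambda>\<omega>. \<Phi> (h (coupled_past \<eta> \<eta>s j l \<omega>))) \<longleftrightarrow> integrable Eta.past_law (\<lambda>z. \<Phi> (h z))"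
    and "(\<integral>\<omega>. \<Phi> (h (coupled_past \<eta> \<eta>s j l \<omega>)) \<partial>M) = (\<integral>z. \<Phi> (h z) \<partial>Eta.past_law :: real)"
proof -
  have hm: "(\<lambda>z. \<Phi> (h z)) \<in> borel_measurable (PiM UNIV (\<lambda>_. borel))"
    by (rule measurable_compose[OF h_measurable \<Phi>])
  have m: "(\<lambda>\<omega>. \<Phi> (\<epsilon> i \<omega>)) \<in> borel_measurable M" by (rule measurable_compose[OF eps_measurable \<Phi>])
  have hp: "(\<lambda>\<omega>. \<Phi> (h (past \<eta> i \<omega>))) \<in> borel_measurable M"
    by (rule measurable_compose[OF Eta.past_measurable hm])
  have ae: "AE \<omega> in M. \<Phi> (\<epsilon> i \<omega>) = \<Phi> (h (past \<eta> i \<omega>))" using eps_AE[of i] by eventually_elim simp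
  note L = Eta.integral_law[OF hm]
  show "integrable M (\<lambda>\<omega>. \<Phi> (\<epsilon> i \<omega>)) \<longleftrightarrow> integrable Eta.past_law (\<lambda>z. \<Phi> (h z))"
    using Bochner_Integration.integrable_cong_AE[OF m hp ae] L(1)[of i] by simp
  show "(\<integral>\<omega>. \<Phi> (\<epsilon> i \<omega>) \<partial>M) = (\<integral>z. \<Phi> (h z) \<partial>Eta.past_law)"
    using Bochner_Integration.integral_cong_AE[OF m hp ae] L(3)[of i] by simp
  show "integrable M (\<lambda>\<omega>. \<Phi> (h (coupled_past \<eta> \<eta>s j l \<omega>))) \<longleftrightarrow> integrable Eta.past_law (\<lambda>z. \<Phi> (h z))"
    by (rule L(2))
  show "(\<integral>\<omega>. \<Phi> (h (coupled_past \<eta> \<eta>s j l \<omega>)) \<partial>M) = (\<integral>z. \<Phi> (h z) \<partial>Eta.past_law)"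
    by (rule L(4))
qed

lemma eps_mean: "integrable Eta.past_law h" "(\<integral>z. h z \<partial>Eta.past_law) = 0"
proof -
  have "integrable M (\<epsilon> 0)" "(\<integral>\<omega>. \<epsilon> 0 \<omega> \<partial>M) = 0" using model by (auto simp: regression_model_def)
  then show "integrable Eta.past_law h" "(\<integral>z. h z \<partial>Eta.past_law) = 0"
    using eps_law(1,2)[of "\<lambda>x. x" 0] by simp_all
qed

lemma eps_square_integrable:
  assumes p: "p \<ge> 2" and int: "integrable M (\<lambda>\<omega>. \<bar>\<epsilon> 0 \<omega>\<bar> powr p)"
  shows "integrable M (\<lambda>\<omega>. (\<epsilon> i \<omega>)\<^sup>2)" and "(\<integral>\<omega>. (\<epsilon> i \<omega>)\<^sup>2 \<partial>M) = (\<integral>\<omega>. (\<epsilon> 0 \<omega>)\<^sup>2 \<partial>M)"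
    and "integrable M (\<lambda>\<omega>. (h (coupled_past \<eta> \<eta>s j l \<omega>))\<^sup>2)"
proof -
  have m: "(\<lambda>x. x\<^sup>2) \<in> borel_measurable (borel :: real measure)" by measurable
  have "integrable M (\<lambda>\<omega>. (\<epsilon> 0 \<omega>)\<^sup>2)"
  proof (rule Bochner_Integration.integrable_bound)
    show "integrable M (\<lambda>\<omega>. 1 + \<bar>\<epsilon> 0 \<omega>\<bar> powr p)" by (intro Bochner_Integration.integrable_add int) simp
    show "(\<lambda>\<omega>. (\<epsilon> 0 \<omega>)\<^sup>2) \<in> borel_measurable M" using eps_measurable by measurable
    show "AE \<omega> in M. norm ((\<epsilon> 0 \<omega>)\<^sup>2) \<le> norm (1 + \<bar>\<epsilon> 0 \<omega>\<bar> powr p)"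
      using square_le_powr[OF p] by (intro AE_I2) (simp add: abs_of_nonneg add_nonneg_nonneg)
  qed
  then show "integrable M (\<lambda>\<omega>. (\<epsilon> i \<omega>)\<^sup>2)" "integrable M (\<lambda>\<omega>. (h (coupled_past \<eta> \<eta>s j l \<omega>))\<^sup>2)"
    using eps_law(1)[OF m] eps_law(3)[OF m] by auto
  show "(\<integral>\<omega>. (\<epsilon> i \<omega>)\<^sup>2 \<partial>M) = (\<integral>\<omega>. (\<epsilon> 0 \<omega>)\<^sup>2 \<partial>M)"
    using eps_law(2)[OF m, of i] eps_law(2)[OF m, of 0] by simp
qed

definition eps_distance :: "int \<Rightarrow> nat \<Rightarrow> 'w \<Rightarrow> real" where
  "eps_distance i r \<omega> = \<epsilon> i \<omega> - h (coupled_past \<eta> \<eta>s i r \<omega>)"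

lemma eps_distance_integrable:
  assumes p: "p \<ge> 2" and int: "integrable M (\<lambda>\<omega>. \<bar>\<epsilon> 0 \<omega>\<bar> powr p)"
  shows "integrable M (\<lambda>\<omega>. \<bar>eps_distance i r \<omega>\<bar> powr p)"
proof (rule Bochner_Integration.integrable_bound)
  let ?u = "\<lambda>\<omega>. \<bar>\<epsilon> i \<omega>\<bar>" and ?v = "\<lambda>\<omega>. \<bar>h (coupled_past \<eta> \<eta>s i r \<omega>)\<bar>"
  have m: "(\<lambda>x. \<bar>x\<bar> powr p) \<in> borel_measurable (borel :: real measure)" by measurable
  show "integrable M (\<lambda>\<omega>. 2 powr p * (?u \<omega> powr p + ?v \<omega> powr p))"
    using int eps_law(1)[OF m] eps_law(3)[OF m]
    by (intro integrable_mult_right Bochner_Integration.integrable_add) auto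
  show "(\<lambda>\<omega>. \<bar>eps_distance i r \<omega>\<bar> powr p) \<in> borel_measurable M"
    unfolding eps_distance_def using eps_measurable eps'_measurable by measurable
  show "AE \<omega> in M. norm (\<bar>eps_distance i r \<omega>\<bar> powr p) \<le> norm (2 powr p * (?u \<omega> powr p + ?v \<omega> powr p))"
  proof (intro AE_I2)
    fix \<omega>
    have "\<bar>eps_distance i r \<omega>\<bar> powr p \<le> (2 * max (?u \<omega>) (?v \<omega>)) powr p"
      using p unfolding eps_distance_def by (intro powr_mono2) auto
    also have "\<dots> = 2 powr p * max (?u \<omega>) (?v \<omega>) powr p" by (simp add: powr_mult le_max_iff_disj)
    also have "\<dots> \<le> 2 powr p * (?u \<omega> powr p + ?v \<omega> powr p)" by (intro mult_left_mono) (auto simp: max_def)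
    finally show "norm (\<bar>eps_distance i r \<omega>\<bar> powr p) \<le> norm (2 powr p * (?u \<omega> powr p + ?v \<omega> powr p))" by simp
  qed
qed

lemma eps_distance_stationary:
  "(\<integral>\<omega>. \<bar>eps_distance i r \<omega>\<bar> powr p \<partial>M) = (\<integral>\<omega>. \<bar>eps_distance 0 r \<omega>\<bar> powr p \<partial>M)"
proof -
  let ?f = "\<lambda>q q'. \<bar>h q - h q'\<bar> powr p"
  have m1: "(\<lambda>z. h (\<lambda>j. z (Inl j))) \<in> borel_measurable (PiM (UNIV :: (nat + nat) set) (\<lambda>_. borel))"
    by (rule measurable_compose[OF _ h_measurable], intro measurable_PiM_single') (auto simp: space_PiM)
  have m2: "(\<lambda>z. h (Eta.couple r z)) \<in> borel_measurable (PiM (UNIV :: (nat + nat) set) (\<lambda>_. borel))"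
    by (rule measurable_compose[OF Eta.couple_measurable h_measurable])
  have m: "(\<lambda>z. ?f (\<lambda>j. z (Inl j)) (Eta.couple r z)) \<in> borel_measurable (PiM UNIV (\<lambda>_. borel))"
    using m1 m2 by measurable
  have "(\<integral>\<omega>. \<bar>eps_distance i r \<omega>\<bar> powr p \<partial>M) = (\<integral>\<omega>. ?f (past \<eta> i \<omega>) (coupled_past \<eta> \<eta>s i r \<omega>) \<partial>M)" for i
  proof (rule Bochner_Integration.integral_cong_AE)
    show "(\<lambda>\<omega>. \<bar>eps_distance i r \<omega>\<bar> powr p) \<in> borel_measurable M"
      unfolding eps_distance_def using eps_measurable eps'_measurable by measurable
    show "(\<lambda>\<omega>. ?f (past \<eta> i \<omega>) (coupled_past \<eta> \<eta>s i r \<omega>)) \<in> borel_measurable M"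
      using measurable_compose[OF Eta.reindex_measurable[of "Eta.pair_index i r"] m]
      by (simp only: Eta.past_eq[of i _ r] Eta.coupled_past_eq)
    show "AE \<omega> in M. \<bar>eps_distance i r \<omega>\<bar> powr p = ?f (past \<eta> i \<omega>) (coupled_past \<eta> \<eta>s i r \<omega>)"
      using eps_AE[of i] by eventually_elim (simp add: eps_distance_def)
  qed
  from this[of i] this[of 0] Eta.coupled_integral_stationary[of ?f, OF m, of i] show ?thesis by simp
qed

lemma integrable_product_of_squares:
  fixes u v :: "'w \<Rightarrow> real"
  assumes "u \<in> borel_measurable M" "v \<in> borel_measurable M" "integrable M (\<lambda>\<omega>. (u \<omega>)\<^sup>2)" "integrable M (\<lambda>\<omega>. (v \<omega>)\<^sup>2)"
  shows "integrable M (\<lambda>\<omega>. u \<omega> * v \<omega>)" and "\<bar>\<integral>\<omega>. u \<omega> * v \<omega> \<partial>M\<bar> \<le> ((\<integral>\<omega>. (u \<omega>)\<^sup>2 \<partial>M) + (\<integral>\<omega>. (v \<omega>)\<^sup>2 \<partial>M)) / 2"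
proof -
  have le: "\<bar>x * y\<bar> \<le> (x\<^sup>2 + y\<^sup>2) / 2" for x y :: real
    using sum_squares_bound[of "\<bar>x\<bar>" "\<bar>y\<bar>"] by (simp add: abs_mult)
  have i2: "integrable M (\<lambda>\<omega>. ((u \<omega>)\<^sup>2 + (v \<omega>)\<^sup>2) / 2)" using assms by simp
  show i: "integrable M (\<lambda>\<omega>. u \<omega> * v \<omega>)"
    by (rule Bochner_Integration.integrable_bound[OF i2])
      (use assms in measurable, intro AE_I2, simp only: real_norm_def order_trans[OF le abs_ge_self])
  have "\<bar>\<integral>\<omega>. u \<omega> * v \<omega> \<partial>M\<bar> \<le> (\<integral>\<omega>. \<bar>u \<omega> * v \<omega>\<bar> \<partial>M)" by (rule integral_abs_bound)
  also have "\<dots> \<le> (\<integral>\<omega>. ((u \<omega>)\<^sup>2 + (v \<omega>)\<^sup>2) / 2 \<partial>M)" by (intro integral_mono integrable_abs i i2 le)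
  also have "\<dots> = ((\<integral>\<omega>. (u \<omega>)\<^sup>2 \<partial>M) + (\<integral>\<omega>. (v \<omega>)\<^sup>2 \<partial>M)) / 2" using assms by simp
  finally show "\<bar>\<integral>\<omega>. u \<omega> * v \<omega> \<partial>M\<bar> \<le> ((\<integral>\<omega>. (u \<omega>)\<^sup>2 \<partial>M) + (\<integral>\<omega>. (v \<omega>)\<^sup>2 \<partial>M)) / 2" .
qed

text \<open>With \<open>\<epsilon> i'\<close> replaced by a copy independent of
  \<open>\<epsilon> i\<close> the product has mean zero, so the covariance is the mean of
  \<open>\<epsilon> i\<close> times the coupling error.\<close>

lemma eps_covariance_le:
  assumes i: "i < i'" and p: "p \<ge> 2" and t: "t > 0" and int: "integrable M (\<lambda>\<omega>. \<bar>\<epsilon> 0 \<omega>\<bar> powr p)"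
  shows "\<bar>\<integral>\<omega>. \<epsilon> i \<omega> * \<epsilon> i' \<omega> \<partial>M\<bar>
    \<le> t * ((\<integral>\<omega>. (\<epsilon> 0 \<omega>)\<^sup>2 \<partial>M) + 1 + (\<integral>\<omega>. \<bar>eps_distance 0 (nat (i' - i)) \<omega>\<bar> powr p \<partial>M) / t powr p)"
proof -
  let ?r = "nat (i' - i)"
  let ?e = "\<lambda>\<omega>. h (coupled_past \<eta> \<eta>s i' ?r \<omega>)"
  note sq = eps_square_integrable[OF p int]
  have i1: "integrable M (\<lambda>\<omega>. \<epsilon> i \<omega> * \<epsilon> i' \<omega>)" and i2: "integrable M (\<lambda>\<omega>. \<epsilon> i \<omega> * ?e \<omega>)"
    by (intro integrable_product_of_squares(1) eps_measurable eps'_measurable sq)+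
  have "(\<integral>\<omega>. \<epsilon> i \<omega> * ?e \<omega> \<partial>M) = (\<integral>\<omega>. h (past \<eta> i \<omega>) * ?e \<omega> \<partial>M)"
  proof (rule Bochner_Integration.integral_cong_AE)
    show "(\<lambda>\<omega>. \<epsilon> i \<omega> * ?e \<omega>) \<in> borel_measurable M" using i2 by auto
    show "(\<lambda>\<omega>. h (past \<eta> i \<omega>) * ?e \<omega>) \<in> borel_measurable M"
      by (intro borel_measurable_times eps'_measurable measurable_compose[OF Eta.past_measurable h_measurable])
    show "AE \<omega> in M. \<epsilon> i \<omega> * ?e \<omega> = h (past \<eta> i \<omega>) * ?e \<omega>" using eps_AE[of i] by eventually_elim simp
  qed
  also have "\<dots> = 0"
    using Eta.past_coupled_product[OF h_measurable eps_mean(1) h_measurable eps_mean(1) i] eps_mean(2) by simp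
  finally have z: "(\<integral>\<omega>. \<epsilon> i \<omega> * ?e \<omega> \<partial>M) = 0" .
  have i3: "integrable M (\<lambda>\<omega>. \<epsilon> i \<omega> * eps_distance i' ?r \<omega>)"
    using Bochner_Integration.integrable_diff[OF i1 i2] by (simp add: eps_distance_def right_diff_distrib)
  have i4: "integrable M (\<lambda>\<omega>. t * ((\<epsilon> i \<omega>)\<^sup>2 + 1 + \<bar>eps_distance i' ?r \<omega>\<bar> powr p / t powr p))"
    by (intro integrable_mult_right Bochner_Integration.integrable_add integrable_divide sq eps_distance_integrable p int) simp
  have "(\<integral>\<omega>. \<epsilon> i \<omega> * \<epsilon> i' \<omega> \<partial>M) = (\<integral>\<omega>. \<epsilon> i \<omega> * eps_distance i' ?r \<omega> \<partial>M)"
    using Bochner_Integration.integral_diff[OF i1 i2] z by (simp add: eps_distance_def right_diff_distrib)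
  then have "\<bar>\<integral>\<omega>. \<epsilon> i \<omega> * \<epsilon> i' \<omega> \<partial>M\<bar> \<le> (\<integral>\<omega>. \<bar>\<epsilon> i \<omega> * eps_distance i' ?r \<omega>\<bar> \<partial>M)"
    using integral_abs_bound[of M "\<lambda>\<omega>. \<epsilon> i \<omega> * eps_distance i' ?r \<omega>"] by simp
  also have "\<dots> \<le> (\<integral>\<omega>. t * ((\<epsilon> i \<omega>)\<^sup>2 + 1 + \<bar>eps_distance i' ?r \<omega>\<bar> powr p / t powr p) \<partial>M)"
    by (intro integral_mono integrable_abs i3 i4 abs_mult_le_coupling t p)
  also have "\<dots> = t * ((\<integral>\<omega>. (\<epsilon> i \<omega>)\<^sup>2 \<partial>M) + 1 + (\<integral>\<omega>. \<bar>eps_distance i' ?r \<omega>\<bar> powr p \<partial>M) / t powr p)"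
    using sq(1)[of i] eps_distance_integrable[OF p int, of i' ?r] by (simp add: prob_space)
  finally show ?thesis
    using sq(2)[of i] eps_distance_stationary[of i' ?r p] by simp
qed

text \<open>Independence of regressors and noise factors the expectation, and the score factor is at
  most one in absolute value. The bound is therefore free of \<open>j\<close>, which is why an
  exponent above \<open>1 / (2 * D)\<close> is enough for the noise.\<close>

lemma noise_pair:
  assumes int: "\<And>i. integrable M (\<lambda>\<omega>. (\<epsilon> i \<omega>)\<^sup>2)"
  shows "integrable M (\<lambda>\<omega>. (\<epsilon> i \<omega> * sc j i \<omega>) * (\<epsilon> i' \<omega> * sc j i' \<omega>))"
    and "(\<integral>\<omega>. (\<epsilon> i \<omega> * sc j i \<omega>) * (\<epsilon> i' \<omega> * sc j i' \<omega>) \<partial>M) \<le> \<bar>\<integral>\<omega>. \<epsilon> i \<omega> * \<epsilon> i' \<omega> \<partial>M\<bar>"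
proof -
  let ?xi = "\<lambda>\<omega> i. \<xi> i \<omega>" and ?eta = "\<lambda>\<omega> i. \<eta> i \<omega>"
  \<comment> \<open>Independence is assumed for the two-sided innovation sequences as a whole, so
    scores and errors at both times are written as functions of these.\<close>
  have sh: "(\<lambda>z k. z (i - int k)) \<in> measurable (PiM (UNIV :: int set) (\<lambda>_. N)) (PiM (UNIV :: nat set) (\<lambda>_. N))" for i and N :: "'y measure"
    by (intro measurable_PiM_single') (auto simp: space_PiM)
  let ?F0 = "\<lambda>i z. L2_inner (g (\<lambda>k. z (i - int k))) (ev j)" and ?G0 = "\<lambda>i z. h (\<lambda>k. z (i - int k))"
  have F0: "?F0 i \<in> borel_measurable (PiM UNIV (\<lambda>_. S))" for i
    by (rule measurable_compose[OF sh measurable_compose[OF g_measurable measurable_L2_inner[OF ev_L2]]])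
  have G0: "?G0 i \<in> borel_measurable (PiM UNIV (\<lambda>_. borel))" for i
    by (rule measurable_compose[OF sh h_measurable])
  let ?F = "\<lambda>\<omega>. ?F0 i (?xi \<omega>) * ?F0 i' (?xi \<omega>)" and ?G = "\<lambda>\<omega>. ?G0 i (?eta \<omega>) * ?G0 i' (?eta \<omega>)"
  have "indep_elements M borel ?F borel ?G"
    by (rule indep_elements_compose[OF indep_xi_eta]) (intro borel_measurable_times F0 G0)+
  then have ind: "indep_var borel ?F borel ?G" by (rule indep_elements_imp_indep_var)
  then have Fm: "?F \<in> borel_measurable M" and Gm: "?G \<in> borel_measurable M"
    using indep_var_rv1 indep_var_rv2 by blast+
  have i1: "integrable M (\<lambda>\<omega>. sc j i \<omega> * sc j i' \<omega>)" and e1: "\<bar>\<integral>\<omega>. sc j i \<omega> * sc j i' \<omega> \<partial>M\<bar> \<le> 1"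
  proof -
    have "integrable M (\<lambda>\<omega>. (sc j i \<omega>)\<^sup>2)" "(\<integral>\<omega>. (sc j i \<omega>)\<^sup>2 \<partial>M) = 1" for i
      using sc_pair_integrable[of i j j] sc_pair_integral[of i j j] by (simp_all add: power2_eq_square)
    then show "integrable M (\<lambda>\<omega>. sc j i \<omega> * sc j i' \<omega>)" "\<bar>\<integral>\<omega>. sc j i \<omega> * sc j i' \<omega> \<partial>M\<bar> \<le> 1"
      using integrable_product_of_squares[OF sc_measurable[of i j] sc_measurable[of i' j]] by simp_all
  qed
  have i2: "integrable M (\<lambda>\<omega>. \<epsilon> i \<omega> * \<epsilon> i' \<omega>)"
    by (intro integrable_product_of_squares(1) eps_measurable int)
  have aeF: "AE \<omega> in M. sc j i \<omega> * sc j i' \<omega> = ?F \<omega>"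
    using X_inner_AE[OF ev_L2[of j], of i] X_inner_AE[OF ev_L2[of j], of i']
    by eventually_elim (simp add: past_def)
  have aeG: "AE \<omega> in M. \<epsilon> i \<omega> * \<epsilon> i' \<omega> = ?G \<omega>"
    using eps_AE[of i] eps_AE[of i'] by eventually_elim (simp add: past_def)
  have Fi: "integrable M ?F" "(\<integral>\<omega>. ?F \<omega> \<partial>M) = (\<integral>\<omega>. sc j i \<omega> * sc j i' \<omega> \<partial>M)"
    using i1 Bochner_Integration.integrable_cong_AE[OF borel_measurable_integrable[OF i1] Fm aeF]
      Bochner_Integration.integral_cong_AE[OF borel_measurable_integrable[OF i1] Fm aeF] by simp_all
  have Gi: "integrable M ?G" "(\<integral>\<omega>. ?G \<omega> \<partial>M) = (\<integral>\<omega>. \<epsilon> i \<omega> * \<epsilon> i' \<omega> \<partial>M)"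
    using i2 Bochner_Integration.integrable_cong_AE[OF borel_measurable_integrable[OF i2] Gm aeG]
      Bochner_Integration.integral_cong_AE[OF borel_measurable_integrable[OF i2] Gm aeG] by simp_all
  let ?Z = "\<lambda>\<omega>. (\<epsilon> i \<omega> * sc j i \<omega>) * (\<epsilon> i' \<omega> * sc j i' \<omega>)"
  have Zm: "?Z \<in> borel_measurable M" by (intro borel_measurable_times eps_measurable sc_measurable)
  have FGi: "integrable M (\<lambda>\<omega>. ?F \<omega> * ?G \<omega>)" by (rule indep_var_integrable[OF ind Fi(1) Gi(1)])
  have ae: "AE \<omega> in M. ?Z \<omega> = ?F \<omega> * ?G \<omega>"
    using aeF aeG
  proof eventually_elim
    case (elim \<omega>)
    show ?case unfolding elim[symmetric] by (simp only: mult_ac)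
  qed
  show "integrable M ?Z"
    using Bochner_Integration.integrable_cong_AE[OF Zm borel_measurable_integrable[OF FGi] ae] FGi by simp
  have "(\<integral>\<omega>. ?Z \<omega> \<partial>M) = (\<integral>\<omega>. ?F \<omega> * ?G \<omega> \<partial>M)"
    by (rule Bochner_Integration.integral_cong_AE[OF Zm borel_measurable_integrable[OF FGi] ae])
  also have "\<dots> = (\<integral>\<omega>. sc j i \<omega> * sc j i' \<omega> \<partial>M) * (\<integral>\<omega>. \<epsilon> i \<omega> * \<epsilon> i' \<omega> \<partial>M)"
    unfolding indep_var_lebesgue_integral[OF ind Fi(1) Gi(1)] Fi(2) Gi(2) ..
  also have "\<dots> \<le> \<bar>\<integral>\<omega>. sc j i \<omega> * sc j i' \<omega> \<partial>M\<bar> * \<bar>\<integral>\<omega>. \<epsilon> i \<omega> * \<epsilon> i' \<omega> \<partial>M\<bar>"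
    by (simp only: abs_mult[symmetric] abs_ge_self)
  also have "\<dots> \<le> 1 * \<bar>\<integral>\<omega>. \<epsilon> i \<omega> * \<epsilon> i' \<omega> \<partial>M\<bar>" by (intro mult_right_mono e1) simp
  finally show "(\<integral>\<omega>. ?Z \<omega> \<partial>M) \<le> \<bar>\<integral>\<omega>. \<epsilon> i \<omega> * \<epsilon> i' \<omega> \<partial>M\<bar>" by simp
qed

lemma noise_second_moment:
  obtains C where "C \<ge> 0"
    "\<And>j b k. integrable M (\<lambda>\<omega>. (\<Sum>n\<in>{b..<b + k}. \<epsilon> (int n) \<omega> * sc j (int n) \<omega>)\<^sup>2)"
    "\<And>j b k. (\<integral>\<omega>. (\<Sum>n\<in>{b..<b + k}. \<epsilon> (int n) \<omega> * sc j (int n) \<omega>)\<^sup>2 \<partial>M) \<le> C * real k"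
proof -
  obtain \<delta> \<kappa> where \<delta>: "0 < \<delta>" and int: "integrable M (\<lambda>\<omega>. \<bar>\<epsilon> 0 \<omega>\<bar> powr (2 + \<delta>))" and \<kappa>: "2 + \<delta> < \<kappa>"
    and sm: "(\<lambda>r. (\<integral>\<omega>. \<bar>eps_distance 0 r \<omega>\<bar> powr (2 + \<delta>) \<partial>M) powr (1 / \<kappa>)) summable_on {1..}"
    using A5 unfolding A5_def eps_distance_def by auto
  have p: "2 + \<delta> \<ge> 2" using \<delta> by simp
  note sq = eps_square_integrable[OF p int]
  define d where "d = (\<lambda>r. \<integral>\<omega>. \<bar>eps_distance 0 r \<omega>\<bar> powr (2 + \<delta>) \<partial>M)"
  have d0: "0 \<le> d r" for r by (simp add: d_def)
  obtain t T where t: "\<And>r. (t r :: real) > 0" and T: "T \<ge> 0" "\<And>N. (\<Sum>r<N. t r) \<le> T"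
    and tT: "\<And>r. 1 \<le> r \<Longrightarrow> d r / t r powr (2 + \<delta>) \<le> T powr (\<kappa> - (2 + \<delta>))"
    by (rule coupling_rates[of d "2 + \<delta>" \<kappa>]) (use d0 \<delta> \<kappa> sm in \<open>auto simp: d_def\<close>)
  define e where "e = (\<integral>\<omega>. (\<epsilon> 0 \<omega>)\<^sup>2 \<partial>M)"
  have e0: "e \<ge> 0" by (simp add: e_def)
  define U where "U = e + 1 + T powr (\<kappa> - (2 + \<delta>))"
  have U0: "U \<ge> 0" using e0 by (simp add: U_def)
  define \<gamma> where "\<gamma> = (\<lambda>r. (if r = 0 then e else 0) + t r * U)"
  have \<gamma>0: "0 \<le> \<gamma> r" for r using e0 U0 t[of r] by (simp add: \<gamma>_def)
  have \<gamma>\<Gamma>: "(\<Sum>r<N. \<gamma> r) \<le> e + T * U" for N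
  proof -
    have "(\<Sum>r<N. if r = 0 then e else 0) \<le> e" using e0 by (simp add: sum.delta)
    moreover have "(\<Sum>r<N. t r) * U \<le> T * U" by (intro mult_right_mono T U0)
    ultimately show ?thesis by (simp add: \<gamma>_def sum.distrib sum_distrib_right)
  qed
  let ?z = "\<lambda>j n \<omega>. \<epsilon> (int n) \<omega> * sc j (int n) \<omega>"
  have cov: "(\<integral>\<omega>. ?z j n \<omega> * ?z j n' \<omega> \<partial>M) \<le> \<gamma> (n' - n)" if n: "n \<le> n'" for n n' j
  proof -
    have "(\<integral>\<omega>. ?z j n \<omega> * ?z j n' \<omega> \<partial>M) \<le> \<bar>\<integral>\<omega>. \<epsilon> n \<omega> * \<epsilon> n' \<omega> \<partial>M\<bar>" by (rule noise_pair(2)[OF sq(1)])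
    also have "\<dots> \<le> \<gamma> (n' - n)"
    proof (cases "n = n'")
      case True
      have "\<bar>\<integral>\<omega>. \<epsilon> n \<omega> * \<epsilon> n' \<omega> \<partial>M\<bar> = e" using sq(2)[of n] e0 True by (simp add: e_def power2_eq_square)
      also have "\<dots> \<le> \<gamma> (n' - n)" using t[of 0] U0 True by (simp add: \<gamma>_def)
      finally show ?thesis .
    next
      case False
      then have lt: "int n < int n'" and r: "nat (int n' - int n) = n' - n" "1 \<le> n' - n" using n by auto
      have "\<bar>\<integral>\<omega>. \<epsilon> n \<omega> * \<epsilon> n' \<omega> \<partial>M\<bar> \<le> t (n' - n) * (e + 1 + d (n' - n) / t (n' - n) powr (2 + \<delta>))"
        using eps_covariance_le[OF lt p t[of "n' - n"] int] unfolding d_def e_def r(1) .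
      also have "\<dots> \<le> t (n' - n) * U"
        using tT[OF r(2)] t[of "n' - n"] by (intro mult_left_mono) (auto simp: U_def)
      also have "\<dots> = \<gamma> (n' - n)" using r(2) by (simp add: \<gamma>_def)
      finally show ?thesis .
    qed
    finally show ?thesis .
  qed
  note sms = second_moment_sum[of "?z j" \<gamma> "e + T * U" for j, OF noise_pair(1)[OF sq(1)] cov \<gamma>0 \<gamma>\<Gamma>]
  show ?thesis
    using sms e0 T(1) U0 by (intro that[of "2 * (e + T * U)"]) auto
qed

end

section \<open>The uniform rate\<close>

context regularized_regression
begin

text \<open>For \<open>l \<le> 1\<close> the maximum in \<open>weighted_sum_bound\<close> is the
  power of \<open>l\<close>. Adding 1 to the sum of \<open>G\<close> makes the constant
  positive.\<close>

lemma weight_sum_le: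
  assumes \<theta>: "0 \<le> \<theta>" "\<theta> \<le> 1" and p: "p + 1 < 2 * D * \<theta>"
  obtains C where "C > 0"
    "\<And>l F. 0 < l \<Longrightarrow> l \<le> 1 \<Longrightarrow> finite F \<Longrightarrow> (\<Sum>k\<in>F. real (Suc k) powr p * wt l k) \<le> l powr (- \<theta>) * C"
proof -
  obtain G where G: "summable G" "\<And>k. 0 \<le> G k"
    and le: "\<And>l k. l > 0 \<Longrightarrow> real (Suc k) powr p * wt l k \<le> max 1 (l powr (- \<theta>)) * G k"
    by (rule weighted_sum_bound[OF \<theta> p]; rule that; blast)
  have "(\<Sum>k\<in>F. real (Suc k) powr p * wt l k) \<le> l powr (- \<theta>) * (suminf G + 1)" if l: "0 < l" "l \<le> 1" and F: "finite F" for l F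
  proof -
    have "l powr 0 \<le> l powr (- \<theta>)" using l \<theta> by (intro powr_mono') auto
    then have "max 1 (l powr (- \<theta>)) = l powr (- \<theta>)" using l by simp
    then have "(\<Sum>k\<in>F. real (Suc k) powr p * wt l k) \<le> (\<Sum>k\<in>F. l powr (- \<theta>) * G k)"
      using le[OF l(1)] by (intro sum_mono) simp
    also have "\<dots> = l powr (- \<theta>) * sum G F" by (simp add: sum_distrib_left)
    also have "\<dots> \<le> l powr (- \<theta>) * (suminf G + 1)"
      using sum_le_suminf[OF G(1) F] G(2) by (intro mult_left_mono) (auto intro: order_trans)
    finally show ?thesis .
  qed
  moreover have "suminf G + 1 > 0" using suminf_nonneg[OF G] by simp
  ultimately show ?thesis using that by blast
qed

end

text \<open>\<open>L\<close> is the binary logarithm rounded up: \<open>2 ^ L \<le> 2 * n\<close>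
  and \<open>L + 1 \<le> 4 * ln n\<close> give \<open>32 = 16 * 2\<close>. From
  \<open>n \<ge> 3\<close> on, \<open>ln n \<ge> 1\<close> absorbs the additive constants.\<close>

lemma ceiling_log_bounds:
  assumes n: "n \<ge> (3 :: nat)"
  obtains L where "n \<le> 2 ^ L" "(real L + 1)\<^sup>2 * 2 ^ L \<le> 32 * real n * (ln (real n))\<^sup>2" "ln (real n) \<ge> 1"
proof -
  have "exp 1 \<le> real n" using n exp_le by linarith
  then have ln1: "ln (real n) \<ge> 1" using n by (subst ln_ge_iff) auto
  define L where "L = nat \<lceil>log 2 (real n)\<rceil>"
  have l0: "log 2 (real n) \<ge> 0" using n by simp
  have L: "log 2 (real n) \<le> real L" "real L \<le> log 2 (real n) + 1" using l0 by (auto simp: L_def)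
  have e: "2 powr (log 2 (real n)) = real n" using n by simp
  have "2 powr log 2 (real n) \<le> 2 powr real L" using L by (intro powr_mono) auto
  then have "real n \<le> 2 ^ L" unfolding e by (simp add: powr_realpow)
  then have 1: "n \<le> 2 ^ L" by (metis of_nat_le_iff of_nat_numeral of_nat_power)
  have "2 powr real L \<le> 2 powr (log 2 (real n) + 1)" using L by (intro powr_mono) auto
  then have 2: "2 ^ L \<le> 2 * real n" using e by (simp add: powr_realpow powr_add)
  have "log 2 (real n) \<le> 2 * ln (real n)"
  proof -
    have "ln 2 \<ge> (1 / 2 :: real)" using ln2_ge_two_thirds by simp
    then have "ln (real n) / ln 2 \<le> ln (real n) / (1 / 2)" using ln1 by (intro divide_left_mono) auto
    then show ?thesis by (simp add: log_def)
  qed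
  then have "real L + 1 \<le> 4 * ln (real n)" using L ln1 by linarith
  then have "(real L + 1)\<^sup>2 \<le> (4 * ln (real n))\<^sup>2" by (intro power_mono) auto
  then have "(real L + 1)\<^sup>2 * 2 ^ L \<le> (4 * ln (real n))\<^sup>2 * (2 * real n)" using 2 by (intro mult_mono) auto
  then show ?thesis using 1 ln1 by (intro that[of L]) (auto simp: power_mult_distrib mult_ac)
qed

context dependent_regression
begin

text \<open>Each index of \<open>cross\<close> contributes a sum of
  \<open>k powr a * wt l k\<close>, hence \<open>a + 1 < 2 * D * \<theta>\<close> and the exponent
  \<open>2 * \<theta>\<close> for the pair. The noise has one index and no growth in it, hence
  \<open>1 < 2 * D * \<theta>'\<close>.\<close>

lemma maximal_bounds:
  assumes \<theta>: "0 \<le> \<theta>" "\<theta> \<le> 1" "a + 1 < 2 * D * \<theta>" and \<theta>': "0 \<le> \<theta>'" "\<theta>' \<le> 1" "1 < 2 * D * \<theta>'"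
  obtains C where "C > 0"
    "\<And>B l n. B > 0 \<Longrightarrow> 0 < l \<Longrightarrow> l \<le> 1 \<Longrightarrow> n \<ge> 3 \<Longrightarrow> \<exists>A\<in>events. prob A \<ge> 1 - 2 / B \<and> (\<forall>\<omega>\<in>A. \<forall>k\<le>n. \<forall>N.
       (\<Sum>(j,i)\<in>{..<N} \<times> {..<N}. wt l j * wt l i * (\<Sum>n=1..k. cross \<omega> n j i)\<^sup>2) \<le> B * C * real n * (ln (real n))\<^sup>2 * l powr (- (2 * \<theta>)) \<and>
       (\<Sum>j<N. wt l j * (\<Sum>n=1..k. \<epsilon> (int n) \<omega> * sc j (int n) \<omega>)\<^sup>2) \<le> B * C * real n * (ln (real n))\<^sup>2 * l powr (- \<theta>'))"
proof -
  obtain G where G: "G > 0" "\<And>l F. 0 < l \<Longrightarrow> l \<le> 1 \<Longrightarrow> finite F \<Longrightarrow> (\<Sum>k\<in>F. real (Suc k) powr a * wt l k) \<le> l powr (- \<theta>) * G"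
    by (rule weight_sum_le[OF \<theta>]; rule that; blast)
  have \<theta>'0: "0 + 1 < 2 * D * \<theta>'" using \<theta>' by simp
  obtain G' where G': "G' > 0" "\<And>l F. 0 < l \<Longrightarrow> l \<le> 1 \<Longrightarrow> finite F \<Longrightarrow> (\<Sum>k\<in>F. real (Suc k) powr 0 * wt l k) \<le> l powr (- \<theta>') * G'"
    by (rule weight_sum_le[OF \<theta>'(1,2) \<theta>'0]; rule that; blast)
  obtain Cx where Cx: "Cx \<ge> 0"
    and xi: "\<And>j l b k. integrable M (\<lambda>\<omega>. (\<Sum>n\<in>{b..<b + k}. cross \<omega> n j l)\<^sup>2)"
    and xb: "\<And>j l b k. (\<integral>\<omega>. (\<Sum>n\<in>{b..<b + k}. cross \<omega> n j l)\<^sup>2 \<partial>M) \<le> Cx * (real (Suc j) powr a * real (Suc l) powr a) * real k"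
    by (rule cross_second_moment; rule that; blast)
  obtain Ce where Ce: "Ce \<ge> 0"
    and ei: "\<And>j b k. integrable M (\<lambda>\<omega>. (\<Sum>n\<in>{b..<b + k}. \<epsilon> (int n) \<omega> * sc j (int n) \<omega>)\<^sup>2)"
    and eb: "\<And>j b k. (\<integral>\<omega>. (\<Sum>n\<in>{b..<b + k}. \<epsilon> (int n) \<omega> * sc j (int n) \<omega>)\<^sup>2 \<partial>M) \<le> Ce * real k"
    by (rule noise_second_moment; rule that; blast)
  define C1 where "C1 = (Cx + 1) * G\<^sup>2" define C2 where "C2 = (Ce + 1) * G'"
  have C12: "C1 > 0" "C2 > 0" using Cx Ce G(1) G'(1) by (simp_all add: C1_def C2_def)
  define C where "C = 32 * (C1 + C2)"
  have "\<exists>A\<in>events. prob A \<ge> 1 - 2 / B \<and> (\<forall>\<omega>\<in>A. \<forall>k\<le>n. \<forall>N.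
       (\<Sum>(j,i)\<in>{..<N} \<times> {..<N}. wt l j * wt l i * (\<Sum>n=1..k. cross \<omega> n j i)\<^sup>2) \<le> B * C * real n * (ln (real n))\<^sup>2 * l powr (- (2 * \<theta>)) \<and>
       (\<Sum>j<N. wt l j * (\<Sum>n=1..k. \<epsilon> (int n) \<omega> * sc j (int n) \<omega>)\<^sup>2) \<le> B * C * real n * (ln (real n))\<^sup>2 * l powr (- \<theta>'))"
    if B: "B > 0" and l: "0 < l" "l \<le> 1" and n: "n \<ge> 3" for B l n
  proof -
    obtain L where L: "n \<le> 2 ^ L" "(real L + 1)\<^sup>2 * 2 ^ L \<le> 32 * real n * (ln (real n))\<^sup>2"
      using ceiling_log_bounds[OF n] by metis
    have w0: "0 \<le> wt l j" for j using wt_pos[OF l(1), of j] by simp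
    \<comment> \<open>The maximal inequality is indexed by natural numbers; pairs are coded by
      \<open>prod_decode\<close>.\<close>
    let ?w = "\<lambda>p. wt l (fst (prod_decode p)) * wt l (snd (prod_decode p))"
    let ?C = "\<lambda>p. Cx * (real (Suc (fst (prod_decode p))) powr a * real (Suc (snd (prod_decode p))) powr a)"
    let ?x = "\<lambda>p i \<omega>. cross \<omega> i (fst (prod_decode p)) (snd (prod_decode p))"
    have c1: "(\<Sum>p\<in>F. ?w p * ?C p) \<le> C1 * l powr (- (2 * \<theta>))" if F: "finite F" for F
    proof -
      have "finite (fst ` prod_decode ` F \<union> snd ` prod_decode ` F)" using F by simp
      then obtain N where N: "fst ` prod_decode ` F \<union> snd ` prod_decode ` F \<subseteq> {..<N}"
        by (rule finite_nat_bounded[THEN exE])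
      let ?s = "\<lambda>j. real (Suc j) powr a * wt l j"
      have s0: "0 \<le> ?s j" for j using w0 by simp
      have "(\<Sum>p\<in>F. ?w p * ?C p) = (\<Sum>p\<in>F. case prod_decode p of (j, i) \<Rightarrow> Cx * (?s j * ?s i))"
        by (intro sum.cong) (auto simp: split_beta)
      also have "\<dots> = (\<Sum>(j,i)\<in>prod_decode ` F. Cx * (?s j * ?s i))"
        by (subst sum.reindex) (auto simp: inj_prod_decode)
      \<comment> \<open>Enlarging the index set to a square lets the double sum factor into two
        single ones.\<close>
      also have "\<dots> \<le> (\<Sum>(j,i)\<in>{..<N} \<times> {..<N}. Cx * (?s j * ?s i))"
      proof (rule sum_mono2)
        show "prod_decode ` F \<subseteq> {..<N} \<times> {..<N}" using N by (auto simp: image_subset_iff mem_Times_iff)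
      qed (use Cx w0 in auto)
      also have "\<dots> = Cx * ((\<Sum>j<N. ?s j) * (\<Sum>i<N. ?s i))"
        unfolding sum_product sum.cartesian_product[symmetric] by (simp only: sum_distrib_left)
      also have "\<dots> \<le> (Cx + 1) * ((l powr (- \<theta>) * G) * (l powr (- \<theta>) * G))"
        using Cx G by (intro mult_mono G(2) l finite_lessThan sum_nonneg s0 mult_nonneg_nonneg) auto
      also have "\<dots> = C1 * (l powr (- \<theta>) * l powr (- \<theta>))" by (simp add: C1_def power2_eq_square mult_ac)
      also have "l powr (- \<theta>) * l powr (- \<theta>) = l powr (- (2 * \<theta>))" by (simp add: powr_add[symmetric])
      finally show ?thesis .
    qed
    have c1p: "C1 * l powr (- (2 * \<theta>)) > 0" using C12 l by simp
    obtain A1 where A1: "A1 \<in> events" "prob A1 \<ge> 1 - 1 / B"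
      and A1b: "\<And>\<omega> k F. \<omega> \<in> A1 \<Longrightarrow> k \<le> n \<Longrightarrow> finite F \<Longrightarrow>
        (\<Sum>p\<in>F. ?w p * (\<Sum>i\<in>{1..<1 + k}. ?x p i \<omega>)\<^sup>2) \<le> B * ((real L + 1)\<^sup>2 * 2 ^ L * (C1 * l powr (- (2 * \<theta>))))"
    proof -
      have "\<exists>A\<in>events. prob A \<ge> 1 - 1 / B \<and> (\<forall>\<omega>\<in>A. \<forall>k\<le>n. \<forall>F. finite F \<longrightarrow>
        (\<Sum>p\<in>F. ?w p * (\<Sum>i\<in>{1..<1 + k}. ?x p i \<omega>)\<^sup>2) \<le> B * ((real L + 1)\<^sup>2 * 2 ^ L * (C1 * l powr (- (2 * \<theta>)))))"
        by (rule weighted_maximal_inequality[where C = ?C, OF xi xb _ _ c1 c1p L(1) B]) (use Cx w0 in auto)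
      then show ?thesis using that by blast
    qed
    have c2: "(\<Sum>j\<in>F. wt l j * Ce) \<le> C2 * l powr (- \<theta>')" if F: "finite F" for F
    proof -
      have "(\<Sum>j\<in>F. wt l j * Ce) = Ce * (\<Sum>j\<in>F. real (Suc j) powr 0 * wt l j)" by (simp add: sum_distrib_left mult.commute)
      also have "\<dots> \<le> (Ce + 1) * (l powr (- \<theta>') * G')"
        using Ce G' w0 by (intro mult_mono G'(2) l F sum_nonneg) auto
      finally show ?thesis by (simp add: C2_def mult_ac)
    qed
    have c2p: "C2 * l powr (- \<theta>') > 0" using C12 l by simp
    obtain A2 where A2: "A2 \<in> events" "prob A2 \<ge> 1 - 1 / B"
      and A2b: "\<And>\<omega> k F. \<omega> \<in> A2 \<Longrightarrow> k \<le> n \<Longrightarrow> finite F \<Longrightarrow>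
        (\<Sum>j\<in>F. wt l j * (\<Sum>i\<in>{1..<1 + k}. \<epsilon> (int i) \<omega> * sc j (int i) \<omega>)\<^sup>2) \<le> B * ((real L + 1)\<^sup>2 * 2 ^ L * (C2 * l powr (- \<theta>')))"
    proof -
      have "\<exists>A\<in>events. prob A \<ge> 1 - 1 / B \<and> (\<forall>\<omega>\<in>A. \<forall>k\<le>n. \<forall>F. finite F \<longrightarrow>
        (\<Sum>j\<in>F. wt l j * (\<Sum>i\<in>{1..<1 + k}. \<epsilon> (int i) \<omega> * sc j (int i) \<omega>)\<^sup>2) \<le> B * ((real L + 1)\<^sup>2 * 2 ^ L * (C2 * l powr (- \<theta>'))))"
        by (rule weighted_maximal_inequality[where C = "\<lambda>_. Ce", OF ei eb _ _ c2 c2p L(1) B]) (use Ce w0 in auto)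
      then show ?thesis using that by blast
    qed
    have "prob (A1 \<inter> A2) \<ge> 1 - 2 / B"
    proof -
      have "prob (A1 \<union> A2) = prob A1 + prob A2 - prob (A1 \<inter> A2)"
        using finite_measure_Union'[of A1 A2] finite_measure_Diff'[of A2 A1] A1 A2 by (simp add: Int_commute)
      then show ?thesis using A1(2) A2(2) prob_le_1[of "A1 \<union> A2"] add_divide_distrib[of 1 1 B] by linarith
    qed
    moreover have up: "B * ((real L + 1)\<^sup>2 * 2 ^ L * (c * r)) \<le> B * C * real n * (ln (real n))\<^sup>2 * r" if "0 < c" "32 * c \<le> C" "0 \<le> r" for c r
    proof -
      have "(real L + 1)\<^sup>2 * 2 ^ L * (c * r) \<le> (32 * real n * (ln (real n))\<^sup>2) * (c * r)" using L(2) that by (intro mult_right_mono) auto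
      also have "\<dots> = (32 * c) * (real n * (ln (real n))\<^sup>2 * r)" by simp
      also have "\<dots> \<le> C * (real n * (ln (real n))\<^sup>2 * r)" using that by (intro mult_right_mono) auto
      finally show ?thesis using B by (simp add: mult.assoc mult_left_mono)
    qed
    have int: "{1..<1 + k} = {1..k}" for k :: nat by auto
    have "(\<Sum>(j,i)\<in>{..<N} \<times> {..<N}. wt l j * wt l i * (\<Sum>n=1..k. cross \<omega> n j i)\<^sup>2) \<le> B * C * real n * (ln (real n))\<^sup>2 * l powr (- (2 * \<theta>))"
      if "\<omega> \<in> A1" "k \<le> n" for \<omega> k N
    proof -
      have "(\<Sum>(j,i)\<in>{..<N} \<times> {..<N}. wt l j * wt l i * (\<Sum>n=1..k. cross \<omega> n j i)\<^sup>2)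
        = (\<Sum>p\<in>prod_encode ` ({..<N} \<times> {..<N}). ?w p * (\<Sum>i\<in>{1..<1 + k}. ?x p i \<omega>)\<^sup>2)"
        unfolding int by (subst sum.reindex) (auto simp: inj_prod_encode split_beta intro!: sum.cong)
      also have "\<dots> \<le> B * ((real L + 1)\<^sup>2 * 2 ^ L * (C1 * l powr (- (2 * \<theta>))))" using that by (intro A1b) auto
      also have "\<dots> \<le> B * C * real n * (ln (real n))\<^sup>2 * l powr (- (2 * \<theta>))" using C12 by (intro up) (auto simp: C_def)
      finally show ?thesis .
    qed
    moreover have "(\<Sum>j<N. wt l j * (\<Sum>n=1..k. \<epsilon> (int n) \<omega> * sc j (int n) \<omega>)\<^sup>2) \<le> B * C * real n * (ln (real n))\<^sup>2 * l powr (- \<theta>')"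
      if "\<omega> \<in> A2" "k \<le> n" for \<omega> k N
    proof -
      have "(\<Sum>j<N. wt l j * (\<Sum>n=1..k. \<epsilon> (int n) \<omega> * sc j (int n) \<omega>)\<^sup>2) \<le> B * ((real L + 1)\<^sup>2 * 2 ^ L * (C2 * l powr (- \<theta>')))"
        using A2b[OF that, of "{..<N}"] unfolding int by simp
      also have "\<dots> \<le> B * C * real n * (ln (real n))\<^sup>2 * l powr (- \<theta>')" using C12 by (intro up) (auto simp: C_def)
      finally show ?thesis .
    qed
    ultimately show ?thesis using A1(1) A2(1) by (intro bexI[of _ "A1 \<inter> A2"]) auto
  qed
  moreover have "C > 0" using C12 by (simp add: C_def)
  ultimately show ?thesis using that by blast
qed

end

text \<open>Bookkeeping of exponents, applied with \<open>x = n powr (- 1 / 2)\<close> and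
  \<open>u = sqrt (ln n)\<close>. The wanted rate has one factor \<open>u\<close>, while
  \<open>q * r\<close> carries four and the other terms two; every surplus \<open>u\<close> costs
  \<open>l powr (- (s / 6))\<close>.\<close>

lemma rate_combination:
  fixes l x u c s \<theta> t \<sigma> A B J q r :: real
  assumes l: "0 < l" "l \<le> 1" and x: "0 \<le> x" "x \<le> 1" and u: "0 \<le> u" "u \<le> c * l powr (- (s / 6))"
    and \<theta>: "\<theta> + s / 6 \<le> \<sigma>" and \<theta>t: "\<theta> + t + s / 2 \<le> \<sigma> + A" and t: "t + s / 6 \<le> \<sigma> + A"
    and q: "0 \<le> q" "q \<le> B * (x * u\<^sup>2 * l powr (- \<theta>))" and r: "0 \<le> r" "r \<le> B * (x * u\<^sup>2 * l powr (- t))"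
    and nn: "0 \<le> B" "0 \<le> J" "0 \<le> c"
  shows "q \<le> B * c * (x * u * l powr (- \<sigma>))"
    and "q * (2 * (r + sqrt l * J)) + r * x\<^sup>2
      \<le> (2 * B\<^sup>2 * c ^ 3 + 2 * B * J * c + B * c) * (x * l powr (- \<sigma>) * (l powr (1 / 2) + x * l powr (- A)) * u)"
proof -
  have absorb: "u ^ e * l powr (- b) \<le> c ^ e * l powr (- d)" if "b + real e * (s / 6) \<le> d" for e b d
  proof -
    have "u ^ e \<le> (c * l powr (- (s / 6))) ^ e" using u by (intro power_mono)
    also have "\<dots> = c ^ e * l powr (- (real e * (s / 6)))"
      using l by (simp add: power_mult_distrib powr_realpow[symmetric] powr_powr mult_ac)
    finally have "u ^ e * l powr (- b) \<le> c ^ e * l powr (- (real e * (s / 6))) * l powr (- b)"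
      by (rule mult_right_mono) simp
    also have "\<dots> = c ^ e * l powr (- (real e * (s / 6)) + - b)" by (simp only: powr_add mult.assoc)
    also have "\<dots> \<le> c ^ e * l powr (- d)" using l nn that by (intro mult_left_mono powr_mono') auto
    finally show ?thesis .
  qed
  have a1: "u * l powr (- \<theta>) \<le> c * l powr (- \<sigma>)" using absorb[of \<theta> 1 \<sigma>] \<theta> by simp
  have a3: "u ^ 3 * l powr (- (\<theta> + t)) \<le> c ^ 3 * l powr (- (\<sigma> + A))" using absorb[of "\<theta> + t" 3 "\<sigma> + A"] \<theta>t by simp
  have a2: "u * l powr (- t) \<le> c * l powr (- (\<sigma> + A))" using absorb[of t 1 "\<sigma> + A"] t by simp
  \<comment> \<open>The two halves of the rate: \<open>v1\<close> takes the deviation times the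
    bias, \<open>v2\<close> the deviation times the noise and the rounding term.\<close>
  define v1 where "v1 = x * u * l powr (- \<sigma>) * l powr (1 / 2)"
  define v2 where "v2 = x\<^sup>2 * u * l powr (- (\<sigma> + A))"
  have v0: "0 \<le> v1" "0 \<le> v2" using x u by (simp_all add: v1_def v2_def)
  have "q \<le> B * (x * u * (u * l powr (- \<theta>)))" using q by (simp add: power2_eq_square mult_ac)
  also have "\<dots> \<le> B * (x * u * (c * l powr (- \<sigma>)))" using nn x u by (intro mult_left_mono a1) auto
  finally show q': "q \<le> B * c * (x * u * l powr (- \<sigma>))" by (simp add: mult_ac)
  have "sqrt l = l powr (1 / 2)" using l by (simp add: powr_half_sqrt)
  then have t1: "q * sqrt l \<le> B * c * v1"
    using mult_right_mono[OF q', of "sqrt l"] l by (simp add: v1_def mult_ac)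
  have "q * r \<le> (B * (x * u\<^sup>2 * l powr (- \<theta>))) * (B * (x * u\<^sup>2 * l powr (- t)))"
    using q r nn x by (intro mult_mono) auto
  also have "\<dots> = B\<^sup>2 * (x\<^sup>2 * u * (u ^ 3 * l powr (- (\<theta> + t))))"
  proof -
    have "l powr (- (\<theta> + t)) = l powr (- \<theta>) * l powr (- t)" unfolding minus_add_distrib by (rule powr_add)
    then show ?thesis by (simp only: power2_eq_square power3_eq_cube mult_ac)
  qed
  also have "\<dots> \<le> B\<^sup>2 * (x\<^sup>2 * u * (c ^ 3 * l powr (- (\<sigma> + A))))" using u by (intro mult_left_mono a3) auto
  finally have t2: "q * r \<le> B\<^sup>2 * c ^ 3 * v2" by (simp add: v2_def mult_ac)
  have "r * x\<^sup>2 \<le> (B * (x * u\<^sup>2 * l powr (- t))) * x\<^sup>2" using r by (intro mult_right_mono) auto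
  also have "\<dots> = B * x * (x\<^sup>2 * u * (u * l powr (- t)))" by (simp add: power2_eq_square mult_ac)
  also have "\<dots> \<le> B * 1 * (x\<^sup>2 * u * (c * l powr (- (\<sigma> + A))))"
    using nn x u by (intro mult_mono a2) auto
  finally have t3: "r * x\<^sup>2 \<le> B * c * v2" by (simp add: v2_def mult_ac)
  have v: "x * l powr (- \<sigma>) * (l powr (1 / 2) + x * l powr (- A)) * u = v1 + v2"
  proof -
    have "l powr (- (\<sigma> + A)) = l powr (- \<sigma>) * l powr (- A)" unfolding minus_add_distrib by (rule powr_add)
    then show ?thesis by (simp only: v1_def v2_def power2_eq_square mult_ac distrib_left distrib_right)
  qed
  have "q * (2 * (r + sqrt l * J)) + r * x\<^sup>2 = 2 * (q * r) + 2 * J * (q * sqrt l) + r * x\<^sup>2"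
    by (simp add: algebra_simps)
  also have "\<dots> \<le> 2 * (B\<^sup>2 * c ^ 3 * v2) + 2 * J * (B * c * v1) + B * c * v2"
    using nn by (intro add_mono mult_left_mono t1 t2 t3) auto
  also have "\<dots> \<le> (2 * B\<^sup>2 * c ^ 3 + 2 * B * J * c + B * c) * (v1 + v2)"
  proof -
    have "0 \<le> 2 * B\<^sup>2 * c ^ 3 * v1" "0 \<le> 2 * B * J * c * v2" "0 \<le> B * c * v1" using nn v0 by simp_all
    then show ?thesis by (simp add: algebra_simps)
  qed
  finally show "q * (2 * (r + sqrt l * J)) + r * x\<^sup>2
      \<le> (2 * B\<^sup>2 * c ^ 3 + 2 * B * J * c + B * c) * (x * l powr (- \<sigma>) * (l powr (1 / 2) + x * l powr (- A)) * u)"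
    unfolding v .
qed

lemma powr_minus_half: "0 < n \<Longrightarrow> n powr (- 1 / 2) = 1 / sqrt n" for n :: real
proof -
  assume "0 < n"
  then have "n powr (1 / 2) = sqrt n" by (simp add: powr_half_sqrt)
  then have "n powr (- (1 / 2)) = 1 / sqrt n" by (simp only: powr_minus_divide)
  then show ?thesis by simp
qed

lemma sqrt_over_sample_size_le:
  fixes G L w \<nu> k n :: real
  assumes "0 < n" "0 < \<nu>" "n * \<nu> / 2 \<le> k" "0 \<le> G" "0 \<le> L" "0 \<le> w"
  shows "sqrt (G * n * L\<^sup>2 * w\<^sup>2) / k \<le> (2 / \<nu>) * sqrt G * (n powr (- 1 / 2) * L * w)"
proof -
  have k: "0 < k" using assms(1-3) mult_pos_pos[OF assms(1,2)] by linarith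
  have "n powr (- 1 / 2) = 1 / sqrt n" by (rule powr_minus_half[OF assms(1)])
  moreover have "sqrt n / k \<le> sqrt n / (n * \<nu> / 2)" using assms(1-3) k by (intro divide_left_mono) auto
  moreover have "sqrt n / (n * \<nu> / 2) = (2 / \<nu>) * (1 / sqrt n)"
    using assms(1,2) real_sqrt_mult_self[of n] by (simp add: field_simps)
  ultimately have "sqrt n / k \<le> (2 / \<nu>) * n powr (- 1 / 2)" by simp
  then have "(sqrt G * L * w) * (sqrt n / k) \<le> (sqrt G * L * w) * ((2 / \<nu>) * n powr (- 1 / 2))"
    using assms by (intro mult_left_mono) auto
  moreover have "sqrt (G * n * L\<^sup>2 * w\<^sup>2) = sqrt G * sqrt n * L * w" using assms by (simp add: real_sqrt_mult)
  ultimately show ?thesis by (simp add: mult_ac)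
qed

text \<open>Nonemptiness matters: the supremum over the empty set is minus infinity.\<close>

lemma ereal_abs_SUP_le:
  assumes "I \<noteq> {}" "\<And>i. i \<in> I \<Longrightarrow> \<bar>f i\<bar> \<le> (b :: real)"
  shows "\<bar>SUP i\<in>I. ereal (f i)\<bar> \<le> ereal b"
proof -
  obtain i where i: "i \<in> I" using assms(1) by blast
  have "(SUP i\<in>I. ereal (f i)) \<le> ereal b" using assms(2) by (intro SUP_least) (simp add: abs_le_iff)
  moreover have "ereal (- b) \<le> ereal (f i)" using assms(2)[OF i] by (simp add: abs_le_iff)
  then have "ereal (- b) \<le> (SUP i\<in>I. ereal (f i))" using i by (rule SUP_upper2[rotated])
  ultimately show ?thesis by (cases "SUP i\<in>I. ereal (f i)") auto
qed

context dependent_regression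
begin

theorem Bahadur_uniform:
  assumes \<beta>0: "\<beta>0 \<in> H" and lam_pos: "\<And>n. lam n > 0" and A4: "A4 m a D lam" and \<nu>0: "0 < \<nu>0" "\<nu>0 \<le> 1"
    and est: "is_estimator M X (response X \<epsilon> \<beta>0) m lam \<nu>0 \<beta>hat"
  shows "bigO_p M
    (\<lambda>n \<omega>. SUP \<nu>\<in>{\<nu>0..1}. ereal (Kn (lam n) (\<lambda>s.
        \<nu> * (\<beta>hat n \<nu> \<omega> s - \<beta>0 s + W_op M X m (lam n) \<beta>0 s)
        - 1 / real n * (\<Sum>i=1..subsample n \<nu>. \<epsilon> (int i) \<omega> * tau M X m (lam n) (X (int i) \<omega>) s))))
    (\<lambda>n. real n powr (- 1 / 2) * lam n powr (- varsigma m a D)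
       * (lam n powr (1 / 2) + real n powr (- 1 / 2) * lam n powr (- (2 * a + 1) / (4 * D)))
       * sqrt (ln (real n)))"
  unfolding bigO_p_def
proof (intro allI impI)
  fix e :: real assume e: "e > 0"
  have D: "D > a + 1 / 2" "a \<ge> 0" "D > 0" using D_gt a_nonneg by auto
  have m1: "real m \<ge> 1" using m by simp
  define \<sigma> where "\<sigma> = varsigma m a D"
  define s where "s = (2 * D - 2 * a - 1) / (4 * D * real m)"
  \<comment> \<open>\<open>\<sigma>\<close> exceeds the exponent \<open>(a + 1) / (2 * D)\<close> by \<open>s > 0\<close>; this slack pays for \<open>\<theta>\<close>, \<open>\<theta>'\<close> lying strictly above the
    critical exponents and for all surplus powers of \<open>ln n\<close>.\<close>
  define \<theta> where "\<theta> = (a + 1) / (2 * D) + s / 4"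
  define \<theta>' where "\<theta>' = 1 / (2 * D) + s / 2"
  define A where "A = (2 * a + 1) / (4 * D)"
  have s: "s > 0" using D m1 by (simp add: s_def)
  have \<sigma>: "\<sigma> = s + (a + 1) / (2 * D)" by (simp add: \<sigma>_def varsigma_def s_def)
  \<comment> \<open>Follows from \<open>m \<ge> 1\<close>; it keeps \<open>\<theta>\<close> and
    \<open>\<theta>'\<close> at most 1, as the weight sums require.\<close>
  have s_le: "s \<le> (2 * D - 2 * a - 1) / (4 * D)"
  proof -
    have "4 * D * 1 \<le> 4 * D * real m" using D m1 by (intro mult_left_mono) auto
    then show ?thesis unfolding s_def using D by (intro divide_left_mono) auto
  qed
  have sD: "4 * D * s \<le> 2 * D - 2 * a - 1" using s_le D by (simp add: field_simps)
  have \<theta>D: "2 * D * \<theta> = a + 1 + D * s / 2" "2 * D * \<theta>' = 1 + D * s" using D by (simp_all add: \<theta>_def \<theta>'_def field_simps)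
  have Ds: "D * s > 0" using D s by simp
  have \<theta>1: "\<theta> \<le> 1"
  proof (rule mult_left_le_imp_le[of "2 * D"])
    show "2 * D * \<theta> \<le> 2 * D * 1" using \<theta>D(1) sD D by linarith
  qed (use D in simp)
  have \<theta>'1: "\<theta>' \<le> 1"
  proof (rule mult_left_le_imp_le[of "2 * D"])
    show "2 * D * \<theta>' \<le> 2 * D * 1" using \<theta>D(2) sD D by linarith
  qed (use D in simp)
  have \<theta>0: "0 \<le> \<theta>" "0 \<le> \<theta>'" unfolding \<theta>_def \<theta>'_def using D s by (auto intro!: add_nonneg_nonneg)
  have \<theta>p: "a + 1 < 2 * D * \<theta>" "1 < 2 * D * \<theta>'" using \<theta>D Ds by linarith+
  have A_ge: "1 / (4 * D) \<le> A" using D by (simp add: A_def divide_right_mono)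
  \<comment> \<open>The conditions of \<open>rate_combination\<close> with
    \<open>t = \<theta>' / 2\<close>. In the second one the slack is spent completely:
    \<open>s / 4 + s / 4 + s / 2 = s\<close>, and the remaining \<open>1 / (4 * D)\<close> is at
    most \<open>A\<close>.\<close>
  have exps: "\<theta> + s / 6 \<le> \<sigma>" "\<theta> + \<theta>' / 2 + s / 2 \<le> \<sigma> + A" "\<theta>' / 2 + s / 6 \<le> \<sigma> + A"
  proof -
    have h: "\<theta>' / 2 = 1 / (4 * D) + s / 4" by (simp add: \<theta>'_def)
    have "0 \<le> (a + 1) / (2 * D)" using D by simp
    then show "\<theta> + s / 6 \<le> \<sigma>" "\<theta> + \<theta>' / 2 + s / 2 \<le> \<sigma> + A" "\<theta>' / 2 + s / 6 \<le> \<sigma> + A"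
      unfolding \<sigma> h \<theta>_def using A_ge s by linarith+
  qed
  obtain C where C: "C > 0"
    and ev: "\<And>B l n. B > 0 \<Longrightarrow> 0 < l \<Longrightarrow> l \<le> 1 \<Longrightarrow> n \<ge> 3 \<Longrightarrow> \<exists>A\<in>events. prob A \<ge> 1 - 2 / B \<and> (\<forall>\<omega>\<in>A. \<forall>k\<le>n. \<forall>N.
       (\<Sum>(j,i)\<in>{..<N} \<times> {..<N}. wt l j * wt l i * (\<Sum>n=1..k. cross \<omega> n j i)\<^sup>2) \<le> B * C * real n * (ln (real n))\<^sup>2 * l powr (- (2 * \<theta>)) \<and>
       (\<Sum>j<N. wt l j * (\<Sum>n=1..k. \<epsilon> (int n) \<omega> * sc j (int n) \<omega>)\<^sup>2) \<le> B * C * real n * (ln (real n))\<^sup>2 * l powr (- \<theta>'))"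
    by (rule maximal_bounds[OF \<theta>0(1) \<theta>1 \<theta>p(1) \<theta>0(2) \<theta>'1 \<theta>p(2)]; rule that; blast)
  define e0 where "e0 = 2 + (2 * a + 1) / (2 * D)"
  have e0: "e0 > 0" using D by (simp add: e0_def add_pos_nonneg)
  \<comment> \<open>\<open>A4\<close> gives \<open>n \<le> l powr (- e0)\<close> eventually, so
    \<open>n powr b \<le> l powr (- (s / 3))\<close>. With \<open>ln n \<le> n powr b / b\<close>
    and a square root this becomes \<open>u \<le> c * l powr (- (s / 6))\<close>.\<close>
  define b where "b = s / (3 * e0)"
  have b: "b > 0" using s e0 by (simp add: b_def)
  define c where "c = sqrt (1 / b)"
  have c: "c \<ge> 0" using b by (simp add: c_def)
  \<comment> \<open>\<open>2 / \<nu>0\<close> pays for the sample size being at least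
    \<open>n * \<nu>0 / 2\<close>; \<open>2 / e\<close> is the constant in
    \<open>maximal_bounds\<close> for which the exceptional probability is at most
    \<open>e\<close>.\<close>
  define B where "B = (2 / \<nu>0) * sqrt (2 / e * C)"
  have B: "B \<ge> 0" using \<nu>0 e C by (simp add: B_def)
  define Jb where "Jb = sqrt (J \<beta>0 \<beta>0)"
  have Jb: "Jb \<ge> 0" by (simp add: Jb_def J_form_nonneg)
  \<comment> \<open>Level with \<open>B * c * z \<le> 1 / 2\<close>, the smallness needed to absorb
    the deviation term. The \<open>+ 1\<close> avoids a zero denominator.\<close>
  define z where "z = 1 / (2 * (B * c + 1))"
  have z: "z > 0" "B * c * z \<le> 1 / 2"
  proof -
    have "0 \<le> B * c" using B c by simp
    then show "z > 0" "B * c * z \<le> 1 / 2" unfolding z_def by (auto simp: divide_le_eq)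
  qed
  define K where "K = 2 * B\<^sup>2 * c ^ 3 + 2 * B * Jb * c + B * c + 1"
  have K: "K > 0" using B c Jb by (simp add: K_def add_nonneg_pos)
  have lim: "lam \<longlonglongrightarrow> 0" "(\<lambda>n. real n * lam n powr e0) \<longlonglongrightarrow> 0"
    "(\<lambda>n. 1 / real n * lam n powr (- 2 * \<sigma>) * ln (real n)) \<longlonglongrightarrow> 0"
    using A4 by (simp_all add: A4_def e0_def \<sigma>_def)
  let ?v = "\<lambda>n. real n powr (- 1 / 2) * lam n powr (- varsigma m a D)
       * (lam n powr (1 / 2) + real n powr (- 1 / 2) * lam n powr (- (2 * a + 1) / (4 * D))) * sqrt (ln (real n))"
  let ?Z = "\<lambda>n \<omega>. SUP \<nu>\<in>{\<nu>0..1}. ereal (Kn (lam n) (\<lambda>s.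
        \<nu> * (\<beta>hat n \<nu> \<omega> s - \<beta>0 s + W_op M X m (lam n) \<beta>0 s)
        - 1 / real n * (\<Sum>i=1..subsample n \<nu>. \<epsilon> (int i) \<omega> * tau M X m (lam n) (X (int i) \<omega>) s)))"
  have "0 < z\<^sup>2" using z by simp
  note small = order_tendstoD(2)[OF lim(3) this]
  have "\<forall>\<^sub>F n in sequentially. \<exists>A\<in>events. 1 - e \<le> prob A \<and> (\<forall>\<omega>\<in>A. \<bar>?Z n \<omega>\<bar> \<le> ereal (K * ?v n))"
    using order_tendstoD(2)[OF lim(1) zero_less_one] order_tendstoD(2)[OF lim(2) zero_less_one] small
      eventually_ge_at_top[of "max 3 (nat \<lceil>2 / \<nu>0\<rceil>)"]
  proof eventually_elim
    case (elim n)
    define l where "l = lam n"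
    define x where "x = real n powr (- 1 / 2)"
    define u where "u = sqrt (ln (real n))"
    have l: "0 < l" "l \<le> 1" using lam_pos[of n] elim(1) by (auto simp: l_def)
    have n: "n \<ge> 3" "real n > 0" "ln (real n) \<ge> 0" using elim(4) by auto
    \<comment> \<open>Guarantees that rounding \<open>n * \<nu>\<close> down leaves at least
      \<open>n * \<nu>0 / 2\<close>, uniformly in \<open>\<nu>\<close>.\<close>
    have n\<nu>: "real n * \<nu>0 \<ge> 2"
    proof -
      have "2 / \<nu>0 \<le> real n" using elim(4) by linarith
      then show ?thesis using \<nu>0 by (simp add: field_simps)
    qed
    have x: "0 \<le> x" "x \<le> 1" "x\<^sup>2 = 1 / real n"
    proof -
      have "x = 1 / sqrt (real n)" unfolding x_def by (rule powr_minus_half[OF n(2)])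
      then show "0 \<le> x" "x \<le> 1" "x\<^sup>2 = 1 / real n" using n by (auto simp: power_divide)
    qed
    have u: "0 \<le> u" "u\<^sup>2 = ln (real n)" using n by (auto simp: u_def)
    have uc: "u \<le> c * l powr (- (s / 6))"
    proof -
      have "real n \<le> l powr (- e0)"
        using elim(2) l by (simp add: l_def[symmetric] powr_minus field_simps)
      then have "real n powr b \<le> (l powr (- e0)) powr b" using b by (intro powr_mono2) auto
      also have "\<dots> = l powr (- (s / 3))" using e0 by (simp add: powr_powr b_def)
      finally have "ln (real n) \<le> l powr (- (s / 3)) / b"
        using order_trans[OF ln_powr_bound[of "real n" b] divide_right_mono[of _ _ b]] n b by simp
      also have "\<dots> = (c * l powr (- (s / 6)))\<^sup>2"
      proof -
        have "(l powr (- (s / 6)))\<^sup>2 = l powr (- (s / 3))" by (simp add: power2_eq_square powr_add[symmetric])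
        then show ?thesis using b by (simp add: c_def power_mult_distrib)
      qed
      finally have "u \<le> sqrt ((c * l powr (- (s / 6)))\<^sup>2)" unfolding u_def by (rule real_sqrt_le_mono)
      then show ?thesis using c by simp
    qed
    obtain E where E: "E \<in> events" "prob E \<ge> 1 - e"
      and EQ: "\<And>\<omega> k N. \<omega> \<in> E \<Longrightarrow> k \<le> n \<Longrightarrow> (\<Sum>(j,i)\<in>{..<N} \<times> {..<N}. wt l j * wt l i * (\<Sum>n=1..k. cross \<omega> n j i)\<^sup>2) \<le> 2 / e * C * real n * (ln (real n))\<^sup>2 * l powr (- (2 * \<theta>))"
      and ER: "\<And>\<omega> k N. \<omega> \<in> E \<Longrightarrow> k \<le> n \<Longrightarrow> (\<Sum>j<N. wt l j * (\<Sum>n=1..k. \<epsilon> (int n) \<omega> * sc j (int n) \<omega>)\<^sup>2) \<le> 2 / e * C * real n * (ln (real n))\<^sup>2 * l powr (- \<theta>')"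
    proof -
      have "2 / e > 0" using e by simp
      from ev[OF this l n(1)] obtain E where "E \<in> events" "1 - 2 / (2 / e) \<le> prob E" and b: "\<forall>\<omega>\<in>E. \<forall>k\<le>n. \<forall>N.
       (\<Sum>(j,i)\<in>{..<N} \<times> {..<N}. wt l j * wt l i * (\<Sum>n=1..k. cross \<omega> n j i)\<^sup>2) \<le> 2 / e * C * real n * (ln (real n))\<^sup>2 * l powr (- (2 * \<theta>)) \<and>
       (\<Sum>j<N. wt l j * (\<Sum>n=1..k. \<epsilon> (int n) \<omega> * sc j (int n) \<omega>)\<^sup>2) \<le> 2 / e * C * real n * (ln (real n))\<^sup>2 * l powr (- \<theta>')"
        by (elim bexE conjE)
      show ?thesis
      proof (rule that)
        show "E \<in> events" by fact
        show "1 - e \<le> prob E" using \<open>1 - 2 / (2 / e) \<le> prob E\<close> e by simp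
      qed (use b in blast)+
    qed
    \<comment> \<open>The powers of \<open>l\<close> are written as squares to match
      \<open>sqrt_over_sample_size_le\<close>; \<open>sqp\<close> leads back to the form of
      \<open>EQ\<close> and \<open>ER\<close>.\<close>
    define Q where "Q = 2 / e * C * real n * (ln (real n))\<^sup>2 * (l powr (- \<theta>))\<^sup>2"
    define R where "R = 2 / e * C * real n * (ln (real n))\<^sup>2 * (l powr (- (\<theta>' / 2)))\<^sup>2"
    have sqp: "(l powr (- \<theta>))\<^sup>2 = l powr (- (2 * \<theta>))" "(l powr (- (\<theta>' / 2)))\<^sup>2 = l powr (- \<theta>')"
      by (simp_all add: power2_eq_square powr_add[symmetric])
    have QR0: "0 \<le> Q" "0 \<le> R" using e C n by (simp_all add: Q_def R_def)
    have bound: "\<bar>Kn l (\<lambda>s. \<nu> * (\<beta>hat n \<nu> \<omega> s - \<beta>0 s + W_op M X m l \<beta>0 s)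
        - 1 / real n * (\<Sum>i=1..subsample n \<nu>. \<epsilon> (int i) \<omega> * tau M X m l (X (int i) \<omega>) s))\<bar> \<le> K * ?v n"
      if \<nu>: "\<nu> \<in> {\<nu>0..1}" and w: "\<omega> \<in> E" for \<nu> \<omega>
    proof -
      have wM: "\<omega> \<in> space M" using w E(1) sets.sets_into_space by blast
      define k where "k = subsample n \<nu>"
      have n\<nu>0: "real n * \<nu>0 \<le> real n * \<nu>" "real n * \<nu> \<le> real n * 1" using \<nu> by (intro mult_left_mono; simp)+
      have k: "real k \<le> real n * \<nu>" "real n * \<nu> \<le> real k + 1" using n\<nu>0 n\<nu> unfolding k_def by linarith+
      have k1: "real n * \<nu>0 / 2 \<le> real k" "k \<ge> 1" "k \<le> n" using k n\<nu>0 n\<nu> by linarith+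
      have k0: "real k > 0" using k1 by simp
      have arg: "is_arg_min (criterion X (response X \<epsilon> \<beta>0) m l k \<omega>) (\<lambda>b. b \<in> H) (\<beta>hat n \<nu> \<omega>)"
        using est \<nu> wM k1(2) unfolding is_estimator_def k_def l_def by blast
      have q: "0 \<le> sqrt Q / real k" "sqrt Q / real k \<le> B * (x * u\<^sup>2 * l powr (- \<theta>))"
        using sqrt_over_sample_size_le[OF n(2) \<nu>0(1) k1(1), of "2 / e * C" "ln (real n)" "l powr (- \<theta>)"] e C n QR0
        by (auto simp: Q_def B_def x_def u(2))
      have r: "0 \<le> sqrt R / real k" "sqrt R / real k \<le> B * (x * u\<^sup>2 * l powr (- (\<theta>' / 2)))"
        using sqrt_over_sample_size_le[OF n(2) \<nu>0(1) k1(1), of "2 / e * C" "ln (real n)" "l powr (- (\<theta>' / 2))"] e C n QR0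
        by (auto simp: R_def B_def x_def u(2))
      note rc = rate_combination[OF l x(1,2) u(1) uc exps q r B Jb c]
      have "sqrt Q / real k \<le> 1 / 2"
      proof -
        \<comment> \<open>This square is the fourth sequence in \<open>A4\<close>, which tends to
          zero.\<close>
        have "(x * u * l powr (- \<sigma>))\<^sup>2 = 1 / real n * l powr (- 2 * \<sigma>) * ln (real n)"
          by (simp add: power_mult_distrib x(3) u(2)) (simp add: power2_eq_square powr_add[symmetric])
        also have "\<dots> \<le> z\<^sup>2" using elim(3) by (simp add: l_def)
        finally have "x * u * l powr (- \<sigma>) \<le> z" by (rule power2_le_imp_le) (use z in simp)
        then have "B * c * (x * u * l powr (- \<sigma>)) \<le> B * c * z" using B c by (intro mult_left_mono) auto
        then show ?thesis using rc(1) z(2) by linarith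
      qed
      note det = Bahadur_deterministic[OF wM l(1) \<beta>0 k1(2) arg _ _ this _ _ _ k, of R]
      have "\<bar>Kn l (\<lambda>s. \<nu> * (\<beta>hat n \<nu> \<omega> s - \<beta>0 s + W_op M X m l \<beta>0 s)
        - 1 / real n * (\<Sum>i=1..k. \<epsilon> (int i) \<omega> * tau M X m l (X (int i) \<omega>) s))\<bar>
        \<le> sqrt Q / real k * (2 * (sqrt R / real k + sqrt l * Jb)) + sqrt R / (real n * real k)"
        unfolding Jb_def
      proof (rule det)
        show "(\<Sum>(j,i)\<in>{..<N} \<times> {..<N}. wt l j * wt l i * (\<Sum>n=1..k. cross \<omega> n j i)\<^sup>2) \<le> Q" for N
          using EQ[OF w k1(3), of N] unfolding Q_def sqp .
        show "(\<Sum>j<N. wt l j * (\<Sum>n=1..k. \<epsilon> (int n) \<omega> * sc j (int n) \<omega>)\<^sup>2) \<le> R" for N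
          using ER[OF w k1(3), of N] unfolding R_def sqp .
      qed (use n \<nu> \<nu>0 in auto)
      also have "sqrt R / (real n * real k) = sqrt R / real k * x\<^sup>2" by (simp add: x(3))
      also have "sqrt Q / real k * (2 * (sqrt R / real k + sqrt l * Jb)) + sqrt R / real k * x\<^sup>2
        \<le> (2 * B\<^sup>2 * c ^ 3 + 2 * B * Jb * c + B * c) * (x * l powr (- \<sigma>) * (l powr (1 / 2) + x * l powr (- A)) * u)" by (rule rc(2))
      also have "\<dots> \<le> K * (x * l powr (- \<sigma>) * (l powr (1 / 2) + x * l powr (- A)) * u)"
        unfolding K_def using x u by (intro mult_right_mono) auto
      also have "\<dots> = K * ?v n"
      proof -
        have "- A = - (2 * a + 1) / (4 * D)" unfolding A_def by (rule minus_divide_left)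
        then show ?thesis by (simp only: x_def l_def u_def \<sigma>_def)
      qed
      finally show ?thesis unfolding k_def .
    qed
    have "\<bar>?Z n \<omega>\<bar> \<le> ereal (K * ?v n)" if w: "\<omega> \<in> E" for \<omega>
      using \<nu>0 bound[OF _ w] unfolding l_def by (intro ereal_abs_SUP_le) auto
    then show ?case using E by blast
  qed
  then show "\<exists>B>0. \<forall>\<^sub>F n in sequentially. \<exists>A\<in>events. 1 - e \<le> prob A \<and> (\<forall>\<omega>\<in>A. \<bar>?Z n \<omega>\<bar> \<le> ereal (B * ?v n))"
    using K by blast
qed

end

theorem theorem2p1:
  fixes M :: "'w measure"
    and X :: "int \<Rightarrow> 'w \<Rightarrow> real \<Rightarrow> real" and \<epsilon> :: "int \<Rightarrow> 'w \<Rightarrow> real"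
    and \<beta>\<^sub>0 :: "real \<Rightarrow> real" and m :: nat
    and lam :: "nat \<Rightarrow> real"
    and \<phi> :: "nat \<Rightarrow> real \<Rightarrow> real" and \<rho> :: "nat \<Rightarrow> real" and a D \<nu>\<^sub>0 :: real
    and S :: "(real \<Rightarrow> 'r) measure" and R :: "'r measure"
    and g :: "(nat \<Rightarrow> real \<Rightarrow> 'r) \<Rightarrow> real \<Rightarrow> real" and h :: "(nat \<Rightarrow> real) \<Rightarrow> real"
    and \<xi> :: "int \<Rightarrow> 'w \<Rightarrow> real \<Rightarrow> 'r" and \<eta> :: "int \<Rightarrow> 'w \<Rightarrow> real"
    and \<xi>s :: "int \<Rightarrow> nat \<Rightarrow> int \<Rightarrow> 'w \<Rightarrow> real \<Rightarrow> 'r"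
    and \<eta>s :: "int \<Rightarrow> nat \<Rightarrow> int \<Rightarrow> 'w \<Rightarrow> real"
    and \<beta>hat :: "nat \<Rightarrow> real \<Rightarrow> 'w \<Rightarrow> real \<Rightarrow> real"
  assumes model: "regression_model M X \<epsilon>"
    and m: "real m > 1 / 2"
    and \<beta>\<^sub>0: "\<beta>\<^sub>0 \<in> sobolev m"
    and lam_pos: "\<And>n. lam n > 0"
    and A1: "A1 M X"
    and A2: "A2 M X m \<phi> \<rho> a D"
    and A3: "A3 M X \<epsilon> \<beta>\<^sub>0 m \<phi> \<rho> a D"
    and A4: "A4 m a D lam"
    and A5: "A5 M X \<epsilon> S R g h \<xi> \<eta> \<xi>s \<eta>s"
    and \<nu>\<^sub>0: "0 < \<nu>\<^sub>0" "\<nu>\<^sub>0 \<le> 1"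
    and estimator: "is_estimator M X (response X \<epsilon> \<beta>\<^sub>0) m lam \<nu>\<^sub>0 \<beta>hat"
  shows "bigO_p M
    (\<lambda>n \<omega>. SUP \<nu>\<in>{\<nu>\<^sub>0..1}. ereal (K_norm M X m (lam n) (\<lambda>s.
        \<nu> * (\<beta>hat n \<nu> \<omega> s - \<beta>\<^sub>0 s + W_op M X m (lam n) \<beta>\<^sub>0 s)
        - 1 / real n * (\<Sum>i=1..subsample n \<nu>. \<epsilon> (int i) \<omega> * tau M X m (lam n) (X (int i) \<omega>) s))))
    (\<lambda>n. real n powr (- 1 / 2) * lam n powr (- varsigma m a D)
       * (lam n powr (1 / 2) + real n powr (- 1 / 2) * lam n powr (- (2 * a + 1) / (4 * D)))
       * sqrt (ln (real n)))"
proof -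
  have "m \<ge> 1" using m by linarith
  then interpret dependent_regression M X \<epsilon> m \<phi> \<rho> a D \<beta>\<^sub>0 S R g h \<xi> \<eta> \<xi>s \<eta>s
    using model A1 A2 A3 A5 by unfold_locales
  show ?thesis by (rule Bahadur_uniform[OF \<beta>\<^sub>0 lam_pos A4 \<nu>\<^sub>0 estimator])
qed

end
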